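(* Let $M$ be a compact complex manifold of complex dimension $m$ with $C^\infty$ boundary $\partial M$, and let $\Omega_0$ be a smooth, closed, non-negative $(1,1)$-form on $M$ (not necessarily strictly positive). Let $E$ be an effective divisor on $M$, supported away from $\partial M$, and let $\varepsilon>0$ be fixed such that $\Omega_0-\varepsilon[E]>0$, i.e. such that there is a smooth Hermitian metric $H$ on the line bundle $O(E)$ for which $$\Omega_0^{\varepsilon}:=\Omega_0+\tfrac{i}{2}\partial\bar\partial\log H^{\varepsilon}$$ is a Kähler form on $M$. Let $\sigma$ be the canonical section of $O(E)$ vanishing on $E$, and $\|\sigma\|^2=|\sigma|^2H$. Let $\Phi\in C^2(M)\cap C^4(M\setminus\partial M)$ be a solution of the Dirichlet problem $$\left(\Omega_0+\tfrac{i}{2}\partial\bar\partial\Phi\right)^m=F\,(\Omega_0^{\varepsilon})^m,\qquad \Omega_0+\tfrac{i}{2}\partial\bar\partial\Phi\ge 0,\qquad \Phi|_{\partial M}=\varphi,$$ where $F>0$ is a smooth function on $M$ and $\varphi\in C^\infty(\partial M)$. Let $-B$ be a lower bound for the bisectional curvature of $\Omega_0^{\varepsilon}$, with $B\varepsilon>1$, and let $b\ge 0$ be an upper bound for the scalar curvature of $\Omega_0^\varepsilon$. All covariant derivatives, Laplacians and norms below are taken with respect to $\Omega_0^{\varepsilon}$. Then: (i) ($C^1$ estimates) $$|\nabla\Phi(z)|\le C_1\|\sigma(z)\|^{-\varepsilon A_1},\qquad z\in M\setminus E,$$ where $A_1$ is a constant depending only on an upper bound for $B$ and $\sup_M|\nabla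 F^{1/m}|$, and the constant $C_1$ depends on the dimension $m$ and upper bounds for $$B,\ \ \sup_M|\nabla F^{1/m}|,\ \ \sup_M F,\ \ \sup_M|\Phi|,\ \ \sup_M\|\sigma\|^{2\varepsilon},\ \ \sup_{\partial M}|\nabla\Phi|,\ \ \sup_{\partial M}\frac{1}{\|\sigma\|^{2\varepsilon}}.$$ (ii) ($C^2$ estimates) $$|\Delta\Phi(z)|\le C_2\|\sigma(z)\|^{-\varepsilon A_2},\qquad z\in M\setminus E,$$ where $A_2$ is a constant depending only on upper bounds for $-\Delta\log F$, $b$ and $B$, and the constant $C_2$ depends on the dimension $m$ and upper bounds for $$-\Delta\log F,\ \ b,\ \ B,\ \ \mathrm{osc}_M(\Phi),\ \ \sup_M\|\sigma\|^{2\varepsilon},\ \ \sup_{\partial M}(m+\Delta\Phi).$$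
   Context: $[E]$ is the current of integration on $E$. The condition $\Omega_0-\varepsilon[E]>0$ is equivalent to the existence of a smooth Hermitian metric $H$ on $O(E)$ with $\Omega_0+\frac{i}{2}\partial\bar\partial\log H^{\varepsilon}>0$ on $M$; here, in a local trivialization, $H$ is a positive function and $\|\sigma\|^2=|\sigma|^2H$, and $\partial\bar\partial\log H^\varepsilon$ is globally well defined. The data $E$, $\varepsilon$, $H$ are fixed once and for all. For a Kähler form $\Omega=\frac{i}{2}g_{\bar kj}\,dz^j\wedge d\bar z^k$, $\Delta=g^{j\bar k}\partial_j\partial_{\bar k}$ and $|\nabla f|^2=g^{j\bar k}\partial_jf\,\partial_{\bar k}f$ for real $f$. That $-B$ is a lower bound for the bisectional curvature means $R_{\bar ji\bar lk}a^i\overline{a^j}b^k\overline{b^l}\ge -B|a|^2|b|^2$ for all $(1,0)$-vectors $a,b$. $\mathrm{osc}_M(\Phi)=\sup_M\Phi-\inf_M\Phi$.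
   Formalization: C_1 and C_2 may also depend on M and Ω_0, taken as fixed along with E, ε, H; uniformity in Ω_0 is false: on the unit disc with E=0, F=1, Φ=log H^ε=-|z|^2, Ω_0^ε=δ·flat, all bounds listed in (ii) stay bounded while |ΔΦ|=1/δ is unbounded as δ→0. *)

theory Defs
  imports "HOL-Analysis.Analysis"
begin

text \<open>
  The dimension \<open>m\<close> has to be quantified inside formulas, so \<open>\<complex>\<^sup>m\<close> is the set of sequences
  supported on \<open>{..<m}\<close>; the product topology of \<open>nat \<Rightarrow> complex\<close> induces the Euclidean
  topology on it.
\<close>

type_synonym cvec = "nat \<Rightarrow> complex"

definition Cn :: "nat \<Rightarrow> cvec set" where
  "Cn m = {z. \<forall>i\<ge>m. z i = 0}"

definition Cint :: "nat \<Rightarrow> cvec set \<Rightarrow> cvec set" where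
  "Cint m S = top_of_set (Cn m) interior_of S"

text \<open>
  \<open>rpartial m S j c f\<close> is the real partial derivative of \<open>f\<close> in the direction \<open>c\<close> of the
  \<open>j\<close>-th complex coordinate, \<open>c = 1\<close> giving \<open>\<partial>/\<partial>x\<^sub>j\<close> and \<open>c = \<i>\<close> giving \<open>\<partial>/\<partial>y\<^sub>j\<close>. The value
  at a boundary point of \<open>S\<close> is the limit of the values at interior points, which for
  functions of class \<open>C\<^sup>1\<close> up to the boundary is the usual one.
\<close>

definition rpartial ::
  "nat \<Rightarrow> cvec set \<Rightarrow> nat \<Rightarrow> complex \<Rightarrow> (cvec \<Rightarrow> 'b::real_normed_vector) \<Rightarrow> cvec \<Rightarrow> 'b" where
  "rpartial m S j c f z =
     Lim (at z within Cint m S)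
       (\<lambda>w. vector_derivative (\<lambda>t. f (w(j := w j + complex_of_real t * c))) (at 0))"

text \<open>
  \<open>Ck k m S f\<close>: on the interior of \<open>S\<close> all iterated partial derivatives of \<open>f\<close> of order at
  most \<open>k\<close> exist, and they extend continuously to \<open>S\<close>. It is only used for sets \<open>S\<close> that are
  contained in the closure of their interior, where the extension \<open>h\<close> is unique.
\<close>

primrec Ck :: "nat \<Rightarrow> nat \<Rightarrow> cvec set \<Rightarrow> (cvec \<Rightarrow> 'b::real_normed_vector) \<Rightarrow> bool" where
  "Ck 0 m S f \<longleftrightarrow> continuous_on S f"
| "Ck (Suc k) m S f \<longleftrightarrow> continuous_on S f \<and>
     (\<forall>j<m. \<forall>c\<in>{1, \<i>}. \<exists>h.
        (\<forall>z\<in>Cint m S.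
           ((\<lambda>t. f (z(j := z j + complex_of_real t * c))) has_vector_derivative h z) (at 0)) \<and>
        Ck k m S h)"

definition Csmooth :: "nat \<Rightarrow> cvec set \<Rightarrow> (cvec \<Rightarrow> 'b::real_normed_vector) \<Rightarrow> bool" where
  "Csmooth m S f \<longleftrightarrow> (\<forall>k. Ck k m S f)"

definition dz :: "nat \<Rightarrow> cvec set \<Rightarrow> nat \<Rightarrow> (cvec \<Rightarrow> complex) \<Rightarrow> cvec \<Rightarrow> complex" where
  "dz m S j f z = (rpartial m S j 1 f z - \<i> * rpartial m S j \<i> f z) / 2"

definition dzbar :: "nat \<Rightarrow> cvec set \<Rightarrow> nat \<Rightarrow> (cvec \<Rightarrow> complex) \<Rightarrow> cvec \<Rightarrow> complex" where
  "dzbar m S j f z = (rpartial m S j 1 f z + \<i> * rpartial m S j \<i> f z) / 2"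

definition Cholo :: "nat \<Rightarrow> cvec set \<Rightarrow> (cvec \<Rightarrow> complex) \<Rightarrow> bool" where
  "Cholo m S f \<longleftrightarrow> Csmooth m S f \<and> (\<forall>z\<in>S. \<forall>j<m. dzbar m S j f z = 0)"

text \<open>
  Local models of complex manifolds with smooth boundary: locally \<open>S = {\<rho> \<le> 0}\<close> with \<open>\<rho>\<close>
  smooth and \<open>d\<rho> \<noteq> 0\<close> on \<open>\<rho> = 0\<close>. (Half spaces do not suffice, since real hypersurfaces of
  \<open>\<complex>\<^sup>m\<close> are not all locally biholomorphic.)
\<close>

definition smooth_domain :: "nat \<Rightarrow> cvec set \<Rightarrow> bool" where
  "smooth_domain m S \<longleftrightarrow> S \<subseteq> Cn m \<and>
     (\<forall>p\<in>S. \<exists>W (\<rho> :: cvec \<Rightarrow> real).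
        openin (top_of_set (Cn m)) W \<and> p \<in> W \<and> Csmooth m W \<rho> \<and>
        S \<inter> W = {z \<in> W. \<rho> z \<le> 0} \<and>
        (\<forall>z\<in>W. \<rho> z = 0 \<longrightarrow> (\<exists>j<m. \<exists>c\<in>{1, \<i>}. rpartial m W j c \<rho> z \<noteq> 0)))"

type_synonym 'a chart = "'a set \<times> ('a \<Rightarrow> cvec)"

record 'a mfd =
  mtop :: "'a topology"
  mdim :: nat
  atlas :: "'a chart set"

abbreviation pts :: "'a mfd \<Rightarrow> 'a set" where
  "pts M \<equiv> topspace (mtop M)"

definition chart_img :: "'a chart \<Rightarrow> 'a set \<Rightarrow> cvec set" where
  "chart_img c N = snd c ` (fst c \<inter> N)"

definition in_chart :: "'a chart \<Rightarrow> ('a \<Rightarrow> 'b) \<Rightarrow> cvec \<Rightarrow> 'b" where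
  "in_chart c f = (\<lambda>z. f (inv_into (fst c) (snd c) z))"

definition complex_manifold_with_boundary :: "'a mfd \<Rightarrow> bool" where
  "complex_manifold_with_boundary M \<longleftrightarrow>
     mdim M \<ge> 1 \<and> Hausdorff_space (mtop M) \<and> second_countable (mtop M) \<and>
     \<Union>(fst ` atlas M) = pts M \<and>
     (\<forall>c\<in>atlas M. openin (mtop M) (fst c) \<and> smooth_domain (mdim M) (snd c ` fst c) \<and>
        homeomorphic_map (subtopology (mtop M) (fst c)) (top_of_set (snd c ` fst c)) (snd c)) \<and>
     (\<forall>c\<in>atlas M. \<forall>c'\<in>atlas M. \<forall>i<mdim M.
        Cholo (mdim M) (chart_img c (fst c')) (in_chart c (\<lambda>p. snd c' p i)))"

definition mfd_interior :: "'a mfd \<Rightarrow> 'a set" where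
  "mfd_interior M =
     {p. \<exists>c\<in>atlas M. p \<in> fst c \<and> snd c p \<in> Cint (mdim M) (snd c ` fst c)}"

definition mfd_boundary :: "'a mfd \<Rightarrow> 'a set" where
  "mfd_boundary M = pts M - mfd_interior M"

text \<open>Regularity on a (relatively) open subset \<open>N\<close> of \<open>M\<close>, up to \<open>N \<inter> \<partial>M\<close>.\<close>

definition Ck_on :: "nat \<Rightarrow> 'a mfd \<Rightarrow> 'a set \<Rightarrow> ('a \<Rightarrow> 'b::real_normed_vector) \<Rightarrow> bool" where
  "Ck_on k M N f \<longleftrightarrow> (\<forall>c\<in>atlas M. Ck k (mdim M) (chart_img c N) (in_chart c f))"

definition smooth_on :: "'a mfd \<Rightarrow> 'a set \<Rightarrow> ('a \<Rightarrow> 'b::real_normed_vector) \<Rightarrow> bool" where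
  "smooth_on M N f \<longleftrightarrow> (\<forall>k. Ck_on k M N f)"

definition holo_on :: "'a mfd \<Rightarrow> 'a set \<Rightarrow> ('a \<Rightarrow> complex) \<Rightarrow> bool" where
  "holo_on M N f \<longleftrightarrow> (\<forall>c\<in>atlas M. Cholo (mdim M) (chart_img c N) (in_chart c f))"

text \<open>Smooth functions on \<open>\<partial>M\<close>: locally, restrictions of smooth functions on \<open>M\<close>.\<close>

definition smooth_on_boundary :: "'a mfd \<Rightarrow> ('a \<Rightarrow> real) \<Rightarrow> bool" where
  "smooth_on_boundary M \<phi> \<longleftrightarrow>
     (\<forall>p\<in>mfd_boundary M. \<exists>N \<psi>. openin (mtop M) N \<and> p \<in> N \<and> smooth_on M N \<psi> \<and>
        (\<forall>q\<in>N \<inter> mfd_boundary M. \<psi> q = \<phi> q))"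

definition pd :: "'a mfd \<Rightarrow> 'a chart \<Rightarrow> nat \<Rightarrow> ('a \<Rightarrow> complex) \<Rightarrow> 'a \<Rightarrow> complex" where
  "pd M c j f p = dz (mdim M) (snd c ` fst c) j (in_chart c f) (snd c p)"

definition pdbar :: "'a mfd \<Rightarrow> 'a chart \<Rightarrow> nat \<Rightarrow> ('a \<Rightarrow> complex) \<Rightarrow> 'a \<Rightarrow> complex" where
  "pdbar M c j f p = dzbar (mdim M) (snd c ` fst c) j (in_chart c f) (snd c p)"

text \<open>
  Below, a prime marks a conjugate index. A \<open>(1,1)\<close>-form \<open>\<omega> = \<i>/2 \<Sum> g(k',j) dz\<^sup>j \<and> dz\<^sup>k\<^sup>'\<close> is
  given by its coefficients in every chart: \<open>\<omega> c p j k\<close> is \<open>g(k',j)\<close> at \<open>p\<close> in the coordinates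
  of \<open>c\<close>, with the holomorphic index first.
\<close>

type_synonym 'a form11 = "'a chart \<Rightarrow> 'a \<Rightarrow> nat \<Rightarrow> nat \<Rightarrow> complex"

definition real_form11 :: "'a mfd \<Rightarrow> 'a form11 \<Rightarrow> bool" where
  "real_form11 M \<omega> \<longleftrightarrow>
     (\<forall>c\<in>atlas M. \<forall>p\<in>fst c. \<forall>j<mdim M. \<forall>k<mdim M. \<omega> c p k j = cnj (\<omega> c p j k)) \<and>
     (\<forall>c\<in>atlas M. \<forall>c'\<in>atlas M. \<forall>p\<in>fst c \<inter> fst c'. \<forall>j<mdim M. \<forall>k<mdim M.
        \<omega> c p j k = (\<Sum>a<mdim M. \<Sum>b<mdim M.
          \<omega> c' p a b * pd M c j (\<lambda>q. snd c' q a) p * cnj (pd M c k (\<lambda>q. snd c' q b) p)))"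

definition smooth_form11 :: "'a mfd \<Rightarrow> 'a form11 \<Rightarrow> bool" where
  "smooth_form11 M \<omega> \<longleftrightarrow>
     (\<forall>c\<in>atlas M. \<forall>j<mdim M. \<forall>k<mdim M.
        Csmooth (mdim M) (snd c ` fst c) (in_chart c (\<lambda>p. \<omega> c p j k)))"

text \<open>The two conditions say that the \<open>(2,1)\<close>- and the \<open>(1,2)\<close>-part of \<open>d\<omega>\<close> vanish.\<close>

definition closed_form11 :: "'a mfd \<Rightarrow> 'a form11 \<Rightarrow> bool" where
  "closed_form11 M \<omega> \<longleftrightarrow>
     (\<forall>c\<in>atlas M. \<forall>p\<in>fst c. \<forall>j<mdim M. \<forall>k<mdim M. \<forall>l<mdim M.
        pd M c l (\<lambda>q. \<omega> c q j k) p = pd M c j (\<lambda>q. \<omega> c q l k) p \<and>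
        pdbar M c l (\<lambda>q. \<omega> c q j k) p = pdbar M c k (\<lambda>q. \<omega> c q j l) p)"

definition sqn :: "nat \<Rightarrow> (nat \<Rightarrow> nat \<Rightarrow> complex) \<Rightarrow> cvec \<Rightarrow> real" where
  "sqn m g a = Re (\<Sum>j<m. \<Sum>k<m. g j k * a j * cnj (a k))"

definition nonneg_form11 :: "'a mfd \<Rightarrow> 'a form11 \<Rightarrow> bool" where
  "nonneg_form11 M \<omega> \<longleftrightarrow> (\<forall>c\<in>atlas M. \<forall>p\<in>fst c. \<forall>a. sqn (mdim M) (\<omega> c p) a \<ge> 0)"

definition pos_form11 :: "'a mfd \<Rightarrow> 'a form11 \<Rightarrow> bool" where
  "pos_form11 M \<omega> \<longleftrightarrow>
     (\<forall>c\<in>atlas M. \<forall>p\<in>fst c. \<forall>a. (\<exists>j<mdim M. a j \<noteq> 0) \<longrightarrow> sqn (mdim M) (\<omega> c p) a > 0)"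

definition kaehler_form :: "'a mfd \<Rightarrow> 'a form11 \<Rightarrow> bool" where
  "kaehler_form M \<omega> \<longleftrightarrow>
     real_form11 M \<omega> \<and> smooth_form11 M \<omega> \<and> closed_form11 M \<omega> \<and> pos_form11 M \<omega>"

text \<open>The form \<open>\<i>/2 \<partial>\<partial>' f\<close>, where \<open>\<partial>'\<close> is the conjugate of \<open>\<partial>\<close>.\<close>

definition ddbar :: "'a mfd \<Rightarrow> ('a \<Rightarrow> real) \<Rightarrow> 'a form11" where
  "ddbar M f = (\<lambda>c p j k. pd M c j (pdbar M c k (\<lambda>q. complex_of_real (f q))) p)"

definition form_add :: "'a form11 \<Rightarrow> 'a form11 \<Rightarrow> 'a form11" where
  "form_add \<omega> \<eta> = (\<lambda>c p j k. \<omega> c p j k + \<eta> c p j k)"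

text \<open>
  Expanding \<open>(\<i>/2 \<Sum> h(k',j) dz\<^sup>j \<and> dz\<^sup>k\<^sup>')\<^sup>m\<close> gives \<open>wedge_power_coeff m h\<close> times the form
  \<open>(\<i>/2)\<^sup>m dz\<^sup>1 \<and> dz\<^sup>1\<^sup>' \<and> \<dots> \<and> dz\<^sup>m \<and> dz\<^sup>m\<^sup>'\<close>; it equals \<open>m!\<close> times the determinant of \<open>h\<close>.
\<close>

definition wedge_power_coeff :: "nat \<Rightarrow> (nat \<Rightarrow> nat \<Rightarrow> complex) \<Rightarrow> complex" where
  "wedge_power_coeff m h =
     (\<Sum>\<pi> | \<pi> permutes {..<m}. \<Sum>\<tau> | \<tau> permutes {..<m}.
        of_int (sign \<pi> * sign \<tau>) * (\<Prod>i<m. h (\<pi> i) (\<tau> i)))"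

text \<open>The inverse matrix \<open>g\<^sup>j\<^sup>k\<^sup>'\<close>, normalized by \<open>\<Sum>\<^sub>k g\<^sup>j\<^sup>k\<^sup>' g(k',l) = \<delta>\<^sub>j\<^sub>l\<close>.\<close>

definition ginv :: "nat \<Rightarrow> (nat \<Rightarrow> nat \<Rightarrow> complex) \<Rightarrow> nat \<Rightarrow> nat \<Rightarrow> complex" where
  "ginv m g = (THE h. (\<forall>j k. j \<ge> m \<or> k \<ge> m \<longrightarrow> h j k = 0) \<and>
     (\<forall>j<m. \<forall>l<m. (\<Sum>k<m. h j k * g l k) = (if j = l then 1 else 0)))"

text \<open>
  The Laplacian and the gradient norm do not depend on the chart in which they are computed.
\<close>

definition chart_at :: "'a mfd \<Rightarrow> 'a \<Rightarrow> 'a chart" where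
  "chart_at M p = (SOME c. c \<in> atlas M \<and> p \<in> fst c)"

definition laplacian :: "'a mfd \<Rightarrow> 'a form11 \<Rightarrow> ('a \<Rightarrow> real) \<Rightarrow> 'a \<Rightarrow> real" where
  "laplacian M g f p = (let c = chart_at M p in
     Re (\<Sum>j<mdim M. \<Sum>k<mdim M. ginv (mdim M) (g c p) j k * ddbar M f c p j k))"

definition grad_norm :: "'a mfd \<Rightarrow> 'a form11 \<Rightarrow> ('a \<Rightarrow> real) \<Rightarrow> 'a \<Rightarrow> real" where
  "grad_norm M g f p = (let c = chart_at M p; f' = (\<lambda>q. complex_of_real (f q)) in
     sqrt (Re (\<Sum>j<mdim M. \<Sum>k<mdim M.
       ginv (mdim M) (g c p) j k * pd M c j f' p * pdbar M c k f' p)))"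

text \<open>
  \<open>curvature M g c p i j k l\<close> is \<open>R(j',i,l',k) = - \<partial>\<^sub>i \<partial>\<^sub>j\<^sub>' g(l',k) + \<Sum> g\<^sup>a\<^sup>b\<^sup>' \<partial>\<^sub>i g(b',k) \<partial>\<^sub>j\<^sub>' g(l',a)\<close>;
  with this sign the Fubini-Study metric has positive bisectional curvature.
\<close>

definition curvature ::
  "'a mfd \<Rightarrow> 'a form11 \<Rightarrow> 'a chart \<Rightarrow> 'a \<Rightarrow> nat \<Rightarrow> nat \<Rightarrow> nat \<Rightarrow> nat \<Rightarrow> complex" where
  "curvature M g c p i j k l =
     - pd M c i (pdbar M c j (\<lambda>q. g c q k l)) p +
     (\<Sum>a<mdim M. \<Sum>b<mdim M. ginv (mdim M) (g c p) a b *
        pd M c i (\<lambda>q. g c q k b) p * pdbar M c j (\<lambda>q. g c q a l) p)"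

definition bisectional_ge :: "'a mfd \<Rightarrow> 'a form11 \<Rightarrow> real \<Rightarrow> bool" where
  "bisectional_ge M g \<kappa> \<longleftrightarrow>
     (\<forall>c\<in>atlas M. \<forall>p\<in>fst c. \<forall>a b.
        Re (\<Sum>i<mdim M. \<Sum>j<mdim M. \<Sum>k<mdim M. \<Sum>l<mdim M.
          curvature M g c p i j k l * a i * cnj (a j) * b k * cnj (b l))
        \<ge> \<kappa> * sqn (mdim M) (g c p) a * sqn (mdim M) (g c p) b)"

definition scalar_curvature :: "'a mfd \<Rightarrow> 'a form11 \<Rightarrow> 'a \<Rightarrow> real" where
  "scalar_curvature M g p = (let c = chart_at M p; h = ginv (mdim M) (g c p) in
     Re (\<Sum>i<mdim M. \<Sum>j<mdim M. \<Sum>k<mdim M. \<Sum>l<mdim M.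
       h i j * h k l * curvature M g c p i j k l))"

text \<open>
  An effective divisor \<open>E\<close> is given by local equations: pairs \<open>(V, s)\<close> with \<open>s\<close> holomorphic on
  \<open>V\<close>, nowhere locally identically zero, any two of which differ by a nowhere vanishing
  holomorphic factor on the common domain. The sets \<open>V\<close> trivialize \<open>O(E)\<close>, the transition
  functions being the quotients of the \<open>s\<close>, and the \<open>s\<close> represent the canonical section.
\<close>

type_synonym 'a local_eqn = "'a set \<times> ('a \<Rightarrow> complex)"

definition transition_fun ::
  "'a mfd \<Rightarrow> 'a local_eqn \<Rightarrow> 'a local_eqn \<Rightarrow> ('a \<Rightarrow> complex) \<Rightarrow> bool" where
  "transition_fun M t t' u \<longleftrightarrow> holo_on M (fst t \<inter> fst t') u \<and>
     (\<forall>p\<in>fst t \<inter> fst t'. u p \<noteq> 0 \<and> snd t p = u p * snd t' p)"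

definition effective_divisor :: "'a mfd \<Rightarrow> 'a local_eqn set \<Rightarrow> bool" where
  "effective_divisor M E \<longleftrightarrow>
     \<Union>(fst ` E) = pts M \<and>
     (\<forall>t\<in>E. openin (mtop M) (fst t) \<and> holo_on M (fst t) (snd t) \<and>
        (\<forall>W. openin (mtop M) W \<and> W \<subseteq> fst t \<and> W \<noteq> {} \<longrightarrow> (\<exists>p\<in>W. snd t p \<noteq> 0))) \<and>
     (\<forall>t\<in>E. \<forall>t'\<in>E. \<exists>u. transition_fun M t t' u)"

definition divisor_support :: "'a local_eqn set \<Rightarrow> 'a set" where
  "divisor_support E = {p. \<exists>t\<in>E. p \<in> fst t \<and> snd t p = 0}"

text \<open>
  A section of \<open>O(E)\<close> with representatives \<open>h\<^sub>t = u h\<^sub>t\<^sub>'\<close> has norm \<open>|h\<^sub>t|\<^sup>2 H t = |h\<^sub>t\<^sub>'|\<^sup>2 H t'\<close>.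
\<close>

definition hermitian_metric ::
  "'a mfd \<Rightarrow> 'a local_eqn set \<Rightarrow> ('a local_eqn \<Rightarrow> 'a \<Rightarrow> real) \<Rightarrow> bool" where
  "hermitian_metric M E H \<longleftrightarrow>
     (\<forall>t\<in>E. smooth_on M (fst t) (H t) \<and> (\<forall>p\<in>fst t. H t p > 0)) \<and>
     (\<forall>t\<in>E. \<forall>t'\<in>E. \<forall>u. transition_fun M t t' u \<longrightarrow>
        (\<forall>p\<in>fst t \<inter> fst t'. H t' p = (cmod (u p))\<^sup>2 * H t p))"

definition triv_at :: "'a local_eqn set \<Rightarrow> 'a \<Rightarrow> 'a local_eqn" where
  "triv_at E p = (SOME t. t \<in> E \<and> p \<in> fst t)"

text \<open>\<open>\<parallel>\<sigma>\<parallel>\<close> and \<open>\<i>/2 \<partial>\<partial>' log H\<^sup>\<epsilon>\<close>; neither depends on the trivialization used.\<close>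

definition section_norm ::
  "'a local_eqn set \<Rightarrow> ('a local_eqn \<Rightarrow> 'a \<Rightarrow> real) \<Rightarrow> 'a \<Rightarrow> real" where
  "section_norm E H p = (let t = triv_at E p in sqrt ((cmod (snd t p))\<^sup>2 * H t p))"

definition ddbar_log_metric ::
  "'a mfd \<Rightarrow> 'a local_eqn set \<Rightarrow> ('a local_eqn \<Rightarrow> 'a \<Rightarrow> real) \<Rightarrow> real \<Rightarrow> 'a form11" where
  "ddbar_log_metric M E H \<epsilon> = (\<lambda>c p. ddbar M (\<lambda>q. ln (H (triv_at E p) q powr \<epsilon>)) c p)"

definition dirichlet_solution ::
  "'a mfd \<Rightarrow> 'a form11 \<Rightarrow> 'a form11 \<Rightarrow> ('a \<Rightarrow> real) \<Rightarrow> ('a \<Rightarrow> real) \<Rightarrow> ('a \<Rightarrow> real) \<Rightarrow> bool" where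
  "dirichlet_solution M \<Omega> g F \<phi> \<Phi> \<longleftrightarrow>
     Ck_on 2 M (pts M) \<Phi> \<and> Ck_on 4 M (mfd_interior M) \<Phi> \<and>
     (\<forall>c\<in>atlas M. \<forall>p\<in>fst c.
        wedge_power_coeff (mdim M) (form_add \<Omega> (ddbar M \<Phi>) c p)
          = complex_of_real (F p) * wedge_power_coeff (mdim M) (g c p)) \<and>
     nonneg_form11 M (form_add \<Omega> (ddbar M \<Phi>)) \<and>
     (\<forall>p\<in>mfd_boundary M. \<Phi> p = \<phi> p)"

definition osc :: "'a set \<Rightarrow> ('a \<Rightarrow> real) \<Rightarrow> real" where
  "osc S f = (SUP p\<in>S. f p) - (INF p\<in>S. f p)"

end

theory Submission
  imports Defs "HOL-Complex_Analysis.Complex_Analysis" "HOL-Homology.Invariance_of_Domain" "Jordan_Normal_Form.Determinant"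
begin

text \<open>
  Off \<open>E\<close> put \<open>phi = \<Phi> - \<epsilon> log \<parallel>\<sigma>\<parallel>\<^sup>2\<close>. Then \<open>\<Omega>\<^sub>0 + \<i>/2 \<partial>\<partial>' \<Phi> = g + \<i>/2 \<partial>\<partial>' phi\<close> and \<open>phi\<close> tends to infinity at
  \<open>E\<close>, so both estimates follow from the maximum principle on the complement of \<open>E\<close>.

  For (i) the test function is \<open>\<bar>\<nabla>phi\<bar>\<^sup>2 exp (- A phi + 1 / x)\<close> with \<open>x = phi + C \<ge> 1\<close>. Since
  \<open>\<bar>\<nabla>phi\<bar>\<^sup>2\<close> grows at most like \<open>\<parallel>\<sigma>\<parallel>\<^sup>-\<^sup>2\<close> and \<open>\<epsilon> A > \<epsilon> B > 1\<close>, it vanishes at \<open>E\<close>; on \<open>\<partial>M\<close> it is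
  controlled by the data. At an interior maximum take Kaehler normal coordinates in which
  \<open>g + \<i>/2 \<partial>\<partial>' phi\<close> is diagonal with eigenvalues \<open>\<lambda>\<^sub>p\<close>. If \<open>\<bar>\<nabla>phi\<bar> \<ge> 1\<close>, the second derivative test bounds
  \<open>\<Sum> 1 / \<lambda>\<^sub>p\<close> and, thanks to the term \<open>1 / x\<close>, also \<open>x\<^sup>-\<^sup>3 \<Sum> \<bar>phi\<^sub>p\<bar>\<^sup>2 / \<lambda>\<^sub>p\<close>. As the product of the
  \<open>\<lambda>\<^sub>p\<close> is \<open>F\<close>, each of them is then bounded, hence so is \<open>x\<^sup>-\<^sup>3 \<bar>\<nabla>phi\<bar>\<^sup>2\<close>.

  For (ii) the test function is \<open>exp (- A phi)\<close> times the trace of \<open>g + \<i>/2 \<partial>\<partial>' phi\<close>. A bound for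
  \<open>F\<close> is not among the admissible quantities there; it comes from the maximum principle for
  \<open>\<Phi> + log F / m\<close>, since \<open>F\<close> is at most the \<open>m\<close>-th power of the trace.
\<close>

(* The arrow of exact sequences would make limits ambiguous. *)
no_notation Exact_Sequence.exact_seq_arrow
  (\<open>(\<open>indent=3 notation=\<open>mixfix exact_seq\<close>\<close>_ / \<longlongrightarrow>\<index> _)\<close> [1000, 60])

subsection \<open>Partial derivatives on open subsets of \<open>\<complex>\<^sup>m\<close>\<close>

text \<open>In (i) the danger in the second derivative test is the square of the first derivative of
  the exponent. The first order condition at the maximum, put into Cauchy-Schwarz for the pure
  second derivatives of \<open>phi\<close>, gives a lower bound that cancels this square exactly, so
  that only terms linear in the slope survive. The data enter through the gradient of
  \<open>F^(1/m)\<close> because the gradient of \<open>log F\<close> is \<open>m F^(-1/m)\<close>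
  times it, and \<open>m F^(-1/m)\<close> is at most the sum of the reciprocal eigenvalues by the
  arithmetic-geometric mean inequality: the good curvature-type term absorbs it. In (ii) the squared
  gradient of the trace is absorbed, with constant 1, by the squares of third derivatives that
  appear when the equation is differentiated twice. The complement of \<open>E\<close> is not
  compact and the fourth derivatives of the solution exist only inside \<open>M\<close>; hence the
  maximum principle is stated with one-sided conditions on neighbourhoods, and boundary values of
  derivatives enter as limits from the interior. That interior points do not depend on the chart
  rests on invariance of domain.\<close>

abbreviation opn :: "nat \<Rightarrow> cvec set \<Rightarrow> bool" where
  "opn m U \<equiv> openin (top_of_set (Cn m)) U"

lemma tendsto_coordinatewise:
  fixes f :: "'x \<Rightarrow> 'i \<Rightarrow> 'b::topological_space"
  assumes "\<And>i. ((\<lambda>x. f x i) \<longlongrightarrow> l i) F"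
  shows "(f \<longlongrightarrow> l) F"
proof -
  have "limitin (product_topology (\<lambda>i. euclidean) UNIV) f l F"
    using assms by (subst limitin_componentwise) (auto simp: limitin_canonical_iff)
  then show ?thesis by (simp add: euclidean_product_topology limitin_canonical_iff)
qed

lemma tendsto_coordinate:
  fixes f :: "'x \<Rightarrow> 'i \<Rightarrow> 'b::topological_space"
  assumes "(f \<longlongrightarrow> l) F"
  shows "((\<lambda>x. f x i) \<longlongrightarrow> l i) F"
proof -
  have "limitin (product_topology (\<lambda>i. euclidean) UNIV) f l F"
    using assms by (simp add: euclidean_product_topology limitin_canonical_iff)
  then show ?thesis by (subst (asm) limitin_componentwise) (auto simp: limitin_canonical_iff)
qed

lemma opn_eventually:
  assumes "opn m U" "(\<gamma> \<longlongrightarrow> z) F" "z \<in> U" "\<forall>\<^sub>F t in F. \<gamma> t \<in> Cn m"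
  shows "\<forall>\<^sub>F t in F. \<gamma> t \<in> U"
proof -
  obtain V where V: "open V" "U = Cn m \<inter> V" using assms(1) by (auto simp: openin_open)
  have "\<forall>\<^sub>F t in F. \<gamma> t \<in> V" using assms V by (intro topological_tendstoD) auto
  with assms(4) show ?thesis by eventually_elim (use V in auto)
qed

lemma opn_Cn: "opn m U \<Longrightarrow> z \<in> U \<Longrightarrow> z \<in> Cn m"
  by (auto simp: openin_open)

lemma Cn_upd: "z \<in> Cn m \<Longrightarrow> j < m \<Longrightarrow> z(j := x) \<in> Cn m"
  by (auto simp: Cn_def)

lemma line_tendsto:
  "((\<lambda>t. z(j := z j + complex_of_real t * c)) \<longlongrightarrow> z) (nhds (0::real))"
proof (rule tendsto_coordinatewise)
  fix i
  have "((\<lambda>t. z j + complex_of_real t * c) \<longlongrightarrow> z j + complex_of_real 0 * c) (nhds 0)"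
    by (intro tendsto_intros filterlim_ident)
  then show "((\<lambda>t. (z(j := z j + complex_of_real t * c)) i) \<longlongrightarrow> z i) (nhds 0)"
    by (cases "i = j") auto
qed

lemma opn_line:
  assumes "opn m U" "z \<in> U" "j < m"
  shows "\<forall>\<^sub>F t in nhds (0::real). z(j := z j + complex_of_real t * c) \<in> U"
  using assms by (intro opn_eventually[OF assms(1) line_tendsto]) (auto simp: Cn_upd opn_Cn)

text \<open>The relational form carries the existence of the derivative, which the function
  \<open>pdv\<close> does not: its value is unspecified where no derivative exists.\<close>

definition hpd :: "nat \<Rightarrow> complex \<Rightarrow> (cvec \<Rightarrow> complex) \<Rightarrow> cvec \<Rightarrow> complex \<Rightarrow> bool" where
  "hpd j c f z d \<longleftrightarrow>
     ((\<lambda>t. f (z(j := z j + complex_of_real t * c))) has_vector_derivative d) (at 0)"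

definition pdv :: "nat \<Rightarrow> complex \<Rightarrow> (cvec \<Rightarrow> complex) \<Rightarrow> cvec \<Rightarrow> complex" where
  "pdv j c f z = vector_derivative (\<lambda>t. f (z(j := z j + complex_of_real t * c))) (at 0)"

lemma hpd_pdv: "hpd j c f z d \<Longrightarrow> pdv j c f z = d"
  by (auto simp: hpd_def pdv_def intro: vector_derivative_at)

lemma hpd_transform:
  assumes "opn m U" "z \<in> U" "j < m" "\<And>w. w \<in> U \<Longrightarrow> f w = g w"
  shows "hpd j c f z d \<longleftrightarrow> hpd j c g z d"
proof -
  have ev: "\<forall>\<^sub>F t in nhds 0. f (z(j := z j + complex_of_real t * c)) = g (z(j := z j + complex_of_real t * c))"
    using opn_line[OF assms(1-3)] by eventually_elim (use assms in auto)
  then show ?thesis unfolding hpd_def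
    using assms by (intro has_vector_derivative_cong_ev) auto
qed

lemma pdv_transform:
  assumes "opn m U" "z \<in> U" "j < m" "\<And>w. w \<in> U \<Longrightarrow> f w = g w"
  shows "pdv j c f z = pdv j c g z"
proof -
  have "hpd j c f z = hpd j c g z" by (intro ext hpd_transform[OF assms])
  then show ?thesis unfolding pdv_def vector_derivative_def by (simp add: hpd_def fun_eq_iff)
qed

lemma hpd_const: "hpd j c (\<lambda>_. a) z 0"
  by (simp add: hpd_def)

lemma hpd_coord: "hpd j c (\<lambda>w. w i) z (if i = j then c else 0)"
  unfolding hpd_def by (cases "i = j") (auto intro!: derivative_eq_intros)

lemma hpd_add: "hpd j c f z d \<Longrightarrow> hpd j c g z e \<Longrightarrow> hpd j c (\<lambda>w. f w + g w) z (d + e)"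
  unfolding hpd_def by (rule has_vector_derivative_add)

lemma hpd_mult: "hpd j c f z d \<Longrightarrow> hpd j c g z e \<Longrightarrow> hpd j c (\<lambda>w. f w * g w) z (d * g z + f z * e)"
  unfolding hpd_def by (auto intro!: derivative_eq_intros)

lemma hpd_cnj: "hpd j c f z d \<Longrightarrow> hpd j c (\<lambda>w. cnj (f w)) z (cnj d)"
  unfolding hpd_def by (rule has_vector_derivative_cnj)

text \<open>The outer function is complex differentiable, so its derivative acts by complex
  multiplication and no conjugate term arises.\<close>

lemma hpd_comp:
  assumes "hpd j c f z d" "(\<psi> has_field_derivative e) (at (f z))"
  shows "hpd j c (\<lambda>w. \<psi> (f w)) z (e * d)"
  using field_vector_diff_chain_at[OF assms(1)[unfolded hpd_def], of \<psi> e] assms(2)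
  by (simp add: hpd_def o_def mult.commute)

lemma Cint_opn [simp]: "opn m U \<Longrightarrow> Cint m U = U"
  unfolding Cint_def by (simp add: interior_of_openin)

lemma Cint_open: "opn m (Cint m S)" "Cint m S \<subseteq> S"
  unfolding Cint_def by (auto intro: openin_interior_of dest: interior_of_subset[THEN subsetD])

lemma Cint_maximal: "opn m U \<Longrightarrow> U \<subseteq> S \<Longrightarrow> U \<subseteq> Cint m S"
  unfolding Cint_def by (rule interior_of_maximal)

lemma Ck_cong:
  fixes f g :: "cvec \<Rightarrow> complex"
  assumes "\<And>z. z \<in> S \<Longrightarrow> f z = g z" "Ck k m S f"
  shows "Ck k m S g"
proof (cases k)
  case 0
  then show ?thesis using assms by (auto cong: continuous_on_cong)
next
  case (Suc n)
  have "\<exists>h. (\<forall>z\<in>Cint m S. hpd j c g z (h z)) \<and> Ck n m S h" if jc: "j < m" "c \<in> {1, \<i>}" for j c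
  proof -
    have "\<forall>j<m. \<forall>c\<in>{1, \<i>}. \<exists>h. (\<forall>z\<in>Cint m S. hpd j c f z (h z)) \<and> Ck n m S h"
      using assms(2) unfolding Suc Ck.simps hpd_def by (rule conjunct2)
    then obtain h where "\<forall>z\<in>Cint m S. hpd j c f z (h z)" "Ck n m S h"
      using jc by blast
    moreover have "hpd j c f z d = hpd j c g z d" if "z \<in> Cint m S" for z d
      using Cint_open[of m S] that assms(1) \<open>j < m\<close> by (intro hpd_transform[of m "Cint m S"]) auto
    ultimately show ?thesis by auto
  qed
  then show ?thesis using assms unfolding Suc hpd_def
    by (auto cong: continuous_on_cong simp del: fun_upd_apply)
qed

lemma Ck_SucI:
  assumes "opn m U" "continuous_on U f"
    and "\<And>j c. j < m \<Longrightarrow> c \<in> {1, \<i>} \<Longrightarrow> (\<forall>z\<in>U. hpd j c f z (d j c z)) \<and> Ck k m U (d j c)"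
  shows "Ck (Suc k) m U f"
  unfolding Ck.simps Cint_opn[OF assms(1)] hpd_def[symmetric] using assms(2,3) by blast

lemma Ck_continuous: "Ck k m U f \<Longrightarrow> continuous_on U f"
  by (cases k) auto

lemma Ck_SucD:
  fixes f :: "cvec \<Rightarrow> complex"
  assumes "opn m U" "Ck (Suc k) m U f" "j < m" "c \<in> {1, \<i>}"
  shows "z \<in> U \<Longrightarrow> hpd j c f z (pdv j c f z)" "Ck k m U (pdv j c f)"
proof -
  obtain h where h: "\<forall>z\<in>U. hpd j c f z (h z)" "Ck k m U h"
    using assms by (auto simp: hpd_def simp del: fun_upd_apply)
  then have "\<And>z. z \<in> U \<Longrightarrow> h z = pdv j c f z" using hpd_pdv by metis
  then show "z \<in> U \<Longrightarrow> hpd j c f z (pdv j c f z)" "Ck k m U (pdv j c f)"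
    using h Ck_cong[of U h "pdv j c f"] by auto
qed

lemma Ck_SucD_mono: "Ck (Suc k) m U f \<Longrightarrow> Ck k m U f"
proof (induction k arbitrary: f)
  case 0
  then show ?case by simp
next
  case (Suc k)
  then show ?case by (simp only: Ck.simps(2)) blast
qed

lemma Ck_mono:
  assumes "Ck k m U f" "l \<le> k"
  shows "Ck l m U f"
  using assms(2,1) by (induction k rule: dec_induct) (auto dest: Ck_SucD_mono simp del: Ck.simps)

lemma Ck_subset:
  fixes f :: "cvec \<Rightarrow> 'b::real_normed_vector"
  assumes "Ck k m S f" "opn m U" "U \<subseteq> S"
  shows "Ck k m U f"
  using assms(1)
proof (induction k arbitrary: f)
  case 0
  then show ?case using assms(3) by (auto intro: continuous_on_subset)
next
  case (Suc k)
  have "U \<subseteq> Cint m S" using assms by (intro Cint_maximal)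
  then have sub: "Cint m U \<subseteq> Cint m S" using assms by simp
  show ?case unfolding Ck.simps
  proof (intro conjI allI impI ballI)
    show "continuous_on U f" using Suc.prems assms(3) by (auto intro: continuous_on_subset)
    fix j c assume "j < m" "c \<in> {1, \<i>}"
    then obtain h where h: "\<forall>z\<in>Cint m S. ((\<lambda>t. f (z(j := z j + complex_of_real t * c))) has_vector_derivative h z) (at 0)"
      "Ck k m S h" using Suc.prems unfolding Ck.simps by metis
    show "\<exists>h. (\<forall>z\<in>Cint m U. ((\<lambda>t. f (z(j := z j + complex_of_real t * c))) has_vector_derivative h z) (at 0)) \<and> Ck k m U h"
      using h(1) sub Suc.IH[OF h(2)] by (intro exI[of _ h] conjI) blast+
  qed
qed

lemma Ck_of_real:
  assumes "Ck k m S f"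
  shows "Ck k m S (\<lambda>z. complex_of_real (f z))"
  using assms
proof (induction k arbitrary: f)
  case 0
  then show ?case by (auto intro!: continuous_intros)
next
  case (Suc k)
  show ?case unfolding Ck.simps
  proof (intro conjI allI impI ballI)
    show "continuous_on S (\<lambda>z. complex_of_real (f z))"
      using Suc.prems by (auto intro!: continuous_intros)
    fix j c assume "j < m" "c \<in> {1, \<i>}"
    then obtain h where h: "\<forall>z\<in>Cint m S. ((\<lambda>t. f (z(j := z j + complex_of_real t * c))) has_vector_derivative h z) (at 0)"
      "Ck k m S h" using Suc.prems unfolding Ck.simps by metis
    then show "\<exists>h. (\<forall>z\<in>Cint m S. ((\<lambda>t. complex_of_real (f (z(j := z j + complex_of_real t * c)))) has_vector_derivative h z) (at 0)) \<and> Ck k m S h"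
      using Suc.IH[OF h(2)] by (intro exI[of _ "\<lambda>z. complex_of_real (h z)"]) (auto intro!: bounded_linear.has_vector_derivative[OF bounded_linear_of_real] simp del: fun_upd_apply)
  qed
qed

subsection \<open>Closure properties of functions of class \<open>C\<^sup>k\<close>\<close>

lemma Ck_const: "opn m U \<Longrightarrow> Ck k m U (\<lambda>_. a::complex)"
proof (induction k arbitrary: a)
  case (Suc k)
  then show ?case by (intro Ck_SucI[where d="\<lambda>_ _ _. 0"]) (auto simp: hpd_const)
qed auto

lemma Ck_coord: "opn m U \<Longrightarrow> Ck k m U (\<lambda>w. w i)"
proof (induction k)
  case 0
  then show ?case by (auto intro: continuous_on_subset[OF continuous_on_product_coordinates])
next
  case (Suc k)
  then show ?case
    by (intro Ck_SucI[where d="\<lambda>j c _. if i = j then c else 0"])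
       (auto simp: hpd_coord Ck_const intro: continuous_on_subset[OF continuous_on_product_coordinates])
qed

lemma Ck_add: "opn m U \<Longrightarrow> Ck k m U f \<Longrightarrow> Ck k m U g \<Longrightarrow> Ck k m U (\<lambda>w. f w + g w :: complex)"
proof (induction k arbitrary: f g)
  case 0
  then show ?case by (auto intro: continuous_intros)
next
  case (Suc k)
  then show ?case
    by (intro Ck_SucI[where d="\<lambda>j c w. pdv j c f w + pdv j c g w"])
       (auto intro!: hpd_add continuous_intros dest: Ck_continuous intro: Ck_SucD simp del: Ck.simps)
qed

lemma Ck_mult: "opn m U \<Longrightarrow> Ck k m U f \<Longrightarrow> Ck k m U g \<Longrightarrow> Ck k m U (\<lambda>w. f w * g w :: complex)"
proof (induction k arbitrary: f g)
  case 0
  then show ?case by (auto intro: continuous_intros)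
next
  case (Suc k)
  then show ?case
    by (intro Ck_SucI[where d="\<lambda>j c w. pdv j c f w * g w + f w * pdv j c g w"])
       (auto intro!: hpd_mult Ck_add continuous_intros dest: Ck_continuous Ck_SucD_mono intro: Ck_SucD simp del: Ck.simps)
qed

lemma Ck_cnj: "opn m U \<Longrightarrow> Ck k m U f \<Longrightarrow> Ck k m U (\<lambda>w. cnj (f w))"
proof (induction k arbitrary: f)
  case 0
  then show ?case by (auto intro: continuous_intros)
next
  case (Suc k)
  then show ?case
    by (intro Ck_SucI[where d="\<lambda>j c w. cnj (pdv j c f w)"])
       (auto intro!: hpd_cnj continuous_intros dest: Ck_continuous intro: Ck_SucD simp del: Ck.simps)
qed

text \<open>The induction generalizes \<open>\<psi>\<close>, because the derivatives of the
  composite involve \<open>deriv \<psi>\<close>, which is again holomorphic on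
  \<open>T\<close>.\<close>

lemma Ck_comp:
  assumes "opn m U" "open T"
  shows "Ck k m U f \<Longrightarrow> f ` U \<subseteq> T \<Longrightarrow> \<psi> holomorphic_on T \<Longrightarrow> Ck k m U (\<lambda>w. \<psi> (f w))"
proof (induction k arbitrary: \<psi>)
  case 0
  then show ?case
    using continuous_on_compose2[OF holomorphic_on_imp_continuous_on] by (simp only: Ck.simps) blast
next
  case (Suc k)
  have *: "(\<psi> has_field_derivative deriv \<psi> (f z)) (at (f z))" if "z \<in> U" for z
    using Suc.prems assms(2) that by (intro holomorphic_derivI[of \<psi> T]) auto
  have "deriv \<psi> holomorphic_on T" using Suc.prems assms(2) by (intro holomorphic_deriv)
  then have 1: "Ck k m U (\<lambda>w. deriv \<psi> (f w))" using Suc.IH Suc.prems Ck_SucD_mono by blast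
  have "Ck k m U (\<lambda>w. \<psi> (f w))" using Suc.IH Suc.prems Ck_SucD_mono by blast
  then have 2: "continuous_on U (\<lambda>w. \<psi> (f w))" by (rule Ck_continuous)
  show ?case
    using 2 1 * Suc.prems assms(1)
    by (intro Ck_SucI[where d="\<lambda>j c w. deriv \<psi> (f w) * pdv j c f w"])
       (auto intro!: hpd_comp[where \<psi>=\<psi>] Ck_mult intro: Ck_SucD simp del: Ck.simps)
qed

lemma Ck_cmult: "opn m U \<Longrightarrow> Ck k m U f \<Longrightarrow> Ck k m U (\<lambda>w. a * f w :: complex)"
  by (intro Ck_mult Ck_const)

lemma Ck_uminus: "opn m U \<Longrightarrow> Ck k m U f \<Longrightarrow> Ck k m U (\<lambda>w. - f w :: complex)"
  using Ck_cmult[of m U k f "-1"] by simp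

lemma Ck_diff: "opn m U \<Longrightarrow> Ck k m U f \<Longrightarrow> Ck k m U g \<Longrightarrow> Ck k m U (\<lambda>w. f w - g w :: complex)"
  using Ck_add[of m U k f "\<lambda>w. - g w"] Ck_uminus by simp

lemma Ck_sum:
  "opn m U \<Longrightarrow> (\<And>i. i \<in> I \<Longrightarrow> Ck k m U (f i)) \<Longrightarrow> Ck k m U (\<lambda>w. \<Sum>i\<in>I. f i w :: complex)"
  by (induction I rule: infinite_finite_induct) (auto simp: Ck_const Ck_add simp del: Ck.simps)

lemma Ck_prod:
  "opn m U \<Longrightarrow> (\<And>i. i \<in> I \<Longrightarrow> Ck k m U (f i)) \<Longrightarrow> Ck k m U (\<lambda>w. \<Prod>i\<in>I. f i w :: complex)"
  by (induction I rule: infinite_finite_induct) (auto simp: Ck_const Ck_mult simp del: Ck.simps)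

lemma Ck_divide:
  fixes f g :: "cvec \<Rightarrow> complex"
  assumes "opn m U" "Ck k m U f" "Ck k m U g" "\<And>w. w \<in> U \<Longrightarrow> g w \<noteq> 0"
  shows "Ck k m U (\<lambda>w. f w / g w)"
proof -
  have "Ck k m U (\<lambda>w. inverse (g w))"
    using assms(4) by (intro Ck_comp[where T="-{0}" and \<psi>=inverse and f=g, OF assms(1) _ assms(3)]) (auto intro!: holomorphic_intros)
  then show ?thesis using Ck_mult[OF assms(1,2)] by (simp add: divide_inverse)
qed

lemmas Ck_intros = Ck_const Ck_coord Ck_add Ck_mult Ck_cnj Ck_uminus Ck_diff Ck_sum Ck_prod

section \<open>Differentiability along curves\<close>

lemma hpd_shift:
  assumes "hpd j c f (z(j := z j + complex_of_real s * c)) d"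
  shows "((\<lambda>s. f (z(j := z j + complex_of_real s * c))) has_vector_derivative d) (at s)"
proof -
  have "((\<lambda>t. t - s) has_vector_derivative 1) (at s)"
    by (auto intro!: derivative_eq_intros)
  from vector_diff_chain_at[OF this, of "\<lambda>t. f ((z(j := z j + complex_of_real s * c))(j := (z(j := z j + complex_of_real s * c)) j + complex_of_real t * c))" d]
  show ?thesis using assms unfolding hpd_def by (simp add: o_def algebra_simps)
qed

text \<open>One step of the argument that continuous partial derivatives give total
  differentiability. The point moves along \<open>\<delta>\<close> and then by \<open>r\<close> in
  one real coordinate direction. As a function of the two parameters, \<open>f\<close> has a partial
  derivative in the first at the base point and a continuous one in the second, and this suffices
  for differentiability there.\<close>

lemma curve_step:
  fixes r :: "real \<Rightarrow> real"
  assumes U: "opn m U" and f: "Ck (Suc k) m U f" and j: "j < m" "c \<in> {1, \<i>}"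
    and \<delta>: "\<delta> 0 \<in> U" "\<forall>\<^sub>F t in nhds 0. \<delta> t \<in> Cn m" "(\<delta> \<longlongrightarrow> \<delta> 0) (nhds 0)"
    and d: "((\<lambda>t. f (\<delta> t)) has_vector_derivative d) (at 0)"
    and r: "(r has_vector_derivative r') (at 0)" "r 0 = 0"
  shows "((\<lambda>t. f ((\<delta> t)(j := \<delta> t j + complex_of_real (r t) * c)))
           has_vector_derivative (d + r' *\<^sub>R pdv j c f (\<delta> 0))) (at 0)"
proof -
  define V where "V = (\<lambda>s y. (\<delta> s)(j := \<delta> s j + complex_of_real y * c))"
  have V0: "V 0 0 = \<delta> 0" by (auto simp: V_def)
  have Vlim: "((\<lambda>(s, y). V s y) \<longlongrightarrow> \<delta> 0) (nhds (0, 0))"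
  proof (rule tendsto_coordinatewise)
    fix i
    have f1: "filterlim fst (nhds 0) (nhds (0::real, 0::real))"
      and f2: "filterlim snd (nhds 0) (nhds (0::real, 0::real))"
      using tendsto_fst[OF filterlim_ident[of "nhds (0::real, 0::real)"]]
        tendsto_snd[OF filterlim_ident[of "nhds (0::real, 0::real)"]] by simp_all
    have d1: "((\<lambda>p. \<delta> (fst p) i) \<longlongrightarrow> \<delta> 0 i) (nhds (0::real, 0::real))" for i
      using filterlim_compose[OF tendsto_coordinate[OF \<delta>(3)] f1] by simp
    have d2: "((\<lambda>p. \<delta> (fst p) j + complex_of_real (snd p) * c) \<longlongrightarrow> \<delta> 0 j + of_real 0 * c) (nhds (0::real, 0::real))"
      by (intro tendsto_intros d1 f2)
    show "((\<lambda>x. (case x of (s, y) \<Rightarrow> V s y) i) \<longlongrightarrow> \<delta> 0 i) (nhds (0, 0))"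
      using d1[of i] d2 by (cases "i = j") (auto simp: V_def case_prod_unfold)
  qed
  have ev1: "\<forall>\<^sub>F p in nhds (0::real, 0::real). \<delta> (fst p) \<in> Cn m"
    using eventually_compose_filterlim[OF \<delta>(2), of fst "nhds (0::real, 0::real)"]
      tendsto_fst[OF filterlim_ident[of "nhds (0::real, 0::real)"]] by simp
  have "\<forall>\<^sub>F p in nhds (0::real, 0::real). (\<lambda>(s, y). V s y) p \<in> U"
    using ev1 by (intro opn_eventually[OF U Vlim \<delta>(1)]) (auto simp: V_def case_prod_unfold elim!: eventually_mono intro!: Cn_upd j)
  then obtain e where e: "e > 0" "\<And>s y. dist (s, y) (0, 0) < e \<Longrightarrow> V s y \<in> U"
    unfolding eventually_nhds_metric by auto
  \<comment> \<open>Half the radius, so that the square \<open>X \<times> X\<close> lies in the ball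
    of radius \<open>e\<close>: the partial derivative criterion wants a product with a convex
    second factor.\<close>
  define X where "X = ball (0::real) (e/2)"
  have XV: "V s y \<in> U" if "s \<in> X" "y \<in> X" for s y
  proof -
    have "dist (s, y) (0, 0) \<le> \<bar>s\<bar> + \<bar>y\<bar>"
      using norm_Pair_le[of s y] by (simp add: dist_norm)
    also have "\<dots> < e" using that by (auto simp: X_def)
    finally show ?thesis by (rule e(2))
  qed
  have op: "open (X \<times> X)" "(0, 0) \<in> X \<times> X" using e by (auto simp: X_def intro!: open_Times)
  have "continuous_on U (pdv j c f)" using Ck_SucD(2)[OF U f j] by (rule Ck_continuous)
  then have "((\<lambda>w. pdv j c f w) \<longlongrightarrow> pdv j c f (\<delta> 0)) (at (\<delta> 0) within U)"
    using \<delta>(1) by (auto simp: continuous_on_def)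
  then have pl: "((\<lambda>w. pdv j c f w) \<longlongrightarrow> pdv j c f (\<delta> 0)) (inf (nhds (\<delta> 0)) (principal U))"
    by (subst (asm) tendsto_at_within_iff_tendsto_nhds) (auto simp: at_within_def \<delta>(1))
  have "filterlim (\<lambda>(s, y). V s y) (inf (nhds (\<delta> 0)) (principal U)) (at (0, 0) within X \<times> X)"
    unfolding filterlim_inf filterlim_principal
  proof
    show "filterlim (\<lambda>(s, y). V s y) (nhds (\<delta> 0)) (at (0, 0) within X \<times> X)"
      using Vlim by (rule filterlim_mono) (auto simp: at_within_def)
    show "\<forall>\<^sub>F x in at (0, 0) within X \<times> X. (case x of (s, y) \<Rightarrow> V s y) \<in> U"
      unfolding eventually_at_filter using XV by (intro always_eventually) auto
  qed
  then have "((\<lambda>(s, y). pdv j c f (V s y)) \<longlongrightarrow> pdv j c f (V 0 0)) (at (0, 0) within X \<times> X)"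
    using filterlim_compose[OF pl] by (simp add: case_prod_unfold V0)
  then have cont: "continuous (at (0, 0) within X \<times> X) (\<lambda>(s, y). blinfun_scaleR_left (pdv j c f (V s y)))"
    unfolding continuous_within case_prod_unfold
    by (intro bounded_linear.tendsto[OF bounded_linear_blinfun_scaleR_left]) auto
  have fx: "((\<lambda>s. f (V s 0)) has_derivative (\<lambda>x. x *\<^sub>R d)) (at 0 within X)"
    using d unfolding has_vector_derivative_def by (auto simp: V_def intro: has_derivative_at_withinI)
  have fy: "((\<lambda>y. f (V s y)) has_derivative blinfun_apply (blinfun_scaleR_left (pdv j c f (V s y)))) (at y within X)"
    if "s \<in> X" "y \<in> X" for s y
  proof -
    have "hpd j c f (V s y) (pdv j c f (V s y))" by (rule Ck_SucD(1)[OF U f j XV[OF that]])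
    from hpd_shift[OF this[unfolded V_def]]
    show ?thesis unfolding has_vector_derivative_def V_def by (auto intro: has_derivative_at_withinI)
  qed
  have "((\<lambda>(s, y). f (V s y)) has_derivative (\<lambda>(a, b). a *\<^sub>R d + b *\<^sub>R pdv j c f (\<delta> 0))) (at (0, 0) within X \<times> X)"
  proof -
    have "0 \<in> X" "convex X" using e(1) unfolding X_def by (simp, simp add: convex_ball)
    from has_derivative_partialsI[OF fx fy cont this] show ?thesis
      unfolding V0 blinfun_scaleR_left.rep_eq .
  qed
  then have tot: "((\<lambda>(s, y). f (V s y)) has_derivative (\<lambda>(a, b). a *\<^sub>R d + b *\<^sub>R pdv j c f (\<delta> 0))) (at (0, r 0))"
    unfolding r(2) at_within_open[OF op(2,1)] .
  have "((\<lambda>t. (t, r t)) has_derivative (\<lambda>x. (x, x *\<^sub>R r'))) (at 0)"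
    using r(1) unfolding has_vector_derivative_def by (intro has_derivative_Pair) auto
  from has_derivative_compose[OF this tot]
  show ?thesis unfolding has_vector_derivative_def V_def by (simp add: algebra_simps)
qed

text \<open>The parameter \<open>s\<close> treats both Wirtinger derivatives at once, so that every
  rule of calculus is proved only once for the two.\<close>

definition Wd :: "complex \<Rightarrow> nat \<Rightarrow> (cvec \<Rightarrow> complex) \<Rightarrow> cvec \<Rightarrow> complex" where
  "Wd s j f z = (pdv j 1 f z + s * pdv j \<i> f z) / 2"

abbreviation "Dz \<equiv> Wd (- \<i>)"
abbreviation "Dzb \<equiv> Wd \<i>"

lemma pdv_Dz:
  "pdv j 1 f z = Dz j f z + Dzb j f z"
  "pdv j \<i> f z = \<i> * (Dz j f z - Dzb j f z)"
  by (simp_all add: Wd_def field_simps)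

text \<open>The coordinates of the curve are released one after the other, each in a real and then
  an imaginary step, and every step adds its term by \<open>curve_step\<close>. Since nothing is
  asked of the curve but derivatives of its coordinates at \<open>0\<close>, this also yields the
  chain rule for maps that are not holomorphic.\<close>

lemma curve_derivative:
  assumes U: "opn m U" and f: "Ck (Suc k) m U f"
    and \<gamma>0: "\<gamma> 0 \<in> U" and \<gamma>Cn: "\<forall>\<^sub>F t in nhds (0::real). \<gamma> t \<in> Cn m"
    and \<gamma>': "\<And>a. a < m \<Longrightarrow> ((\<lambda>t. \<gamma> t a) has_vector_derivative \<gamma>' a) (at 0)"
  shows "((\<lambda>t. f (\<gamma> t)) has_vector_derivative
           (\<Sum>a<m. Dz a f (\<gamma> 0) * \<gamma>' a + Dzb a f (\<gamma> 0) * cnj (\<gamma>' a))) (at 0)"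
proof -
  define \<delta> where "\<delta> = (\<lambda>n t a. if a < n then \<gamma> t a else \<gamma> 0 a)"
  have \<gamma>c: "((\<lambda>t. \<gamma> t a) \<longlongrightarrow> \<gamma> 0 a) (nhds 0)" if "a < m" for a
    using has_vector_derivative_continuous[OF \<gamma>'[OF that]]
      tendsto_at_iff_tendsto_nhds[of "\<lambda>t. \<gamma> t a" 0] by (simp add: continuous_at)
  have \<gamma>Cn0: "\<gamma> 0 \<in> Cn m" using U \<gamma>0 by (rule opn_Cn)
  have \<delta>Cn: "\<delta> n t \<in> Cn m" if "n \<le> m" for n t using \<gamma>Cn0 that by (auto simp: Cn_def \<delta>_def)
  have \<delta>0: "\<delta> n 0 = \<gamma> 0" for n by (auto simp: \<delta>_def)
  have \<delta>lim: "(\<delta> n \<longlongrightarrow> \<gamma> 0) (nhds 0)" if "n \<le> m" for n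
  proof (rule tendsto_coordinatewise)
    fix i show "((\<lambda>x. \<delta> n x i) \<longlongrightarrow> \<gamma> 0 i) (nhds 0)"
      using that \<gamma>c[of i] by (cases "i < n") (auto simp: \<delta>_def)
  qed
  have "((\<lambda>t. f (\<delta> n t)) has_vector_derivative
           (\<Sum>a<n. Dz a f (\<gamma> 0) * \<gamma>' a + Dzb a f (\<gamma> 0) * cnj (\<gamma>' a))) (at 0)" if "n \<le> m" for n
    using that
  proof (induction n)
    case 0
    have "\<delta> 0 t = \<gamma> 0" for t by (auto simp: \<delta>_def)
    then show ?case by simp
  next
    case (Suc n)
    then have n: "n < m" "n \<le> m" by auto
    define r1 where "r1 = (\<lambda>t. Re (\<gamma> t n - \<gamma> 0 n))"
    define r2 where "r2 = (\<lambda>t. Im (\<gamma> t n - \<gamma> 0 n))"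
    have r1: "(r1 has_vector_derivative Re (\<gamma>' n)) (at 0)"
      unfolding r1_def using bounded_linear.has_vector_derivative[OF bounded_linear_Re \<gamma>'[OF n(1)]]
      by (auto intro!: derivative_eq_intros)
    have r2: "(r2 has_vector_derivative Im (\<gamma>' n)) (at 0)"
      unfolding r2_def using bounded_linear.has_vector_derivative[OF bounded_linear_Im \<gamma>'[OF n(1)]]
      by (auto intro!: derivative_eq_intros)
    define \<delta>' where "\<delta>' = (\<lambda>t. (\<delta> n t)(n := \<delta> n t n + complex_of_real (r1 t) * 1))"
    have \<delta>'0: "\<delta>' 0 = \<gamma> 0" by (auto simp: \<delta>'_def \<delta>0 r1_def)
    have r1c: "(r1 \<longlongrightarrow> 0) (nhds 0)"
      unfolding r1_def using \<gamma>c[OF n(1)] by (auto intro!: tendsto_eq_intros)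
    have \<delta>'lim: "(\<delta>' \<longlongrightarrow> \<gamma> 0) (nhds 0)"
    proof (rule tendsto_coordinatewise)
      fix i
      have "((\<lambda>t. \<delta> n t i) \<longlongrightarrow> \<gamma> 0 i) (nhds 0)" for i
        using tendsto_coordinate[OF \<delta>lim[OF n(2)]] .
      then show "((\<lambda>t. \<delta>' t i) \<longlongrightarrow> \<gamma> 0 i) (nhds 0)"
        using r1c by (cases "i = n") (auto simp: \<delta>'_def intro!: tendsto_eq_intros)
    qed
    have \<delta>'Cn: "\<delta>' t \<in> Cn m" for t
      unfolding \<delta>'_def by (intro Cn_upd \<delta>Cn n)
    have 1: "((\<lambda>t. f (\<delta>' t)) has_vector_derivative
         ((\<Sum>a<n. Dz a f (\<gamma> 0) * \<gamma>' a + Dzb a f (\<gamma> 0) * cnj (\<gamma>' a)) + Re (\<gamma>' n) *\<^sub>R pdv n 1 f (\<gamma> 0))) (at 0)"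
      unfolding \<delta>'_def \<delta>0[of n, symmetric]
      by (rule curve_step[OF U f n(1) _ _ _ _ _ r1])
         (use Suc \<delta>Cn[OF n(2)] \<delta>lim[OF n(2)] \<gamma>0 in \<open>auto simp: \<delta>0 r1_def\<close>)
    have 2: "((\<lambda>t. f ((\<delta>' t)(n := \<delta>' t n + complex_of_real (r2 t) * \<i>))) has_vector_derivative
         ((\<Sum>a<n. Dz a f (\<gamma> 0) * \<gamma>' a + Dzb a f (\<gamma> 0) * cnj (\<gamma>' a)) + Re (\<gamma>' n) *\<^sub>R pdv n 1 f (\<gamma> 0)
           + Im (\<gamma>' n) *\<^sub>R pdv n \<i> f (\<delta>' 0))) (at 0)"
      by (rule curve_step[OF U f n(1) _ _ _ _ 1 r2])
         (use \<delta>'lim \<gamma>0 \<delta>'Cn in \<open>auto simp: \<delta>'0 r2_def simp del: fun_upd_apply\<close>)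
    have eq: "(\<delta>' t)(n := \<delta>' t n + complex_of_real (r2 t) * \<i>) = \<delta> (Suc n) t" for t
      by (auto simp: \<delta>'_def \<delta>_def r1_def r2_def complex_eq_iff)
    have "Re (\<gamma>' n) *\<^sub>R pdv n 1 f (\<gamma> 0) + Im (\<gamma>' n) *\<^sub>R pdv n \<i> f (\<gamma> 0)
        = Dz n f (\<gamma> 0) * \<gamma>' n + Dzb n f (\<gamma> 0) * cnj (\<gamma>' n)"
      unfolding pdv_Dz scaleR_conv_of_real by (subst (3 4) complex_eq) (simp add: algebra_simps)
    then show ?case using 2 unfolding eq \<delta>'0 by (simp add: add.assoc)
  qed
  from this[of m] have D: "((\<lambda>t. f (\<delta> m t)) has_vector_derivative
           (\<Sum>a<m. Dz a f (\<gamma> 0) * \<gamma>' a + Dzb a f (\<gamma> 0) * cnj (\<gamma>' a))) (at 0)" by simp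
  have "\<forall>\<^sub>F t in nhds 0. f (\<delta> m t) = f (\<gamma> t)"
    using \<gamma>Cn
  proof eventually_elim
    case (elim t)
    have "\<delta> m t = \<gamma> t" using elim \<gamma>Cn0 by (auto simp: \<delta>_def Cn_def fun_eq_iff)
    then show ?case by simp
  qed
  then show ?thesis
    using D by (subst (asm) has_vector_derivative_cong_ev[where g="\<lambda>t. f (\<gamma> t)"]) (auto dest: eventually_nhds_x_imp_x elim: eventually_mono)
qed

subsection \<open>Calculus of \<open>\<partial>\<close> and \<open>\<partial>'\<close>\<close>

text \<open>Pointwise existence of both real partial derivatives is all that the algebraic rules for
  \<open>Wd\<close> need; regularity enters only through \<open>Ck_dj\<close>.\<close>

definition dj :: "nat \<Rightarrow> (cvec \<Rightarrow> complex) \<Rightarrow> cvec \<Rightarrow> bool" where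
  "dj j f z \<longleftrightarrow> hpd j 1 f z (pdv j 1 f z) \<and> hpd j \<i> f z (pdv j \<i> f z)"

lemma dj_I: "hpd j 1 f z a \<Longrightarrow> hpd j \<i> f z b \<Longrightarrow> dj j f z"
  unfolding dj_def using hpd_pdv by metis

lemma Ck_dj: "opn m U \<Longrightarrow> Ck (Suc k) m U f \<Longrightarrow> z \<in> U \<Longrightarrow> j < m \<Longrightarrow> dj j f z"
  unfolding dj_def by (auto intro!: Ck_SucD)

lemma Ck_Wd: "opn m U \<Longrightarrow> Ck (Suc k) m U f \<Longrightarrow> j < m \<Longrightarrow> Ck k m U (Wd s j f)"
  unfolding Wd_def[abs_def] divide_inverse by (intro Ck_intros Ck_SucD) auto

lemma Wd_I:
  assumes "hpd j 1 f z a" "hpd j \<i> f z b"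
  shows "dj j f z" "Wd s j f z = (a + s * b) / 2"
  using assms[THEN hpd_pdv] assms by (auto simp: dj_def Wd_def)

lemma Wd_const: "dj j (\<lambda>_. a) z" "Wd s j (\<lambda>_. a) z = 0"
  using Wd_I[OF hpd_const hpd_const] by auto

lemma Wd_coord: "dj j (\<lambda>w. w i) z" "Dz j (\<lambda>w. w i) z = (if i = j then 1 else 0)"
    "Dzb j (\<lambda>w. w i) z = 0"
  using Wd_I(1)[OF hpd_coord hpd_coord] by (auto simp: Wd_I(2)[OF hpd_coord hpd_coord])

lemma Wd_add:
  assumes "dj j f z" "dj j g z"
  shows "dj j (\<lambda>w. f w + g w) z" "Wd s j (\<lambda>w. f w + g w) z = Wd s j f z + Wd s j g z"
proof -
  note * = Wd_I[OF hpd_add[OF conjunct1[OF assms(1)[unfolded dj_def]] conjunct1[OF assms(2)[unfolded dj_def]]]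
    hpd_add[OF conjunct2[OF assms(1)[unfolded dj_def]] conjunct2[OF assms(2)[unfolded dj_def]]]]
  show "dj j (\<lambda>w. f w + g w) z" by (rule *)
  show "Wd s j (\<lambda>w. f w + g w) z = Wd s j f z + Wd s j g z"
    unfolding * by (simp add: Wd_def algebra_simps add_divide_distrib)
qed

lemma Wd_mult:
  assumes "dj j f z" "dj j g z"
  shows "dj j (\<lambda>w. f w * g w) z" "Wd s j (\<lambda>w. f w * g w) z = Wd s j f z * g z + f z * Wd s j g z"
proof -
  note * = hpd_mult[of j 1 f z _ g, OF conjunct1[OF assms(1)[unfolded dj_def]] conjunct1[OF assms(2)[unfolded dj_def]]]
    hpd_mult[of j \<i> f z _ g, OF conjunct2[OF assms(1)[unfolded dj_def]] conjunct2[OF assms(2)[unfolded dj_def]]]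
  show "dj j (\<lambda>w. f w * g w) z" using * by (rule dj_I)
  show "Wd s j (\<lambda>w. f w * g w) z = Wd s j f z * g z + f z * Wd s j g z"
    unfolding Wd_def *[THEN hpd_pdv] by (simp add: field_simps)
qed

lemma Wd_cnj:
  assumes "dj j f z"
  shows "dj j (\<lambda>w. cnj (f w)) z" "Wd s j (\<lambda>w. cnj (f w)) z = cnj (Wd (cnj s) j f z)"
proof -
  note * = hpd_cnj[OF conjunct1[OF assms(1)[unfolded dj_def]]] hpd_cnj[OF conjunct2[OF assms(1)[unfolded dj_def]]]
  show "dj j (\<lambda>w. cnj (f w)) z" using * by (rule dj_I)
  show "Wd s j (\<lambda>w. cnj (f w)) z = cnj (Wd (cnj s) j f z)"
    unfolding Wd_def *[THEN hpd_pdv] by simp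
qed

lemma Wd_comp:
  assumes "dj j f z" "(\<psi> has_field_derivative e) (at (f z))"
  shows "dj j (\<lambda>w. \<psi> (f w)) z" "Wd s j (\<lambda>w. \<psi> (f w)) z = e * Wd s j f z"
proof -
  note * = hpd_comp[OF conjunct1[OF assms(1)[unfolded dj_def]] assms(2)] hpd_comp[OF conjunct2[OF assms(1)[unfolded dj_def]] assms(2)]
  show "dj j (\<lambda>w. \<psi> (f w)) z" using * by (rule dj_I)
  show "Wd s j (\<lambda>w. \<psi> (f w)) z = e * Wd s j f z"
    unfolding Wd_def *[THEN hpd_pdv] by (simp add: algebra_simps)
qed

lemma Wd_cmult:
  assumes "dj j f z"
  shows "dj j (\<lambda>w. a * f w) z" "Wd s j (\<lambda>w. a * f w) z = a * Wd s j f z"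
  using Wd_mult[OF Wd_const(1) assms] by (auto simp: Wd_const)

lemma Wd_uminus:
  assumes "dj j f z"
  shows "dj j (\<lambda>w. - f w) z" "Wd s j (\<lambda>w. - f w) z = - Wd s j f z"
  using Wd_cmult(1)[OF assms, of "-1"] Wd_cmult(2)[OF assms, of s "-1"] by auto

lemma Wd_sum:
  assumes "\<And>i. i \<in> I \<Longrightarrow> dj j (f i) z"
  shows "dj j (\<lambda>w. \<Sum>i\<in>I. f i w) z" "Wd s j (\<lambda>w. \<Sum>i\<in>I. f i w) z = (\<Sum>i\<in>I. Wd s j (f i) z)"
proof -
  have "dj j (\<lambda>w. \<Sum>i\<in>I. f i w) z \<and> Wd s j (\<lambda>w. \<Sum>i\<in>I. f i w) z = (\<Sum>i\<in>I. Wd s j (f i) z)"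
    using assms by (induction I rule: infinite_finite_induct) (auto simp: Wd_const Wd_add)
  then show "dj j (\<lambda>w. \<Sum>i\<in>I. f i w) z" "Wd s j (\<lambda>w. \<Sum>i\<in>I. f i w) z = (\<Sum>i\<in>I. Wd s j (f i) z)"
    by auto
qed

lemma Wd_transform:
  assumes "opn m U" "z \<in> U" "j < m" "\<And>w. w \<in> U \<Longrightarrow> f w = g w"
  shows "Wd s j f z = Wd s j g z"
  using pdv_transform[OF assms] by (simp add: Wd_def)

subsection \<open>Symmetry of second derivatives\<close>

text \<open>The second difference of \<open>F\<close> over a small square of side \<open>h\<close>
  is \<open>h^2\<close> times a value of either mixed derivative, by the mean value theorem applied
  twice in the two possible orders. Continuity at the origin forces the two limits to agree.\<close>

lemma symmetric_mixed_real:
  fixes F A B AB BA :: "real \<Rightarrow> real \<Rightarrow> real"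
  assumes e: "e > 0"
    and A: "\<And>s t. \<bar>s\<bar> < e \<Longrightarrow> \<bar>t\<bar> < e \<Longrightarrow> ((\<lambda>s. F s t) has_real_derivative A s t) (at s)"
    and AB: "\<And>s t. \<bar>s\<bar> < e \<Longrightarrow> \<bar>t\<bar> < e \<Longrightarrow> ((\<lambda>t. A s t) has_real_derivative AB s t) (at t)"
    and B: "\<And>s t. \<bar>s\<bar> < e \<Longrightarrow> \<bar>t\<bar> < e \<Longrightarrow> ((\<lambda>t. F s t) has_real_derivative B s t) (at t)"
    and BA: "\<And>s t. \<bar>s\<bar> < e \<Longrightarrow> \<bar>t\<bar> < e \<Longrightarrow> ((\<lambda>s. B s t) has_real_derivative BA s t) (at s)"
    and cAB: "((\<lambda>p. AB (fst p) (snd p)) \<longlongrightarrow> AB 0 0) (nhds (0, 0))"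
    and cBA: "((\<lambda>p. BA (fst p) (snd p)) \<longlongrightarrow> BA 0 0) (nhds (0, 0))"
  shows "AB 0 0 = BA 0 0"
proof (rule ccontr)
  assume "AB 0 0 \<noteq> BA 0 0"
  define d where "d = \<bar>AB 0 0 - BA 0 0\<bar> / 2"
  have d: "d > 0" using \<open>AB 0 0 \<noteq> BA 0 0\<close> by (simp add: d_def)
  have "\<forall>\<^sub>F p in nhds (0::real, 0::real). \<bar>AB (fst p) (snd p) - AB 0 0\<bar> < d \<and> \<bar>BA (fst p) (snd p) - BA 0 0\<bar> < d"
    using tendstoD[OF cAB d] tendstoD[OF cBA d] by eventually_elim (auto simp: dist_real_def)
  then obtain r where r: "r > 0" "\<And>s t. dist (s, t) (0, 0) < r \<Longrightarrow> \<bar>AB s t - AB 0 0\<bar> < d \<and> \<bar>BA s t - BA 0 0\<bar> < d"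
    unfolding eventually_nhds_metric by auto
  define h where "h = min (e/2) (r/3)"
  have h: "h > 0" "h < e" "2 * h < r" using e r by (auto simp: h_def)
  have near: "\<bar>AB s t - AB 0 0\<bar> < d \<and> \<bar>BA s t - BA 0 0\<bar> < d" if "0 < s" "s < h" "0 < t" "t < h" for s t
  proof (rule r(2))
    have "dist (s, t) (0, 0) \<le> \<bar>s\<bar> + \<bar>t\<bar>" using norm_Pair_le[of s t] by (simp add: dist_norm)
    then show "dist (s, t) (0, 0) < r" using that h by auto
  qed
  have "\<exists>x>0. x < h \<and> (F h h - F h 0) - (F 0 h - F 0 0) = (h - 0) * (A x h - A x 0)"
    using h by (intro MVT2[where f="\<lambda>s. F s h - F s 0"]) (auto intro!: DERIV_diff A)
  then obtain x where x: "0 < x" "x < h" "(F h h - F h 0) - (F 0 h - F 0 0) = h * (A x h - A x 0)" by auto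
  have "\<exists>y>0. y < h \<and> A x h - A x 0 = (h - 0) * AB x y"
    using h x by (intro MVT2) (auto intro!: AB)
  then obtain y where y: "0 < y" "y < h" "A x h - A x 0 = h * AB x y" by auto
  have "\<exists>x>0. x < h \<and> (F h h - F 0 h) - (F h 0 - F 0 0) = (h - 0) * (B h x - B 0 x)"
    using h by (intro MVT2[where f="\<lambda>t. F h t - F 0 t"]) (auto intro!: DERIV_diff B)
  then obtain y' where y': "0 < y'" "y' < h" "(F h h - F 0 h) - (F h 0 - F 0 0) = h * (B h y' - B 0 y')" by auto
  have "\<exists>x>0. x < h \<and> B h y' - B 0 y' = (h - 0) * BA x y'"
    using h y' by (intro MVT2) (auto intro!: BA)
  then obtain x' where x': "0 < x'" "x' < h" "B h y' - B 0 y' = h * BA x' y'" by auto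
  have "h * (h * AB x y) = h * (h * BA x' y')"
    using x(3) y'(3) unfolding y(3) x'(3) by linarith
  then have "AB x y = BA x' y'" using h by (metis less_irrefl mult_cancel_left)
  with near[OF x(1,2) y(1,2)] near[OF x'(1,2) y'(1,2)] show False unfolding d_def by (auto simp: abs_if split: if_splits)
qed

text \<open>The mean value theorem is real, so the real and imaginary parts of \<open>f\<close> on a
  two-parameter slice are treated separately.\<close>

lemma pdv_commute:
  assumes U: "opn m U" and f: "Ck (Suc (Suc k)) m U f" and z: "z \<in> U"
    and j: "j < m" "c \<in> {1, \<i>}" and l: "l < m" "d \<in> {1, \<i>}"
  shows "pdv l d (pdv j c f) z = pdv j c (pdv l d f) z"
proof -
  \<comment> \<open>The nested updates keep the case \<open>j = l\<close>, the two real directions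
    of one complex coordinate, within the same formula.\<close>
  define V where "V = (\<lambda>s t. z(j := z j + complex_of_real s * c, l := (z(j := z j + complex_of_real s * c)) l + complex_of_real t * d))"
  have V2: "V s t = (let w = z(l := z l + complex_of_real t * d) in w(j := w j + complex_of_real s * c))" for s t
    by (auto simp: V_def Let_def fun_eq_iff)
  have V0: "V 0 0 = z" by (auto simp: V_def)
  have Vlim: "((\<lambda>p. V (fst p) (snd p)) \<longlongrightarrow> z) (nhds (0, 0))"
  proof (rule tendsto_coordinatewise)
    fix i
    have "((\<lambda>p. z i + (if i = j then complex_of_real (fst p) * c else 0) + (if i = l then complex_of_real (snd p) * d else 0))
       \<longlongrightarrow> z i + (if i = j then complex_of_real 0 * c else 0) + (if i = l then complex_of_real 0 * d else 0)) (nhds (0::real, 0::real))"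
    proof -
      have f: "(fst \<longlongrightarrow> 0) (nhds (0::real, 0::real))" "(snd \<longlongrightarrow> 0) (nhds (0::real, 0::real))"
        using tendsto_fst[OF filterlim_ident[of "nhds (0::real, 0::real)"]]
          tendsto_snd[OF filterlim_ident[of "nhds (0::real, 0::real)"]] by simp_all
      show ?thesis
      proof (intro tendsto_add tendsto_const)
        show "((\<lambda>p. if i = j then complex_of_real (fst p) * c else 0) \<longlongrightarrow> (if i = j then complex_of_real 0 * c else 0)) (nhds (0::real, 0::real))"
          using tendsto_mult[OF tendsto_of_real[OF f(1)] tendsto_const] by (cases "i = j") simp_all
        show "((\<lambda>p. if i = l then complex_of_real (snd p) * d else 0) \<longlongrightarrow> (if i = l then complex_of_real 0 * d else 0)) (nhds (0::real, 0::real))"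
          using tendsto_mult[OF tendsto_of_real[OF f(2)] tendsto_const] by (cases "i = l") simp_all
      qed
    qed
    moreover have "(\<lambda>p. V (fst p) (snd p) i) = (\<lambda>p. z i + (if i = j then complex_of_real (fst p) * c else 0) + (if i = l then complex_of_real (snd p) * d else 0))"
      by (auto simp: V_def fun_eq_iff)
    ultimately show "((\<lambda>p. V (fst p) (snd p) i) \<longlongrightarrow> z i) (nhds (0, 0))" by (simp cong: if_cong)
  qed
  have "\<forall>\<^sub>F p in nhds (0::real, 0::real). V (fst p) (snd p) \<in> U"
    by (intro opn_eventually[OF U Vlim z] always_eventually allI)
       (unfold V_def, intro Cn_upd j(1) l(1) opn_Cn[OF U z])
  then obtain e0 where e0: "e0 > 0" "\<And>s t. dist (s, t) (0, 0) < e0 \<Longrightarrow> V s t \<in> U"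
    unfolding eventually_nhds_metric by auto
  define e where "e = e0 / 2"
  have e: "e > 0" using e0 by (simp add: e_def)
  have VU: "V s t \<in> U" if "\<bar>s\<bar> < e" "\<bar>t\<bar> < e" for s t
  proof (rule e0(2))
    have "dist (s, t) (0, 0) \<le> \<bar>s\<bar> + \<bar>t\<bar>" using norm_Pair_le[of s t] by (simp add: dist_norm)
    then show "dist (s, t) (0, 0) < e0" using that by (auto simp: e_def)
  qed
  note f1 = Ck_SucD(2)[OF U f j] Ck_SucD(2)[OF U f l]
  have dj: "((\<lambda>s. f' (V s t)) has_vector_derivative pdv j c f' (V s t)) (at s)"
    if "\<bar>s\<bar> < e" "\<bar>t\<bar> < e" "Ck (Suc n) m U f'" for s t f' n
    using Ck_SucD(1)[OF U that(3) j VU[OF that(1,2)]] unfolding V2 Let_def by (rule hpd_shift)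
  have dl: "((\<lambda>t. f' (V s t)) has_vector_derivative pdv l d f' (V s t)) (at t)"
    if "\<bar>s\<bar> < e" "\<bar>t\<bar> < e" "Ck (Suc n) m U f'" for s t f' n
    using Ck_SucD(1)[OF U that(3) l VU[OF that(1,2)]] unfolding V_def by (rule hpd_shift)
  have lim: "((\<lambda>p. q (V (fst p) (snd p))) \<longlongrightarrow> q (V 0 0)) (nhds (0, 0))" if "Ck k m U q" for q
  proof -
    have "continuous_on U q" using that by (rule Ck_continuous)
    then have "(q \<longlongrightarrow> q z) (at z within U)" using z by (auto simp: continuous_on_def)
    then have pl: "(q \<longlongrightarrow> q z) (inf (nhds z) (principal U))"
      by (subst (asm) tendsto_at_within_iff_tendsto_nhds) (auto simp: at_within_def z)
    have "\<forall>\<^sub>F p in nhds (0::real, 0::real). dist p (0,0) < e0"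
      using e0(1) by (auto simp: eventually_nhds_metric)
    then have "\<forall>\<^sub>F p in nhds (0::real, 0::real). V (fst p) (snd p) \<in> U"
      by eventually_elim (auto intro: e0)
    then have "filterlim (\<lambda>p. V (fst p) (snd p)) (inf (nhds z) (principal U)) (nhds (0, 0))"
      using Vlim by (simp add: filterlim_inf filterlim_principal)
    from filterlim_compose[OF pl this] show ?thesis by (simp add: V0)
  qed
  have main: "h (pdv l d (pdv j c f) z) = h (pdv j c (pdv l d f) z)" if h: "bounded_linear (h :: complex \<Rightarrow> real)" for h
  proof -
    note L = bounded_linear.tendsto[OF h lim[OF Ck_SucD(2)[OF U f1(1) l]]]
      bounded_linear.tendsto[OF h lim[OF Ck_SucD(2)[OF U f1(2) j]]]
    have "h (pdv l d (pdv j c f) (V 0 0)) = h (pdv j c (pdv l d f) (V 0 0))"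
      by (rule symmetric_mixed_real[OF e, where F="\<lambda>s t. h (f (V s t))" and A="\<lambda>s t. h (pdv j c f (V s t))"
            and B="\<lambda>s t. h (pdv l d f (V s t))" and AB="\<lambda>s t. h (pdv l d (pdv j c f) (V s t))"
            and BA="\<lambda>s t. h (pdv j c (pdv l d f) (V s t))"])
         (auto simp: has_real_derivative_iff_has_vector_derivative
           intro!: bounded_linear.has_vector_derivative[OF h] L
             dj[OF _ _ f] dl[OF _ _ f] dj[OF _ _ f1(2)] dl[OF _ _ f1(1)])
    then show ?thesis by (simp add: V0)
  qed
  show ?thesis using main[OF bounded_linear_Re] main[OF bounded_linear_Im] by (simp add: complex_eq_iff)
qed

lemma Wd_pdv:
  assumes "hpd j c (pdv l 1 f) z d" "hpd j c (pdv l \<i> f) z e"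
  shows "pdv j c (Wd s l f) z = (d + s * e) / 2"
proof (rule hpd_pdv)
  have "hpd j c (\<lambda>w. inverse 2 * (pdv l 1 f w + s * pdv l \<i> f w)) z (0 * (pdv l 1 f z + s * pdv l \<i> f z) + inverse 2 * (d + (0 * pdv l \<i> f z + s * e)))"
    by (intro hpd_mult hpd_add hpd_const assms)
  then show "hpd j c (Wd s l f) z ((d + s * e) / 2)" unfolding Wd_def[abs_def] by (simp add: field_simps)
qed

lemma Wd_commute:
  assumes U: "opn m U" and f: "Ck (Suc (Suc k)) m U f" and z: "z \<in> U" and j: "j < m" and l: "l < m"
  shows "Wd s j (Wd t l f) z = Wd t l (Wd s j f) z"
proof -
  have h: "hpd a c (pdv b d f) z (pdv a c (pdv b d f) z)" if "a < m" "b < m" "c \<in> {1,\<i>}" "d \<in> {1,\<i>}" for a b c d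
    using Ck_SucD(1)[OF U Ck_SucD(2)[OF U f]] that z by auto
  note [simp] = pdv_commute[OF U f z l _ j]
  show ?thesis
    unfolding Wd_def[of s j "Wd t l f"] Wd_def[of t l "Wd s j f"]
    by (simp add: Wd_pdv[OF h h] j l field_simps)
qed

declare Ck.simps [simp del]

lemma tendsto_within_open:
  "continuous_on U q \<Longrightarrow> z \<in> U \<Longrightarrow> (q \<longlongrightarrow> q z) (inf (nhds z) (principal U))"
  for q :: "cvec \<Rightarrow> 'b::topological_space"
  unfolding continuous_on_def
  by (drule bspec, assumption, subst (asm) tendsto_at_within_iff_tendsto_nhds) auto

subsection \<open>The chain rule\<close>

locale cmap =
  fixes m :: nat and W U :: "cvec set" and T :: "cvec \<Rightarrow> cvec"
  assumes W: "opn m W" and U: "opn m U" and T: "\<And>w. w \<in> W \<Longrightarrow> T w \<in> U"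
begin

text \<open>Coordinates from \<open>m\<close> on vanish identically because \<open>T\<close> takes
  its values in \<open>Cn m\<close>.\<close>

lemma continuous_on_T:
  assumes "\<And>a. a < m \<Longrightarrow> continuous_on W (\<lambda>w. T w a)"
  shows "continuous_on W T"
proof (rule continuous_on_coordinatewise_then_product)
  fix a show "continuous_on W (\<lambda>w. T w a)"
  proof (cases "a < m")
    case False
    then have "T w a = 0" if "w \<in> W" for w using opn_Cn[OF U T[OF that]] by (auto simp: Cn_def)
    then show ?thesis using continuous_on_cong[of W W "\<lambda>w. T w a" "\<lambda>_. 0"] by auto
  qed (use assms in auto)
qed

lemma hpd_chain:
  assumes f: "Ck (Suc k) m U f" and C: "\<And>a. a < m \<Longrightarrow> Ck (Suc l) m W (\<lambda>w. T w a)"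
    and w: "w \<in> W" "j < m" "c \<in> {1, \<i>}"
  shows "hpd j c (\<lambda>w. f (T w)) w (\<Sum>a<m. Dz a f (T w) * pdv j c (\<lambda>w. T w a) w
      + Dzb a f (T w) * cnj (pdv j c (\<lambda>w. T w a) w))"
proof -
  define \<gamma> where "\<gamma> = (\<lambda>t::real. T (w(j := w j + complex_of_real t * c)))"
  have \<gamma>0: "\<gamma> 0 = T w" by (simp add: \<gamma>_def)
  have "\<forall>\<^sub>F t in nhds 0. \<gamma> t \<in> Cn m"
    unfolding \<gamma>_def using opn_line[OF W w(1,2)] by eventually_elim (use T U opn_Cn in blast)
  then have "((\<lambda>t. f (\<gamma> t)) has_vector_derivative (\<Sum>a<m. Dz a f (\<gamma> 0) * pdv j c (\<lambda>w. T w a) w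
      + Dzb a f (\<gamma> 0) * cnj (pdv j c (\<lambda>w. T w a) w))) (at 0)"
    using Ck_SucD(1)[OF W C w(2,3,1)] T w
    by (intro curve_derivative[OF U f]) (auto simp: \<gamma>_def hpd_def simp del: fun_upd_apply)
  then show ?thesis by (simp add: \<gamma>_def hpd_def)
qed

lemma Wd_chain:
  assumes f: "Ck (Suc k) m U f" and C: "\<And>a. a < m \<Longrightarrow> Ck (Suc l) m W (\<lambda>w. T w a)"
    and w: "w \<in> W" "j < m"
  shows "Wd s j (\<lambda>w. f (T w)) w = (\<Sum>a<m. Dz a f (T w) * Wd s j (\<lambda>w. T w a) w
      + Dzb a f (T w) * cnj (Wd (cnj s) j (\<lambda>w. T w a) w))"
  unfolding Wd_def[of s j "\<lambda>w. f (T w)"] hpd_pdv[OF hpd_chain[OF f C w, of 1], simplified]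
    hpd_pdv[OF hpd_chain[OF f C w, of \<i>], simplified]
    sum_distrib_left sum.distrib[symmetric] sum_divide_distrib
  by (rule sum.cong) (simp_all add: Wd_def[of _ j "\<lambda>w. T w _"] field_simps)

lemma Ck_compose:
  fixes f :: "cvec \<Rightarrow> complex"
  assumes "Ck k m U f" and "\<And>a. a < m \<Longrightarrow> Ck k m W (\<lambda>w. T w a)"
  shows "Ck k m W (\<lambda>w. f (T w))"
  using assms
proof (induction k arbitrary: f)
  case 0
  have "continuous_on W T" using 0 by (intro continuous_on_T Ck_continuous)
  then show ?case
    using continuous_on_compose2[OF Ck_continuous[OF 0(1)], of W T] T by (auto simp: Ck.simps)
next
  case (Suc k)
  have "continuous_on W T" using Suc.prems by (intro continuous_on_T Ck_continuous)
  then have cont: "continuous_on W (\<lambda>w. f (T w))"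
    using continuous_on_compose2[OF Ck_continuous[OF Suc.prems(1)], of W T] T by auto
  show ?case
    by (intro Ck_SucI[OF W cont, where d="\<lambda>j c w. \<Sum>a<m. Dz a f (T w) * pdv j c (\<lambda>w. T w a) w
      + Dzb a f (T w) * cnj (pdv j c (\<lambda>w. T w a) w)"] conjI ballI hpd_chain[OF Suc.prems])
       (auto intro!: Ck_intros W Suc.IH Ck_Wd[OF U Suc.prems(1)] Ck_SucD(2)[OF W Suc.prems(2)] Ck_SucD_mono[OF Suc.prems(2)] simp del: Ck.simps)
qed

end

locale hmap = cmap +
  assumes smooth: "\<And>a k. a < m \<Longrightarrow> Ck k m W (\<lambda>w. T w a)"
    and holo: "\<And>a j w. a < m \<Longrightarrow> j < m \<Longrightarrow> w \<in> W \<Longrightarrow> Dzb j (\<lambda>w. T w a) w = 0"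
begin

definition "J a j w = Dz j (\<lambda>w. T w a) w"

lemma Ck_pull:
  fixes f :: "cvec \<Rightarrow> complex"
  shows "Ck k m U f \<Longrightarrow> Ck k m W (\<lambda>w. f (T w))"
  by (rule Ck_compose[OF _ smooth])

lemma Ck_J: "a < m \<Longrightarrow> j < m \<Longrightarrow> Ck k m W (J a j)"
  using Ck_Wd[OF W smooth] unfolding J_def[abs_def] by blast

lemma Dz_pull:
  assumes "Ck (Suc k) m U f" "w \<in> W" "j < m"
  shows "Dz j (\<lambda>w. f (T w)) w = (\<Sum>a<m. Dz a f (T w) * J a j w)"
    and "Dzb j (\<lambda>w. f (T w)) w = (\<Sum>a<m. Dzb a f (T w) * cnj (J a j w))"
  using assms by (auto simp: Wd_chain[OF assms(1) smooth] holo J_def)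

text \<open>The Jacobian of a holomorphic map is itself holomorphic: the mixed derivatives commute
  and the inner one is then zero.\<close>

lemma Dz_cnj_J:
  assumes "w \<in> W" "j < m" "k < m" "b < m"
  shows "Dzb j (J b k) w = 0" "Dz j (\<lambda>w. cnj (J b k w)) w = 0"
proof -
  have "Dzb j (J b k) w = Dz k (Dzb j (\<lambda>w. T w b)) w"
    unfolding J_def[abs_def] using assms by (intro Wd_commute[OF W smooth])
  also have "\<dots> = Dz k (\<lambda>_. 0) w"
    using assms holo by (intro Wd_transform[OF W]) auto
  finally show 1: "Dzb j (J b k) w = 0" by (simp add: Wd_const)
  have "dj j (J b k) w" using assms by (intro Ck_dj[OF W Ck_J])
  then show "Dz j (\<lambda>w. cnj (J b k w)) w = 0" using 1 by (simp add: Wd_cnj)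
qed

text \<open>Second derivatives of \<open>T\<close> do not appear, since \<open>Dz\<close>
  annihilates the conjugate Jacobian. This is what makes the complex Hessian a tensor under
  holomorphic changes of coordinates.\<close>

lemma ddb_pull:
  assumes "Ck (Suc (Suc k)) m U f" "w \<in> W" "j < m" "l < m"
  shows "Dz j (Dzb l (\<lambda>w. f (T w))) w = (\<Sum>a<m. \<Sum>b<m. Dz a (Dzb b f) (T w) * J a j w * cnj (J b l w))"
proof -
  have "Dz j (Dzb l (\<lambda>w. f (T w))) w = Dz j (\<lambda>w. \<Sum>b<m. Dzb b f (T w) * cnj (J b l w)) w"
    using assms by (intro Wd_transform[OF W] Dz_pull) auto
  also have "\<dots> = (\<Sum>b<m. Dz j (\<lambda>w. Dzb b f (T w) * cnj (J b l w)) w)"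
    using assms by (intro Wd_sum Wd_mult Wd_cnj Ck_dj[OF W] Ck_J Ck_pull Ck_Wd[OF U]) auto
  also have "\<dots> = (\<Sum>b<m. Dz j (\<lambda>w. Dzb b f (T w)) w * cnj (J b l w))"
  proof (rule sum.cong)
    fix b assume "b \<in> {..<m}"
    then have "dj j (\<lambda>w. Dzb b f (T w)) w" "dj j (\<lambda>w. cnj (J b l w)) w"
      using assms by (auto intro!: Wd_cnj Ck_dj[OF W] Ck_J Ck_pull Ck_Wd[OF U] simp del: Ck.simps)
    then show "Dz j (\<lambda>w. Dzb b f (T w) * cnj (J b l w)) w = Dz j (\<lambda>w. Dzb b f (T w)) w * cnj (J b l w)"
      using assms \<open>b \<in> {..<m}\<close> by (simp add: Wd_mult Dz_cnj_J)
  qed simp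
  also have "\<dots> = (\<Sum>b<m. (\<Sum>a<m. Dz a (Dzb b f) (T w) * J a j w) * cnj (J b l w))"
    using assms by (intro sum.cong refl) (auto simp: Dz_pull[OF Ck_Wd[OF U assms(1)]] simp del: Ck.simps)
  also have "\<dots> = (\<Sum>b<m. \<Sum>a<m. Dz a (Dzb b f) (T w) * J a j w * cnj (J b l w))"
    by (simp add: sum_distrib_right)
  finally show ?thesis by (subst sum.swap)
qed

end

subsection \<open>The second derivative test\<close>

text \<open>\<open>h'\<close> is differentiated at \<open>0\<close> only. If \<open>l\<close> were
  positive, \<open>h'\<close> would be positive just to the right of \<open>0\<close>, and the mean
  value theorem would lift \<open>h\<close> above its maximum.\<close>

lemma second_derivative_max:
  fixes h h' :: "real \<Rightarrow> real"
  assumes e: "e > 0" and h: "\<And>t. \<bar>t\<bar> < e \<Longrightarrow> (h has_real_derivative h' t) (at t)"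
    and h': "(h' has_real_derivative l) (at 0)" and max: "\<And>t. \<bar>t\<bar> < e \<Longrightarrow> h t \<le> h 0"
  shows "h' 0 = 0" "l \<le> 0"
proof -
  show h0: "h' 0 = 0"
    using DERIV_local_max[OF h[of 0] e] max e by auto
  show "l \<le> 0"
  proof (rule ccontr)
    assume "\<not> l \<le> 0"
    then obtain d where d: "d > 0" "\<And>x. 0 < x \<Longrightarrow> x < d \<Longrightarrow> h' 0 < h' (0 + x)"
      using DERIV_pos_inc_right[OF h'] by force
    define x where "x = min (d/2) (e/2)"
    have x: "0 < x" "x < d" "x < e" using d e by (auto simp: x_def)
    then have "\<exists>z>0. z < x \<and> h x - h 0 = (x - 0) * h' z"
      by (intro MVT2 h) auto
    then obtain z where z: "0 < z" "z < x" "h x - h 0 = x * h' z" by auto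
    then have "h' z > 0" using d(2)[of z] x h0 by auto
    then have "h x > h 0" using z x by (metis diff_gt_0_iff_gt mult_pos_pos)
    then show False using max[of x] x by auto
  qed
qed

text \<open>The one-variable test applies along the two real directions of coordinate
  \<open>j\<close>. As the mixed derivatives commute, \<open>4 Dz Dzb\<close> is the sum of the two
  pure second derivatives.\<close>

lemma max_derivatives:
  assumes U: "opn m U" and f: "Ck (Suc (Suc k)) m U f" and z: "z \<in> U" and j: "j < m"
    and real: "\<And>w. w \<in> U \<Longrightarrow> f w \<in> \<real>" and max: "\<And>w. w \<in> U \<Longrightarrow> Re (f w) \<le> Re (f z)"
  shows "Dz j f z = 0" "Re (Dz j (Dzb j f) z) \<le> 0"
proof -
  have *: "pdv j c f z = 0 \<and> Re (pdv j c (pdv j c f) z) \<le> 0" if c: "c \<in> {1, \<i>}" for c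
  proof -
    let ?l = "\<lambda>t::real. z(j := z j + complex_of_real t * c)"
    obtain e where e: "e > 0" "\<And>t. \<bar>t\<bar> < e \<Longrightarrow> ?l t \<in> U"
      using opn_line[OF U z j, of c] unfolding eventually_nhds_metric dist_real_def by auto
    have 1: "((\<lambda>t. f (?l t)) has_vector_derivative pdv j c f (?l t)) (at t)" if "\<bar>t\<bar> < e" for t
      using Ck_SucD(1)[OF U f j c e(2)[OF that]] by (rule hpd_shift)
    have 2: "((\<lambda>t. pdv j c f (?l t)) has_vector_derivative pdv j c (pdv j c f) z) (at 0)"
      using Ck_SucD(1)[OF U Ck_SucD(2)[OF U f j c] j c z] by (simp add: hpd_def)
    have h: "((\<lambda>t. Re (f (?l t))) has_real_derivative Re (pdv j c f (?l t))) (at t)" if "\<bar>t\<bar> < e" for t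
      unfolding has_real_derivative_iff_has_vector_derivative
      by (rule bounded_linear.has_vector_derivative[OF bounded_linear_Re 1[OF that]])
    have h': "((\<lambda>t. Re (pdv j c f (?l t))) has_real_derivative Re (pdv j c (pdv j c f) z)) (at 0)"
      unfolding has_real_derivative_iff_has_vector_derivative
      by (rule bounded_linear.has_vector_derivative[OF bounded_linear_Re 2])
    note D = second_derivative_max[OF e(1) h h']
    have "Re (f (?l t)) \<le> Re (f (?l 0))" if "\<bar>t\<bar> < e" for t
      using max[OF e(2)[OF that]] by simp
    note D = second_derivative_max[OF e(1) h h' this]
    have "((\<lambda>t. Im (f (?l t))) has_real_derivative Im (pdv j c f (?l 0))) (at 0)"
      unfolding has_real_derivative_iff_has_vector_derivative
      using e by (intro bounded_linear.has_vector_derivative[OF bounded_linear_Im 1]) auto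
    moreover have "((\<lambda>t. Im (f (?l t))) has_real_derivative 0) (at 0)"
    proof -
      have "\<forall>\<^sub>F t in nhds 0. Im (f (?l t)) = 0"
        using opn_line[OF U z j, of c] by eventually_elim (use real complex_is_Real_iff in blast)
      then show ?thesis by (subst DERIV_cong_ev[OF refl _ refl, where g="\<lambda>_. 0"]) auto
    qed
    ultimately have "Im (pdv j c f (?l 0)) = 0" by (rule DERIV_unique)
    then show ?thesis using D by (simp add: complex_eq_iff)
  qed
  show "Dz j f z = 0" using *[of 1] *[of \<i>] by (simp add: Wd_def)
  have "Dz j (Dzb j f) z = (pdv j 1 (pdv j 1 f) z + pdv j \<i> (pdv j \<i> f) z) / 4"
  proof -
    have h: "hpd j c (pdv j d f) z (pdv j c (pdv j d f) z)" if "c \<in> {1,\<i>}" "d \<in> {1,\<i>}" for c d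
      using Ck_SucD(1)[OF U Ck_SucD(2)[OF U f]] that z j by auto
    have "pdv j 1 (pdv j \<i> f) z = pdv j \<i> (pdv j 1 f) z"
      using pdv_commute[OF U f z j _ j] by auto
    then show ?thesis
      unfolding Wd_def[of "-\<i>" j "Dzb j f"] by (simp add: Wd_pdv[OF h h] field_simps)
  qed
  then show "Re (Dz j (Dzb j f) z) \<le> 0" using *[of 1] *[of \<i>] by (simp only:) simp
qed

subsection \<open>Derivatives at boundary points\<close>

text \<open>Unlike \<open>at z within Cint m S\<close>, this filter keeps the point \<open>z\<close>
  itself if it is interior, so one convergence statement serves interior and boundary points
  alike.\<close>

definition inner_nhds :: "nat \<Rightarrow> cvec set \<Rightarrow> cvec \<Rightarrow> cvec filter" where
  "inner_nhds m S z = inf (nhds z) (principal (Cint m S))"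

text \<open>Moving along a coordinate line gives interior points other than \<open>z\<close>. The
  filter has to be nontrivial for the \<open>Lim\<close> in \<open>rpartial\<close> to be
  determined.\<close>

lemma at_within_Cint:
  assumes "z \<in> Cint m S" "j < m"
  shows "at z within Cint m S \<noteq> bot"
proof -
  let ?l = "\<lambda>t::real. z(j := z j + complex_of_real t * 1)"
  have "filterlim ?l (at z within Cint m S) (at 0)"
    unfolding filterlim_at
  proof
    have "\<forall>\<^sub>F t in at (0::real). ?l t \<in> Cint m S"
      unfolding eventually_at_filter using opn_line[OF Cint_open(1) assms, of 1] by (rule eventually_mono) blast
    moreover have "\<forall>\<^sub>F t in at (0::real). t \<noteq> 0" by (auto simp: eventually_at_filter)
    ultimately show "\<forall>\<^sub>F t in at 0. ?l t \<in> Cint m S \<and> ?l t \<noteq> z"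
      by eventually_elim (auto simp: fun_upd_idem_iff)
    show "(?l \<longlongrightarrow> z) (at 0)" using line_tendsto[of z j 1] by (rule filterlim_mono) (auto simp: at_within_def)
  qed
  then show ?thesis unfolding filterlim_def by (metis at_neq_bot filtermap_bot_iff le_bot)
qed

lemma rpartial_tendsto:
  assumes h: "continuous_on S h" "\<And>w. w \<in> Cint m S \<Longrightarrow> pdv j c f w = h w" and j: "j < m" and z: "z \<in> S"
  shows "(pdv j c f \<longlongrightarrow> rpartial m S j c f z) (inner_nhds m S z)"
    and "z \<in> Cint m S \<Longrightarrow> rpartial m S j c f z = pdv j c f z"
proof -
  have "(h \<longlongrightarrow> h z) (inf (nhds z) (principal S))" by (rule tendsto_within_open[OF h(1) z])
  then have "(h \<longlongrightarrow> h z) (inner_nhds m S z)"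
    unfolding inner_nhds_def by (rule filterlim_mono) (use Cint_open(2)[of m S] in \<open>auto intro: le_infI2\<close>)
  then have lim: "(pdv j c f \<longlongrightarrow> h z) (inner_nhds m S z)"
    by (rule Lim_transform_eventually) (auto simp: inner_nhds_def eventually_inf_principal h)
  have rp: "rpartial m S j c f z = Lim (at z within Cint m S) (pdv j c f)"
    unfolding rpartial_def pdv_def ..
  have lim': "(pdv j c f \<longlongrightarrow> h z) (at z within Cint m S)"
    using lim by (rule filterlim_mono) (auto simp: inner_nhds_def at_within_def intro: le_infI2)
  have eq: "rpartial m S j c f z = h z" if "at z within Cint m S \<noteq> bot"
    unfolding rp using that lim' by (rule tendsto_Lim)
  show "rpartial m S j c f z = pdv j c f z" if "z \<in> Cint m S"
    using eq[OF at_within_Cint[OF that j]] h(2)[OF that] by simp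
  show "(pdv j c f \<longlongrightarrow> rpartial m S j c f z) (inner_nhds m S z)"
  \<comment> \<open>If the punctured filter is trivial, \<open>z\<close> is not an interior point
    and \<open>inner_nhds\<close> is trivial as well; the claim is then vacuous although the value
    of \<open>Lim\<close> is unspecified.\<close>
  proof (cases "at z within Cint m S = bot")
    case True
    then have "z \<notin> Cint m S" using at_within_Cint j by blast
    then have "inner_nhds m S z = bot" using True by (simp add: inner_nhds_def at_within_def)
    then show ?thesis by simp
  qed (use lim eq in simp)
qed

lemma Ck_pdv_ext:
  fixes f :: "cvec \<Rightarrow> complex"
  assumes "Ck (Suc k) m S f" "j < m" "c \<in> {1, \<i>}"
  shows "\<exists>h. Ck k m S h \<and> (\<forall>w\<in>Cint m S. pdv j c f w = h w)"
proof -
  have "\<forall>j<m. \<forall>c\<in>{1, \<i>}. \<exists>h. (\<forall>z\<in>Cint m S. hpd j c f z (h z)) \<and> Ck k m S h"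
    using assms(1) unfolding Ck.simps hpd_def by (rule conjunct2)
  then show ?thesis using assms(2,3) hpd_pdv by blast
qed

lemma Ck_pdv_ext2:
  fixes f :: "cvec \<Rightarrow> complex"
  assumes "Ck (Suc (Suc k)) m S f" "j < m" "c \<in> {1, \<i>}" "l < m" "d \<in> {1, \<i>}"
  shows "\<exists>h. continuous_on S h \<and> (\<forall>w\<in>Cint m S. pdv l d (pdv j c f) w = h w)"
proof -
  obtain h1 where h1: "Ck (Suc k) m S h1" "\<forall>w\<in>Cint m S. pdv j c f w = h1 w"
    using Ck_pdv_ext[OF assms(1-3)] by blast
  obtain h2 where h2: "Ck k m S h2" "\<forall>w\<in>Cint m S. pdv l d h1 w = h2 w"
    using Ck_pdv_ext[OF h1(1) assms(4,5)] by blast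
  have "pdv l d (pdv j c f) w = pdv l d h1 w" if "w \<in> Cint m S" for w
    using h1 that assms by (intro pdv_transform[OF Cint_open(1)]) auto
  then show ?thesis using h2 Ck_continuous by metis
qed

lemma dz_tendsto:
  assumes f: "Ck (Suc k) m S f" and j: "j < m" and z: "z \<in> S"
  shows "(Dz j f \<longlongrightarrow> dz m S j f z) (inner_nhds m S z)" "(Dzb j f \<longlongrightarrow> dzbar m S j f z) (inner_nhds m S z)"
    and "z \<in> Cint m S \<Longrightarrow> dz m S j f z = Dz j f z" "z \<in> Cint m S \<Longrightarrow> dzbar m S j f z = Dzb j f z"
proof -
  have *: "(pdv j c f \<longlongrightarrow> rpartial m S j c f z) (inner_nhds m S z) \<and> (z \<in> Cint m S \<longrightarrow> rpartial m S j c f z = pdv j c f z)"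
    if "c \<in> {1, \<i>}" for c
    using Ck_pdv_ext[OF f j that] rpartial_tendsto[OF Ck_continuous _ j z] by metis
  have l: "(pdv j 1 f \<longlongrightarrow> rpartial m S j 1 f z) (inner_nhds m S z)" "(pdv j \<i> f \<longlongrightarrow> rpartial m S j \<i> f z) (inner_nhds m S z)"
    using *[of 1] *[of \<i>] by auto
  show "(Dz j f \<longlongrightarrow> dz m S j f z) (inner_nhds m S z)" "(Dzb j f \<longlongrightarrow> dzbar m S j f z) (inner_nhds m S z)"
    using tendsto_divide[OF tendsto_diff[OF l(1) tendsto_mult[OF tendsto_const[of \<i>] l(2)]] tendsto_const[of 2]]
      tendsto_divide[OF tendsto_add[OF l(1) tendsto_mult[OF tendsto_const[of \<i>] l(2)]] tendsto_const[of 2]]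
    unfolding Wd_def[abs_def] dz_def dzbar_def by simp_all
  show "z \<in> Cint m S \<Longrightarrow> dz m S j f z = Dz j f z" "z \<in> Cint m S \<Longrightarrow> dzbar m S j f z = Dzb j f z"
    using *[of 1] *[of \<i>] unfolding Wd_def dz_def dzbar_def by simp_all
qed

text \<open>\<open>q\<close> is the first derivative including its boundary values, the function
  that an iterated derivative such as \<open>ddbar\<close> actually differentiates. Only its
  interior values matter for the limit, and there it coincides with \<open>Dzb l f\<close>.\<close>

lemma dz_dzbar_tendsto:
  assumes f: "Ck (Suc (Suc k)) m S f" and j: "j < m" and l: "l < m" and z: "z \<in> S"
    and q: "\<And>w. w \<in> S \<Longrightarrow> q w = dzbar m S l f w"
  shows "((\<lambda>w. Dz j (Dzb l f) w) \<longlongrightarrow> dz m S j q z) (inner_nhds m S z)"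
    and "z \<in> Cint m S \<Longrightarrow> dz m S j q z = Dz j (Dzb l f) z"
proof -
  have q': "q w = Dzb l f w" if "w \<in> Cint m S" for w
    using dz_tendsto(4)[OF f l _ that] q Cint_open(2)[of m S] that by auto
  have qq: "pdv j c q w = pdv j c (Dzb l f) w" if "w \<in> Cint m S" for w c
    using q' that j by (intro pdv_transform[OF Cint_open(1)]) auto
  have fC: "Ck (Suc (Suc k)) m (Cint m S) f" by (rule Ck_subset[OF f Cint_open])
  have "\<exists>h. continuous_on S h \<and> (\<forall>w\<in>Cint m S. pdv j c q w = h w)" if c: "c \<in> {1, \<i>}" for c
  proof -
    obtain h1 where h1: "continuous_on S h1" "\<forall>w\<in>Cint m S. pdv j c (pdv l 1 f) w = h1 w"
      using Ck_pdv_ext2[OF f l _ j c, of 1] by auto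
    obtain h2 where h2: "continuous_on S h2" "\<forall>w\<in>Cint m S. pdv j c (pdv l \<i> f) w = h2 w"
      using Ck_pdv_ext2[OF f l _ j c, of \<i>] by auto
    have "pdv j c q w = (h1 w + \<i> * h2 w) / 2" if w: "w \<in> Cint m S" for w
    proof -
      have *: "hpd j c (pdv l d f) w (pdv j c (pdv l d f) w)" if "d \<in> {1, \<i>}" for d
        by (rule Ck_SucD(1)[OF Cint_open(1) Ck_SucD(2)[OF Cint_open(1) fC l that] j c w])
      show ?thesis using h1 h2 w unfolding qq[OF w] Wd_pdv[OF *[of 1, simplified] *[of \<i>, simplified]] by simp
    qed
    then show ?thesis using h1 h2 by (intro exI[of _ "\<lambda>w. (h1 w + \<i> * h2 w) / 2"]) (auto intro!: continuous_intros)
  qed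
  then have *: "(pdv j c q \<longlongrightarrow> rpartial m S j c q z) (inner_nhds m S z) \<and> (z \<in> Cint m S \<longrightarrow> rpartial m S j c q z = pdv j c q z)"
    if "c \<in> {1, \<i>}" for c
    using rpartial_tendsto[OF _ _ j z, of _ c q] that by metis
  have l: "(pdv j 1 q \<longlongrightarrow> rpartial m S j 1 q z) (inner_nhds m S z)" "(pdv j \<i> q \<longlongrightarrow> rpartial m S j \<i> q z) (inner_nhds m S z)"
    using *[of 1] *[of \<i>] by auto
  have "(Dz j q \<longlongrightarrow> dz m S j q z) (inner_nhds m S z)"
    using tendsto_divide[OF tendsto_diff[OF l(1) tendsto_mult[OF tendsto_const[of \<i>] l(2)]] tendsto_const[of 2]]
    unfolding Wd_def[abs_def] dz_def by simp
  then show "((\<lambda>w. Dz j (Dzb l f) w) \<longlongrightarrow> dz m S j q z) (inner_nhds m S z)"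
    by (rule Lim_transform_eventually) (auto simp: inner_nhds_def eventually_inf_principal Wd_def[of "-\<i>" j] qq)
  show "z \<in> Cint m S \<Longrightarrow> dz m S j q z = Dz j (Dzb l f) z"
    using *[of 1] *[of \<i>] qq[of z] unfolding Wd_def[of "-\<i>" j] dz_def by simp
qed

subsection \<open>Determinants and inverse matrices\<close>

text \<open>Coefficient arrays are functions of two natural numbers of which only the indices below
  \<open>m\<close> matter; this passes them to the matrix type that carries determinants.\<close>

definition mt :: "nat \<Rightarrow> (nat \<Rightarrow> nat \<Rightarrow> complex) \<Rightarrow> complex Matrix.mat" where
  "mt m A = Matrix.mat m m (\<lambda>(i, j). A i j)"

definition dt :: "nat \<Rightarrow> (nat \<Rightarrow> nat \<Rightarrow> complex) \<Rightarrow> complex" where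
  "dt m A = Determinant.det (mt m A)"

definition cof :: "nat \<Rightarrow> (nat \<Rightarrow> nat \<Rightarrow> complex) \<Rightarrow> nat \<Rightarrow> nat \<Rightarrow> complex" where
  "cof m A j k = cofactor (mt m A) j k"

lemma mt_carrier: "mt m A \<in> carrier_mat m m"
  by (simp add: mt_def)

lemma mt_index: "i < m \<Longrightarrow> j < m \<Longrightarrow> mt m A $$ (i, j) = A i j"
  by (simp add: mt_def)

lemma mt_mult: "mt m A * mt m B = mt m (\<lambda>i j. \<Sum>k<m. A i k * B k j)"
  by (rule eq_matI) (auto simp: mt_def scalar_prod_def lessThan_atLeast0 intro!: sum.cong)

lemma mt_cong: "(\<And>i j. i < m \<Longrightarrow> j < m \<Longrightarrow> A i j = B i j) \<Longrightarrow> mt m A = mt m B"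
  by (rule eq_matI) (auto simp: mt_def)

lemma mt_one: "mt m (\<lambda>i j. if i = j then 1 else 0) = 1\<^sub>m m"
  by (rule eq_matI) (auto simp: mt_def)

lemma mt_eq_one: "mt m A = 1\<^sub>m m \<longleftrightarrow> (\<forall>i<m. \<forall>j<m. A i j = (if i = j then 1 else 0))"
proof
  assume "mt m A = 1\<^sub>m m"
  then show "\<forall>i<m. \<forall>j<m. A i j = (if i = j then 1 else 0)"
    by (metis mt_index index_one_mat(1))
next
  assume "\<forall>i<m. \<forall>j<m. A i j = (if i = j then 1 else 0)"
  then have "mt m A = mt m (\<lambda>i j. if i = j then 1 else 0)" by (intro mt_cong) auto
  then show "mt m A = 1\<^sub>m m" by (simp add: mt_one)
qed

lemma sum_delta_mult:
  fixes f :: "nat \<Rightarrow> complex"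
  assumes "j < m"
  shows "(\<Sum>k<m. (if j = k then 1 else 0) * f k) = f j" "(\<Sum>k<m. (if k = j then 1 else 0) * f k) = f j"
    "(\<Sum>k<m. f k * (if j = k then 1 else 0)) = f j" "(\<Sum>k<m. f k * (if k = j then 1 else 0)) = f j"
proof -
  have "(if j = k then 1 else 0) * f k = (if k = j then f k else 0)"
    "(if k = j then 1 else 0) * f k = (if k = j then f k else 0)"
    "f k * (if j = k then 1 else 0) = (if k = j then f k else 0)"
    "f k * (if k = j then 1 else 0) = (if k = j then f k else 0)" for k by auto
  then show "(\<Sum>k<m. (if j = k then 1 else 0) * f k) = f j" "(\<Sum>k<m. (if k = j then 1 else 0) * f k) = f j"
    "(\<Sum>k<m. f k * (if j = k then 1 else 0)) = f j" "(\<Sum>k<m. f k * (if k = j then 1 else 0)) = f j"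
    using assms by simp_all
qed

lemma left_right_inverse:
  fixes A B :: "nat \<Rightarrow> nat \<Rightarrow> complex"
  assumes "\<And>i j. i < m \<Longrightarrow> j < m \<Longrightarrow> (\<Sum>k<m. A i k * B k j) = (if i = j then 1 else 0)"
    and "i < m" "j < m"
  shows "(\<Sum>k<m. B i k * A k j) = (if i = j then 1 else 0)"
proof -
  have "mt m A * mt m B = 1\<^sub>m m" using assms(1) by (simp add: mt_mult mt_eq_one)
  then have "mt m B * mt m A = 1\<^sub>m m" by (rule mat_mult_left_right_inverse[OF mt_carrier mt_carrier])
  then show ?thesis using assms(2,3) by (simp add: mt_mult mt_eq_one)
qed

lemma dt_cong: "(\<And>i j. i < m \<Longrightarrow> j < m \<Longrightarrow> A i j = B i j) \<Longrightarrow> dt m A = dt m B"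
  unfolding dt_def by (subst mt_cong) auto

lemma dt_mult: "dt m (\<lambda>i j. \<Sum>k<m. A i k * B k j) = dt m A * dt m B"
  unfolding dt_def mt_mult[symmetric] by (rule det_mult[OF mt_carrier mt_carrier])

lemma dt_transpose: "dt m (\<lambda>i j. A j i) = dt m A"
proof -
  have "mt m (\<lambda>i j. A j i) = transpose_mat (mt m A)" by (rule eq_matI) (auto simp: mt_def)
  then show ?thesis unfolding dt_def by (simp add: det_transpose[OF mt_carrier])
qed

lemma dt_leibniz: "dt m A = (\<Sum>p | p permutes {..<m}. of_int (sign p) * (\<Prod>i<m. A i (p i)))"
proof -
  have "dt m A = (\<Sum>p | p permutes {0..<m}. of_int (sign p) * (\<Prod>i=0..<m. mt m A $$ (i, p i)))"
    unfolding dt_def by (rule det_def'[OF mt_carrier])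
  also have "\<dots> = (\<Sum>p | p permutes {0..<m}. of_int (sign p) * (\<Prod>i=0..<m. A i (p i)))"
    by (intro sum.cong refl arg_cong2[where f="(*)"] prod.cong) (auto simp: mt_index permutes_in_image[of _ "{0..<m}", simplified])
  finally show ?thesis by (simp add: lessThan_atLeast0)
qed

lemma dt_one: "dt m (\<lambda>i j. if i = j then 1 else 0) = 1"
  unfolding dt_def mt_one by simp

lemma dt_diag: "dt m (\<lambda>i j. if i = j then d i else 0) = (\<Prod>i<m. d i)"
proof -
  have "upper_triangular (mt m (\<lambda>i j. if i = j then d i else 0))" by (auto simp: mt_def)
  then show ?thesis unfolding dt_def
    by (subst det_upper_triangular[OF _ mt_carrier])
       (auto simp: prod_list_diag_prod mt_def lessThan_atLeast0 intro!: prod.cong)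
qed

lemma dt_cnj: "dt m (\<lambda>i j. cnj (A i j)) = cnj (dt m A)"
  by (simp add: dt_leibniz)

text \<open>Composing the inner permutation with the inverse of the outer one shows that each of the
  \<open>m!\<close> outer permutations contributes one determinant. The factor \<open>m!\<close>
  later cancels in the equation between volume forms.\<close>

lemma wedge_power_coeff_dt: "wedge_power_coeff m h = fact m * dt m h"
proof -
  have "(\<Sum>\<tau> | \<tau> permutes {..<m}. of_int (sign \<pi> * sign \<tau>) * (\<Prod>i<m. h (\<pi> i) (\<tau> i))) = dt m h"
    if \<pi>: "\<pi> permutes {..<m}" for \<pi>
  proof -
    have "dt m h = (\<Sum>\<rho> | \<rho> permutes {..<m}. of_int (sign \<rho>) * (\<Prod>i<m. h i (\<rho> i)))"
      by (rule dt_leibniz)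
    also have "\<dots> = (\<Sum>\<tau> | \<tau> permutes {..<m}. of_int (sign (\<tau> \<circ> Hilbert_Choice.inv \<pi>)) * (\<Prod>i<m. h i ((\<tau> \<circ> Hilbert_Choice.inv \<pi>) i)))"
      by (rule sum_permutations_compose_right[OF permutes_inv[OF \<pi>]])
    also have "\<dots> = (\<Sum>\<tau> | \<tau> permutes {..<m}. of_int (sign \<pi> * sign \<tau>) * (\<Prod>i<m. h (\<pi> i) (\<tau> i)))"
    proof (intro sum.cong refl arg_cong2[where f="(*)"])
      fix \<tau> assume "\<tau> \<in> {\<tau>. \<tau> permutes {..<m}}"
      then have \<tau>: "\<tau> permutes {..<m}" by simp
      have "permutation \<pi>" "permutation \<tau>" using \<pi> \<tau> by (auto intro: permutes_imp_permutation)
      then show "of_int (sign (\<tau> \<circ> Hilbert_Choice.inv \<pi>)) = (of_int (sign \<pi> * sign \<tau>) :: complex)"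
        by (simp add: sign_compose permutation_inverse sign_inverse mult.commute)
      show "(\<Prod>i<m. h i ((\<tau> \<circ> Hilbert_Choice.inv \<pi>) i)) = (\<Prod>i<m. h (\<pi> i) (\<tau> i))"
        by (subst prod.permute[OF \<pi>]) (simp add: o_def permutes_inverses[OF \<pi>])
    qed
    finally show ?thesis ..
  qed
  then have "wedge_power_coeff m h = (\<Sum>\<pi> | \<pi> permutes {..<m}. dt m h)"
    unfolding wedge_power_coeff_def by (intro sum.cong) auto
  also have "\<dots> = fact m * dt m h"
    using card_permutations[of "{..<m}" m] by simp
  finally show ?thesis .
qed

lemma dt_kernel:
  "dt m A = 0 \<longleftrightarrow> (\<exists>v. (\<exists>j<m. v j \<noteq> 0) \<and> (\<forall>i<m. (\<Sum>j<m. A i j * v j) = 0))" (is "_ \<longleftrightarrow> ?R")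
proof -
  have "dt m A = 0 \<longleftrightarrow> (\<exists>v. v \<in> carrier_vec m \<and> v \<noteq> 0\<^sub>v m \<and> mt m A *\<^sub>v v = 0\<^sub>v m)"
    unfolding dt_def by (rule det_0_iff_vec_prod_zero[OF mt_carrier])
  also have "\<dots> \<longleftrightarrow> ?R"
  proof
    assume "\<exists>v. v \<in> carrier_vec m \<and> v \<noteq> 0\<^sub>v m \<and> mt m A *\<^sub>v v = 0\<^sub>v m"
    then obtain v where v: "v \<in> carrier_vec m" "v \<noteq> 0\<^sub>v m" "mt m A *\<^sub>v v = 0\<^sub>v m" by auto
    have "\<exists>j<m. vec_index v j \<noteq> 0"
    proof (rule ccontr)
      assume "\<not> ?thesis"
      then have "v = 0\<^sub>v m" using v(1) by (intro eq_vecI) auto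
      then show False using v(2) by simp
    qed
    moreover have "(\<Sum>j<m. A i j * vec_index v j) = 0" if "i < m" for i
    proof -
      have "vec_index (mt m A *\<^sub>v v) i = 0" using v(3) that by simp
      then show ?thesis using that v(1) by (simp add: mt_def scalar_prod_def lessThan_atLeast0)
    qed
    ultimately show ?R by (intro exI[of _ "vec_index v"]) auto
  next
    assume ?R
    then obtain v where v: "\<exists>j<m. v j \<noteq> 0" "\<forall>i<m. (\<Sum>j<m. A i j * v j) = 0" by auto
    have "Matrix.vec m v \<noteq> 0\<^sub>v m" using v(1) by (metis index_vec index_zero_vec(1))
    moreover have "mt m A *\<^sub>v Matrix.vec m v = 0\<^sub>v m"
      using v(2) by (intro eq_vecI) (auto simp: mt_def scalar_prod_def lessThan_atLeast0)
    ultimately show "\<exists>v. v \<in> carrier_vec m \<and> v \<noteq> 0\<^sub>v m \<and> mt m A *\<^sub>v v = 0\<^sub>v m"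
      by (intro exI[of _ "Matrix.vec m v"]) auto
  qed
  finally show ?thesis .
qed

lemma cof_row: "i < m \<Longrightarrow> j < m \<Longrightarrow> (\<Sum>k<m. A i k * cof m A j k) = (if i = j then dt m A else 0)"
proof -
  assume ij: "i < m" "j < m"
  have "(mt m A * adj_mat (mt m A)) $$ (i, j) = (dt m A \<cdot>\<^sub>m 1\<^sub>m m) $$ (i, j)"
    using adj_mat(2)[OF mt_carrier, of m A] by (simp add: dt_def)
  moreover have "(mt m A * adj_mat (mt m A)) $$ (i, j) = (\<Sum>k<m. A i k * cof m A j k)"
    using ij by (simp add: adj_mat_def mt_def scalar_prod_def cof_def lessThan_atLeast0)
  ultimately show ?thesis using ij by simp
qed

text \<open>A left inverse of a square matrix is also a right inverse, so two left inverses agree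
  below \<open>m\<close>; the prescribed zeros outside the index range make them equal as
  functions.\<close>

lemma ginv_unique:
  assumes h: "\<forall>j k. j \<ge> m \<or> k \<ge> m \<longrightarrow> h j k = 0"
    "\<forall>j<m. \<forall>l<m. (\<Sum>k<m. h j k * g l k) = (if j = l then 1 else 0)"
  shows "ginv m g = h"
  unfolding ginv_def
proof (rule the_equality)
  show "(\<forall>j k. j \<ge> m \<or> k \<ge> m \<longrightarrow> h j k = 0) \<and> (\<forall>j<m. \<forall>l<m. (\<Sum>k<m. h j k * g l k) = (if j = l then 1 else 0))"
    using h by blast
  fix h' assume h': "(\<forall>j k. j \<ge> m \<or> k \<ge> m \<longrightarrow> h' j k = 0) \<and> (\<forall>j<m. \<forall>l<m. (\<Sum>k<m. h' j k * g l k) = (if j = l then 1 else 0))"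
  have r: "(\<Sum>l<m. g l i * h l k) = (if i = k then 1 else 0)" if "i < m" "k < m" for i k
    using left_right_inverse[of m h "\<lambda>k l. g l k" i k] h(2) that by auto
  show "h' = h"
  proof (intro ext)
    fix j k
    show "h' j k = h j k"
    proof (cases "j < m \<and> k < m")
      case True
      have "h' j k = (\<Sum>i<m. h' j i * (if i = k then 1 else 0))" using True by (simp only: sum_delta_mult)
      also have "\<dots> = (\<Sum>i<m. h' j i * (\<Sum>l<m. g l i * h l k))" using r True by (intro sum.cong) auto
      also have "\<dots> = (\<Sum>l<m. (\<Sum>i<m. h' j i * g l i) * h l k)"
        unfolding sum_distrib_left sum_distrib_right by (subst sum.swap) (simp add: mult.assoc)
      also have "\<dots> = (\<Sum>l<m. (if j = l then 1 else 0) * h l k)" using h' True by (intro sum.cong) auto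
      also have "\<dots> = h j k" using True by (simp only: sum_delta_mult)
      finally show ?thesis .
    next
      case False
      then show ?thesis using h h' by (metis not_less)
    qed
  qed
qed

text \<open>Cramer's rule. It makes the entries of the inverse rational in those of
  \<open>g\<close>, which yields both their smoothness and their continuity under limits.\<close>

lemma ginv_cof:
  assumes "dt m g \<noteq> 0"
  shows "ginv m g = (\<lambda>j k. if j < m \<and> k < m then cof m g j k / dt m g else 0)"
proof (rule ginv_unique)
  show "\<forall>j<m. \<forall>l<m. (\<Sum>k<m. (if j < m \<and> k < m then cof m g j k / dt m g else 0) * g l k) = (if j = l then 1 else 0)"
  proof (intro allI impI)
    fix j l assume jl: "j < m" "l < m"
    have "(\<Sum>k<m. (if j < m \<and> k < m then cof m g j k / dt m g else 0) * g l k) = (\<Sum>k<m. g l k * cof m g j k) / dt m g"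
      using jl by (simp add: sum_divide_distrib mult.commute)
    then show "(\<Sum>k<m. (if j < m \<and> k < m then cof m g j k / dt m g else 0) * g l k) = (if j = l then 1 else 0)"
      using jl assms by (simp add: cof_row)
  qed
qed auto

text \<open>In the first identity both factors are summed over their second index: with the
  holomorphic index first, \<open>ginv\<close> is inverse to the transpose of
  \<open>g\<close>.\<close>

lemma ginv_inverse:
  assumes "dt m g \<noteq> 0" "j < m" "l < m"
  shows "(\<Sum>k<m. ginv m g j k * g l k) = (if j = l then 1 else 0)"
    and "(\<Sum>k<m. ginv m g k j * g k l) = (if j = l then 1 else 0)"
proof -
  have 1: "(\<Sum>k<m. ginv m g j k * g l k) = (if j = l then 1 else 0)" if "j < m" "l < m" for j l
  proof -
    have "(\<Sum>k<m. ginv m g j k * g l k) = (\<Sum>k<m. g l k * cof m g j k) / dt m g"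
      using that by (simp add: ginv_cof[OF assms(1)] sum_divide_distrib mult.commute)
    then show ?thesis using that assms by (simp add: cof_row)
  qed
  show "(\<Sum>k<m. ginv m g j k * g l k) = (if j = l then 1 else 0)" using 1 assms by simp
  show "(\<Sum>k<m. ginv m g k j * g k l) = (if j = l then 1 else 0)"
    using left_right_inverse[of m "ginv m g" "\<lambda>k l. g l k" l j] 1 assms(2,3) by (simp add: mult.commute eq_commute)
qed

lemma Ck_dt:
  assumes "opn m U" "\<And>i j. i < n \<Longrightarrow> j < n \<Longrightarrow> Ck k m U (\<lambda>z. A z i j)"
  shows "Ck k m U (\<lambda>z. dt n (A z))"
  unfolding dt_leibniz
  by (intro Ck_sum Ck_mult Ck_const Ck_prod assms) (auto simp: permutes_in_image[of _ "{..<n}", simplified])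

lemma Ck_ginv:
  assumes U: "opn m U" and g: "\<And>i j. i < m \<Longrightarrow> j < m \<Longrightarrow> Ck k m U (\<lambda>z. g z i j)"
    and d: "\<And>z. z \<in> U \<Longrightarrow> dt m (g z) \<noteq> 0" and ij: "i < m" "j < m"
  shows "Ck k m U (\<lambda>z. ginv m (g z) i j)"
proof -
  have "Ck k m U (\<lambda>z. cof m (g z) i j)"
  proof -
    have "cof m (g z) i j = (-1) ^ (i + j) * dt (m - 1) (\<lambda>a b. g z (if a < i then a else Suc a) (if b < j then b else Suc b))" for z
      unfolding cof_def cofactor_def dt_def
      by (intro arg_cong2[where f="(*)"] refl arg_cong[where f=Determinant.det] eq_matI)
         (auto simp: mt_def mat_delete_def)
    then show ?thesis using g by (auto intro!: Ck_intros U Ck_dt)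
  qed
  from Ck_divide[OF U this Ck_dt[OF U g] d] have "Ck k m U (\<lambda>z. cof m (g z) i j / dt m (g z))" by simp
  moreover have "cof m (g z) i j / dt m (g z) = ginv m (g z) i j" if "z \<in> U" for z
    using ginv_cof[OF d[OF that]] ij by simp
  ultimately show ?thesis using Ck_cong[of U "\<lambda>z. cof m (g z) i j / dt m (g z)" "\<lambda>z. ginv m (g z) i j"] by blast
qed

subsection \<open>Hermitian forms\<close>

text \<open>The congruence of \<open>g\<close> by \<open>A\<close>. It is the transformation law of
  a \<open>(1,1)\<close>-form under a holomorphic map with Jacobian \<open>A\<close>, and also the
  matrix of the form in the frame given by the columns of \<open>A\<close>.\<close>

definition pull :: "nat \<Rightarrow> (nat \<Rightarrow> nat \<Rightarrow> complex) \<Rightarrow> (nat \<Rightarrow> nat \<Rightarrow> complex) \<Rightarrow> nat \<Rightarrow> nat \<Rightarrow> complex" where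
  "pull m A g j k = (\<Sum>a<m. \<Sum>b<m. g a b * A a j * cnj (A b k))"

definition gtr :: "nat \<Rightarrow> (nat \<Rightarrow> nat \<Rightarrow> complex) \<Rightarrow> (nat \<Rightarrow> nat \<Rightarrow> complex) \<Rightarrow> complex" where
  "gtr m g x = (\<Sum>j<m. \<Sum>k<m. ginv m g j k * x j k)"

lemma pull_mult: "pull m A g j k = (\<Sum>a<m. A a j * (\<Sum>b<m. g a b * cnj (A b k)))"
  by (simp add: pull_def sum_distrib_left ac_simps)

lemma dt_pull: "dt m (pull m A g) = dt m A * dt m g * cnj (dt m A)"
proof -
  have "dt m (pull m A g) = dt m (\<lambda>j a. A a j) * dt m (\<lambda>a k. \<Sum>b<m. g a b * cnj (A b k))"
    unfolding dt_mult[symmetric] pull_mult[abs_def] ..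
  also have "\<dots> = dt m A * (dt m g * cnj (dt m A))"
    by (simp add: dt_transpose[of m A] dt_mult dt_cnj)
  finally show ?thesis by (simp add: mult.assoc)
qed

lemma ginv_pull:
  assumes "dt m (pull m A g) \<noteq> 0" "a < m" "b < m"
  shows "ginv m g a b = (\<Sum>j<m. \<Sum>l<m. ginv m (pull m A g) j l * A a j * cnj (A b l))"
proof -
  let ?h = "ginv m (pull m A g)"
  let ?k = "\<lambda>a b. \<Sum>j<m. \<Sum>l<m. ?h j l * A a j * cnj (A b l)"
  \<comment> \<open>\<open>h A\<^sup>* g\<^sup>T\<close> is a left inverse of \<open>A\<close>, hence a right inverse.\<close>
  let ?X = "\<lambda>j c. \<Sum>l<m. ?h j l * (\<Sum>b<m. cnj (A b l) * g c b)"
  have XA: "(\<Sum>c<m. ?X j c * A c i) = (if j = i then 1 else 0)" if "j < m" "i < m" for i j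
  proof -
    have "(\<Sum>c<m. ?X j c * A c i) = (\<Sum>l<m. ?h j l * pull m A g i l)"
      unfolding pull_def sum_distrib_left sum_distrib_right
      by (subst sum.swap) (simp add: ac_simps)
    then show ?thesis using ginv_inverse(1)[OF assms(1) that] by simp
  qed
  have AX: "(\<Sum>j<m. A a j * ?X j c) = (if a = c then 1 else 0)" if "a < m" "c < m" for a c
    by (rule left_right_inverse[OF XA that])
  have "ginv m g = (\<lambda>a b. if a < m \<and> b < m then ?k a b else 0)"
  proof (rule ginv_unique)
    show "\<forall>a<m. \<forall>c<m. (\<Sum>b<m. (if a < m \<and> b < m then ?k a b else 0) * g c b) = (if a = c then 1 else 0)"
    proof (intro allI impI)
      fix a c assume ac: "a < m" "c < m"
      have "(\<Sum>b<m. (if a < m \<and> b < m then ?k a b else 0) * g c b) = (\<Sum>b<m. ?k a b * g c b)"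
        using ac by (intro sum.cong) auto
      also have "\<dots> = (\<Sum>b<m. \<Sum>j<m. \<Sum>l<m. A a j * (?h j l * (cnj (A b l) * g c b)))"
        by (simp add: sum_distrib_right sum_distrib_left ac_simps)
      also have "\<dots> = (\<Sum>j<m. \<Sum>b<m. \<Sum>l<m. A a j * (?h j l * (cnj (A b l) * g c b)))"
        by (rule sum.swap)
      also have "\<dots> = (\<Sum>j<m. \<Sum>l<m. \<Sum>b<m. A a j * (?h j l * (cnj (A b l) * g c b)))"
        by (intro sum.cong refl sum.swap)
      also have "\<dots> = (\<Sum>j<m. A a j * ?X j c)"
        by (simp add: sum_distrib_left)
      finally show "(\<Sum>b<m. (if a < m \<and> b < m then ?k a b else 0) * g c b) = (if a = c then 1 else 0)"
        using AX[OF ac] by simp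
    qed
  qed auto
  then show ?thesis using assms by simp
qed

lemma gtr_pull:
  assumes "dt m (pull m A g) \<noteq> 0"
  shows "gtr m (pull m A g) (pull m A x) = gtr m g x"
proof -
  let ?h = "ginv m (pull m A g)"
  have "gtr m g x = (\<Sum>a<m. \<Sum>b<m. \<Sum>j<m. \<Sum>l<m. ?h j l * (x a b * A a j * cnj (A b l)))"
    unfolding gtr_def using assms by (simp add: ginv_pull sum_distrib_right sum_distrib_left ac_simps)
  also have "\<dots> = (\<Sum>a<m. \<Sum>j<m. \<Sum>b<m. \<Sum>l<m. ?h j l * (x a b * A a j * cnj (A b l)))"
    by (intro sum.cong refl sum.swap)
  also have "\<dots> = (\<Sum>a<m. \<Sum>j<m. \<Sum>l<m. \<Sum>b<m. ?h j l * (x a b * A a j * cnj (A b l)))"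
    by (intro sum.cong refl sum.swap)
  also have "\<dots> = (\<Sum>j<m. \<Sum>a<m. \<Sum>l<m. \<Sum>b<m. ?h j l * (x a b * A a j * cnj (A b l)))"
    by (rule sum.swap)
  also have "\<dots> = (\<Sum>j<m. \<Sum>l<m. \<Sum>a<m. \<Sum>b<m. ?h j l * (x a b * A a j * cnj (A b l)))"
    by (intro sum.cong refl sum.swap)
  also have "\<dots> = gtr m (pull m A g) (pull m A x)"
    by (simp add: gtr_def pull_def sum_distrib_left)
  finally show ?thesis ..
qed

lemma ginv_orthonormal:
  assumes "\<And>i j. i < m \<Longrightarrow> j < m \<Longrightarrow> pull m L g i j = (if i = j then 1 else 0)" "a < m" "b < m"
  shows "ginv m g a b = (\<Sum>i<m. L a i * cnj (L b i))"
proof -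
  have d: "dt m (pull m L g) \<noteq> 0"
    using dt_cong[of m "pull m L g" "\<lambda>i j. if i = j then 1 else 0"] assms(1) dt_one by simp
  have h: "ginv m (pull m L g) = (\<lambda>j k. if j < m \<and> k < m \<and> j = k then 1 else 0)"
  proof (rule ginv_unique)
    show "\<forall>j<m. \<forall>l<m. (\<Sum>k<m. (if j < m \<and> k < m \<and> j = k then 1 else 0) * pull m L g l k) = (if j = l then 1 else 0)"
    proof (intro allI impI)
      fix j l assume jl: "j < m" "l < m"
      have "(\<Sum>k<m. (if j < m \<and> k < m \<and> j = k then 1 else 0) * pull m L g l k) = (\<Sum>k<m. (if j = k then 1 else 0) * pull m L g l k)"
        using jl by (intro sum.cong) auto
      then show "(\<Sum>k<m. (if j < m \<and> k < m \<and> j = k then 1 else 0) * pull m L g l k) = (if j = l then 1 else 0)"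
        using jl assms(1)[of l j] by (simp only: sum_delta_mult) auto
    qed
  qed auto
  have "(\<Sum>l<m. (if j < m \<and> l < m \<and> j = l then 1 else 0) * L a j * cnj (L b l)) = L a j * cnj (L b j)" if "j < m" for j
  proof -
    have "(\<Sum>l<m. (if j < m \<and> l < m \<and> j = l then 1 else 0) * L a j * cnj (L b l)) = (\<Sum>l<m. (if j = l then 1 else 0) * (L a j * cnj (L b l)))"
      using that by (intro sum.cong) auto
    then show ?thesis using that by (simp only: sum_delta_mult)
  qed
  then show ?thesis
    unfolding ginv_pull[OF d assms(2,3)] h by (intro sum.cong refl) simp
qed

lemma gtr_orthonormal:
  assumes "\<And>i j. i < m \<Longrightarrow> j < m \<Longrightarrow> pull m L g i j = (if i = j then 1 else 0)"
  shows "gtr m g x = (\<Sum>i<m. pull m L x i i)"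
proof -
  have "gtr m g x = (\<Sum>a<m. \<Sum>b<m. \<Sum>i<m. x a b * L a i * cnj (L b i))"
  proof -
    have "ginv m g a b * x a b = (\<Sum>i<m. x a b * L a i * cnj (L b i))" if "a < m" "b < m" for a b
      using ginv_orthonormal[OF assms that] by (simp add: sum_distrib_right sum_distrib_left ac_simps)
    then show ?thesis unfolding gtr_def by (auto intro!: sum.cong)
  qed
  also have "\<dots> = (\<Sum>a<m. \<Sum>i<m. \<Sum>b<m. x a b * L a i * cnj (L b i))"
    by (intro sum.cong refl sum.swap)
  also have "\<dots> = (\<Sum>i<m. \<Sum>a<m. \<Sum>b<m. x a b * L a i * cnj (L b i))"
    by (rule sum.swap)
  finally show ?thesis by (simp add: pull_def)
qed

definition bf :: "nat \<Rightarrow> (nat \<Rightarrow> nat \<Rightarrow> complex) \<Rightarrow> cvec \<Rightarrow> cvec \<Rightarrow> complex" where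
  "bf m g x y = (\<Sum>a<m. \<Sum>b<m. g a b * x a * cnj (y b))"

lemma sqn_bf: "sqn m g a = Re (bf m g a a)"
  by (simp add: sqn_def bf_def)

lemma pull_bf: "pull m A g j k = bf m g (\<lambda>a. A a j) (\<lambda>a. A a k)"
  by (simp add: pull_def bf_def)

lemma bf_add:
  "bf m g (\<lambda>a. x a + x' a) y = bf m g x y + bf m g x' y"
  "bf m g x (\<lambda>a. y a + y' a) = bf m g x y + bf m g x y'"
  by (simp_all add: bf_def sum.distrib algebra_simps)

lemma bf_scale:
  "bf m g (\<lambda>a. c * x a) y = c * bf m g x y"
  "bf m g x (\<lambda>a. c * y a) = cnj c * bf m g x y"
  by (simp_all add: bf_def sum_distrib_left ac_simps)

lemma bf_sum: "bf m g x (\<lambda>a. \<Sum>i\<in>I. y i a) = (\<Sum>i\<in>I. bf m g x (y i))"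
  by (induction I rule: infinite_finite_induct) (simp_all add: bf_add, simp_all add: bf_def)

lemma bf_herm:
  assumes "\<And>j k. j < m \<Longrightarrow> k < m \<Longrightarrow> g k j = cnj (g j k)"
  shows "bf m g y x = cnj (bf m g x y)"
proof -
  have "cnj (bf m g x y) = (\<Sum>a<m. \<Sum>b<m. g b a * y b * cnj (x a))"
  proof -
    have "cnj (g a b) * cnj (x a) * y b = g b a * y b * cnj (x a)" if "a < m" "b < m" for a b
      using assms[OF that] by (simp add: ac_simps)
    then show ?thesis unfolding bf_def by (auto intro!: sum.cong)
  qed
  also have "\<dots> = bf m g y x" unfolding bf_def by (rule sum.swap)
  finally show ?thesis ..
qed

lemma continuous_bf: "continuous_on S (\<lambda>x. bf m g x x)" "continuous_on S (\<lambda>x. bf m g x y)"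
proof -
  have c: "continuous_on S (\<lambda>x::cvec. x a)" for a
    by (rule continuous_on_subset[OF continuous_on_product_coordinates]) auto
  show "continuous_on S (\<lambda>x. bf m g x x)" "continuous_on S (\<lambda>x. bf m g x y)"
    unfolding bf_def by (intro continuous_intros c)+
qed

text \<open>Tychonoff: closed discs in the first \<open>m\<close> coordinates and the singleton zero
  in all others.\<close>

lemma compact_polydisc: "compact {x \<in> Cn m. \<forall>i. norm (x i) \<le> 1}"
proof -
  have "compactin (product_topology (\<lambda>i. euclidean) UNIV) (PiE UNIV (\<lambda>i::nat. if i < m then cball 0 1 else {0::complex}))"
    by (subst compactin_PiE) auto
  moreover have "PiE UNIV (\<lambda>i::nat. if i < m then cball 0 1 else {0::complex}) = {x \<in> Cn m. \<forall>i. norm (x i) \<le> 1}"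
    by (auto simp: Cn_def PiE_iff split: if_splits) (metis norm_zero not_less zero_le_one)
  ultimately show ?thesis by (simp add: euclidean_product_topology)
qed

subsection \<open>Simultaneous diagonalization\<close>

lemma linear_term_zero:
  fixes a c :: real
  assumes "\<And>t. 0 \<le> a * t + c * t\<^sup>2"
  shows "a = 0"
proof (rule ccontr)
  assume a: "a \<noteq> 0"
  \<comment> \<open>Any \<open>d > 0\<close> with \<open>2 d > c\<close> works: at
    \<open>t = - a / (2 d)\<close> the expression equals \<open>a^2 (c - 2 d) / (4 d^2)\<close>,
    which is negative.\<close>
  define d where "d = \<bar>c\<bar> + 1"
  have d: "d > 0" by (simp add: d_def)
  have "a * (- a / (2 * d)) + c * (- a / (2 * d))\<^sup>2 = a\<^sup>2 / (4 * d\<^sup>2) * (c - 2 * d)"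
    using d by (simp add: field_simps power2_eq_square)
  moreover have "a\<^sup>2 / (4 * d\<^sup>2) * (c - 2 * d) < 0"
    using a d by (intro mult_pos_neg) (auto simp: d_def)
  ultimately show False using assms[of "- a / (2 * d)"] by simp
qed

context
  fixes m :: nat and g h :: "nat \<Rightarrow> nat \<Rightarrow> complex"
  assumes gh: "\<And>j k. j < m \<Longrightarrow> k < m \<Longrightarrow> g k j = cnj (g j k)"
    and gpos: "\<And>a. \<exists>j<m. a j \<noteq> 0 \<Longrightarrow> Re (bf m g a a) > 0"
    and hh: "\<And>j k. j < m \<Longrightarrow> k < m \<Longrightarrow> h k j = cnj (h j k)"
begin

text \<open>Variational proof of the spectral theorem for a pair of Hermitian forms: a vector that
  maximizes the quotient of \<open>h\<close> by \<open>g\<close> on the \<open>g\<close>-orthogonal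
  complement of the vectors already found is the next eigenvector, with the maximum as eigenvalue.
  Normalizing the largest coordinate to modulus 1 makes the domain compact.\<close>

lemma eigenvector_step:
  assumes n: "n < m"
    and v: "\<And>i. i < n \<Longrightarrow> v i \<in> Cn m"
    and on: "\<And>i j. i < n \<Longrightarrow> j < n \<Longrightarrow> bf m g (v i) (v j) = (if i = j then 1 else 0)"
    and ev: "\<And>i y. i < n \<Longrightarrow> y \<in> Cn m \<Longrightarrow> bf m h (v i) y = complex_of_real (lam i) * bf m g (v i) y"
  shows "\<exists>w l. w \<in> Cn m \<and> (\<forall>i<n. bf m g w (v i) = 0) \<and> bf m g w w = 1 \<and>
     (\<forall>y\<in>Cn m. bf m h w y = complex_of_real l * bf m g w y)"
proof -
  define W where "W = {x \<in> Cn m. \<forall>i<n. bf m g x (v i) = 0}"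
  define K where "K = {x \<in> Cn m. \<forall>i. norm (x i) \<le> 1} \<inter> ((\<Union>i<m. {x. norm (x i) = 1}) \<inter> (\<Inter>i<n. {x. bf m g x (v i) = 0}))"
  have KW: "x \<in> W" if "x \<in> K" for x using that by (auto simp: K_def W_def)
  have Knz: "\<exists>j<m. x j \<noteq> 0" if "x \<in> K" for x using that by (force simp: K_def)
  have "continuous_on UNIV (\<lambda>x::cvec. x i)" for i by simp
  then have "closed {x::cvec. norm (x i) = 1}" for i
    by (intro closed_Collect_eq continuous_intros) auto
  moreover have "closed {x. bf m g x (v i) = 0}" for i
    by (intro closed_Collect_eq continuous_intros continuous_bf)
  ultimately have "closed ((\<Union>i<m. {x::cvec. norm (x i) = 1}) \<inter> (\<Inter>i<n. {x. bf m g x (v i) = 0}))"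
    by (intro closed_Int closed_UN closed_INT) auto
  then have K: "compact K" unfolding K_def by (intro compact_Int_closed compact_polydisc)
  have scaled: "\<exists>y\<in>K. \<exists>c>0. x = (\<lambda>i. complex_of_real c * y i)" if x: "x \<in> W" "\<exists>j<m. x j \<noteq> 0" for x
  proof -
    define c where "c = Max ((\<lambda>i. norm (x i)) ` {..<m})"
    have fin: "finite ((\<lambda>i. norm (x i)) ` {..<m})" "(\<lambda>i. norm (x i)) ` {..<m} \<noteq> {}" using n by auto
    have le: "norm (x i) \<le> c" if "i < m" for i unfolding c_def using that by (intro Max_ge) auto
    obtain j where j: "j < m" "x j \<noteq> 0" using x by auto
    have c: "c > 0" using le[OF j(1)] j(2) by (meson less_le_trans zero_less_norm_iff)
    obtain i where i: "i < m" "norm (x i) = c" using Max_in[OF fin] unfolding c_def by auto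
    define y where "y = (\<lambda>i. complex_of_real (1/c) * x i)"
    have "norm (y i) \<le> 1" for i
    proof (cases "i < m")
      case True then show ?thesis using le c by (simp add: y_def norm_mult norm_divide)
    next
      case False then show ?thesis using x by (simp add: y_def W_def Cn_def)
    qed
    moreover have "norm (y i) = 1" using i c by (simp add: y_def norm_mult norm_divide)
    moreover have "y \<in> Cn m" using x by (auto simp: y_def W_def Cn_def)
    moreover have "bf m g y (v i) = 0" if "i < n" for i
      unfolding y_def bf_scale using x that by (simp add: W_def)
    ultimately have "y \<in> K" using i by (auto simp: K_def)
    moreover have "x = (\<lambda>i. complex_of_real c * y i)" using c by (simp add: y_def fun_eq_iff)
    ultimately show ?thesis using c by blast
  qed
  \<comment> \<open>The orthogonality relations are \<open>n < m\<close> linear equations. Padded by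
    zero rows to a square system they have determinant zero, hence a nontrivial solution.\<close>
  have "dt m (\<lambda>i a. if i < n then \<Sum>b<m. g a b * cnj (v i b) else 0) = 0"
    unfolding dt_leibniz
  proof (rule sum.neutral, intro ballI)
    fix p assume "p \<in> {p. p permutes {..<m}}"
    have "(\<Prod>i<m. if i < n then \<Sum>b<m. g (p i) b * cnj (v i b) else 0) = 0"
      using n by (intro prod_zero) auto
    then show "of_int (sign p) * (\<Prod>i<m. if i < n then \<Sum>b<m. g (p i) b * cnj (v i b) else 0) = 0" by simp
  qed
  then obtain u where u: "\<exists>j<m. u j \<noteq> 0" "\<forall>i<m. (\<Sum>a<m. (if i < n then \<Sum>b<m. g a b * cnj (v i b) else 0) * u a) = 0"
    unfolding dt_kernel by auto
  define u' where "u' = (\<lambda>a. if a < m then u a else 0)"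
  have "bf m g u' (v i) = 0" if "i < n" for i
  proof -
    have "(\<Sum>a<m. (\<Sum>b<m. g a b * cnj (v i b)) * u a) = 0" using u(2)[rule_format, of i] that n by simp
    moreover have "bf m g u' (v i) = (\<Sum>a<m. (\<Sum>b<m. g a b * cnj (v i b)) * u a)"
      unfolding bf_def u'_def by (intro sum.cong refl) (simp add: sum_distrib_left sum_distrib_right ac_simps)
    ultimately show ?thesis by simp
  qed
  then have "u' \<in> W" "\<exists>j<m. u' j \<noteq> 0" using u(1) by (auto simp: W_def Cn_def u'_def)
  then have Kne: "K \<noteq> {}" using scaled by blast
  have "continuous_on K (\<lambda>x. Re (bf m h x x) / Re (bf m g x x))"
    using gpos Knz by (intro continuous_intros continuous_bf) force
  from continuous_attains_sup[OF K Kne this] obtain w0 where w0: "w0 \<in> K"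
    "\<And>x. x \<in> K \<Longrightarrow> Re (bf m h x x) / Re (bf m g x x) \<le> Re (bf m h w0 w0) / Re (bf m g w0 w0)" by auto
  define l where "l = Re (bf m h w0 w0) / Re (bf m g w0 w0)"
  have w0g: "Re (bf m g w0 w0) > 0" using gpos Knz w0 by blast
  \<comment> \<open>\<open>Q\<close> is nonnegative on \<open>W\<close> and vanishes at
    \<open>w0\<close>. An isotropic vector of a semidefinite form is orthogonal to all others, and
    for \<open>Q\<close> this is the eigenvalue equation on \<open>W\<close>.\<close>
  define Q where "Q = (\<lambda>j k. complex_of_real l * g j k - h j k)"
  have Qbf: "bf m Q x y = complex_of_real l * bf m g x y - bf m h x y" for x y
    by (simp add: bf_def Q_def algebra_simps sum_subtractf sum_distrib_left)
  have Qh: "Q k j = cnj (Q j k)" if "j < m" "k < m" for j k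
    using gh[OF that] hh[OF that] by (simp add: Q_def)
  have Qpos: "0 \<le> Re (bf m Q x x)" if "x \<in> W" for x
  proof (cases "\<exists>j<m. x j \<noteq> 0")
    case True
    then obtain y c where y: "y \<in> K" "c > 0" "x = (\<lambda>i. complex_of_real c * y i)" using scaled \<open>x \<in> W\<close> by blast
    have "Re (bf m h y y) \<le> l * Re (bf m g y y)"
      using w0(2)[OF y(1)] gpos[OF Knz[OF y(1)]] by (simp add: l_def divide_le_eq)
    then have "0 \<le> c * (c * (Re (bf m Q y y)))" using y(2) by (simp add: Qbf)
    then show ?thesis unfolding y(3) bf_scale by simp
  next
    case False
    then show ?thesis by (simp add: bf_def)
  qed
  have Q0: "Re (bf m Q w0 w0) = 0" using w0g by (simp add: Qbf l_def)
  have w0W: "w0 \<in> W" using KW w0 by blast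
  have Wadd: "(\<lambda>a. w0 a + c * y a) \<in> W" if "y \<in> W" for y c
    using w0W that unfolding W_def by (auto simp: Cn_def bf_add bf_scale)
  have Re0: "Re (bf m Q w0 y) = 0" if y: "y \<in> W" for y
  proof -
    have "0 \<le> (2 * Re (bf m Q w0 y)) * t + Re (bf m Q y y) * t\<^sup>2" for t
    proof -
      have "bf m Q y w0 = cnj (bf m Q w0 y)" by (rule bf_herm[OF Qh])
      then show ?thesis
        using Qpos[OF Wadd[OF y, of "complex_of_real t"]] Q0
        by (simp add: bf_add bf_scale algebra_simps power2_eq_square)
    qed
    then have "2 * Re (bf m Q w0 y) = 0" by (rule linear_term_zero)
    then show ?thesis by simp
  qed
  \<comment> \<open>Replacing \<open>y\<close> by \<open>\<i> y\<close> turns the vanishing of the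
    real part into that of the imaginary part.\<close>
  have Q00: "bf m Q w0 y = 0" if y: "y \<in> W" for y
  proof -
    have "(\<lambda>a. \<i> * y a) \<in> W" using y by (auto simp: W_def Cn_def bf_scale)
    from Re0[OF this] Re0[OF y] show ?thesis by (simp add: bf_scale complex_eq_iff)
  qed
  \<comment> \<open>A general \<open>y\<close> splits into a vector of \<open>W\<close> and a
    combination of the \<open>v i\<close>. On the latter both sides vanish, the left one because the
    \<open>v i\<close> are eigenvectors themselves.\<close>
  have eig: "bf m h w0 y = complex_of_real l * bf m g w0 y" if y: "y \<in> Cn m" for y
  proof -
    define y' where "y' = (\<lambda>a. y a + (- 1) * (\<Sum>i<n. bf m g y (v i) * v i a))"
    have bs: "bf m g (\<lambda>a. \<Sum>i\<in>I. c i * v i a) x = (\<Sum>i\<in>I. c i * bf m g (v i) x)" for I c x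
      by (induction I rule: infinite_finite_induct) (simp_all add: bf_add bf_scale, simp_all add: bf_def)
    have "bf m g y' (v j) = 0" if "j < n" for j
    proof -
      have "(\<Sum>i<n. bf m g y (v i) * bf m g (v i) (v j)) = (\<Sum>i<n. bf m g y (v i) * (if i = j then 1 else 0))"
        using on that by (intro sum.cong) auto
      also have "\<dots> = bf m g y (v j)" using that by (rule sum_delta_mult)
      finally show ?thesis unfolding y'_def bf_add bf_scale bs by simp
    qed
    moreover have "y' \<in> Cn m" using y v by (auto simp: y'_def Cn_def)
    ultimately have y'W: "y' \<in> W" by (auto simp: W_def)
    have gv: "bf m g w0 (v i) = 0" if "i < n" for i using w0W that by (auto simp: W_def)
    have hv: "bf m h w0 (v i) = 0" if "i < n" for i
    proof -
      have "bf m h w0 (v i) = cnj (bf m h (v i) w0)" by (rule bf_herm[OF hh])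
      also have "bf m h (v i) w0 = complex_of_real (lam i) * bf m g (v i) w0"
        using ev[OF that] w0W by (auto simp: W_def)
      also have "bf m g (v i) w0 = cnj (bf m g w0 (v i))" by (rule bf_herm[OF gh])
      finally show ?thesis using gv[OF that] by simp
    qed
    have yy: "y = (\<lambda>a. y' a + (\<Sum>i<n. bf m g y (v i) * v i a))" by (simp add: y'_def)
    have "bf m Q w0 y = bf m Q w0 y' + (\<Sum>i<n. bf m Q w0 (\<lambda>a. bf m g y (v i) * v i a))"
      by (subst yy) (simp only: bf_add bf_sum)
    also have "\<dots> = 0" using Q00[OF y'W] gv hv by (simp add: bf_scale Qbf)
    finally show ?thesis by (simp add: Qbf)
  qed
  define s where "s = 1 / sqrt (Re (bf m g w0 w0))"
  define w where "w = (\<lambda>a. complex_of_real s * w0 a)"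
  have "Im (bf m g w0 w0) = 0"
    using bf_herm[OF gh, where x=w0 and y=w0] by (simp add: complex_eq_iff)
  then have "bf m g w0 w0 = complex_of_real (Re (bf m g w0 w0))" by (simp add: complex_eq_iff)
  moreover have "s * s * Re (bf m g w0 w0) = 1"
    using w0g by (simp add: s_def)
  ultimately have "bf m g w w = 1"
    unfolding w_def bf_scale by (metis complex_cnj_complex_of_real mult.assoc of_real_1 of_real_mult)
  moreover have "w \<in> Cn m" "\<forall>i<n. bf m g w (v i) = 0"
    using w0W by (auto simp: w_def W_def Cn_def bf_scale)
  moreover have "\<forall>y\<in>Cn m. bf m h w y = complex_of_real l * bf m g w y"
    using eig by (simp add: w_def bf_scale)
  ultimately show ?thesis by blast
qed

lemma simultaneous_diagonalization:
  "\<exists>L lam. (\<forall>i<m. \<forall>j<m. pull m L g i j = (if i = j then 1 else 0)) \<and>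
     (\<forall>i<m. \<forall>j<m. pull m L h i j = (if i = j then complex_of_real (lam i) else 0))"
proof -
  have "\<exists>v lam. (\<forall>i<n. v i \<in> Cn m) \<and> (\<forall>i<n. \<forall>j<n. bf m g (v i) (v j) = (if i = j then 1 else 0)) \<and>
     (\<forall>i<n. \<forall>y\<in>Cn m. bf m h (v i) y = complex_of_real (lam i) * bf m g (v i) y)" if "n \<le> m" for n
    using that
  proof (induction n)
    case (Suc n)
    then obtain v lam where v: "\<forall>i<n. v i \<in> Cn m" "\<forall>i<n. \<forall>j<n. bf m g (v i) (v j) = (if i = j then 1 else 0)"
      "\<forall>i<n. \<forall>y\<in>Cn m. bf m h (v i) y = complex_of_real (lam i) * bf m g (v i) y" by auto
    obtain w l where w: "w \<in> Cn m" "\<forall>i<n. bf m g w (v i) = 0" "bf m g w w = 1"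
     "\<forall>y\<in>Cn m. bf m h w y = complex_of_real l * bf m g w y"
      using eigenvector_step[of n v lam] v Suc.prems by auto
    have w': "bf m g (v i) w = 0" if "i < n" for i
      using bf_herm[OF gh, where x=w and y="v i"] w(2) that by auto
    show ?case
      using v w w' by (intro exI[of _ "v(n := w)"] exI[of _ "lam(n := l)"]) (auto simp: less_Suc_eq)
  qed simp
  from this[of m] obtain v lam where v: "\<forall>i<m. v i \<in> Cn m" "\<forall>i<m. \<forall>j<m. bf m g (v i) (v j) = (if i = j then 1 else 0)"
      "\<forall>i<m. \<forall>y\<in>Cn m. bf m h (v i) y = complex_of_real (lam i) * bf m g (v i) y" by auto
  then show ?thesis
    by (intro exI[of _ "\<lambda>a i. v i a"] exI[of _ lam]) (auto simp: pull_bf)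
qed

end

subsection \<open>Derivatives of products, determinants and inverses\<close>

lemma ddb_mult:
  assumes U: "opn m U" and f: "Ck (Suc (Suc k)) m U f" "Ck (Suc (Suc k)) m U g" and z: "z \<in> U" and j: "j < m"
  shows "Dz j (Dzb j (\<lambda>w. f w * g w)) z =
    Dz j (Dzb j f) z * g z + Dzb j f z * Dz j g z + Dz j f z * Dzb j g z + f z * Dz j (Dzb j g) z"
proof -
  note d = Ck_dj[OF U f(1) _ j] Ck_dj[OF U f(2) _ j]
  note d2 = Ck_dj[OF U Ck_Wd[OF U f(1) j] z j] Ck_dj[OF U Ck_Wd[OF U f(2) j] z j]
  have "Dz j (Dzb j (\<lambda>w. f w * g w)) z = Dz j (\<lambda>w. Dzb j f w * g w + f w * Dzb j g w) z"
    using d by (intro Wd_transform[OF U z j] Wd_mult(2))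
  also have "\<dots> = Dz j (Dzb j f) z * g z + Dzb j f z * Dz j g z + (Dz j f z * Dzb j g z + f z * Dz j (Dzb j g) z)"
    using d[OF z] d2 by (simp add: Wd_add Wd_mult)
  finally show ?thesis by simp
qed

lemma ddb_sum:
  assumes U: "opn m U" and f: "\<And>i. i \<in> I \<Longrightarrow> Ck (Suc (Suc k)) m U (f i)" and z: "z \<in> U" and j: "j < m" "l < m"
  shows "Dz j (Dzb l (\<lambda>w. \<Sum>i\<in>I. f i w)) z = (\<Sum>i\<in>I. Dz j (Dzb l (f i)) z)"
proof -
  have "Dz j (Dzb l (\<lambda>w. \<Sum>i\<in>I. f i w)) z = Dz j (\<lambda>w. \<Sum>i\<in>I. Dzb l (f i) w) z"
    using f j by (intro Wd_transform[OF U z j(1)] Wd_sum(2) Ck_dj[OF U]) auto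
  also have "\<dots> = (\<Sum>i\<in>I. Dz j (Dzb l (f i)) z)"
    using j by (intro Wd_sum(2) Ck_dj[OF U Ck_Wd[OF U f]] z) auto
  finally show ?thesis .
qed

lemma Wd_prod:
  assumes "finite I" "\<And>i. i \<in> I \<Longrightarrow> dj j (f i) z"
  shows "dj j (\<lambda>w. \<Prod>i\<in>I. f i w) z \<and>
    Wd s j (\<lambda>w. \<Prod>i\<in>I. f i w) z = (\<Sum>i\<in>I. Wd s j (f i) z * (\<Prod>l\<in>I - {i}. f l z))"
  using assms
proof (induction I rule: finite_induct)
  case empty
  then show ?case by (simp add: Wd_const)
next
  case (insert x I)
  then have IH: "dj j (\<lambda>w. \<Prod>i\<in>I. f i w) z"
    "Wd s j (\<lambda>w. \<Prod>i\<in>I. f i w) z = (\<Sum>i\<in>I. Wd s j (f i) z * (\<Prod>l\<in>I - {i}. f l z))" by auto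
  have x: "dj j (f x) z" using insert by auto
  have "(\<Prod>l\<in>insert x I - {i}. f l z) = f x z * (\<Prod>l\<in>I - {i}. f l z)" if "i \<in> I" for i
  proof -
    have "insert x I - {i} = insert x (I - {i})" using that insert by auto
    then show ?thesis using insert by simp
  qed
  then have "(\<Sum>i\<in>I. Wd s j (f i) z * (\<Prod>l\<in>insert x I - {i}. f l z)) = f x z * (\<Sum>i\<in>I. Wd s j (f i) z * (\<Prod>l\<in>I - {i}. f l z))"
    unfolding sum_distrib_left by (intro sum.cong) auto
  moreover have "insert x I - {x} = I" using insert by auto
  ultimately show ?case
    using insert IH Wd_mult[OF x IH(1)] by simp
qed

lemma dj_dt:
  assumes "\<And>i l. i < m \<Longrightarrow> l < m \<Longrightarrow> dj j (\<lambda>w. X w i l) z"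
  shows "dj j (\<lambda>w. dt m (X w)) z"
  unfolding dt_leibniz
  by (intro Wd_sum(1) Wd_cmult(1) conjunct1[OF Wd_prod] assms)
     (auto simp: permutes_in_image[of _ "{..<m}", simplified])

text \<open>At the identity matrix only the identity permutation contributes: every other
  permutation moves at least two indices, so that a factor vanishing at \<open>z\<close> survives
  even after one factor has been differentiated.\<close>

lemma Wd_dt_at_one:
  assumes d: "\<And>i l. i < m \<Longrightarrow> l < m \<Longrightarrow> dj j (\<lambda>w. X w i l) z"
    and one: "\<And>i l. i < m \<Longrightarrow> l < m \<Longrightarrow> X z i l = (if i = l then 1 else 0)"
  shows "Wd s j (\<lambda>w. dt m (X w)) z = (\<Sum>i<m. Wd s j (\<lambda>w. X w i i) z)"
proof -
  have dp: "dj j (\<lambda>w. \<Prod>i<m. X w i (p i)) z"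
    and Wp: "Wd s j (\<lambda>w. \<Prod>i<m. X w i (p i)) z = (\<Sum>i<m. Wd s j (\<lambda>w. X w i (p i)) z * (\<Prod>l\<in>{..<m} - {i}. X z l (p l)))"
    if "p permutes {..<m}" for p
    using Wd_prod[of "{..<m}" j "\<lambda>i w. X w i (p i)" z s] d that
    by (auto simp: permutes_in_image[of _ "{..<m}", simplified])
  have zero: "Wd s j (\<lambda>w. \<Prod>i<m. X w i (p i)) z = 0" if p: "p permutes {..<m}" "p \<noteq> id" for p
  proof -
    obtain i0 where i0: "p i0 \<noteq> i0" using p(2) by (auto simp: fun_eq_iff)
    then have i0m: "i0 < m" using p(1) by (auto simp: permutes_def)
    define i1 where "i1 = p i0"
    have i1: "i1 \<noteq> i0" "i1 < m" "p i1 \<noteq> i1"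
      using i0 i0m p(1) permutes_inj[OF p(1)] permutes_in_image[OF p(1), of i0] by (auto simp: i1_def inj_eq)
    have "(\<Prod>l\<in>{..<m} - {i}. X z l (p l)) = 0" if "i < m" for i
    proof -
      define q where "q = (if i = i0 then i1 else i0)"
      have q: "q \<in> {..<m} - {i}" "p q \<noteq> q" using i0 i1 i0m by (auto simp: q_def)
      moreover have "p q < m" using q permutes_in_image[OF p(1), of q] by auto
      ultimately show ?thesis using one by (intro prod_zero) (auto intro!: bexI[of _ q])
    qed
    then show ?thesis unfolding Wp[OF p(1)] by (intro sum.neutral) auto
  qed
  have fin: "finite {p. p permutes {..<m}}" by (simp add: finite_permutations)
  have "Wd s j (\<lambda>w. dt m (X w)) z = (\<Sum>p | p permutes {..<m}. of_int (sign p) * Wd s j (\<lambda>w. \<Prod>i<m. X w i (p i)) z)"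
    unfolding dt_leibniz using dp by (subst Wd_sum(2)) (auto simp: Wd_cmult)
  also have "\<dots> = (\<Sum>p | p permutes {..<m}. if p = id then of_int (sign p) * Wd s j (\<lambda>w. \<Prod>i<m. X w i (p i)) z else 0)"
    using zero by (intro sum.cong) auto
  also have "\<dots> = Wd s j (\<lambda>w. \<Prod>i<m. X w i (id i)) z"
    using fin by (simp add: permutes_id)
  also have "\<dots> = (\<Sum>i<m. Wd s j (\<lambda>w. X w i i) z)"
    unfolding Wp[OF permutes_id] using one by (intro sum.cong) auto
  finally show ?thesis .
qed

text \<open>Jacobi's formula. Multiplication from the left by the constant inverse of
  \<open>h z\<close> moves the base point to the identity matrix.\<close>

lemma Wd_dt:
  assumes d: "\<And>i l. i < m \<Longrightarrow> l < m \<Longrightarrow> dj j (\<lambda>w. h w i l) z" and nz: "dt m (h z) \<noteq> 0"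
  shows "Wd s j (\<lambda>w. dt m (h w)) z = dt m (h z) * (\<Sum>a<m. \<Sum>b<m. ginv m (h z) a b * Wd s j (\<lambda>w. h w a b) z)"
proof -
  define M where "M = (\<lambda>i k. ginv m (h z) k i)"
  define X where "X = (\<lambda>w i l. \<Sum>k<m. M i k * h w k l)"
  have one: "X z i l = (if i = l then 1 else 0)" if "i < m" "l < m" for i l
    unfolding X_def M_def using ginv_inverse(2)[OF nz that] .
  have "dt m M * dt m (h z) = 1"
    unfolding dt_mult[symmetric] using one dt_cong[of m "X z" "\<lambda>i j. if i = j then 1 else 0"]
    by (simp add: X_def dt_one)
  moreover have "dt m (X w) = dt m M * dt m (h w)" for w unfolding X_def by (rule dt_mult)
  ultimately have eq: "dt m (h w) = dt m (h z) * dt m (X w)" for w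
    by (simp add: mult.assoc mult.left_commute)
  have dX: "dj j (\<lambda>w. X w i l) z" if "i < m" "l < m" for i l
    unfolding X_def using d that by (intro Wd_sum Wd_cmult) auto
  have "Wd s j (\<lambda>w. dt m (h w)) z = dt m (h z) * Wd s j (\<lambda>w. dt m (X w)) z"
    by (subst eq) (rule Wd_cmult(2)[OF dj_dt[OF dX]])
  also have "Wd s j (\<lambda>w. dt m (X w)) z = (\<Sum>i<m. Wd s j (\<lambda>w. X w i i) z)"
    by (rule Wd_dt_at_one[OF dX one])
  also have "\<dots> = (\<Sum>i<m. \<Sum>k<m. M i k * Wd s j (\<lambda>w. h w k i) z)"
    unfolding X_def using d by (intro sum.cong refl, subst Wd_sum(2)) (auto intro!: sum.cong Wd_cmult)
  also have "\<dots> = (\<Sum>a<m. \<Sum>b<m. ginv m (h z) a b * Wd s j (\<lambda>w. h w a b) z)"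
    unfolding M_def by (rule sum.swap)
  finally show ?thesis .
qed

text \<open>The product of the inverse with \<open>h\<close> is constant; this is its vanishing
  derivative.\<close>

lemma Wd_ginv:
  assumes U: "opn m U" and h: "\<And>i l. i < m \<Longrightarrow> l < m \<Longrightarrow> Ck (Suc k) m U (\<lambda>w. h w i l)"
    and nz: "\<And>w. w \<in> U \<Longrightarrow> dt m (h w) \<noteq> 0" and z: "z \<in> U" and j: "j < m" and a: "a < m" "b < m"
  shows "(\<Sum>i<m. Wd s j (\<lambda>w. ginv m (h w) a i) z * h z b i) = - (\<Sum>i<m. ginv m (h z) a i * Wd s j (\<lambda>w. h w b i) z)"
proof -
  note gC = Ck_ginv[OF U h nz]
  have "0 = Wd s j (\<lambda>w. if a = b then 1 else 0) z" by (simp add: Wd_const)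
  also have "\<dots> = Wd s j (\<lambda>w. \<Sum>i<m. ginv m (h w) a i * h w b i) z"
    using nz a by (intro Wd_transform[OF U z j]) (simp add: ginv_inverse)
  also have "\<dots> = (\<Sum>i<m. Wd s j (\<lambda>w. ginv m (h w) a i) z * h z b i + ginv m (h z) a i * Wd s j (\<lambda>w. h w b i) z)"
    using a z j by (subst Wd_sum) (auto intro!: sum.cong Wd_mult Ck_dj[OF U gC] Ck_dj[OF U h])
  finally show ?thesis by (simp add: sum.distrib add_eq_0_iff)
qed

lemma Wd_sum2:
  assumes "\<And>a b. a < m \<Longrightarrow> b < m \<Longrightarrow> dj j (f a b) z"
  shows "Wd s j (\<lambda>w. \<Sum>a<m. \<Sum>b<m. f a b w) z = (\<Sum>a<m. \<Sum>b<m. Wd s j (f a b) z)"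
  using assms by (subst Wd_sum(2)) (auto intro!: Wd_sum sum.cong)

subsection \<open>Kaehler normal coordinates\<close>

text \<open>The formula of \<open>curvature\<close> in terms of \<open>Dz\<close> and
  \<open>Dzb\<close> on open coordinate sets; \<open>curvature_eq\<close> links the two at interior
  points.\<close>

definition curv :: "nat \<Rightarrow> (cvec \<Rightarrow> nat \<Rightarrow> nat \<Rightarrow> complex) \<Rightarrow> cvec \<Rightarrow> nat \<Rightarrow> nat \<Rightarrow> nat \<Rightarrow> nat \<Rightarrow> complex" where
  "curv m g z i j k l = - Dz i (Dzb j (\<lambda>w. g w k l)) z +
     (\<Sum>a<m. \<Sum>b<m. ginv m (g z) a b * Dz i (\<lambda>w. g w k b) z * Dzb j (\<lambda>w. g w a l) z)"

text \<open>A kernel vector yields a nonzero vector on which the form vanishes. It has to be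
  conjugated, because the kernel equation contracts the second, antilinear index.\<close>

lemma dt_pos:
  assumes "\<And>a. \<exists>j<m. a j \<noteq> 0 \<Longrightarrow> Re (bf m g a a) > 0"
  shows "dt m g \<noteq> 0"
proof
  assume "dt m g = 0"
  then obtain v where v: "\<exists>j<m. v j \<noteq> 0" "\<forall>i<m. (\<Sum>j<m. g i j * v j) = 0" unfolding dt_kernel by auto
  have "bf m g (\<lambda>a. cnj (v a)) (\<lambda>a. cnj (v a)) = (\<Sum>a<m. cnj (v a) * (\<Sum>b<m. g a b * v b))"
    unfolding bf_def by (simp add: sum_distrib_left ac_simps)
  also have "\<dots> = 0" using v(2) by simp
  finally show False using assms[of "\<lambda>a. cnj (v a)"] v(1) by simp
qed

locale kdata =
  fixes m :: nat and U :: "cvec set" and g :: "cvec \<Rightarrow> nat \<Rightarrow> nat \<Rightarrow> complex"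
  assumes U: "opn m U"
    and gC: "\<And>k j l. j < m \<Longrightarrow> l < m \<Longrightarrow> Ck k m U (\<lambda>z. g z j l)"
    and gherm: "\<And>z j l. z \<in> U \<Longrightarrow> j < m \<Longrightarrow> l < m \<Longrightarrow> g z l j = cnj (g z j l)"
    and gclosed: "\<And>z j k l. z \<in> U \<Longrightarrow> j < m \<Longrightarrow> k < m \<Longrightarrow> l < m \<Longrightarrow>
      Dz l (\<lambda>w. g w j k) z = Dz j (\<lambda>w. g w l k) z"
    and gpos: "\<And>z a. z \<in> U \<Longrightarrow> \<exists>j<m. a j \<noteq> 0 \<Longrightarrow> Re (bf m (g z) a a) > 0"
begin

lemma dt_nz: "z \<in> U \<Longrightarrow> dt m (g z) \<noteq> 0"
  using gpos by (intro dt_pos)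

lemma g_dj: "z \<in> U \<Longrightarrow> j < m \<Longrightarrow> k < m \<Longrightarrow> l < m \<Longrightarrow> dj j (\<lambda>w. g w k l) z"
  using Ck_dj[OF U gC] by blast

lemma Dzb_g:
  assumes "z \<in> U" "j < m" "k < m" "l < m"
  shows "Dzb j (\<lambda>w. g w k l) z = cnj (Dz j (\<lambda>w. g w l k) z)"
proof -
  have "Dzb j (\<lambda>w. g w k l) z = Dzb j (\<lambda>w. cnj (g w l k)) z"
    using assms by (intro Wd_transform[OF U] gherm) auto
  also have "\<dots> = cnj (Dz j (\<lambda>w. g w l k) z)"
    using Wd_cnj(2)[OF g_dj[of z j l k], of \<i>] assms by simp
  finally show ?thesis .
qed

end

section \<open>Quadratic changes of coordinates\<close>

locale qmap =
  fixes m :: nat and U :: "cvec set" and z0 :: cvec and L :: "nat \<Rightarrow> nat \<Rightarrow> complex"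
    and Q :: "nat \<Rightarrow> nat \<Rightarrow> nat \<Rightarrow> complex"
  assumes U: "opn m U" and z0: "z0 \<in> U" and Qsym: "\<And>a i j. Q a i j = Q a j i"
begin

text \<open>Half of \<open>Q\<close>, so that the second derivatives of \<open>T\<close> are exactly
  \<open>Q\<close>.\<close>

definition H :: "nat \<Rightarrow> nat \<Rightarrow> nat \<Rightarrow> complex" where
  "H a i k = Q a i k / 2"

definition T :: "cvec \<Rightarrow> cvec" where
  "T w a = (if a < m then z0 a + ((\<Sum>i<m. L a i * w i) + (\<Sum>i<m. \<Sum>k<m. H a i k * (w i * w k))) else 0)"

definition W :: "cvec set" where "W = {w \<in> Cn m. T w \<in> U}"

lemma T_smooth: "Ck k m (Cn m) (\<lambda>w. T w a)"
proof (cases "a < m")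
  case True
  then show ?thesis unfolding T_def by (auto intro!: Ck_intros)
qed (auto simp: T_def intro!: Ck_const)

lemma T_dj: "dj j (\<lambda>w. \<Sum>i<m. L a i * w i) w" "dj j (\<lambda>w. \<Sum>i<m. \<Sum>k<m. H a i k * (w i * w k)) w"
  by (intro Wd_sum Wd_cmult Wd_mult Wd_coord)+

lemma Wd_T:
  assumes "a < m"
  shows "Wd s j (\<lambda>w. T w a) w = (\<Sum>i<m. L a i * Wd s j (\<lambda>w. w i) w) +
    (\<Sum>i<m. \<Sum>k<m. H a i k * (Wd s j (\<lambda>w. w i) w * w k + w i * Wd s j (\<lambda>w. w k) w))"
proof -
  have "Wd s j (\<lambda>w. T w a) w = 0 + (Wd s j (\<lambda>w. \<Sum>i<m. L a i * w i) w + Wd s j (\<lambda>w. \<Sum>i<m. \<Sum>k<m. H a i k * (w i * w k)) w)"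
    unfolding T_def using assms
    by (simp only: Wd_add(2)[OF Wd_const(1) Wd_add(1)[OF T_dj]] Wd_const(2) Wd_add(2)[OF T_dj] if_True)
  also have "Wd s j (\<lambda>w. \<Sum>i<m. L a i * w i) w = (\<Sum>i<m. L a i * Wd s j (\<lambda>w. w i) w)"
    by (subst Wd_sum(2)) (auto intro!: sum.cong Wd_cmult Wd_coord)
  also have "Wd s j (\<lambda>w. \<Sum>i<m. \<Sum>k<m. H a i k * (w i * w k)) w = (\<Sum>i<m. \<Sum>k<m. Wd s j (\<lambda>w. H a i k * (w i * w k)) w)"
    by (rule Wd_sum2) (intro Wd_sum Wd_cmult Wd_coord Wd_mult)
  also have "\<dots> = (\<Sum>i<m. \<Sum>k<m. H a i k * (Wd s j (\<lambda>w. w i) w * w k + w i * Wd s j (\<lambda>w. w k) w))"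
    by (intro sum.cong refl) (simp add: Wd_cmult(2)[OF Wd_mult(1)[OF Wd_coord(1) Wd_coord(1)]] Wd_mult(2)[OF Wd_coord(1) Wd_coord(1)])
  finally show ?thesis by simp
qed

lemma DzT:
  assumes "a < m" "j < m"
  shows "Dz j (\<lambda>w. T w a) w = L a j + (\<Sum>i<m. Q a i j * w i)" "Dzb j (\<lambda>w. T w a) w = 0"
proof -
  show "Dzb j (\<lambda>w. T w a) w = 0" unfolding Wd_T[OF assms(1)] by (simp add: Wd_coord)
  have d: "(if i = j then 1 else 0) * x = (if i = j then x else 0)" "x * (if i = j then 1 else 0) = (if i = j then x else 0)" for i and x :: complex by auto
  have "(\<Sum>i<m. \<Sum>k<m. H a i k * ((if i = j then 1 else 0) * w k + w i * (if k = j then 1 else 0)))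
    = (\<Sum>i<m. \<Sum>k<m. (if i = j then H a j k * w k else 0)) + (\<Sum>i<m. \<Sum>k<m. (if k = j then H a i j * w i else 0))"
    unfolding sum.distrib[symmetric] by (intro sum.cong refl) (auto simp: algebra_simps)
  also have "(\<Sum>i<m. \<Sum>k<m. (if i = j then H a j k * w k else 0)) = (\<Sum>i<m. if i = j then (\<Sum>k<m. H a j k * w k) else 0)"
    by (intro sum.cong refl) auto
  also have "\<dots> = (\<Sum>k<m. H a k j * w k)" using assms by (simp add: H_def Qsym[of a j])
  also have "(\<Sum>i<m. \<Sum>k<m. (if k = j then H a i j * w i else 0)) = (\<Sum>k<m. H a k j * w k)"
    using assms by simp
  also have "(\<Sum>k<m. H a k j * w k) + (\<Sum>k<m. H a k j * w k) = (\<Sum>i<m. Q a i j * w i)"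
    unfolding sum.distrib[symmetric] by (intro sum.cong refl) (simp add: H_def field_simps)
  finally show "Dz j (\<lambda>w. T w a) w = L a j + (\<Sum>i<m. Q a i j * w i)"
    unfolding Wd_T[OF assms(1)] Wd_coord using assms by (simp add: sum_delta_mult)
qed

lemma T0: "T (\<lambda>_. 0) = z0"
  using opn_Cn[OF U z0] by (auto simp: T_def Cn_def fun_eq_iff)

lemma T_Cn: "T w \<in> Cn m" by (auto simp: T_def Cn_def)

lemma cont_T: "continuous_on (Cn m) T"
  by (rule continuous_on_coordinatewise_then_product) (rule Ck_continuous[OF T_smooth])

lemma opn_W: "opn m W"
proof -
  obtain V where V: "open V" "U = Cn m \<inter> V" using U by (auto simp: openin_open)
  have "W = Cn m \<inter> T -` V" using T_Cn V(2) unfolding W_def by blast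
  then show ?thesis using continuous_openin_preimage_gen[OF cont_T V(1)] by simp
qed

lemma W0: "(\<lambda>_. 0) \<in> W" using z0 by (auto simp: W_def T0 Cn_def)

sublocale hmap m W U T
proof
  show "opn m W" by (rule opn_W)
  show "opn m U" by (rule U)
  show "\<And>w. w \<in> W \<Longrightarrow> T w \<in> U" by (auto simp: W_def)
  show "\<And>a k. a < m \<Longrightarrow> Ck k m W (\<lambda>w. T w a)"
    using Ck_subset[OF T_smooth opn_W] by (auto simp: W_def)
  show "\<And>a j w. a < m \<Longrightarrow> j < m \<Longrightarrow> w \<in> W \<Longrightarrow> Dzb j (\<lambda>w. T w a) w = 0" by (rule DzT(2))
qed

lemma J_eq: "a < m \<Longrightarrow> j < m \<Longrightarrow> J a j w = L a j + (\<Sum>i<m. Q a i j * w i)"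
  by (simp add: J_def DzT)

lemma Dz_J:
  assumes "a < m" "j < m" "l < m"
  shows "Dz l (J a j) w = Q a l j"
proof -
  have "J a j = (\<lambda>w. L a j + (\<Sum>i<m. Q a i j * w i))"
    using assms by (intro ext J_eq)
  then have "Dz l (J a j) w = Dz l (\<lambda>w. L a j + (\<Sum>i<m. Q a i j * w i)) w" by simp
  also have "\<dots> = (\<Sum>i<m. Q a i j * Dz l (\<lambda>w. w i) w)"
    by (subst Wd_add(2)) (auto simp: Wd_const Wd_sum(2) Wd_cmult Wd_coord intro!: Wd_sum(1) Wd_cmult(1) sum.cong)
  also have "\<dots> = Q a l j" using assms by (simp only: Wd_coord sum_delta_mult)
  finally show ?thesis .
qed

end

section \<open>The metric pulled back by the quadratic map\<close>

locale qdata = kdata m U g + qmap m U z0 L Q for m U g z0 L Q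
begin

definition gt :: "cvec \<Rightarrow> nat \<Rightarrow> nat \<Rightarrow> complex" where
  "gt w = pull m (\<lambda>a j. J a j w) (g (T w))"

lemma gt_C: "j < m \<Longrightarrow> l < m \<Longrightarrow> Ck k m W (\<lambda>w. gt w j l)"
  unfolding gt_def pull_def by (intro Ck_intros W Ck_J Ck_pull gC) auto

lemma gt_herm: "w \<in> W \<Longrightarrow> j < m \<Longrightarrow> l < m \<Longrightarrow> gt w l j = cnj (gt w j l)"
  unfolding gt_def pull_bf by (rule bf_herm[OF gherm[OF T]])

lemma Dz_term:
  assumes w: "w \<in> W" and i: "a < m" "b < m" "j < m" "k < m" "l < m"
  shows "dj l (\<lambda>w. g (T w) a b * J a j w * cnj (J b k w)) w"
    and "Dz l (\<lambda>w. g (T w) a b * J a j w * cnj (J b k w)) w =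
      (\<Sum>c<m. Dz c (\<lambda>z. g z a b) (T w) * J c l w) * J a j w * cnj (J b k w) + g (T w) a b * Q a l j * cnj (J b k w)"
    and "Dzb l (\<lambda>w. g (T w) a b * J a j w * cnj (J b k w)) w =
      (\<Sum>c<m. Dzb c (\<lambda>z. g z a b) (T w) * cnj (J c l w)) * J a j w * cnj (J b k w) + g (T w) a b * J a j w * cnj (Q b l k)"
proof -
  have d: "dj l (\<lambda>w. g (T w) a b) w" "dj l (J a j) w" "dj l (J b k) w"
    using i w by (auto intro!: Ck_dj[OF W] Ck_pull gC Ck_J)
  show "dj l (\<lambda>w. g (T w) a b * J a j w * cnj (J b k w)) w" by (intro Wd_mult Wd_cnj d)
  have "Dz l (\<lambda>w. cnj (J b k w)) w = 0" "Dzb l (\<lambda>w. cnj (J b k w)) w = cnj (Q b l k)" "Dzb l (J a j) w = 0"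
    using Dz_cnj_J i w Wd_cnj(2)[OF d(3)] Dz_J by auto
  then show "Dz l (\<lambda>w. g (T w) a b * J a j w * cnj (J b k w)) w =
      (\<Sum>c<m. Dz c (\<lambda>z. g z a b) (T w) * J c l w) * J a j w * cnj (J b k w) + g (T w) a b * Q a l j * cnj (J b k w)"
    "Dzb l (\<lambda>w. g (T w) a b * J a j w * cnj (J b k w)) w =
      (\<Sum>c<m. Dzb c (\<lambda>z. g z a b) (T w) * cnj (J c l w)) * J a j w * cnj (J b k w) + g (T w) a b * J a j w * cnj (Q b l k)"
    unfolding Wd_mult(2)[OF Wd_mult(1)[OF d(1,2)] Wd_cnj(1)[OF d(3)]] Wd_mult(2)[OF d(1,2)]
      Dz_pull[OF gC[OF i(1,2)] w i(5)] Dz_J[OF i(1,3,5)] by (simp_all add: algebra_simps)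
qed

lemma Dz_gt:
  assumes w: "w \<in> W" and i: "j < m" "k < m" "l < m"
  shows "Dz l (\<lambda>w. gt w j k) w = (\<Sum>a<m. \<Sum>b<m. (\<Sum>c<m. Dz c (\<lambda>z. g z a b) (T w) * J c l w) * J a j w * cnj (J b k w)
      + g (T w) a b * Q a l j * cnj (J b k w))"
  unfolding gt_def pull_def using assms
  by (subst Wd_sum2) (auto intro!: Dz_term sum.cong)

lemma Dzb_gt:
  assumes w: "w \<in> W" and i: "j < m" "k < m" "l < m"
  shows "Dzb l (\<lambda>w. gt w j k) w = (\<Sum>a<m. \<Sum>b<m. (\<Sum>c<m. Dzb c (\<lambda>z. g z a b) (T w) * cnj (J c l w)) * J a j w * cnj (J b k w)
      + g (T w) a b * J a j w * cnj (Q b l k))"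
  unfolding gt_def pull_def using assms
  by (subst Wd_sum2) (auto intro!: Dz_term sum.cong)

text \<open>After an exchange of summation indices the part with derivatives of \<open>g\<close> is
  symmetric because \<open>g\<close> is closed, and the part with second derivatives of
  \<open>T\<close> because \<open>Q\<close> is symmetric.\<close>

lemma gt_closed:
  assumes w: "w \<in> W" and i: "j < m" "k < m" "l < m"
  shows "Dz l (\<lambda>w. gt w j k) w = Dz j (\<lambda>w. gt w l k) w"
proof -
  have *: "(\<Sum>a<m. \<Sum>b<m. (\<Sum>c<m. Dz c (\<lambda>z. g z a b) (T w) * J c l w) * J a j w * cnj (J b k w))
      = (\<Sum>a<m. \<Sum>b<m. (\<Sum>c<m. Dz c (\<lambda>z. g z a b) (T w) * J c j w) * J a l w * cnj (J b k w))"
  proof -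
    have "(\<Sum>a<m. \<Sum>b<m. (\<Sum>c<m. Dz c (\<lambda>z. g z a b) (T w) * J c l w) * J a j w * cnj (J b k w))
      = (\<Sum>b<m. \<Sum>a<m. \<Sum>c<m. Dz c (\<lambda>z. g z a b) (T w) * J c l w * J a j w * cnj (J b k w))"
      by (subst sum.swap) (simp add: sum_distrib_right)
    also have "\<dots> = (\<Sum>b<m. \<Sum>a<m. \<Sum>c<m. Dz a (\<lambda>z. g z c b) (T w) * J c l w * J a j w * cnj (J b k w))"
      using gclosed[OF T[OF w]] by (intro sum.cong refl) simp
    also have "\<dots> = (\<Sum>b<m. \<Sum>c<m. \<Sum>a<m. Dz a (\<lambda>z. g z c b) (T w) * J c l w * J a j w * cnj (J b k w))"
      by (intro sum.cong refl sum.swap)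
    also have "\<dots> = (\<Sum>a<m. \<Sum>b<m. (\<Sum>c<m. Dz c (\<lambda>z. g z a b) (T w) * J c j w) * J a l w * cnj (J b k w))"
      by (subst sum.swap) (simp add: sum_distrib_right sum_distrib_left ac_simps)
    finally show ?thesis .
  qed
  show ?thesis
    unfolding Dz_gt[OF w i] Dz_gt[OF w i(3,2,1)] sum.distrib * by (simp add: Qsym[of _ l j])
qed

text \<open>Four products survive: the holomorphic derivative falls on \<open>g\<close> or on the
  Jacobian, the conjugate one on \<open>g\<close> or on the conjugate Jacobian. All other
  combinations vanish by holomorphy of \<open>T\<close>.\<close>

lemma ddb_term:
  assumes w: "w \<in> W" and i: "a < m" "b < m" "k < m" "l < m" "p < m" "q < m"
  shows "Dz p (\<lambda>w. (\<Sum>c<m. Dzb c (\<lambda>z. g z a b) (T w) * cnj (J c q w)) * J a k w * cnj (J b l w)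
      + g (T w) a b * J a k w * cnj (Q b q l)) w =
    (\<Sum>d<m. \<Sum>c<m. Dz d (Dzb c (\<lambda>z. g z a b)) (T w) * J d p w * cnj (J c q w)) * J a k w * cnj (J b l w)
    + (\<Sum>c<m. Dzb c (\<lambda>z. g z a b) (T w) * cnj (J c q w)) * Q a p k * cnj (J b l w)
    + (\<Sum>d<m. Dz d (\<lambda>z. g z a b) (T w) * J d p w) * J a k w * cnj (Q b q l)
    + g (T w) a b * Q a p k * cnj (Q b q l)" (is "?lhs = ?rhs")
    and "dj p (\<lambda>w. (\<Sum>c<m. Dzb c (\<lambda>z. g z a b) (T w) * cnj (J c q w)) * J a k w * cnj (J b l w)
      + g (T w) a b * J a k w * cnj (Q b q l)) w"
proof -
  let ?v = "\<lambda>w. \<Sum>c<m. Dzb c (\<lambda>z. g z a b) (T w) * cnj (J c q w)"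
  have dv: "dj p ?v w"
    using i w by (intro Wd_sum Wd_mult Wd_cnj Ck_dj[OF W] Ck_pull Ck_J Ck_Wd[OF U gC]) auto
  have d: "dj p (\<lambda>w. g (T w) a b) w" "dj p (J a k) w" "dj p (J b l) w"
    using i w by (auto intro!: Ck_dj[OF W] Ck_pull gC Ck_J)
  have "Dz p ?v w = Dz p (Dzb q (\<lambda>w. g (T w) a b)) w"
    using w i by (intro Wd_transform[OF W]) (auto simp: Dz_pull[OF gC])
  also have "\<dots> = (\<Sum>d<m. \<Sum>c<m. Dz d (Dzb c (\<lambda>z. g z a b)) (T w) * J d p w * cnj (J c q w))"
    using w i by (intro ddb_pull[OF gC]) auto
  finally have v: "Dz p ?v w = (\<Sum>d<m. \<Sum>c<m. Dz d (Dzb c (\<lambda>z. g z a b)) (T w) * J d p w * cnj (J c q w))" .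
  have z: "Dz p (\<lambda>w. cnj (J b l w)) w = 0" using Dz_cnj_J i w by auto
  note d1 = Wd_mult(1)[OF Wd_mult(1)[OF dv d(2)] Wd_cnj(1)[OF d(3)]]
  note d2 = Wd_mult(1)[OF Wd_mult(1)[OF d(1,2)] Wd_const(1)[of p "cnj (Q b q l)"]]
  show "dj p (\<lambda>w. ?v w * J a k w * cnj (J b l w) + g (T w) a b * J a k w * cnj (Q b q l)) w"
    by (rule Wd_add(1)[OF d1 d2])
  show "?lhs = ?rhs"
    unfolding Wd_add(2)[OF d1 d2] Wd_mult(2)[OF Wd_mult(1)[OF dv d(2)] Wd_cnj(1)[OF d(3)]] Wd_mult(2)[OF dv d(2)]
      Wd_mult(2)[OF Wd_mult(1)[OF d(1,2)] Wd_const(1)] Wd_mult(2)[OF d(1,2)] v z Wd_const(2) Dz_J[OF i(1,3,5)]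
      Dz_pull(1)[OF gC[OF i(1,2)] w i(5)]
    by (simp add: algebra_simps)
qed

lemma ddb_gt:
  assumes w: "w \<in> W" and i: "k < m" "l < m" "p < m" "q < m"
  shows "Dz p (Dzb q (\<lambda>w. gt w k l)) w = (\<Sum>a<m. \<Sum>b<m.
    (\<Sum>d<m. \<Sum>c<m. Dz d (Dzb c (\<lambda>z. g z a b)) (T w) * J d p w * cnj (J c q w)) * J a k w * cnj (J b l w)
    + (\<Sum>c<m. Dzb c (\<lambda>z. g z a b) (T w) * cnj (J c q w)) * Q a p k * cnj (J b l w)
    + (\<Sum>d<m. Dz d (\<lambda>z. g z a b) (T w) * J d p w) * J a k w * cnj (Q b q l)
    + g (T w) a b * Q a p k * cnj (Q b q l))"
proof -
  have "Dz p (Dzb q (\<lambda>w. gt w k l)) w = Dz p (\<lambda>w. \<Sum>a<m. \<Sum>b<m. (\<Sum>c<m. Dzb c (\<lambda>z. g z a b) (T w) * cnj (J c q w)) * J a k w * cnj (J b l w)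
      + g (T w) a b * J a k w * cnj (Q b q l)) w"
    using w i Dzb_gt by (intro Wd_transform[OF W]) auto
  also have "\<dots> = (\<Sum>a<m. \<Sum>b<m. Dz p (\<lambda>w. (\<Sum>c<m. Dzb c (\<lambda>z. g z a b) (T w) * cnj (J c q w)) * J a k w * cnj (J b l w)
      + g (T w) a b * J a k w * cnj (Q b q l)) w)"
    using w i by (intro Wd_sum2 ddb_term(2))
  finally show ?thesis using ddb_term(1)[OF w] i by simp
qed

end

text \<open>Serves to factor the contraction of the quadratic part of \<open>curv\<close> with four
  vectors.\<close>

lemma sum6_product:
  fixes G :: "nat \<Rightarrow> nat \<Rightarrow> complex"
  shows "(\<Sum>i<m. \<Sum>j<m. \<Sum>k<m. \<Sum>l<m. (\<Sum>a<m. \<Sum>b<m. G a b * P i k b * R j l a) * x i * y j * u k * v l) =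
    (\<Sum>a<m. \<Sum>b<m. G a b * (\<Sum>k<m. \<Sum>i<m. P i k b * x i * u k) * (\<Sum>l<m. \<Sum>j<m. R j l a * y j * v l))"
proof -
  have "(\<Sum>i<m. \<Sum>j<m. \<Sum>k<m. \<Sum>l<m. (\<Sum>a<m. \<Sum>b<m. G a b * P i k b * R j l a) * x i * y j * u k * v l) =
    (\<Sum>i<m. \<Sum>j<m. \<Sum>k<m. \<Sum>l<m. \<Sum>a<m. \<Sum>b<m. G a b * P i k b * R j l a * x i * y j * u k * v l)"
    by (simp add: sum_distrib_right)
  also have "\<dots> = (\<Sum>a<m. \<Sum>b<m. \<Sum>k<m. \<Sum>l<m. \<Sum>i<m. \<Sum>j<m. G a b * P i k b * R j l a * x i * y j * u k * v l)"
    unfolding sum.cartesian_product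
    by (rule sum.reindex_bij_witness[of _ "\<lambda>(a,b,k,l,i,j). (i,j,k,l,a,b)" "\<lambda>(i,j,k,l,a,b). (a,b,k,l,i,j)"]) auto
  also have "\<dots> = (\<Sum>a<m. \<Sum>b<m. G a b * (\<Sum>k<m. \<Sum>i<m. P i k b * x i * u k) * (\<Sum>l<m. \<Sum>j<m. R j l a * y j * v l))"
    by (intro sum.cong refl) (simp add: sum_distrib_left sum_distrib_right mult.assoc mult.commute mult.left_commute)
  finally show ?thesis .
qed

context qdata
begin

text \<open>First derivatives of the metric at \<open>z0\<close> in the frame \<open>L\<close>,
  before any correction. The choice of \<open>Q\<close> as minus the inverse metric applied to
  \<open>X\<close> will remove them.\<close>

definition X :: "nat \<Rightarrow> nat \<Rightarrow> nat \<Rightarrow> complex" where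
  "X b p k = (\<Sum>a<m. \<Sum>c<m. Dz c (\<lambda>z. g z a b) z0 * L c p * L a k)"

context
  assumes Qg: "\<And>b p k. b < m \<Longrightarrow> p < m \<Longrightarrow> k < m \<Longrightarrow> (\<Sum>a<m. g z0 a b * Q a p k) = - X b p k"
    and QX: "\<And>a p k. a < m \<Longrightarrow> p < m \<Longrightarrow> k < m \<Longrightarrow> Q a p k = - (\<Sum>b<m. ginv m (g z0) a b * X b p k)"
begin

lemma J_zero: "a < m \<Longrightarrow> j < m \<Longrightarrow> J a j (\<lambda>_. 0) = L a j"
  by (simp add: J_eq)

lemma Dz_gt_zero:
  assumes i: "j < m" "k < m" "l < m"
  shows "Dz l (\<lambda>w. gt w j k) (\<lambda>_. 0) = 0"
proof -
  have "Dz l (\<lambda>w. gt w j k) (\<lambda>_. 0) = (\<Sum>a<m. \<Sum>b<m. (\<Sum>c<m. Dz c (\<lambda>z. g z a b) z0 * L c l) * L a j * cnj (L b k)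
      + g z0 a b * Q a l j * cnj (L b k))"
    unfolding Dz_gt[OF W0 i] using i by (intro sum.cong refl) (simp add: J_zero T0)
  also have "\<dots> = (\<Sum>b<m. (X b l j + (\<Sum>a<m. g z0 a b * Q a l j)) * cnj (L b k))"
    by (subst sum.swap) (simp add: X_def sum.distrib sum_distrib_right distrib_right)
  also have "\<dots> = 0" using i by (simp add: Qg)
  finally show ?thesis .
qed

text \<open>Because \<open>Qg\<close> turns \<open>g\<close> times \<open>Q\<close> into
  \<open>- X\<close>, the two terms with a conjugate \<open>Q\<close> cancel, and the one remaining
  mixed term is exactly the quadratic part of the curvature. So in the new coordinates the curvature
  is a second derivative of the metric alone.\<close>

lemma ddb_gt_zero:
  assumes i: "k' < m" "l' < m" "p < m" "q < m"
  shows "- Dz p (Dzb q (\<lambda>w. gt w k' l')) (\<lambda>_. 0) =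
    (\<Sum>i<m. \<Sum>j<m. \<Sum>k<m. \<Sum>l<m. curv m g z0 i j k l * L i p * cnj (L j q) * L k k' * cnj (L l l'))"
proof -
  let ?A = "\<Sum>a<m. \<Sum>b<m. (\<Sum>d<m. \<Sum>c<m. Dz d (Dzb c (\<lambda>z. g z a b)) z0 * L d p * cnj (L c q)) * L a k' * cnj (L b l')"
  let ?B = "\<Sum>a<m. \<Sum>b<m. (\<Sum>c<m. Dzb c (\<lambda>z. g z a b) z0 * cnj (L c q)) * Q a p k' * cnj (L b l')"
  let ?C = "\<Sum>a<m. \<Sum>b<m. (\<Sum>d<m. Dz d (\<lambda>z. g z a b) z0 * L d p) * L a k' * cnj (Q b q l')"
  let ?D = "\<Sum>a<m. \<Sum>b<m. g z0 a b * Q a p k' * cnj (Q b q l')"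
  have "Dz p (Dzb q (\<lambda>w. gt w k' l')) (\<lambda>_. 0) = ?A + ?B + ?C + ?D"
    unfolding ddb_gt[OF W0 i] sum.distrib[symmetric] using i by (intro sum.cong refl) (simp add: J_zero T0)
  moreover have "?C = (\<Sum>b<m. X b p k' * cnj (Q b q l'))"
    by (subst sum.swap) (simp add: X_def sum_distrib_right)
  moreover have "?D = (\<Sum>b<m. (\<Sum>a<m. g z0 a b * Q a p k') * cnj (Q b q l'))"
    by (subst sum.swap) (simp add: sum_distrib_right)
  ultimately have 1: "Dz p (Dzb q (\<lambda>w. gt w k' l')) (\<lambda>_. 0) = ?A + ?B"
    using i by (simp add: Qg sum_negf)
  have XD: "(\<Sum>b<m. (\<Sum>c<m. Dzb c (\<lambda>z. g z a b) z0 * cnj (L c q)) * cnj (L b l')) = cnj (X a q l')" if "a < m" for a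
    unfolding X_def using that by (simp add: Dzb_g z0 sum_distrib_right)
  have "?B = (\<Sum>a<m. Q a p k' * (\<Sum>b<m. (\<Sum>c<m. Dzb c (\<lambda>z. g z a b) z0 * cnj (L c q)) * cnj (L b l')))"
    by (simp add: sum_distrib_left sum_distrib_right ac_simps)
  also have "\<dots> = (\<Sum>a<m. Q a p k' * cnj (X a q l'))" using XD by simp
  also have "\<dots> = (\<Sum>a<m. - (\<Sum>b<m. ginv m (g z0) a b * X b p k' * cnj (X a q l')))"
    using i by (simp add: QX sum_distrib_right)
  finally have B: "?B = - (\<Sum>a<m. \<Sum>b<m. ginv m (g z0) a b * X b p k' * cnj (X a q l'))"
    by (simp add: sum_negf)
  have A: "?A = (\<Sum>i<m. \<Sum>j<m. \<Sum>k<m. \<Sum>l<m. Dz i (Dzb j (\<lambda>z. g z k l)) z0 * L i p * cnj (L j q) * L k k' * cnj (L l l'))"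
    unfolding sum_distrib_right sum.cartesian_product
    by (rule sum.reindex_bij_witness[of _ "\<lambda>(i,j,k,l). (k,l,i,j)" "\<lambda>(k,l,i,j). (i,j,k,l)"]) auto
  have "(\<Sum>i<m. \<Sum>j<m. \<Sum>k<m. \<Sum>l<m. curv m g z0 i j k l * L i p * cnj (L j q) * L k k' * cnj (L l l'))
    = - ?A + (\<Sum>i<m. \<Sum>j<m. \<Sum>k<m. \<Sum>l<m. (\<Sum>a<m. \<Sum>b<m. ginv m (g z0) a b * Dz i (\<lambda>w. g w k b) z0 * Dzb j (\<lambda>w. g w a l) z0)
       * L i p * cnj (L j q) * L k k' * cnj (L l l'))"
    unfolding A curv_def by (simp add: sum.distrib sum_negf sum_subtractf distrib_right left_diff_distrib)
  also have "\<dots> = - ?A + (\<Sum>a<m. \<Sum>b<m. ginv m (g z0) a b * (\<Sum>k<m. \<Sum>i<m. Dz i (\<lambda>w. g w k b) z0 * L i p * L k k')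
     * (\<Sum>l<m. \<Sum>j<m. Dzb j (\<lambda>w. g w a l) z0 * cnj (L j q) * cnj (L l l')))"
    unfolding sum6_product ..
  also have "(\<Sum>a<m. \<Sum>b<m. ginv m (g z0) a b * (\<Sum>k<m. \<Sum>i<m. Dz i (\<lambda>w. g w k b) z0 * L i p * L k k')
     * (\<Sum>l<m. \<Sum>j<m. Dzb j (\<lambda>w. g w a l) z0 * cnj (L j q) * cnj (L l l')))
     = (\<Sum>a<m. \<Sum>b<m. ginv m (g z0) a b * X b p k' * cnj (X a q l'))"
  proof (intro sum.cong refl arg_cong2[where f="(*)"])
    fix a b assume "a \<in> {..<m}" "b \<in> {..<m}"
    show "(\<Sum>k<m. \<Sum>i<m. Dz i (\<lambda>w. g w k b) z0 * L i p * L k k') = X b p k'" by (simp add: X_def)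
    show "(\<Sum>l<m. \<Sum>j<m. Dzb j (\<lambda>w. g w a l) z0 * cnj (L j q) * cnj (L l l')) = cnj (X a q l')"
      using XD[of a] \<open>a \<in> {..<m}\<close> by (simp add: sum_distrib_right)
  qed
  finally show ?thesis using 1 B by simp
qed

end

end

text \<open>The linear part makes \<open>g\<close> the identity and diagonalizes a second Hermitian
  form at the same time; the quadratic part removes the first derivatives of the metric. The
  required correction is symmetric because \<open>g\<close> is closed, which is where the Kaehler
  condition enters.\<close>

lemma (in kdata) normal_coordinates:
  assumes z0: "z0 \<in> U" and h0: "\<And>j k. j < m \<Longrightarrow> k < m \<Longrightarrow> h0 k j = cnj (h0 j k)"
  obtains W T L lam where "hmap m W U T" "(\<lambda>_. 0) \<in> W" "T (\<lambda>_. 0) = z0"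
    "\<And>a j. a < m \<Longrightarrow> j < m \<Longrightarrow> Dz j (\<lambda>w. T w a) (\<lambda>_. 0) = L a j"
    "kdata m W (\<lambda>w. pull m (\<lambda>a j. Dz j (\<lambda>w. T w a) w) (g (T w)))"
    "\<And>i j. i < m \<Longrightarrow> j < m \<Longrightarrow> pull m L (g z0) i j = (if i = j then 1 else 0)"
    "\<And>i j. i < m \<Longrightarrow> j < m \<Longrightarrow> pull m L h0 i j = (if i = j then complex_of_real (lam i) else 0)"
    "\<And>j k l. j < m \<Longrightarrow> k < m \<Longrightarrow> l < m \<Longrightarrow> Dz l (\<lambda>w. pull m (\<lambda>a j. Dz j (\<lambda>w. T w a) w) (g (T w)) j k) (\<lambda>_. 0) = 0"
    "\<And>p q k' l'. p < m \<Longrightarrow> q < m \<Longrightarrow> k' < m \<Longrightarrow> l' < m \<Longrightarrow>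
       - Dz p (Dzb q (\<lambda>w. pull m (\<lambda>a j. Dz j (\<lambda>w. T w a) w) (g (T w)) k' l')) (\<lambda>_. 0) =
       (\<Sum>i<m. \<Sum>j<m. \<Sum>k<m. \<Sum>l<m. curv m g z0 i j k l * L i p * cnj (L j q) * L k k' * cnj (L l l'))"
proof -
  obtain L lam where L: "\<forall>i<m. \<forall>j<m. pull m L (g z0) i j = (if i = j then 1 else 0)"
    "\<forall>i<m. \<forall>j<m. pull m L h0 i j = (if i = j then complex_of_real (lam i) else 0)"
    using simultaneous_diagonalization[of m "g z0" h0] gherm[OF z0] gpos[OF z0] h0 by blast
  define X0 where "X0 = (\<lambda>b p k. \<Sum>a<m. \<Sum>c<m. Dz c (\<lambda>z. g z a b) z0 * L c p * L a k)"
  define Q where "Q = (\<lambda>a p k. if a < m then - (\<Sum>b<m. ginv m (g z0) a b * X0 b p k) else 0)"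
  have Xsym: "X0 b p k = X0 b k p" if "b < m" for b p k
  proof -
    have "X0 b p k = (\<Sum>a<m. \<Sum>c<m. Dz a (\<lambda>z. g z c b) z0 * L c p * L a k)"
      unfolding X0_def using gclosed[OF z0] that by (intro sum.cong refl) simp
    also have "\<dots> = (\<Sum>c<m. \<Sum>a<m. Dz a (\<lambda>z. g z c b) z0 * L c p * L a k)" by (rule sum.swap)
    also have "\<dots> = X0 b k p" unfolding X0_def by (intro sum.cong refl) simp
    finally show ?thesis .
  qed
  interpret qdata m U g z0 L Q
  proof
    show "\<And>a i j. Q a i j = Q a j i" unfolding Q_def using Xsym by (auto intro!: sum.cong)
  qed (use U z0 in auto)
  have XX: "X0 = X" by (simp add: X_def X0_def fun_eq_iff)
  have Qg: "(\<Sum>a<m. g z0 a b * Q a p k) = - X b p k" if "b < m" for b p k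
  proof -
    have "(\<Sum>a<m. g z0 a b * Q a p k) = - (\<Sum>a<m. \<Sum>c<m. ginv m (g z0) a c * g z0 a b * X0 c p k)"
      unfolding Q_def by (simp add: sum_distrib_left sum_negf ac_simps)
    also have "(\<Sum>a<m. \<Sum>c<m. ginv m (g z0) a c * g z0 a b * X0 c p k) = (\<Sum>c<m. (\<Sum>a<m. ginv m (g z0) a c * g z0 a b) * X0 c p k)"
      by (subst sum.swap) (simp add: sum_distrib_right)
    also have "\<dots> = (\<Sum>c<m. (if c = b then 1 else 0) * X0 c p k)"
      using ginv_inverse(2)[OF dt_nz[OF z0] _ that] by (intro sum.cong refl) auto
    also have "\<dots> = X0 b p k" using that by (rule sum_delta_mult)
    finally show ?thesis by (simp add: XX)
  qed
  have QX: "Q a p k = - (\<Sum>b<m. ginv m (g z0) a b * X b p k)" if "a < m" for a p k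
    using that by (simp add: Q_def XX)
  have J0: "J a j (\<lambda>_. 0) = L a j" if "a < m" "j < m" for a j using J_eq that by simp
  \<comment> \<open>The Jacobian may degenerate away from the origin; where its determinant is
    nonzero the pulled back metric stays positive.\<close>
  define W' where "W' = {w \<in> W. dt m (\<lambda>a j. J a j w) \<noteq> 0}"
  have W': "opn m W'"
  proof -
    have c: "continuous_on W (\<lambda>w. dt m (\<lambda>a j. J a j w))"
      by (rule Ck_continuous[OF Ck_dt[OF opn_W Ck_J]])
    have "W' = W \<inter> (\<lambda>w. dt m (\<lambda>a j. J a j w)) -` (- {0})" by (auto simp: W'_def)
    then have "openin (top_of_set W) W'" using continuous_openin_preimage_gen[OF c open_Compl[OF closed_singleton[of 0]]] by simp
    then show ?thesis using opn_W openin_trans by blast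
  qed
  have W'W: "W' \<subseteq> W" by (auto simp: W'_def)
  have "dt m (pull m L (g z0)) = 1"
    using dt_cong[of m "pull m L (g z0)" "\<lambda>i j. if i = j then 1 else 0"] L(1) by (simp add: dt_one)
  then have "dt m L \<noteq> 0" unfolding dt_pull by auto
  moreover have "dt m (\<lambda>a j. J a j (\<lambda>_. 0)) = dt m L" by (rule dt_cong[OF J0])
  ultimately have 0: "(\<lambda>_. 0) \<in> W'" using W0 by (simp add: W'_def)
  have gt_eq: "pull m (\<lambda>a j. Dz j (\<lambda>w. T w a) w) (g (T w)) = gt w" for w
    by (simp add: gt_def J_def)
  have h: "hmap m W' U T"
    using W' W'W smooth holo T U by unfold_locales (auto intro: Ck_subset[OF smooth])
  have k: "kdata m W' gt"
  proof
    fix w a assume w: "w \<in> W'" and a: "\<exists>j<m. a j \<noteq> (0::complex)"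
    let ?x = "\<lambda>c. \<Sum>j<m. J c j w * a j"
    have "bf m (gt w) a a = (\<Sum>j<m. \<Sum>k<m. \<Sum>c<m. \<Sum>d<m. g (T w) c d * (J c j w * a j) * cnj (J d k w * a k))"
      unfolding bf_def gt_def pull_def by (simp add: sum_distrib_right sum_distrib_left ac_simps)
    also have "\<dots> = (\<Sum>c<m. \<Sum>d<m. \<Sum>j<m. \<Sum>k<m. g (T w) c d * (J c j w * a j) * cnj (J d k w * a k))"
      unfolding sum.cartesian_product
      by (rule sum.reindex_bij_witness[of _ "\<lambda>(i,j,k,l). (k,l,i,j)" "\<lambda>(k,l,i,j). (i,j,k,l)"]) auto
    also have "\<dots> = bf m (g (T w)) ?x ?x"
      unfolding bf_def by (intro sum.cong refl, subst sum.swap) (simp add: sum_distrib_left sum_distrib_right mult.assoc)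
    finally have "bf m (gt w) a a = bf m (g (T w)) ?x ?x" .
    moreover have "\<exists>c<m. ?x c \<noteq> 0"
    proof (rule ccontr)
      assume "\<not> ?thesis"
      then have "dt m (\<lambda>a j. J a j w) = 0" unfolding dt_kernel using a by blast
      then show False using w by (simp add: W'_def)
    qed
    ultimately show "Re (bf m (gt w) a a) > 0" using gpos[OF T[OF subsetD[OF W'W w]], of ?x] by simp
  qed (use W' W'W gt_herm gt_closed in \<open>auto intro!: Ck_subset[OF gt_C]\<close>)
  show ?thesis
    by (rule that[of W' T L lam])
       (use h 0 T0 J0 k L Dz_gt_zero[OF Qg QX] ddb_gt_zero[OF Qg QX] in \<open>auto simp: gt_eq J_def\<close>)
qed

subsection \<open>Computations in normal coordinates\<close>

lemma ddb_comp:
  assumes U: "opn m U" and u: "Ck (Suc (Suc k)) m U u" and T: "open T" "u ` U \<subseteq> T" "\<psi> holomorphic_on T"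
    and z: "z \<in> U" and j: "j < m"
  shows "Wd s j (\<lambda>w. \<psi> (u w)) z = deriv \<psi> (u z) * Wd s j u z"
    and "Dz j (Dzb j (\<lambda>w. \<psi> (u w))) z = deriv (deriv \<psi>) (u z) * Dz j u z * Dzb j u z + deriv \<psi> (u z) * Dz j (Dzb j u) z"
proof -
  have d: "(\<psi> has_field_derivative deriv \<psi> (u w)) (at (u w))" if "w \<in> U" for w
    using T that by (intro holomorphic_derivI[of \<psi> T]) auto
  have d2: "(deriv \<psi> has_field_derivative deriv (deriv \<psi>) (u w)) (at (u w))" if "w \<in> U" for w
    using T that by (intro holomorphic_derivI[of _ T] holomorphic_deriv) auto
  note uj = Ck_dj[OF U u _ j]
  show "Wd s j (\<lambda>w. \<psi> (u w)) z = deriv \<psi> (u z) * Wd s j u z" by (rule Wd_comp(2)[OF uj[OF z] d[OF z]])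
  have "Dz j (Dzb j (\<lambda>w. \<psi> (u w))) z = Dz j (\<lambda>w. deriv \<psi> (u w) * Dzb j u w) z"
    by (intro Wd_transform[OF U z j] Wd_comp(2) uj d)
  also have "\<dots> = deriv (deriv \<psi>) (u z) * Dz j u z * Dzb j u z + deriv \<psi> (u z) * Dz j (Dzb j u) z"
    using Wd_mult(2)[OF Wd_comp(1)[OF uj[OF z] d2[OF z]] Ck_dj[OF U Ck_Wd[OF U u j] z j]] Wd_comp(2)[OF uj[OF z] d2[OF z]]
    by simp
  finally show "Dz j (Dzb j (\<lambda>w. \<psi> (u w))) z = deriv (deriv \<psi>) (u z) * Dz j u z * Dzb j u z + deriv \<psi> (u z) * Dz j (Dzb j u) z" .
qed

lemma Dzb_real:
  assumes U: "opn m U" and u: "Ck (Suc k) m U u" and z: "z \<in> U" and j: "j < m" and real: "\<And>w. w \<in> U \<Longrightarrow> u w \<in> \<real>"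
  shows "Dzb j u z = cnj (Dz j u z)"
proof -
  have "Dzb j u z = Dzb j (\<lambda>w. cnj (u w)) z"
    using real by (intro Wd_transform[OF U z j]) (simp add: Reals_cnj_iff)
  then show ?thesis using Wd_cnj(2)[OF Ck_dj[OF U u z j], of \<i>] by simp
qed

lemma ddb_real:
  assumes U: "opn m U" and u: "Ck (Suc (Suc k)) m U u" and z: "z \<in> U" and j: "j < m" "l < m" and real: "\<And>w. w \<in> U \<Longrightarrow> u w \<in> \<real>"
  shows "Dz l (Dzb j u) z = cnj (Dz j (Dzb l u) z)"
proof -
  have "Dz l (Dzb j u) z = Dzb j (Dz l u) z" by (rule Wd_commute[OF U u z j(2,1)])
  also have "\<dots> = Dzb j (\<lambda>w. cnj (Dzb l u w)) z"
    using Dzb_real[OF U u _ j(2) real] by (intro Wd_transform[OF U z j(1)]) simp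
  also have "\<dots> = cnj (Dz j (Dzb l u) z)"
    using Wd_cnj(2)[OF Ck_dj[OF U Ck_Wd[OF U u j(2)] z j(1)], of \<i> \<i>] by simp
  finally show ?thesis .
qed

text \<open>The first order condition expresses the derivative of \<open>u\<close> by that of
  \<open>\<phi>\<close>. The two cross terms of the second derivative then become
  \<open>- 2 u \<gamma>1^2 |Dz j \<phi>|^2\<close>, and the exponential gives the same square once
  with the opposite sign, so one copy remains. \<open>\<Gamma>\<close> is holomorphic so that
  \<open>ddb_comp\<close> applies, and real on the values that occur.\<close>

lemma max_product:
  assumes U: "opn m U" and u: "Ck (Suc (Suc k)) m U u" and \<phi>: "Ck (Suc (Suc k)) m U \<phi>"
    and T: "open T" "\<phi> ` U \<subseteq> T" "\<Gamma> holomorphic_on T"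
    and ur: "\<And>w. w \<in> U \<Longrightarrow> u w \<in> \<real>" and \<phi>r: "\<And>w. w \<in> U \<Longrightarrow> \<phi> w \<in> \<real>" and \<Gamma>r: "\<And>w. w \<in> U \<Longrightarrow> \<Gamma> (\<phi> w) \<in> \<real>"
    and max: "\<And>w. w \<in> U \<Longrightarrow> Re (u w * exp (- \<Gamma> (\<phi> w))) \<le> Re (u z * exp (- \<Gamma> (\<phi> z)))"
    and z: "z \<in> U" and j: "j < m"
    and \<gamma>: "deriv \<Gamma> (\<phi> z) = of_real \<gamma>1" "deriv (deriv \<Gamma>) (\<phi> z) = of_real \<gamma>2"
  shows "Dz j u z = u z * of_real \<gamma>1 * Dz j \<phi> z"
    and "Re (Dz j (Dzb j u) z) - Re (u z) * \<gamma>1\<^sup>2 * (cmod (Dz j \<phi> z))\<^sup>2 - Re (u z) * \<gamma>2 * (cmod (Dz j \<phi> z))\<^sup>2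
      - Re (u z) * \<gamma>1 * Re (Dz j (Dzb j \<phi>) z) \<le> 0"
proof -
  define E where "E = (\<lambda>w. exp (- \<Gamma> (\<phi> w)))"
  have \<Gamma>\<phi>: "Ck (Suc (Suc k)) m U (\<lambda>w. - \<Gamma> (\<phi> w))"
    by (intro Ck_uminus[OF U] Ck_comp[OF U T(1) \<phi> T(2,3)])
  have E: "Ck (Suc (Suc k)) m U E"
    unfolding E_def by (rule Ck_comp[OF U open_UNIV \<Gamma>\<phi>]) (auto intro: holomorphic_on_exp)
  have "u w * E w \<in> \<real>" if "w \<in> U" for w
    using ur[OF that] \<Gamma>r[OF that] by (auto simp: E_def elim!: Reals_cases simp flip: of_real_minus exp_of_real)
  moreover have "Re (u w * E w) \<le> Re (u z * E z)" if "w \<in> U" for w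
    using max[OF that] by (simp add: E_def)
  ultimately have M: "Dz j (\<lambda>w. u w * E w) z = 0" "Re (Dz j (Dzb j (\<lambda>w. u w * E w)) z) \<le> 0"
    using max_derivatives[OF U Ck_mult[OF U u E] z j] by auto
  have D\<Gamma>: "Wd s j (\<lambda>w. - \<Gamma> (\<phi> w)) z = - (of_real \<gamma>1 * Wd s j \<phi> z)" for s
    using Wd_uminus(2)[OF Ck_dj[OF U Ck_comp[OF U T(1) \<phi> T(2,3)] z j]] ddb_comp(1)[OF U \<phi> T z j] \<gamma> by simp
  have DD\<Gamma>: "Dz j (Dzb j (\<lambda>w. - \<Gamma> (\<phi> w))) z = - (of_real \<gamma>2 * Dz j \<phi> z * Dzb j \<phi> z + of_real \<gamma>1 * Dz j (Dzb j \<phi>) z)"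
  proof -
    note c = Ck_comp[OF U T(1) \<phi> T(2,3)]
    have "Dz j (Dzb j (\<lambda>w. - \<Gamma> (\<phi> w))) z = Dz j (\<lambda>w. - Dzb j (\<lambda>w. \<Gamma> (\<phi> w)) w) z"
      by (intro Wd_transform[OF U z j] Wd_uminus(2) Ck_dj[OF U c _ j])
    also have "\<dots> = - Dz j (Dzb j (\<lambda>w. \<Gamma> (\<phi> w))) z"
      by (rule Wd_uminus(2)[OF Ck_dj[OF U Ck_Wd[OF U c j] z j]])
    finally show ?thesis using ddb_comp(2)[OF U \<phi> T z j] \<gamma> by simp
  qed
  have dexp: "deriv exp = (exp :: complex \<Rightarrow> complex)"
    by (intro ext DERIV_imp_deriv DERIV_exp)
  have DE: "Wd s j E z = - (E z * of_real \<gamma>1 * Wd s j \<phi> z)" for s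
    using ddb_comp(1)[OF U \<Gamma>\<phi> open_UNIV _ holomorphic_on_exp z j, of s] D\<Gamma>[of s] by (simp add: E_def dexp)
  have DDE: "Dz j (Dzb j E) z = E z * (of_real (\<gamma>1\<^sup>2) * Dz j \<phi> z * Dzb j \<phi> z - of_real \<gamma>2 * Dz j \<phi> z * Dzb j \<phi> z - of_real \<gamma>1 * Dz j (Dzb j \<phi>) z)"
    using ddb_comp(2)[OF U \<Gamma>\<phi> open_UNIV _ holomorphic_on_exp z j]
    by (simp add: E_def dexp D\<Gamma> DD\<Gamma> algebra_simps power2_eq_square)
  have Enz: "E z \<noteq> 0" by (simp add: E_def)
  have "Dz j (\<lambda>w. u w * E w) z = E z * (Dz j u z - u z * of_real \<gamma>1 * Dz j \<phi> z)"
    using Wd_mult(2)[OF Ck_dj[OF U u z j] Ck_dj[OF U E z j]] by (simp add: DE algebra_simps)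
  then show Du: "Dz j u z = u z * of_real \<gamma>1 * Dz j \<phi> z" using M(1) Enz by simp
  have ub: "Dzb j u z = u z * of_real \<gamma>1 * Dzb j \<phi> z"
    using Dzb_real[OF U u z j ur] Dzb_real[OF U \<phi> z j \<phi>r] ur[OF z] by (simp add: Du Reals_cnj_iff)
  have pb: "Dz j \<phi> z * Dzb j \<phi> z = of_real ((cmod (Dz j \<phi> z))\<^sup>2)"
    using Dzb_real[OF U \<phi> z j \<phi>r] by (simp add: complex_norm_square[symmetric])
  obtain uz where uz: "u z = of_real uz" using ur[OF z] by (auto elim: Reals_cases)
  obtain ez where ez: "E z = of_real ez" "ez > 0"
  proof -
    obtain r where "\<Gamma> (\<phi> z) = of_real r" using \<Gamma>r[OF z] by (auto elim: Reals_cases)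
    then show ?thesis using that[of "exp (- r)"] by (simp add: E_def flip: of_real_minus exp_of_real)
  qed
  have "Dz j (Dzb j (\<lambda>w. u w * E w)) z = E z * (Dz j (Dzb j u) z - u z * of_real (\<gamma>1\<^sup>2) * (Dz j \<phi> z * Dzb j \<phi> z)
      - u z * of_real \<gamma>2 * (Dz j \<phi> z * Dzb j \<phi> z) - u z * of_real \<gamma>1 * Dz j (Dzb j \<phi>) z)"
    unfolding ddb_mult[OF U u E z j] DE DDE Du ub by (simp add: algebra_simps power2_eq_square)
  also have "\<dots> = of_real ez * (Dz j (Dzb j u) z - of_real (uz * \<gamma>1\<^sup>2 * (cmod (Dz j \<phi> z))\<^sup>2)
      - of_real (uz * \<gamma>2 * (cmod (Dz j \<phi> z))\<^sup>2) - of_real (uz * \<gamma>1) * Dz j (Dzb j \<phi>) z)"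
    unfolding pb uz ez by simp
  finally have "Re (Dz j (Dzb j (\<lambda>w. u w * E w)) z) = ez * (Re (Dz j (Dzb j u) z) - uz * \<gamma>1\<^sup>2 * (cmod (Dz j \<phi> z))\<^sup>2
      - uz * \<gamma>2 * (cmod (Dz j \<phi> z))\<^sup>2 - uz * \<gamma>1 * Re (Dz j (Dzb j \<phi>) z))"
    by simp
  then have "ez * (Re (Dz j (Dzb j u) z) - uz * \<gamma>1\<^sup>2 * (cmod (Dz j \<phi> z))\<^sup>2
      - uz * \<gamma>2 * (cmod (Dz j \<phi> z))\<^sup>2 - uz * \<gamma>1 * Re (Dz j (Dzb j \<phi>) z)) \<le> 0"
    using M(2) by simp
  then show "Re (Dz j (Dzb j u) z) - Re (u z) * \<gamma>1\<^sup>2 * (cmod (Dz j \<phi> z))\<^sup>2 - Re (u z) * \<gamma>2 * (cmod (Dz j \<phi> z))\<^sup>2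
      - Re (u z) * \<gamma>1 * Re (Dz j (Dzb j \<phi>) z) \<le> 0"
    using ez(2) by (simp add: uz mult_le_0_iff)
qed

section \<open>Second derivatives of traces in normal coordinates\<close>

locale ndata0 = kdata m U g for m U g +
  assumes o: "(\<lambda>_. 0) \<in> U"
    and g0: "\<And>j k. j < m \<Longrightarrow> k < m \<Longrightarrow> g (\<lambda>_. 0) j k = (if j = k then 1 else 0)"
    and Dg0: "\<And>j k l. j < m \<Longrightarrow> k < m \<Longrightarrow> l < m \<Longrightarrow> Dz l (\<lambda>w. g w j k) (\<lambda>_. 0) = 0"
begin

abbreviation (input) "O0 \<equiv> (\<lambda>_::nat. 0::complex)"

text \<open>The curvature with both indices of the first pair equal to \<open>p\<close>. Its
  quadratic part is absent because the first derivatives of the metric vanish at the origin.\<close>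

definition Rm :: "nat \<Rightarrow> nat \<Rightarrow> nat \<Rightarrow> complex" where
  "Rm p k l = - Dz p (Dzb p (\<lambda>w. g w k l)) O0"

lemma Wg0: "j < m \<Longrightarrow> k < m \<Longrightarrow> l < m \<Longrightarrow> s = \<i> \<or> s = - \<i> \<Longrightarrow> Wd s l (\<lambda>w. g w j k) O0 = 0"
  using Dg0 Dzb_g[OF o] by auto

lemma gi_C: "j < m \<Longrightarrow> l < m \<Longrightarrow> Ck k m U (\<lambda>z. ginv m (g z) j l)"
  by (rule Ck_ginv[OF U gC dt_nz])

lemma gi0: "j < m \<Longrightarrow> k < m \<Longrightarrow> ginv m (g O0) j k = (if j = k then 1 else 0)"
proof -
  assume jk: "j < m" "k < m"
  have "(if j = k then 1 else 0) = (\<Sum>i<m. ginv m (g O0) j i * g O0 k i)"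
    using ginv_inverse(1)[OF dt_nz[OF o] jk] by simp
  also have "\<dots> = (\<Sum>i<m. ginv m (g O0) j i * (if k = i then 1 else 0))"
    using jk by (intro sum.cong) (auto simp: g0)
  also have "\<dots> = ginv m (g O0) j k" using jk by (simp only: sum_delta_mult)
  finally show ?thesis by simp
qed

lemma Wgi0:
  assumes "j < m" "k < m" "l < m" "s = \<i> \<or> s = - \<i>"
  shows "Wd s l (\<lambda>w. ginv m (g w) j k) O0 = 0"
proof -
  have "(\<Sum>i<m. Wd s l (\<lambda>w. ginv m (g w) j i) O0 * g O0 k i) = - (\<Sum>i<m. ginv m (g O0) j i * Wd s l (\<lambda>w. g w k i) O0)"
    by (rule Wd_ginv[OF U gC dt_nz o assms(3,1,2)])
  also have "\<dots> = 0" using Wg0[OF assms(2) _ assms(3,4)] by simp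
  also have "(\<Sum>i<m. Wd s l (\<lambda>w. ginv m (g w) j i) O0 * g O0 k i) = (\<Sum>i<m. Wd s l (\<lambda>w. ginv m (g w) j i) O0 * (if k = i then 1 else 0))"
    using assms by (intro sum.cong) (auto simp: g0)
  finally show ?thesis using assms by (simp only: sum_delta_mult)
qed

text \<open>Differentiate the product of inverse and metric twice. All products of first derivatives
  vanish at the origin, so the inverse has minus the second derivative of the metric, with indices
  exchanged.\<close>

lemma ddb_gi0:
  assumes "j < m" "k < m" "p < m"
  shows "Dz p (Dzb p (\<lambda>w. ginv m (g w) j k)) O0 = Rm p k j"
proof -
  have "0 = Dz p (Dzb p (\<lambda>w. if j = k then 1 else 0)) O0"
    by (simp add: Wd_const(2)[abs_def])
  also have "\<dots> = Dz p (Dzb p (\<lambda>w. \<Sum>i<m. ginv m (g w) j i * g w k i)) O0"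
    using assms by (intro Wd_transform[OF U o] Wd_transform[OF U]) (auto simp: ginv_inverse dt_nz)
  also have "\<dots> = (\<Sum>i<m. Dz p (Dzb p (\<lambda>w. ginv m (g w) j i * g w k i)) O0)"
    using assms by (intro ddb_sum[OF U _ o]) (auto intro!: Ck_mult[OF U] gi_C gC)
  also have "\<dots> = (\<Sum>i<m. Dz p (Dzb p (\<lambda>w. ginv m (g w) j i)) O0 * (if k = i then 1 else 0) + (if j = i then 1 else 0) * Dz p (Dzb p (\<lambda>w. g w k i)) O0)"
    using assms by (intro sum.cong refl) (simp add: ddb_mult[OF U gi_C gC o] Wg0 g0 gi0)
  also have "\<dots> = Dz p (Dzb p (\<lambda>w. ginv m (g w) j k)) O0 + Dz p (Dzb p (\<lambda>w. g w k j)) O0"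
    using assms by (simp only: sum.distrib sum_delta_mult)
  finally show ?thesis by (simp add: Rm_def add_eq_0_iff)
qed

lemma diag_sum:
  assumes "\<And>j k. j < m \<Longrightarrow> k < m \<Longrightarrow> a j k = (if j = k then d j else 0)"
  shows "(\<Sum>j<m. \<Sum>k<m. a j k * b j k) = (\<Sum>j<m. d j * (b j j :: complex))"
proof -
  have "(\<Sum>k<m. a j k * b j k) = d j * b j j" if "j < m" for j
  proof -
    have "(\<Sum>k<m. a j k * b j k) = (\<Sum>k<m. (if j = k then 1 else 0) * (d j * b j k))"
      using assms that by (intro sum.cong) auto
    then show ?thesis using that by (simp only: sum_delta_mult)
  qed
  then show ?thesis by simp
qed

lemma gtr_Wd:
  assumes x: "\<And>j k. j < m \<Longrightarrow> k < m \<Longrightarrow> Ck (Suc n) m U (\<lambda>w. x w j k)" and p: "p < m" and s: "s = \<i> \<or> s = - \<i>"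
  shows "Wd s p (\<lambda>w. gtr m (g w) (x w)) O0 = (\<Sum>j<m. Wd s p (\<lambda>w. x w j j) O0)"
proof -
  have d: "dj p (\<lambda>w. ginv m (g w) j k) O0" "dj p (\<lambda>w. x w j k) O0" if "j < m" "k < m" for j k
    using that Ck_dj[OF U gi_C o p] Ck_dj[OF U x o p] by auto
  have "Wd s p (\<lambda>w. gtr m (g w) (x w)) O0 = (\<Sum>j<m. \<Sum>k<m. Wd s p (\<lambda>w. ginv m (g w) j k * x w j k) O0)"
    unfolding gtr_def using d by (intro Wd_sum2 Wd_mult(1))
  also have "\<dots> = (\<Sum>j<m. \<Sum>k<m. ginv m (g O0) j k * Wd s p (\<lambda>w. x w j k) O0)"
    using d p s by (intro sum.cong refl) (simp add: Wd_mult Wgi0)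
  also have "\<dots> = (\<Sum>j<m. 1 * Wd s p (\<lambda>w. x w j j) O0)"
    by (rule diag_sum) (simp add: gi0)
  finally show ?thesis by simp
qed

lemma gtr_ddb:
  assumes x: "\<And>j k. j < m \<Longrightarrow> k < m \<Longrightarrow> Ck (Suc (Suc n)) m U (\<lambda>w. x w j k)" and p: "p < m"
  shows "Dz p (Dzb p (\<lambda>w. gtr m (g w) (x w))) O0 =
     (\<Sum>j<m. \<Sum>k<m. Rm p k j * x O0 j k) + (\<Sum>j<m. Dz p (Dzb p (\<lambda>w. x w j j)) O0)"
proof -
  have "Dz p (Dzb p (\<lambda>w. gtr m (g w) (x w))) O0 = (\<Sum>j<m. \<Sum>k<m. Dz p (Dzb p (\<lambda>w. ginv m (g w) j k * x w j k)) O0)"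
    unfolding gtr_def using x p
    by (subst ddb_sum[OF U _ o]) (auto intro!: Ck_sum[OF U] Ck_mult[OF U] gi_C sum.cong ddb_sum[OF U _ o])
  also have "\<dots> = (\<Sum>j<m. \<Sum>k<m. Rm p k j * x O0 j k + ginv m (g O0) j k * Dz p (Dzb p (\<lambda>w. x w j k)) O0)"
    using x p by (intro sum.cong refl) (simp add: ddb_mult[OF U gi_C x o] Wgi0 ddb_gi0)
  also have "\<dots> = (\<Sum>j<m. \<Sum>k<m. Rm p k j * x O0 j k) + (\<Sum>j<m. 1 * Dz p (Dzb p (\<lambda>w. x w j j)) O0)"
    unfolding sum.distrib by (subst diag_sum[where d="\<lambda>_. 1" and a="ginv m (g O0)"]) (auto simp: gi0)
  finally show ?thesis by simp
qed

end

section \<open>The Monge-Ampere equation in normal coordinates\<close>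

locale ndata = ndata0 m U g for m U g +
  fixes \<phi> f :: "cvec \<Rightarrow> complex" and lam :: "nat \<Rightarrow> real" and h :: "cvec \<Rightarrow> nat \<Rightarrow> nat \<Rightarrow> complex"
  assumes \<phi>C: "Ck (Suc (Suc (Suc (Suc 0)))) m U \<phi>" and \<phi>r: "\<And>w. w \<in> U \<Longrightarrow> \<phi> w \<in> \<real>"
    and h_def: "\<And>w j k. h w j k = g w j k + Dz j (Dzb k \<phi>) w"
    and h0: "\<And>j k. j < m \<Longrightarrow> k < m \<Longrightarrow> h (\<lambda>_. 0) j k = (if j = k then complex_of_real (lam j) else 0)"
    and lam: "\<And>j. j < m \<Longrightarrow> lam j > 0"
    and fC: "Ck (Suc (Suc 0)) m U f" and fr: "\<And>w. w \<in> U \<Longrightarrow> f w \<in> \<real>"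
    and dth: "\<And>w. w \<in> U \<Longrightarrow> dt m (h w) = exp (f w) * dt m (g w)"
begin

lemma hC: "j < m \<Longrightarrow> k < m \<Longrightarrow> Ck (Suc (Suc 0)) m U (\<lambda>w. h w j k)"
  unfolding h_def by (intro Ck_add[OF U] gC Ck_Wd[OF U Ck_Wd[OF U \<phi>C]])

lemma dth_nz: "w \<in> U \<Longrightarrow> dt m (h w) \<noteq> 0"
  by (simp add: dth dt_nz)

lemma h_herm: "w \<in> U \<Longrightarrow> j < m \<Longrightarrow> k < m \<Longrightarrow> h w k j = cnj (h w j k)"
  unfolding h_def using ddb_real[OF U \<phi>C _ _ _ \<phi>r, of w j k] gherm[of w j k] by simp

lemma hdj: "w \<in> U \<Longrightarrow> j < m \<Longrightarrow> k < m \<Longrightarrow> l < m \<Longrightarrow> dj l (\<lambda>w. h w j k) w"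
  using Ck_dj[OF U hC] by blast

lemma Dzb_h:
  assumes "w \<in> U" "j < m" "k < m" "l < m"
  shows "Dzb l (\<lambda>w. h w j k) w = cnj (Dz l (\<lambda>w. h w k j) w)"
proof -
  have "Dzb l (\<lambda>w. h w j k) w = Dzb l (\<lambda>w. cnj (h w k j)) w"
    using assms by (intro Wd_transform[OF U] h_herm) auto
  also have "\<dots> = cnj (Dz l (\<lambda>w. h w k j) w)"
    using Wd_cnj(2)[OF hdj[of w k j l], of \<i>] assms by simp
  finally show ?thesis .
qed

lemma ddb_dj: "w \<in> U \<Longrightarrow> j < m \<Longrightarrow> k < m \<Longrightarrow> l < m \<Longrightarrow> dj l (Dz j (Dzb k \<phi>)) w"
  by (rule Ck_dj[OF U Ck_Wd[OF U Ck_Wd[OF U \<phi>C]]])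

lemma h_closed:
  assumes "w \<in> U" "j < m" "k < m" "l < m"
  shows "Dz l (\<lambda>w. h w j k) w = Dz j (\<lambda>w. h w l k) w"
proof -
  have "Dz l (Dz j (Dzb k \<phi>)) w = Dz j (Dz l (Dzb k \<phi>)) w"
    by (rule Wd_commute[OF U Ck_Wd[OF U \<phi>C assms(3)] assms(1,4,2)])
  then show ?thesis
    unfolding h_def using assms gclosed[OF assms] g_dj ddb_dj by (simp add: Wd_add)
qed

lemma Wh0: "j < m \<Longrightarrow> k < m \<Longrightarrow> l < m \<Longrightarrow> s = \<i> \<or> s = - \<i> \<Longrightarrow>
  Wd s l (Dz j (Dzb k \<phi>)) O0 = Wd s l (\<lambda>w. h w j k) O0"
  unfolding h_def using g_dj[OF o] ddb_dj[OF o] by (simp add: Wd_add Wg0)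

text \<open>The logarithmic derivative of \<open>dth\<close>. It is stated at all points of
  \<open>U\<close>, not just at the origin, so that it can be differentiated once more.\<close>

lemma jacobi:
  assumes w: "w \<in> U" and j: "j < m"
  shows "(\<Sum>a<m. \<Sum>b<m. ginv m (h w) a b * Wd s j (\<lambda>w. h w a b) w) =
    Wd s j f w + (\<Sum>a<m. \<Sum>b<m. ginv m (g w) a b * Wd s j (\<lambda>w. g w a b) w)"
proof -
  have dg: "dj j (\<lambda>w. dt m (g w)) w" using w j by (intro dj_dt g_dj)
  have e: "(exp has_field_derivative exp (f w)) (at (f w))" by (rule DERIV_exp)
  note fd = Ck_dj[OF U fC w j]
  have "dt m (h w) * (\<Sum>a<m. \<Sum>b<m. ginv m (h w) a b * Wd s j (\<lambda>w. h w a b) w) = Wd s j (\<lambda>w. dt m (h w)) w"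
    using w j by (intro Wd_dt[symmetric] hdj dth_nz)
  also have "\<dots> = Wd s j (\<lambda>w. exp (f w) * dt m (g w)) w"
    by (intro Wd_transform[OF U w j] dth)
  also have "\<dots> = exp (f w) * Wd s j f w * dt m (g w) + exp (f w) * Wd s j (\<lambda>w. dt m (g w)) w"
    using Wd_mult(2)[OF Wd_comp(1)[OF fd e] dg] Wd_comp(2)[OF fd e] by simp
  also have "Wd s j (\<lambda>w. dt m (g w)) w = dt m (g w) * (\<Sum>a<m. \<Sum>b<m. ginv m (g w) a b * Wd s j (\<lambda>w. g w a b) w)"
    using w j by (intro Wd_dt g_dj dt_nz)
  finally have "dt m (h w) * (\<Sum>a<m. \<Sum>b<m. ginv m (h w) a b * Wd s j (\<lambda>w. h w a b) w) =
    dt m (h w) * (Wd s j f w + (\<Sum>a<m. \<Sum>b<m. ginv m (g w) a b * Wd s j (\<lambda>w. g w a b) w))"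
    by (simp add: dth[OF w] algebra_simps)
  then show ?thesis using dth_nz[OF w] by simp
qed

lemma hi_C: "j < m \<Longrightarrow> l < m \<Longrightarrow> Ck (Suc (Suc 0)) m U (\<lambda>z. ginv m (h z) j l)"
  by (rule Ck_ginv[OF U hC dth_nz])

lemma hi0: "j < m \<Longrightarrow> k < m \<Longrightarrow> ginv m (h O0) j k = (if j = k then of_real (1 / lam j) else 0)"
proof -
  assume jk: "j < m" "k < m"
  have "(if j = k then 1 else 0) = (\<Sum>i<m. ginv m (h O0) j i * h O0 k i)"
    using ginv_inverse(1)[OF dth_nz[OF o] jk] by simp
  also have "\<dots> = (\<Sum>i<m. (ginv m (h O0) j i * of_real (lam k)) * (if k = i then 1 else 0))"
    using jk by (intro sum.cong) (auto simp: h0)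
  also have "\<dots> = ginv m (h O0) j k * of_real (lam k)" using jk by (simp only: sum_delta_mult)
  finally show ?thesis using lam[OF jk(2)] by (auto simp: field_simps split: if_splits)
qed

lemma Dhi0:
  assumes "a < m" "b < m" "j < m"
  shows "Dz j (\<lambda>w. ginv m (h w) a b) O0 = - Dz j (\<lambda>w. h w b a) O0 * of_real (1 / (lam a * lam b))"
proof -
  have "(\<Sum>i<m. Dz j (\<lambda>w. ginv m (h w) a i) O0 * h O0 b i) = - (\<Sum>i<m. ginv m (h O0) a i * Dz j (\<lambda>w. h w b i) O0)"
    by (rule Wd_ginv[OF U hC dth_nz o assms(3,1,2)])
  also have "(\<Sum>i<m. Dz j (\<lambda>w. ginv m (h w) a i) O0 * h O0 b i) = (\<Sum>i<m. (Dz j (\<lambda>w. ginv m (h w) a i) O0 * of_real (lam b)) * (if b = i then 1 else 0))"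
    using assms by (intro sum.cong) (auto simp: h0)
  also have "\<dots> = Dz j (\<lambda>w. ginv m (h w) a b) O0 * of_real (lam b)"
    using assms by (simp only: sum_delta_mult)
  also have "(\<Sum>i<m. ginv m (h O0) a i * Dz j (\<lambda>w. h w b i) O0) = (\<Sum>i<m. (if a = i then 1 else 0) * (of_real (1 / lam a) * Dz j (\<lambda>w. h w b i) O0))"
    using assms by (intro sum.cong) (auto simp: hi0)
  also have "\<dots> = of_real (1 / lam a) * Dz j (\<lambda>w. h w b a) O0"
    using assms by (simp only: sum_delta_mult)
  finally show ?thesis using lam[OF assms(1)] lam[OF assms(2)] by (simp add: field_simps)
qed

lemma trace_Dh:
  assumes "j < m" "s = \<i> \<or> s = - \<i>"
  shows "(\<Sum>p<m. of_real (1 / lam p) * Wd s j (\<lambda>w. h w p p) O0) = Wd s j f O0"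
proof -
  have "(\<Sum>a<m. \<Sum>b<m. ginv m (h O0) a b * Wd s j (\<lambda>w. h w a b) O0) = (\<Sum>p<m. of_real (1 / lam p) * Wd s j (\<lambda>w. h w p p) O0)"
    by (rule diag_sum) (simp add: hi0)
  moreover have "(\<Sum>a<m. \<Sum>b<m. ginv m (g O0) a b * Wd s j (\<lambda>w. g w a b) O0) = 0"
    using assms by (intro sum.neutral ballI) (simp add: Wg0)
  ultimately show ?thesis using jacobi[OF o assms(1), of s] by simp
qed

text \<open>The derivative of \<open>jacobi\<close> at the origin. Differentiating the inverse of
  \<open>h\<close> produces the squares of third derivatives, with a favourable sign;
  differentiating the side of \<open>g\<close> produces minus the Ricci curvature.\<close>

lemma trace_ddb_h:
  assumes j: "j < m"
  shows "(\<Sum>p<m. of_real (1 / lam p) * Dz j (Dzb j (\<lambda>w. h w p p)) O0) =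
    of_real (\<Sum>a<m. \<Sum>b<m. (cmod (Dz j (\<lambda>w. h w a b) O0))\<^sup>2 / (lam a * lam b)) + Dz j (Dzb j f) O0 - (\<Sum>a<m. Rm j a a)"
proof -
  have d: "dj j (\<lambda>w. ginv m (h w) a b) O0" "dj j (Dzb j (\<lambda>w. h w a b)) O0"
     "dj j (\<lambda>w. ginv m (g w) a b) O0" "dj j (Dzb j (\<lambda>w. g w a b)) O0" if "a < m" "b < m" for a b
    using that by (auto intro!: Ck_dj[OF U hi_C o j] Ck_dj[OF U gi_C o j] Ck_dj[OF U Ck_Wd[OF U hC j] o j] Ck_dj[OF U Ck_Wd[OF U gC j] o j])
  have "Dz j (\<lambda>w. \<Sum>a<m. \<Sum>b<m. ginv m (h w) a b * Dzb j (\<lambda>w. h w a b) w) O0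
    = (\<Sum>a<m. \<Sum>b<m. Dz j (\<lambda>w. ginv m (h w) a b) O0 * Dzb j (\<lambda>w. h w a b) O0 + ginv m (h O0) a b * Dz j (Dzb j (\<lambda>w. h w a b)) O0)"
    using d by (subst Wd_sum2) (auto intro!: Wd_mult sum.cong)
  also have "\<dots> = (\<Sum>a<m. \<Sum>b<m. - of_real ((cmod (Dz j (\<lambda>w. h w b a) O0))\<^sup>2 / (lam b * lam a))) +
       (\<Sum>p<m. of_real (1 / lam p) * Dz j (Dzb j (\<lambda>w. h w p p)) O0)"
  proof -
    have "Dz j (\<lambda>w. ginv m (h w) a b) O0 * Dzb j (\<lambda>w. h w a b) O0 = - of_real ((cmod (Dz j (\<lambda>w. h w b a) O0))\<^sup>2 / (lam b * lam a))"
      if "a < m" "b < m" for a b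
      unfolding Dhi0[OF that j] Dzb_h[OF o that j] of_real_divide complex_norm_square by (simp add: field_simps)
    moreover have "(\<Sum>a<m. \<Sum>b<m. ginv m (h O0) a b * Dz j (Dzb j (\<lambda>w. h w a b)) O0) = (\<Sum>p<m. of_real (1 / lam p) * Dz j (Dzb j (\<lambda>w. h w p p)) O0)"
      by (rule diag_sum) (simp add: hi0)
    ultimately show ?thesis unfolding sum.distrib by simp
  qed
  also have "(\<Sum>a<m. \<Sum>b<m. - of_real ((cmod (Dz j (\<lambda>w. h w b a) O0))\<^sup>2 / (lam b * lam a)))
     = - complex_of_real (\<Sum>a<m. \<Sum>b<m. (cmod (Dz j (\<lambda>w. h w a b) O0))\<^sup>2 / (lam a * lam b))"
    by (subst sum.swap) (simp add: sum_negf)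
  finally have 1: "Dz j (\<lambda>w. \<Sum>a<m. \<Sum>b<m. ginv m (h w) a b * Dzb j (\<lambda>w. h w a b) w) O0 =
     - of_real (\<Sum>a<m. \<Sum>b<m. (cmod (Dz j (\<lambda>w. h w a b) O0))\<^sup>2 / (lam a * lam b)) +
     (\<Sum>p<m. of_real (1 / lam p) * Dz j (Dzb j (\<lambda>w. h w p p)) O0)" .
  have "Dz j (\<lambda>w. \<Sum>a<m. \<Sum>b<m. ginv m (h w) a b * Dzb j (\<lambda>w. h w a b) w) O0
    = Dz j (\<lambda>w. Dzb j f w + (\<Sum>a<m. \<Sum>b<m. ginv m (g w) a b * Dzb j (\<lambda>w. g w a b) w)) O0"
    by (intro Wd_transform[OF U o j] jacobi j)
  also have "\<dots> = Dz j (Dzb j f) O0 + Dz j (\<lambda>w. \<Sum>a<m. \<Sum>b<m. ginv m (g w) a b * Dzb j (\<lambda>w. g w a b) w) O0"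
    using d by (intro Wd_add(2) Ck_dj[OF U Ck_Wd[OF U fC j] o j] Wd_sum Wd_mult) auto
  also have "Dz j (\<lambda>w. \<Sum>a<m. \<Sum>b<m. ginv m (g w) a b * Dzb j (\<lambda>w. g w a b) w) O0
    = (\<Sum>a<m. \<Sum>b<m. ginv m (g O0) a b * Dz j (Dzb j (\<lambda>w. g w a b)) O0)"
    using d j by (subst Wd_sum2) (auto intro!: Wd_mult sum.cong simp: Wd_mult Wgi0)
  also have "\<dots> = (\<Sum>a<m. 1 * Dz j (Dzb j (\<lambda>w. g w a a)) O0)"
    by (rule diag_sum) (simp add: gi0)
  finally have 2: "Dz j (\<lambda>w. \<Sum>a<m. \<Sum>b<m. ginv m (h w) a b * Dzb j (\<lambda>w. h w a b) w) O0 = Dz j (Dzb j f) O0 - (\<Sum>a<m. Rm j a a)"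
    by (simp add: Rm_def sum_negf)
  show ?thesis using 1 2 by (simp add: algebra_simps)
qed

subsection \<open>The gradient\<close>

abbreviation (input) "v j \<equiv> Dz j \<phi> O0"

text \<open>The squared gradient norm of the potential, kept complex valued so that
  \<open>Ck\<close> and \<open>Dz\<close> apply to it.\<close>

definition \<beta> :: "cvec \<Rightarrow> complex" where
  "\<beta> w = gtr m (g w) (\<lambda>j k. Dz j \<phi> w * Dzb k \<phi> w)"

lemma D\<phi>: "w \<in> U \<Longrightarrow> j < m \<Longrightarrow> Dzb j \<phi> w = cnj (Dz j \<phi> w)"
  by (rule Dzb_real[OF U \<phi>C _ _ \<phi>r])

lemma ddb\<phi>0: "j < m \<Longrightarrow> k < m \<Longrightarrow> Dz j (Dzb k \<phi>) O0 = (if j = k then of_real (lam j - 1) else 0)"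
  using h0[of j k] unfolding h_def by (auto simp: g0 algebra_simps)

lemma \<beta>C: "Ck (Suc (Suc 0)) m U \<beta>"
  unfolding \<beta>_def[abs_def] gtr_def
  by (intro Ck_sum[OF U] Ck_mult[OF U] gi_C Ck_mono[OF Ck_Wd[OF U \<phi>C]]) auto

lemma xC: "j < m \<Longrightarrow> k < m \<Longrightarrow> Ck (Suc (Suc 0)) m U (\<lambda>w. Dz j \<phi> w * Dzb k \<phi> w)"
  by (intro Ck_mult[OF U] Ck_mono[OF Ck_Wd[OF U \<phi>C]]) auto

lemma \<beta>0: "\<beta> O0 = of_real (\<Sum>j<m. (cmod (v j))\<^sup>2)"
proof -
  have "\<beta> O0 = (\<Sum>j<m. 1 * (Dz j \<phi> O0 * Dzb j \<phi> O0))"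
    unfolding \<beta>_def gtr_def by (rule diag_sum) (simp add: gi0)
  then show ?thesis by (simp add: D\<phi>[OF o] complex_norm_square[symmetric])
qed

lemma D\<beta>:
  assumes p: "p < m"
  shows "Dz p \<beta> O0 = (\<Sum>j<m. Dz p (Dz j \<phi>) O0 * cnj (v j)) + v p * of_real (lam p - 1)"
proof -
  have "Dz p \<beta> O0 = (\<Sum>j<m. Dz p (\<lambda>w. Dz j \<phi> w * Dzb j \<phi> w) O0)"
    unfolding \<beta>_def[abs_def] using xC p by (intro gtr_Wd) auto
  also have "\<dots> = (\<Sum>j<m. Dz p (Dz j \<phi>) O0 * cnj (v j) + v j * (if p = j then of_real (lam p - 1) else 0))"
    using p Wd_mult(2)[OF Ck_dj[OF U Ck_Wd[OF U \<phi>C] o p] Ck_dj[OF U Ck_Wd[OF U \<phi>C] o p]]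
    by (intro sum.cong refl) (simp add: ddb\<phi>0 D\<phi>[OF o])
  also have "\<dots> = (\<Sum>j<m. Dz p (Dz j \<phi>) O0 * cnj (v j)) + (\<Sum>j<m. (v j * of_real (lam p - 1)) * (if p = j then 1 else 0))"
    unfolding sum.distrib by (intro arg_cong2[where f="(+)"] sum.cong) auto
  finally show ?thesis using p by (simp only: sum_delta_mult)
qed

text \<open>A Bochner formula. Third derivatives of \<open>\<phi>\<close> that contain
  \<open>p\<close> and its conjugate can be commuted into derivatives of the entry
  \<open>h p p\<close>, since the first derivatives of \<open>g\<close> vanish at the origin; in
  this form the equation controls them.\<close>

lemma ddb\<beta>:
  assumes p: "p < m"
  shows "Dz p (Dzb p \<beta>) O0 = (\<Sum>j<m. \<Sum>k<m. Rm p k j * (v j * cnj (v k)))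
     + of_real (\<Sum>j<m. (cmod (Dz p (Dz j \<phi>) O0))\<^sup>2) + of_real ((lam p - 1)\<^sup>2)
     + of_real (2 * Re (\<Sum>j<m. Dz j (\<lambda>w. h w p p) O0 * cnj (v j)))"
proof -
  have 3: "Dz p (Dzb p (Dz j \<phi>)) O0 = Dz j (\<lambda>w. h w p p) O0" "Dz p (Dzb p (Dzb j \<phi>)) O0 = cnj (Dz j (\<lambda>w. h w p p) O0)"
    if j: "j < m" for j
  proof -
    have "Dz p (Dzb p (Dz j \<phi>)) O0 = Dz p (Dz j (Dzb p \<phi>)) O0"
      using j p by (intro Wd_transform[OF U o p] Wd_commute[OF U \<phi>C])
    also have "\<dots> = Dz j (Dz p (Dzb p \<phi>)) O0" by (rule Wd_commute[OF U Ck_Wd[OF U \<phi>C p] o p j])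
    also have "\<dots> = Dz j (\<lambda>w. h w p p) O0" using Wh0 p j by simp
    finally show "Dz p (Dzb p (Dz j \<phi>)) O0 = Dz j (\<lambda>w. h w p p) O0" .
    have "Dz p (Dzb p (Dzb j \<phi>)) O0 = Dz p (Dzb j (Dzb p \<phi>)) O0"
      using j p by (intro Wd_transform[OF U o p] Wd_commute[OF U \<phi>C])
    also have "\<dots> = Dzb j (Dz p (Dzb p \<phi>)) O0" by (rule Wd_commute[OF U Ck_Wd[OF U \<phi>C p] o p j])
    also have "\<dots> = cnj (Dz j (\<lambda>w. h w p p) O0)" using Wh0 Dzb_h[OF o p p j] p j by simp
    finally show "Dz p (Dzb p (Dzb j \<phi>)) O0 = cnj (Dz j (\<lambda>w. h w p p) O0)" .
  qed
  have 2: "Dzb p (Dz j \<phi>) O0 = (if j = p then of_real (lam p - 1) else 0)" "Dzb p (Dzb j \<phi>) O0 = cnj (Dz p (Dz j \<phi>) O0)"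
    if j: "j < m" for j
  proof -
    have "Dzb p (Dz j \<phi>) O0 = Dz j (Dzb p \<phi>) O0" by (rule Wd_commute[OF U \<phi>C o p j])
    then show "Dzb p (Dz j \<phi>) O0 = (if j = p then of_real (lam p - 1) else 0)" using ddb\<phi>0[OF j p] by auto
    have "Dzb p (Dzb j \<phi>) O0 = Dzb p (\<lambda>w. cnj (Dz j \<phi> w)) O0"
      using j D\<phi> by (intro Wd_transform[OF U o p]) auto
    then show "Dzb p (Dzb j \<phi>) O0 = cnj (Dz p (Dz j \<phi>) O0)"
      using Wd_cnj(2)[OF Ck_dj[OF U Ck_Wd[OF U \<phi>C j] o p], of \<i>] by simp
  qed
  have "Dz p (Dzb p \<beta>) O0 = (\<Sum>j<m. \<Sum>k<m. Rm p k j * (v j * Dzb k \<phi> O0)) + (\<Sum>j<m. Dz p (Dzb p (\<lambda>w. Dz j \<phi> w * Dzb j \<phi> w)) O0)"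
    unfolding \<beta>_def[abs_def] using xC p by (intro gtr_ddb) auto
  also have "(\<Sum>j<m. Dz p (Dzb p (\<lambda>w. Dz j \<phi> w * Dzb j \<phi> w)) O0) =
    (\<Sum>j<m. of_real ((cmod (Dz p (Dz j \<phi>) O0))\<^sup>2) + of_real ((lam p - 1)\<^sup>2) * (if p = j then 1 else 0)
      + of_real (2 * Re (Dz j (\<lambda>w. h w p p) O0 * cnj (v j))))"
  proof (intro sum.cong refl)
    fix j assume "j \<in> {..<m}"
    then have j: "j < m" by simp
    have "Dz p (Dzb p (\<lambda>w. Dz j \<phi> w * Dzb j \<phi> w)) O0 = Dz j (\<lambda>w. h w p p) O0 * cnj (v j) + cnj (Dz j (\<lambda>w. h w p p) O0 * cnj (v j))
       + (if p = j then of_real (lam p - 1) * of_real (lam p - 1) else 0) + Dz p (Dz j \<phi>) O0 * cnj (Dz p (Dz j \<phi>) O0)"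
      unfolding ddb_mult[OF U Ck_Wd[OF U \<phi>C j] Ck_Wd[OF U \<phi>C j] o p] 3[OF j] 2[OF j] ddb\<phi>0[OF p j] D\<phi>[OF o j]
      by (auto simp: algebra_simps)
    also have "Dz j (\<lambda>w. h w p p) O0 * cnj (v j) + cnj (Dz j (\<lambda>w. h w p p) O0 * cnj (v j)) = of_real (2 * Re (Dz j (\<lambda>w. h w p p) O0 * cnj (v j)))"
      by (rule complex_add_cnj)
    also have "Dz p (Dz j \<phi>) O0 * cnj (Dz p (Dz j \<phi>) O0) = of_real ((cmod (Dz p (Dz j \<phi>) O0))\<^sup>2)"
      by (simp add: complex_norm_square[symmetric])
    finally show "Dz p (Dzb p (\<lambda>w. Dz j \<phi> w * Dzb j \<phi> w)) O0 = of_real ((cmod (Dz p (Dz j \<phi>) O0))\<^sup>2) + of_real ((lam p - 1)\<^sup>2) * (if p = j then 1 else 0)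
      + of_real (2 * Re (Dz j (\<lambda>w. h w p p) O0 * cnj (v j)))"
      by (auto simp: power2_eq_square)
  qed
  also have "\<dots> = of_real (\<Sum>j<m. (cmod (Dz p (Dz j \<phi>) O0))\<^sup>2) + of_real ((lam p - 1)\<^sup>2)
     + of_real (2 * Re (\<Sum>j<m. Dz j (\<lambda>w. h w p p) O0 * cnj (v j)))"
    using p by (simp only: sum.distrib sum_delta_mult of_real_sum[symmetric] Re_sum sum_distrib_left)
  also have "(\<Sum>j<m. \<Sum>k<m. Rm p k j * (v j * Dzb k \<phi> O0)) = (\<Sum>j<m. \<Sum>k<m. Rm p k j * (v j * cnj (v k)))"
    using D\<phi>[OF o] by (intro sum.cong refl) simp
  finally show ?thesis by simp
qed

subsection \<open>The trace\<close>

text \<open>Closedness of \<open>h\<close> is used twice, once for the conjugate and once for the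
  holomorphic index, with a commutation of derivatives in between.\<close>

lemma ddb_h_sym:
  assumes p: "p < m" and j: "j < m"
  shows "Dz p (Dzb p (\<lambda>w. h w j j)) O0 = Dz j (Dzb j (\<lambda>w. h w p p)) O0"
proof -
  have *: "Dz p (Dzb p (\<lambda>w. h w j j)) O0 = Dz p (Dzb j (\<lambda>w. h w j p)) O0"
  proof (intro Wd_transform[OF U o p])
    fix w assume w: "w \<in> U"
    show "Dzb p (\<lambda>w. h w j j) w = Dzb j (\<lambda>w. h w j p) w"
      using h_closed[OF w j j p] by (simp add: Dzb_h[OF w j _ p] Dzb_h[OF w j p j] j)
  qed
  also have "\<dots> = Dzb j (Dz p (\<lambda>w. h w j p)) O0" by (rule Wd_commute[OF U hC[OF j p] o p j])
  also have "\<dots> = Dzb j (Dz j (\<lambda>w. h w p p)) O0"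
    using h_closed p j by (intro Wd_transform[OF U o j]) auto
  also have "\<dots> = Dz j (Dzb j (\<lambda>w. h w p p)) O0" by (rule Wd_commute[OF U hC[OF p p] o j j])
  finally show ?thesis .
qed

definition tr :: "cvec \<Rightarrow> complex" where
  "tr w = gtr m (g w) (h w)"

lemma trC: "Ck (Suc (Suc 0)) m U tr"
  unfolding tr_def[abs_def] gtr_def by (intro Ck_sum[OF U] Ck_mult[OF U] gi_C hC) auto

lemma tr0: "tr O0 = of_real (\<Sum>j<m. lam j)"
proof -
  have "tr O0 = (\<Sum>j<m. 1 * h O0 j j)"
    unfolding tr_def gtr_def by (rule diag_sum) (simp add: gi0)
  then show ?thesis by (simp add: h0)
qed

lemma Dtr: "p < m \<Longrightarrow> Dz p tr O0 = (\<Sum>j<m. Dz p (\<lambda>w. h w j j) O0)"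
  unfolding tr_def[abs_def] by (rule gtr_Wd[OF hC]) auto

lemma ddb_tr:
  assumes p: "p < m"
  shows "Dz p (Dzb p tr) O0 = (\<Sum>j<m. Rm p j j * of_real (lam j)) + (\<Sum>j<m. Dz j (Dzb j (\<lambda>w. h w p p)) O0)"
proof -
  have "Dz p (Dzb p tr) O0 = (\<Sum>j<m. \<Sum>k<m. Rm p k j * h O0 j k) + (\<Sum>j<m. Dz p (Dzb p (\<lambda>w. h w j j)) O0)"
    unfolding tr_def[abs_def] by (rule gtr_ddb[OF hC p])
  also have "(\<Sum>j<m. \<Sum>k<m. Rm p k j * h O0 j k) = (\<Sum>j<m. \<Sum>k<m. h O0 j k * Rm p k j)"
    by (simp add: mult.commute)
  also have "\<dots> = (\<Sum>j<m. of_real (lam j) * Rm p j j)" by (rule diag_sum) (simp add: h0)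
  also have "(\<Sum>j<m. Dz p (Dzb p (\<lambda>w. h w j j)) O0) = (\<Sum>j<m. Dz j (Dzb j (\<lambda>w. h w p p)) O0)"
    using p by (intro sum.cong refl ddb_h_sym) auto
  finally show ?thesis by (simp add: mult.commute)
qed

lemma exp_f0: "exp (Re (f O0)) = (\<Prod>j<m. lam j)"
proof -
  have "dt m (h O0) = dt m (\<lambda>i j. if i = j then complex_of_real (lam i) else 0)"
    by (rule dt_cong) (simp add: h0)
  moreover have "dt m (g O0) = 1"
    using dt_cong[of m "g O0" "\<lambda>i j. if i = j then 1 else 0"] by (simp add: g0 dt_one)
  ultimately have "exp (f O0) = of_real (\<Prod>j<m. lam j)"
    using dth[OF o] by (simp add: dt_diag)
  moreover have "f O0 = of_real (Re (f O0))" using fr[OF o] by simp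
  ultimately show ?thesis by (metis exp_of_real of_real_eq_iff)
qed

end

subsection \<open>The inequalities at an interior maximum\<close>

text \<open>Jensen's inequality for the exponential: add up the tangent line inequalities at the
  mean \<open>M\<close>.\<close>

lemma exp_mean_le:
  fixes a :: "nat \<Rightarrow> real"
  shows "real m * exp ((\<Sum>i<m. a i) / real m) \<le> (\<Sum>i<m. exp (a i))"
proof -
  define M where "M = (\<Sum>i<m. a i) / real m"
  have "exp M * (1 + (a i - M)) \<le> exp (a i)" for i
    using mult_left_mono[OF exp_ge_add_one_self[of "a i - M"], of "exp M"] by (simp add: exp_diff)
  then have s1: "(\<Sum>i<m. exp M * (1 + (a i - M))) \<le> (\<Sum>i<m. exp (a i))" by (intro sum_mono)
  have s2: "(\<Sum>i<m. exp M * (1 + (a i - M))) = exp M * (real m + ((\<Sum>i<m. a i) - real m * M))"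
  proof -
    have "(\<Sum>i<m. 1 + (a i - M)) = real m + ((\<Sum>i<m. a i) - real m * M)"
      unfolding sum.distrib sum_subtractf by simp
    moreover have "(\<Sum>i<m. exp M * (1 + (a i - M))) = exp M * (\<Sum>i<m. 1 + (a i - M))"
      by (rule sum_distrib_left[symmetric])
    ultimately show ?thesis by simp
  qed
  have s3: "(\<Sum>i<m. a i) = real m * M" by (cases "m = 0") (auto simp: M_def)
  have "exp M * real m \<le> (\<Sum>i<m. exp (a i))" using s1 unfolding s2 s3 by simp
  then show ?thesis unfolding M_def by (simp only: mult.commute)
qed

text \<open>\<open>lam p\<close> is the product of all the numbers times the reciprocals of the
  others. So a positive lower bound for the eigenvalues becomes an upper bound once their product is
  known.\<close>

lemma le_prod_power:
  fixes lam :: "nat \<Rightarrow> real"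
  assumes lam: "\<And>j. j < m \<Longrightarrow> lam j > 0" and K: "\<And>j. j < m \<Longrightarrow> 1 / lam j \<le> K" and p: "p < m"
  shows "lam p \<le> (\<Prod>j<m. lam j) * K ^ (m - 1)"
proof -
  have "(\<Prod>j\<in>{..<m} - {p}. 1 / lam j) \<le> (\<Prod>j\<in>{..<m} - {p}. K)"
    using lam K by (intro prod_mono) (auto simp: less_imp_le)
  then have le: "(\<Prod>j\<in>{..<m} - {p}. 1 / lam j) \<le> K ^ (m - 1)" using p by simp
  have pr: "(\<Prod>j<m. lam j) = lam p * (\<Prod>j\<in>{..<m} - {p}. lam j)"
    using p by (subst prod.remove[of _ p]) auto
  have "(\<Prod>j<m. lam j) * (\<Prod>j\<in>{..<m} - {p}. 1 / lam j) = lam p * (\<Prod>j\<in>{..<m} - {p}. lam j * (1 / lam j))"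
    unfolding pr by (simp only: prod.distrib mult.assoc)
  also have "(\<Prod>j\<in>{..<m} - {p}. lam j * (1 / lam j)) = 1"
    using lam by (intro prod.neutral) force
  finally have "lam p = (\<Prod>j<m. lam j) * (\<Prod>j\<in>{..<m} - {p}. 1 / lam j)" by simp
  also have "\<dots> \<le> (\<Prod>j<m. lam j) * K ^ (m - 1)"
    using lam by (intro mult_left_mono le prod_nonneg) (auto simp: less_imp_le)
  finally show ?thesis .
qed

lemma cauchy_schwarz_complex:
  "(cmod (\<Sum>j\<in>I. a j * b j))\<^sup>2 \<le> (\<Sum>j\<in>I. (cmod (a j))\<^sup>2) * (\<Sum>j\<in>I. (cmod (b j))\<^sup>2)"
proof -
  have "cmod (\<Sum>j\<in>I. a j * b j) \<le> (\<Sum>j\<in>I. cmod (a j) * cmod (b j))"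
    by (rule order_trans[OF norm_sum]) (simp add: norm_mult)
  then have "(cmod (\<Sum>j\<in>I. a j * b j))\<^sup>2 \<le> (\<Sum>j\<in>I. cmod (a j) * cmod (b j))\<^sup>2"
    by (intro power_mono) auto
  also have "\<dots> \<le> (\<Sum>j\<in>I. (cmod (a j))\<^sup>2) * (\<Sum>j\<in>I. (cmod (b j))\<^sup>2)"
    by (rule Cauchy_Schwarz_ineq_sum)
  finally show ?thesis .
qed

context ndata
begin

text \<open>The trace of \<open>g\<close> with respect to \<open>h\<close>; bounding it keeps all
  eigenvalues of \<open>h\<close> away from zero.\<close>

definition itr :: real where "itr = (\<Sum>p<m. 1 / lam p)"

lemma lam_div: "p < m \<Longrightarrow> 1 / lam p > 0" using lam by simp

lemma itr_ge: "p < m \<Longrightarrow> 1 / lam p \<le> itr"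
  unfolding itr_def using lam by (intro member_le_sum) (auto simp: less_imp_le)

text \<open>The arithmetic-geometric mean inequality for the reciprocal eigenvalues. The left side
  is the factor between the gradients of \<open>log F\<close> and of \<open>F^(1/m)\<close>.\<close>

lemma itr_amgm: "real m * exp (- Re (f O0) / real m) \<le> itr"
proof -
  have "(\<Sum>i<m. - ln (lam i)) = - Re (f O0)"
  proof -
    have "Re (f O0) = ln (\<Prod>j<m. lam j)" unfolding exp_f0[symmetric] by simp
    also have "\<dots> = (\<Sum>i<m. ln (lam i))" using lam by (intro ln_prod) force+
    finally show ?thesis by (simp add: sum_negf)
  qed
  then have "real m * exp (- Re (f O0) / real m) \<le> (\<Sum>i<m. exp (- ln (lam i)))"
    using exp_mean_le[of m "\<lambda>i. - ln (lam i)"] by simp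
  also have "\<dots> = itr" unfolding itr_def using lam by (intro sum.cong) (auto simp: exp_minus field_simps)
  finally show ?thesis .
qed

text \<open>The inequality of \<open>max_product\<close> for \<open>u = \<beta>\<close> is divided
  by \<open>lam p\<close> and summed. The curvature contributes at least
  \<open>- B * b * itr\<close>; the third derivatives become the gradient of \<open>f\<close> by the
  equation; the squares of second derivatives are handled by Cauchy-Schwarz; and the trace of the
  Hessian of \<open>\<phi>\<close> with respect to \<open>h\<close> is \<open>m - itr\<close>, which
  yields the good multiple of \<open>itr\<close>. Everything is finally divided by
  \<open>b\<close>.\<close>

lemma gradient_estimate_at_max:
  assumes B: "\<And>p b. p < m \<Longrightarrow> Re (\<Sum>k<m. \<Sum>l<m. Rm p k l * b k * cnj (b l)) \<ge> - B * (\<Sum>k<m. (cmod (b k))\<^sup>2)"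
    and kd: "sqrt (\<Sum>j<m. (cmod (Dz j f O0))\<^sup>2) \<le> real m * exp (- Re (f O0) / real m) * kd"
    and \<beta>r: "\<And>w. w \<in> U \<Longrightarrow> \<beta> w \<in> \<real>" and \<beta>1: "Re (\<beta> O0) \<ge> 1"
    and T: "open T" "\<phi> ` U \<subseteq> T" "\<Gamma> holomorphic_on T" and \<Gamma>r: "\<And>w. w \<in> U \<Longrightarrow> \<Gamma> (\<phi> w) \<in> \<real>"
    and max: "\<And>w. w \<in> U \<Longrightarrow> Re (\<beta> w * exp (- \<Gamma> (\<phi> w))) \<le> Re (\<beta> O0 * exp (- \<Gamma> (\<phi> O0)))"
    and \<gamma>: "deriv \<Gamma> (\<phi> O0) = of_real \<gamma>1" "deriv (deriv \<Gamma>) (\<phi> O0) = of_real \<gamma>2" and \<gamma>1: "\<gamma>1 \<ge> 0" and kd0: "kd \<ge> 0"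
  shows "itr * (\<gamma>1 - B - 2 * kd) \<le> (real m + 2) * \<gamma>1 + \<gamma>2 * (\<Sum>p<m. (cmod (v p))\<^sup>2 / lam p)"
proof -
  define b where "b = (\<Sum>j<m. (cmod (v j))\<^sup>2)"
  have \<beta>b: "\<beta> O0 = of_real b" by (simp add: \<beta>0 b_def)
  have b1: "b \<ge> 1" using \<beta>1 by (simp add: \<beta>b)
  define S where "S = (\<lambda>p. \<Sum>j<m. (cmod (Dz p (Dz j \<phi>) O0))\<^sup>2)"
  define c where "c = (\<lambda>p. 2 * Re (\<Sum>j<m. Dz j (\<lambda>w. h w p p) O0 * cnj (v j)))"
  have pointwise: "- B * b / lam p + 2 * \<gamma>1 * (cmod (v p))\<^sup>2 * (1 / lam p - 1) + c p / lam p
      - b * \<gamma>2 * ((cmod (v p))\<^sup>2 / lam p) - b * \<gamma>1 * (1 - 1 / lam p) \<le> 0" if p: "p < m" for p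
  proof -
    note M = max_product[OF U \<beta>C Ck_mono[OF \<phi>C] T \<beta>r \<phi>r \<Gamma>r max o p \<gamma>]
    \<comment> \<open>The first order condition at the maximum, solved for the contraction of the
      pure second derivatives with the gradient.\<close>
    have D1: "(\<Sum>j<m. Dz p (Dz j \<phi>) O0 * cnj (v j)) = of_real (b * \<gamma>1 + 1 - lam p) * v p"
      using M(1) unfolding D\<beta>[OF p] \<beta>b by (simp add: algebra_simps)
    have "(b * \<gamma>1 + 1 - lam p)\<^sup>2 * (cmod (v p))\<^sup>2 = (cmod (\<Sum>j<m. Dz p (Dz j \<phi>) O0 * cnj (v j)))\<^sup>2"
      unfolding D1 norm_mult norm_of_real power_mult_distrib by simp
    also have "\<dots> \<le> S p * b"
      unfolding S_def b_def using cauchy_schwarz_complex[of "\<lambda>j. Dz p (Dz j \<phi>) O0" "\<lambda>j. cnj (v j)" "{..<m}"] by simp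
    finally have CS: "(b * \<gamma>1 + 1 - lam p)\<^sup>2 * (cmod (v p))\<^sup>2 / b \<le> S p"
      using b1 by (simp add: divide_le_eq)
    \<comment> \<open>Of the expanded square the first summand cancels the term with
      \<open>\<gamma>1^2\<close> in \<open>max_product\<close>, the second is kept, and the third is
      dropped as nonnegative.\<close>
    have "(b * \<gamma>1 + 1 - lam p)\<^sup>2 / b = b * \<gamma>1\<^sup>2 + 2 * \<gamma>1 * (1 - lam p) + (1 - lam p)\<^sup>2 / b"
      using b1 by (simp add: field_simps power2_eq_square)
    then have "b * \<gamma>1\<^sup>2 + 2 * \<gamma>1 * (1 - lam p) \<le> (b * \<gamma>1 + 1 - lam p)\<^sup>2 / b" using b1 by simp
    then have CS2: "(b * \<gamma>1\<^sup>2 + 2 * \<gamma>1 * (1 - lam p)) * (cmod (v p))\<^sup>2 \<le> S p"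
      using CS mult_right_mono[of _ _ "(cmod (v p))\<^sup>2"] by fastforce
    have R: "Re (\<Sum>j<m. \<Sum>k<m. Rm p k j * (v j * cnj (v k))) \<ge> - B * b"
    proof -
      have "(\<Sum>j<m. \<Sum>k<m. Rm p k j * (v j * cnj (v k))) = (\<Sum>k<m. \<Sum>l<m. Rm p k l * cnj (v k) * cnj (cnj (v l)))"
        by (subst sum.swap) (simp add: ac_simps)
      then show ?thesis using B[OF p, of "\<lambda>k. cnj (v k)"] by (simp add: b_def)
    qed
    have "Re (Dz p (Dzb p \<beta>) O0) \<ge> - B * b + S p + c p"
      using R zero_le_power2[of "lam p - 1"]
      unfolding ddb\<beta>[OF p] S_def c_def plus_complex.sel Re_complex_of_real by linarith
    moreover have "Re (Dz p (Dzb p \<beta>) O0) - b * \<gamma>1\<^sup>2 * (cmod (v p))\<^sup>2 - b * \<gamma>2 * (cmod (v p))\<^sup>2 - b * \<gamma>1 * (lam p - 1) \<le> 0"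
      using M(2) by (simp add: \<beta>b ddb\<phi>0[OF p p])
    ultimately have "- B * b + 2 * \<gamma>1 * (1 - lam p) * (cmod (v p))\<^sup>2 + c p - b * \<gamma>2 * (cmod (v p))\<^sup>2 - b * \<gamma>1 * (lam p - 1) \<le> 0"
      using CS2 by (simp add: algebra_simps)
    then have "(- B * b + 2 * \<gamma>1 * (1 - lam p) * (cmod (v p))\<^sup>2 + c p - b * \<gamma>2 * (cmod (v p))\<^sup>2 - b * \<gamma>1 * (lam p - 1)) * (1 / lam p) \<le> 0"
      using lam_div[OF p] by (intro mult_nonpos_nonneg) auto
    moreover have "(- B * b + 2 * \<gamma>1 * (1 - lam p) * (cmod (v p))\<^sup>2 + c p - b * \<gamma>2 * (cmod (v p))\<^sup>2 - b * \<gamma>1 * (lam p - 1)) * (1 / lam p) =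
      - B * b / lam p + 2 * \<gamma>1 * (cmod (v p))\<^sup>2 * (1 / lam p - 1) + c p / lam p
      - b * \<gamma>2 * ((cmod (v p))\<^sup>2 / lam p) - b * \<gamma>1 * (1 - 1 / lam p)"
      using lam[OF p] by (simp add: field_simps)
    ultimately show ?thesis by simp
  qed
  have "(\<Sum>p<m. - B * b / lam p + 2 * \<gamma>1 * (cmod (v p))\<^sup>2 * (1 / lam p - 1) + c p / lam p
      - b * \<gamma>2 * ((cmod (v p))\<^sup>2 / lam p) - b * \<gamma>1 * (1 - 1 / lam p)) \<le> 0"
    by (intro sum_nonpos pointwise) auto
  also have "(\<Sum>p<m. - B * b / lam p + 2 * \<gamma>1 * (cmod (v p))\<^sup>2 * (1 / lam p - 1) + c p / lam p
      - b * \<gamma>2 * ((cmod (v p))\<^sup>2 / lam p) - b * \<gamma>1 * (1 - 1 / lam p)) =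
     - B * b * itr + 2 * \<gamma>1 * ((\<Sum>p<m. (cmod (v p))\<^sup>2 / lam p) - b) + (\<Sum>p<m. c p / lam p)
      - b * \<gamma>2 * (\<Sum>p<m. (cmod (v p))\<^sup>2 / lam p) - b * \<gamma>1 * (real m - itr)"
    unfolding itr_def b_def
    by (simp add: sum.distrib sum_subtractf sum_distrib_left right_diff_distrib left_diff_distrib sum_negf)
  finally have main: "- B * b * itr + 2 * \<gamma>1 * ((\<Sum>p<m. (cmod (v p))\<^sup>2 / lam p) - b) + (\<Sum>p<m. c p / lam p)
      - b * \<gamma>2 * (\<Sum>p<m. (cmod (v p))\<^sup>2 / lam p) - b * \<gamma>1 * (real m - itr) \<le> 0" .
  have "(\<Sum>p<m. c p / lam p) = 2 * Re (\<Sum>j<m. Dz j f O0 * cnj (v j))"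
  proof -
    have "(\<Sum>j<m. Dz j f O0 * cnj (v j)) = (\<Sum>j<m. (\<Sum>p<m. of_real (1 / lam p) * Dz j (\<lambda>w. h w p p) O0) * cnj (v j))"
      using trace_Dh[of _ "-\<i>"] by (intro sum.cong refl) simp
    also have "\<dots> = (\<Sum>p<m. of_real (1 / lam p) * (\<Sum>j<m. Dz j (\<lambda>w. h w p p) O0 * cnj (v j)))"
      unfolding sum_distrib_left sum_distrib_right by (subst sum.swap) (simp add: mult.assoc)
    finally have "Re (\<Sum>j<m. Dz j f O0 * cnj (v j)) = (\<Sum>p<m. (1 / lam p) * Re (\<Sum>j<m. Dz j (\<lambda>w. h w p p) O0 * cnj (v j)))"
      by (simp del: of_real_divide)
    moreover have "(\<Sum>p<m. c p / lam p) = 2 * (\<Sum>p<m. (1 / lam p) * Re (\<Sum>j<m. Dz j (\<lambda>w. h w p p) O0 * cnj (v j)))"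
      unfolding c_def sum_distrib_left by (intro sum.cong refl) (simp del: Re_sum)
    ultimately show ?thesis by (simp only:)
  qed
  moreover have "\<bar>Re (\<Sum>j<m. Dz j f O0 * cnj (v j))\<bar> \<le> itr * kd * b"
  proof -
    have "cmod (\<Sum>j<m. Dz j f O0 * cnj (v j)) \<le> sqrt (\<Sum>j<m. (cmod (Dz j f O0))\<^sup>2) * sqrt b"
      using real_sqrt_le_mono[OF cauchy_schwarz_complex[of "\<lambda>j. Dz j f O0" "\<lambda>j. cnj (v j)" "{..<m}"]]
      by (simp add: real_sqrt_mult b_def)
    also have "\<dots> \<le> (itr * kd) * b"
    proof (intro mult_mono)
      have "real m * exp (- Re (f O0) / real m) * kd \<le> itr * kd" using itr_amgm kd0 by (rule mult_right_mono)
      then show "sqrt (\<Sum>j<m. (cmod (Dz j f O0))\<^sup>2) \<le> itr * kd" using kd by linarith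
      \<comment> \<open>The assumption that the gradient is at least 1 serves here: it makes a term
        that is linear in the gradient comparable with \<open>b\<close>.\<close>
      show "sqrt b \<le> b" using b1 by (simp add: real_le_lsqrt real_sqrt_le_iff sqrt_le_D power2_eq_square real_sqrt_le_mono mult_le_cancel_left1 real_le_rsqrt) 
    qed (use kd0 b1 in \<open>auto simp: itr_def intro!: mult_nonneg_nonneg sum_nonneg less_imp_le[OF lam_div, simplified] less_imp_le[OF lam]\<close>)
    finally show ?thesis using abs_Re_le_cmod order_trans by blast
  qed
  moreover have "0 \<le> \<gamma>1 * (\<Sum>p<m. (cmod (v p))\<^sup>2 / lam p)"
    using \<gamma>1 lam by (intro mult_nonneg_nonneg sum_nonneg) (auto simp: less_imp_le)
  ultimately have "b * (itr * (\<gamma>1 - B - 2 * kd)) \<le> b * ((real m + 2) * \<gamma>1 + \<gamma>2 * (\<Sum>p<m. (cmod (v p))\<^sup>2 / lam p))"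
    using main by (simp add: algebra_simps)
  then show ?thesis using b1 by simp
qed

text \<open>The exponent \<open>\<Gamma>\<close> is increasing and concave. Its slope, between
  \<open>A\<close> and \<open>A + 1\<close>, gives the good multiple of \<open>itr\<close>; its
  second derivative \<open>- 2 / x^3\<close> bounds the gradient measured with the inverse of
  \<open>h\<close>. The upper bound for the eigenvalues converts this into a bound for the gradient
  measured with \<open>g\<close>.\<close>

lemma gradient_bound_at_max:
  assumes B: "\<And>p b. p < m \<Longrightarrow> Re (\<Sum>k<m. \<Sum>l<m. Rm p k l * b k * cnj (b l)) \<ge> - B * (\<Sum>k<m. (cmod (b k))\<^sup>2)"
    and kd: "sqrt (\<Sum>j<m. (cmod (Dz j f O0))\<^sup>2) \<le> real m * exp (- Re (f O0) / real m) * kd"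
    and \<beta>r: "\<And>w. w \<in> U \<Longrightarrow> \<beta> w \<in> \<real>" and \<beta>1: "Re (\<beta> O0) \<ge> 1" and m: "m \<ge> 1"
    and C: "\<And>w. w \<in> U \<Longrightarrow> Re (\<phi> w) + C \<ge> 1" and A: "A \<ge> B + 2 * kd + 1" and kd0: "kd \<ge> 0" and A0: "A \<ge> 0"
    and max: "\<And>w. w \<in> U \<Longrightarrow> Re (\<beta> w * exp (- (of_real A * \<phi> w - 1 / (\<phi> w + of_real C)))) \<le>
         Re (\<beta> O0 * exp (- (of_real A * \<phi> O0 - 1 / (\<phi> O0 + of_real C))))"
    and K: "K = (real m + 2) * (A + 1)"
  shows "Re (\<beta> O0) \<le> exp (Re (f O0)) * K ^ m * (Re (\<phi> O0) + C) ^ 3"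
proof -
  define \<Gamma> where "\<Gamma> = (\<lambda>x::complex. of_real A * x - 1 / (x + of_real C))"
  define x where "x = Re (\<phi> O0) + C"
  have x1: "x \<ge> 1" using C[OF o] by (simp add: x_def)
  have \<phi>0: "\<phi> O0 = of_real (Re (\<phi> O0))" using \<phi>r[OF o] by simp
  have xx: "\<phi> O0 + of_real C = of_real x" unfolding x_def by (subst \<phi>0) simp
  have T: "open {z. Re z + C > 0}" "\<phi> ` U \<subseteq> {z. Re z + C > 0}"
    using C by (auto intro!: open_Collect_less continuous_intros) fastforce
  have nz: "z + of_real C \<noteq> 0" if "Re z + C > 0" for z :: complex
    using that by (auto simp: complex_eq_iff)
  have d1: "(\<Gamma> has_field_derivative (of_real A + 1 / (z + of_real C)\<^sup>2)) (at z)" if "Re z + C > 0" for z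
    unfolding \<Gamma>_def using nz[OF that] by (auto intro!: derivative_eq_intros simp: field_simps power2_eq_square)
  have \<Gamma>h: "\<Gamma> holomorphic_on {z. Re z + C > 0}"
    using d1 by (intro holomorphic_onI) (auto simp: field_differentiable_def intro: has_field_derivative_at_within)
  have D1: "deriv \<Gamma> z = of_real A + 1 / (z + of_real C)\<^sup>2" if "Re z + C > 0" for z
    using d1[OF that] by (rule DERIV_imp_deriv)
  have d2: "((\<lambda>z. of_real A + 1 / (z + of_real C)\<^sup>2) has_field_derivative - 2 / (z + of_real C) ^ 3) (at z)" if "Re z + C > 0" for z
  proof -
    have "((\<lambda>u::complex. 1 / u\<^sup>2) has_field_derivative - 2 / u ^ 3) (at u)" if "u \<noteq> 0" for u
      using that by (auto intro!: derivative_eq_intros simp: field_simps power2_eq_square power3_eq_cube)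
    from this[OF nz[OF that]] have "((\<lambda>z. 1 / (z + of_real C)\<^sup>2) has_field_derivative - 2 / (z + of_real C) ^ 3) (at z)"
      by (simp only: DERIV_shift)
    from DERIV_add[OF DERIV_const[of "of_real A"] this] show ?thesis by simp
  qed
  have D2: "deriv (deriv \<Gamma>) z = - 2 / (z + of_real C) ^ 3" if "Re z + C > 0" for z
  proof -
    have "(deriv \<Gamma> has_field_derivative - 2 / (z + of_real C) ^ 3) (at z)"
      by (rule has_field_derivative_transform_within_open[OF d2[OF that] T(1)]) (use that D1 in auto)
    then show ?thesis by (rule DERIV_imp_deriv)
  qed
  have pos: "Re (\<phi> O0) + C > 0" using x1 by (simp add: x_def)
  have \<gamma>: "deriv \<Gamma> (\<phi> O0) = of_real (A + 1 / x\<^sup>2)" "deriv (deriv \<Gamma>) (\<phi> O0) = of_real (- 2 / x ^ 3)"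
    unfolding D1[OF pos] D2[OF pos] xx by simp_all
  have \<Gamma>r: "\<Gamma> (\<phi> w) \<in> \<real>" if "w \<in> U" for w
    unfolding \<Gamma>_def using \<phi>r[OF that] by (auto intro!: Reals_diff Reals_mult Reals_divide Reals_add)
  have max': "Re (\<beta> w * exp (- \<Gamma> (\<phi> w))) \<le> Re (\<beta> O0 * exp (- \<Gamma> (\<phi> O0)))" if "w \<in> U" for w
    using max[OF that] by (simp add: \<Gamma>_def)
  have \<gamma>1: "A \<le> A + 1 / x\<^sup>2" "A + 1 / x\<^sup>2 \<le> A + 1" using x1 by (auto simp: divide_le_eq one_le_power)
  define G where "G = (\<Sum>p<m. (cmod (v p))\<^sup>2 / lam p)"
  have G0: "G \<ge> 0" unfolding G_def using lam by (intro sum_nonneg) (auto simp: less_imp_le)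
  have "A + 1 / x\<^sup>2 \<ge> 0" using \<gamma>1 A0 by linarith
  from gradient_estimate_at_max[OF B kd \<beta>r \<beta>1 T \<Gamma>h \<Gamma>r max' \<gamma> this kd0]
  have E: "itr * (A + 1 / x\<^sup>2 - B - 2 * kd) \<le> (real m + 2) * (A + 1 / x\<^sup>2) + - 2 / x ^ 3 * G"
    by (simp add: G_def)
  have itr0: "itr \<ge> 0" unfolding itr_def using lam by (intro sum_nonneg) (auto simp: less_imp_le)
  \<comment> \<open>The summand \<open>1\<close> in the lower bound for \<open>A\<close> leaves the
    coefficient of \<open>itr\<close> at least 1.\<close>
  have "1 \<le> A + 1 / x\<^sup>2 - B - 2 * kd" using A \<gamma>1(1) by linarith
  then have "itr \<le> itr * (A + 1 / x\<^sup>2 - B - 2 * kd)" using itr0 by (simp add: mult_le_cancel_left1)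
  moreover have "(real m + 2) * (A + 1 / x\<^sup>2) \<le> K" unfolding K using \<gamma>1 by (intro mult_left_mono) auto
  ultimately have E2: "itr + 2 / x ^ 3 * G \<le> K" using E by simp
  moreover have "2 / x ^ 3 * G \<ge> 0" using G0 x1 by simp
  ultimately have iK: "itr \<le> K" and GK: "2 / x ^ 3 * G \<le> K" using itr0 by linarith+
  have K0: "K \<ge> 0" using iK itr0 by linarith
  have lamK: "lam p \<le> exp (Re (f O0)) * K ^ (m - 1)" if "p < m" for p
    unfolding exp_f0 using lam that itr_ge iK by (intro le_prod_power) (auto intro: order_trans)
  have "Re (\<beta> O0) = (\<Sum>p<m. (cmod (v p))\<^sup>2)" by (simp add: \<beta>0)
  also have "\<dots> \<le> (\<Sum>p<m. exp (Re (f O0)) * K ^ (m - 1) * ((cmod (v p))\<^sup>2 / lam p))"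
  proof (rule sum_mono)
    fix p assume "p \<in> {..<m}"
    then have p: "p < m" by simp
    have "(cmod (v p))\<^sup>2 = lam p * ((cmod (v p))\<^sup>2 / lam p)" using lam[OF p] by simp
    also have "\<dots> \<le> exp (Re (f O0)) * K ^ (m - 1) * ((cmod (v p))\<^sup>2 / lam p)"
      using lam[OF p] by (intro mult_right_mono lamK p) auto
    finally show "(cmod (v p))\<^sup>2 \<le> exp (Re (f O0)) * K ^ (m - 1) * ((cmod (v p))\<^sup>2 / lam p)" .
  qed
  also have "\<dots> = exp (Re (f O0)) * K ^ (m - 1) * G" by (simp add: G_def sum_distrib_left)
  also have "\<dots> \<le> exp (Re (f O0)) * K ^ (m - 1) * (K * x ^ 3)"
  proof (intro mult_left_mono)
    have "2 * G \<le> K * x ^ 3" using GK x1 by (simp add: field_simps)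
    then show "G \<le> K * x ^ 3" using G0 by linarith
  qed (use K0 in auto)
  also have "\<dots> = exp (Re (f O0)) * K ^ m * x ^ 3"
    using m by (cases m) auto
  finally show ?thesis by (simp add: x_def)
qed

text \<open>The exponent is linear, so \<open>\<gamma>2 = 0\<close>, and the only dangerous term of
  \<open>max_product\<close> is the squared gradient of the trace. The squares of third derivatives
  \<open>D j\<close> dominate it, and a linear inequality for \<open>itr\<close> remains.\<close>

lemma trace_bound_at_max:
  assumes B: "\<And>p j. p < m \<Longrightarrow> j < m \<Longrightarrow> Re (Rm p j j) \<ge> - B"
    and b: "Re (\<Sum>p<m. \<Sum>j<m. Rm p j j) \<le> b" and kL: "Re (\<Sum>j<m. Dz j (Dzb j f) O0) \<ge> - kL" and m: "m \<ge> 1"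
    and trr: "\<And>w. w \<in> U \<Longrightarrow> tr w \<in> \<real>" and b0: "b \<ge> 0" "kL \<ge> 0" and A: "A \<ge> B + kL + b + 1"
    and max: "\<And>w. w \<in> U \<Longrightarrow> Re (tr w * exp (- (of_real A * \<phi> w))) \<le> Re (tr O0 * exp (- (of_real A * \<phi> O0)))"
  shows "Re (tr O0) \<le> real m * (exp (Re (f O0)) * (A * real m) ^ (m - 1))"
proof -
  define t where "t = (\<Sum>j<m. lam j)"
  have trt: "tr O0 = of_real t" by (simp add: tr0 t_def)
  have t0: "t > 0" unfolding t_def using m lam by (intro sum_pos) (auto simp: lessThan_empty_iff)
  have itr0: "itr > 0" unfolding itr_def using m lam by (intro sum_pos) (auto simp: lessThan_empty_iff)
  have \<gamma>: "deriv (\<lambda>x. of_real A * x) (\<phi> O0) = of_real A" "deriv (deriv (\<lambda>x. of_real A * x)) (\<phi> O0) = of_real 0"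
  proof -
    have *: "deriv (\<lambda>x. complex_of_real A * x) = (\<lambda>_. of_real A)"
      by (intro ext DERIV_imp_deriv) (auto intro!: derivative_eq_intros)
    show "deriv (\<lambda>x. of_real A * x) (\<phi> O0) = of_real A" "deriv (deriv (\<lambda>x. of_real A * x)) (\<phi> O0) = of_real 0"
      unfolding * by simp_all
  qed
  have hol: "(\<lambda>x. complex_of_real A * x) holomorphic_on UNIV" by (intro holomorphic_intros)
  have Ar: "of_real A * \<phi> w \<in> \<real>" if "w \<in> U" for w using \<phi>r[OF that] by (intro Reals_mult) auto
  define D where "D = (\<lambda>j. \<Sum>a<m. \<Sum>b<m. (cmod (Dz j (\<lambda>w. h w a b) O0))\<^sup>2 / (lam a * lam b))"
  define c where "c = (\<lambda>p. Re (\<Sum>j<m. Dz j (Dzb j (\<lambda>w. h w p p)) O0))"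
  have \<phi>2: "Ck (Suc (Suc 0)) m U \<phi>" by (rule Ck_mono[OF \<phi>C]) simp
  note M = max_product[OF U trC \<phi>2 open_UNIV subset_UNIV hol trr \<phi>r Ar max o _ \<gamma>]
  have pointwise: "- B * t / lam p + c p / lam p - (cmod (Dz p tr O0))\<^sup>2 / (t * lam p) - t * A * (1 - 1 / lam p) \<le> 0"
    if p: "p < m" for p
  proof -
    \<comment> \<open>The first order condition turns the square term of \<open>max_product\<close>
      back into the gradient of the trace, the form in which it is absorbed below.\<close>
    have D1: "(cmod (Dz p tr O0))\<^sup>2 / t = t * A\<^sup>2 * (cmod (v p))\<^sup>2"
    proof -
      have "Dz p tr O0 = of_real (t * A) * v p" using M(1)[OF _ _ _ _ p] by (simp add: trt)
      then show ?thesis using t0 by (simp add: norm_mult power2_eq_square)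
    qed
    have "Re (\<Sum>j<m. Rm p j j * of_real (lam j)) \<ge> - B * t"
    proof -
      have "- B * t = (\<Sum>j<m. - B * lam j)" by (simp add: t_def sum_distrib_left sum_negf)
      also have "\<dots> \<le> (\<Sum>j<m. Re (Rm p j j) * lam j)"
        using B[OF p] lam by (intro sum_mono mult_right_mono) (auto simp: less_imp_le)
      finally show ?thesis by simp
    qed
    then have "Re (Dz p (Dzb p tr) O0) \<ge> - B * t + c p" unfolding ddb_tr[OF p] c_def by simp
    moreover have "Re (Dz p (Dzb p tr) O0) - t * A\<^sup>2 * (cmod (v p))\<^sup>2 - t * A * (lam p - 1) \<le> 0"
      using M(2)[OF _ _ _ _ p] by (simp add: trt ddb\<phi>0[OF p p])
    ultimately have "- B * t + c p - (cmod (Dz p tr O0))\<^sup>2 / t - t * A * (lam p - 1) \<le> 0" unfolding D1 by linarith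
    then have "(- B * t + c p - (cmod (Dz p tr O0))\<^sup>2 / t - t * A * (lam p - 1)) * (1 / lam p) \<le> 0"
      using lam_div[OF p] by (intro mult_nonpos_nonneg) auto
    moreover have "(- B * t + c p - (cmod (Dz p tr O0))\<^sup>2 / t - t * A * (lam p - 1)) * (1 / lam p) =
      - B * t / lam p + c p / lam p - (cmod (Dz p tr O0))\<^sup>2 / (t * lam p) - t * A * (1 - 1 / lam p)"
      using lam[OF p] t0 by (simp add: field_simps)
    ultimately show ?thesis by simp
  qed
  have "(\<Sum>p<m. - B * t / lam p + c p / lam p - (cmod (Dz p tr O0))\<^sup>2 / (t * lam p) - t * A * (1 - 1 / lam p)) \<le> 0"
    by (intro sum_nonpos pointwise) auto
  also have "(\<Sum>p<m. - B * t / lam p + c p / lam p - (cmod (Dz p tr O0))\<^sup>2 / (t * lam p) - t * A * (1 - 1 / lam p))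
     = - B * t * itr + (\<Sum>p<m. c p / lam p) - (\<Sum>p<m. (cmod (Dz p tr O0))\<^sup>2 / (t * lam p)) - t * A * (real m - itr)"
    unfolding itr_def by (simp add: sum.distrib sum_subtractf sum_distrib_left right_diff_distrib sum_negf)
  finally have main: "- B * t * itr + (\<Sum>p<m. c p / lam p) - (\<Sum>p<m. (cmod (Dz p tr O0))\<^sup>2 / (t * lam p)) - t * A * (real m - itr) \<le> 0" .
  \<comment> \<open>After the two sums are interchanged, \<open>trace_ddb_h\<close> evaluates the
    inner one for each \<open>j\<close>.\<close>
  have cs: "(\<Sum>p<m. c p / lam p) \<ge> (\<Sum>j<m. D j) - kL - b"
  proof -
    have "complex_of_real (1 / lam p) * x = (1 / lam p) *\<^sub>R x" for p x by (simp add: scaleR_conv_of_real)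
    then have "(\<Sum>p<m. c p / lam p) = (\<Sum>p<m. Re (\<Sum>j<m. of_real (1 / lam p) * Dz j (Dzb j (\<lambda>w. h w p p)) O0))"
      by (simp add: c_def sum_divide_distrib)
    also have "\<dots> = Re (\<Sum>j<m. \<Sum>p<m. of_real (1 / lam p) * Dz j (Dzb j (\<lambda>w. h w p p)) O0)"
      unfolding Re_sum by (rule sum.swap)
    also have "\<dots> = Re (\<Sum>j<m. of_real (D j) + Dz j (Dzb j f) O0 - (\<Sum>a<m. Rm j a a))"
      using trace_ddb_h by (simp add: D_def)
    also have "\<dots> = (\<Sum>j<m. D j) + Re (\<Sum>j<m. Dz j (Dzb j f) O0) - Re (\<Sum>p<m. \<Sum>j<m. Rm p j j)"
      by (simp add: sum.distrib sum_subtractf)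
    finally show ?thesis using b kL by linarith
  qed
  have grad: "(\<Sum>p<m. (cmod (Dz p tr O0))\<^sup>2 / (t * lam p)) \<le> (\<Sum>j<m. D j)"
  proof -
    have "(cmod (Dz p tr O0))\<^sup>2 / (t * lam p) \<le> (\<Sum>j<m. (cmod (Dz j (\<lambda>w. h w p j) O0))\<^sup>2 / (lam p * lam j))" if p: "p < m" for p
    proof -
      \<comment> \<open>Closedness of \<open>h\<close> replaces the derivatives of diagonal entries
        by derivatives of the entries \<open>h p j\<close>. With the weights
        \<open>sqrt (lam j)\<close>, Cauchy-Schwarz then yields part of the sum in \<open>D\<close>,
        with constant 1.\<close>
      have "Dz p tr O0 = (\<Sum>j<m. of_real (sqrt (lam j)) * (Dz j (\<lambda>w. h w p j) O0 / of_real (sqrt (lam j))))"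
        unfolding Dtr[OF p] using h_closed[OF o] p lam by (intro sum.cong refl) force
      then have eq: "Dz p tr O0 = (\<Sum>j<m. of_real (sqrt (lam j)) * (Dz j (\<lambda>w. h w p j) O0 / of_real (sqrt (lam j))))" .
      have "(cmod (Dz p tr O0))\<^sup>2 \<le> (\<Sum>j<m. (cmod (of_real (sqrt (lam j))))\<^sup>2) * (\<Sum>j<m. (cmod (Dz j (\<lambda>w. h w p j) O0 / of_real (sqrt (lam j))))\<^sup>2)"
        by (subst eq) (rule cauchy_schwarz_complex)
      also have "(\<Sum>j<m. (cmod (of_real (sqrt (lam j))))\<^sup>2) = t"
        unfolding t_def using lam by (intro sum.cong) (auto simp: less_imp_le)
      also have "(\<Sum>j<m. (cmod (Dz j (\<lambda>w. h w p j) O0 / of_real (sqrt (lam j))))\<^sup>2) = (\<Sum>j<m. (cmod (Dz j (\<lambda>w. h w p j) O0))\<^sup>2 / lam j)"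
        using lam by (intro sum.cong) (auto simp: norm_divide power_divide less_imp_le)
      finally have "(cmod (Dz p tr O0))\<^sup>2 / (t * lam p) \<le> t * (\<Sum>j<m. (cmod (Dz j (\<lambda>w. h w p j) O0))\<^sup>2 / lam j) / (t * lam p)"
        using t0 lam[OF p] by (intro divide_right_mono) auto
      also have "\<dots> = (\<Sum>j<m. (cmod (Dz j (\<lambda>w. h w p j) O0))\<^sup>2 / (lam p * lam j))"
        using t0 by (simp add: sum_divide_distrib mult.commute)
      finally show ?thesis .
    qed
    then have "(\<Sum>p<m. (cmod (Dz p tr O0))\<^sup>2 / (t * lam p)) \<le> (\<Sum>p<m. \<Sum>j<m. (cmod (Dz j (\<lambda>w. h w p j) O0))\<^sup>2 / (lam p * lam j))"
      by (intro sum_mono) auto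
    also have "\<dots> = (\<Sum>j<m. \<Sum>p<m. (cmod (Dz j (\<lambda>w. h w p j) O0))\<^sup>2 / (lam p * lam j))" by (rule sum.swap)
    also have "\<dots> \<le> (\<Sum>j<m. D j)"
      unfolding D_def using lam by (intro sum_mono member_le_sum) (auto simp: less_imp_le)
    finally show ?thesis .
  qed
  \<comment> \<open>This lets the constants \<open>kL\<close> and \<open>b\<close>, which carry
    neither factor, be absorbed into a multiple of \<open>t * itr\<close>.\<close>
  have ti: "1 \<le> t * itr"
  proof -
    have "lam 0 \<le> t" unfolding t_def using m lam by (intro member_le_sum) (auto simp: less_imp_le)
    moreover have "1 / lam 0 \<le> itr" using m by (intro itr_ge) auto
    ultimately have "lam 0 * (1 / lam 0) \<le> t * itr" using lam[of 0] m t0 by (intro mult_mono) auto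
    then show ?thesis using lam[of 0] m by simp
  qed
  have "t * (itr * (A - B)) \<le> kL + b + t * (A * real m)"
    using main cs grad by (simp add: algebra_simps)
  moreover have "kL + b \<le> (kL + b) * (t * itr)" using ti b0 by (simp add: mult_le_cancel_left1)
  ultimately have "t * (itr * (A - B - kL - b)) \<le> t * (A * real m)" by (simp add: algebra_simps)
  then have "itr * (A - B - kL - b) \<le> A * real m" using t0 by simp
  moreover have "itr \<le> itr * (A - B - kL - b)" using itr0 A by (simp add: mult_le_cancel_left1)
  ultimately have "itr \<le> A * real m" by linarith
  then have "lam p \<le> exp (Re (f O0)) * (A * real m) ^ (m - 1)" if "p < m" for p
    unfolding exp_f0 using lam that itr_ge by (intro le_prod_power) (auto intro: order_trans)
  then have "t \<le> (\<Sum>p<m. exp (Re (f O0)) * (A * real m) ^ (m - 1))" unfolding t_def by (intro sum_mono) auto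
  then show ?thesis by (simp add: trt)
qed

end

subsection \<open>Invariance of domain for \<open>\<complex>\<^sup>m\<close>\<close>

text \<open>Real and imaginary parts are interleaved, so that \<open>Cn m\<close> corresponds to the
  first \<open>2 m\<close> real coordinates, that is, to
  \<open>Euclidean_space (2 * m)\<close>.\<close>

definition to_real :: "cvec \<Rightarrow> nat \<Rightarrow> real" where
  "to_real z i = (if even i then Re (z (i div 2)) else Im (z (i div 2)))"

definition of_reals :: "(nat \<Rightarrow> real) \<Rightarrow> cvec" where
  "of_reals x i = Complex (x (2 * i)) (x (2 * i + 1))"

lemma of_reals_to_real: "of_reals (to_real z) = z"
  by (auto simp: of_reals_def to_real_def fun_eq_iff)

lemma to_real_of_reals: "to_real (of_reals x) = x"
  by (auto simp: of_reals_def to_real_def fun_eq_iff elim!: evenE oddE)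

definition Rn :: "nat \<Rightarrow> (nat \<Rightarrow> real) set" where
  "Rn n = {x. \<forall>i\<ge>n. x i = 0}"

lemma Euclidean_space_top: "Euclidean_space n = top_of_set (Rn n)"
  by (simp add: Euclidean_space_def euclidean_product_topology Rn_def)

lemma to_real_image: "to_real z \<in> Rn (2*m) \<longleftrightarrow> z \<in> Cn m"
proof
  assume *: "to_real z \<in> Rn (2*m)"
  have "z i = 0" if "i \<ge> m" for i
  proof -
    have "to_real z (2 * i) = 0" "to_real z (2 * i + 1) = 0" using * that unfolding Rn_def by auto
    then show ?thesis by (simp add: to_real_def complex_eq_iff)
  qed
  then show "z \<in> Cn m" by (simp add: Cn_def)
qed (auto simp: to_real_def Cn_def Rn_def)

lemma continuous_to_real: "continuous_on S to_real"
proof (rule continuous_on_coordinatewise_then_product)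
  fix i
  have "continuous_on S (\<lambda>z::cvec. z (i div 2))" by (rule continuous_on_subset[OF continuous_on_product_coordinates]) auto
  then show "continuous_on S (\<lambda>z. to_real z i)"
    by (cases "even i") (auto simp: to_real_def intro!: continuous_intros)
qed

lemma continuous_of_reals: "continuous_on S of_reals"
proof (rule continuous_on_coordinatewise_then_product)
  fix i
  have "continuous_on S (\<lambda>x::nat \<Rightarrow> real. x k)" for k by (rule continuous_on_subset[OF continuous_on_product_coordinates]) auto
  then show "continuous_on S (\<lambda>z. of_reals z i)"
    unfolding of_reals_def Complex_eq by (intro continuous_intros)
qed

lemma invariance_of_domain_Cn:
  assumes Y: "opn m Y" and f: "continuous_on Y f" "f ` Y \<subseteq> Cn m" "inj_on f Y"
  shows "opn m (f ` Y)"
proof -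
  let ?R = "Rn (2*m)"
  have YC: "Y \<subseteq> Cn m" using opn_Cn[OF Y] by auto
  have img: "to_real ` S = ?R \<inter> of_reals -` S" if "S \<subseteq> Cn m" for S
  proof (intro equalityI subsetI)
    fix x assume "x \<in> ?R \<inter> of_reals -` S"
    then show "x \<in> to_real ` S" by (metis IntD2 image_eqI to_real_of_reals vimageD)
  qed (use that to_real_image in \<open>auto simp: of_reals_to_real\<close>)
  have open_img: "openin (top_of_set ?R) (to_real ` S)" if S: "opn m S" for S
  proof -
    obtain V where V: "open V" "S = Cn m \<inter> V" using S by (auto simp: openin_open)
    have "to_real ` S = ?R \<inter> of_reals -` V"
    proof -
      have *: "of_reals x \<in> Cn m" if "x \<in> ?R" for x
        using to_real_image[of "of_reals x" m] that unfolding to_real_of_reals by blast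
      have "S \<subseteq> Cn m" using V(2) by blast
      from img[OF this] show ?thesis using * V(2) by blast
    qed
    then show ?thesis using continuous_openin_preimage_gen[OF continuous_of_reals V(1)] by simp
  qed
  let ?f = "to_real \<circ> f \<circ> of_reals"
  have cont: "continuous_on (to_real ` Y) ?f"
    by (intro continuous_on_compose continuous_of_reals continuous_to_real) (auto simp: image_image of_reals_to_real f)
  have "openin (Euclidean_space (2*m)) (?f ` (to_real ` Y))"
  proof (rule invariance_of_domain_Euclidean_space)
    show "openin (Euclidean_space (2*m)) (to_real ` Y)" unfolding Euclidean_space_top by (rule open_img[OF Y])
    have "to_real ` Y \<subseteq> ?R" "?f ` to_real ` Y \<subseteq> ?R"
      using img[OF YC] f(2) to_real_image by (auto simp: of_reals_to_real)
    then show "continuous_map (subtopology (Euclidean_space (2*m)) (to_real ` Y)) (Euclidean_space (2*m)) ?f"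
      unfolding Euclidean_space_top using cont by (simp add: subtopology_subtopology Int_absorb1 continuous_map_in_subtopology image_subset_iff_funcset o_def)
    show "inj_on ?f (to_real ` Y)"
      using f(3) by (auto simp: inj_on_def of_reals_to_real) (metis of_reals_to_real)
  qed
  then have "openin (top_of_set ?R) (to_real ` (f ` Y))"
    unfolding Euclidean_space_top by (simp add: image_image of_reals_to_real)
  then obtain V where V: "open V" "to_real ` (f ` Y) = ?R \<inter> V" by (auto simp: openin_open)
  have "f ` Y = Cn m \<inter> to_real -` V"
  proof (intro equalityI subsetI)
    fix z assume "z \<in> f ` Y" then show "z \<in> Cn m \<inter> to_real -` V" using V(2) f(2) by auto
  next
    fix z assume z: "z \<in> Cn m \<inter> to_real -` V"
    then have "to_real z \<in> to_real ` (f ` Y)" using V(2) to_real_image by auto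
    then show "z \<in> f ` Y" by (metis (no_types, lifting) imageE image_eqI of_reals_to_real)
  qed
  then show ?thesis using continuous_openin_preimage_gen[OF continuous_to_real V(1)] by simp
qed

subsection \<open>Charts\<close>

text \<open>\<open>rpartial\<close> refers to the large set \<open>S\<close>, but near
  \<open>z\<close> the interior of \<open>S\<close> coincides with \<open>W\<close>; hence
  regularity on the small open set suffices.\<close>

lemma rpartial_local:
  assumes W: "opn m W" "W \<subseteq> S" and f: "Ck (Suc k) m W f" and z: "z \<in> W" and j: "j < m" "c \<in> {1, \<i>}"
  shows "rpartial m S j c f z = pdv j c f z"
proof -
  obtain V where V: "open V" "W = Cn m \<inter> V" using W by (auto simp: openin_open)
  have "W \<subseteq> Cint m S" by (rule Cint_maximal[OF W])
  moreover have "Cint m S \<subseteq> Cn m" using opn_Cn[OF Cint_open(1)] by auto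
  ultimately have "Cint m S \<inter> V - {z} = W \<inter> V - {z}" using V by auto
  then have eq: "at z within Cint m S = at z within W"
    using V z by (intro at_within_nhd[of z V]) auto
  have "rpartial m S j c f z = Lim (at z within W) (pdv j c f)"
    unfolding rpartial_def pdv_def eq ..
  moreover have "(pdv j c f \<longlongrightarrow> pdv j c f z) (at z within W)"
    using Ck_continuous[OF Ck_SucD(2)[OF W(1) f j]] z by (auto simp: continuous_on_def)
  moreover have "at z within W \<noteq> bot"
    using at_within_Cint[of z m W j] W(1) z j by simp
  ultimately show ?thesis by (simp add: tendsto_Lim)
qed

lemma dz_local:
  assumes "opn m W" "W \<subseteq> S" "Ck (Suc k) m W f" "z \<in> W" "j < m"
  shows "dz m S j f z = Dz j f z" "dzbar m S j f z = Dzb j f z"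
  unfolding dz_def dzbar_def Wd_def using rpartial_local[OF assms] by simp_all

section \<open>Charts of a manifold with boundary and its interior\<close>

locale mfd =
  fixes M :: "'a mfd"
  assumes mfd: "complex_manifold_with_boundary M"
begin

abbreviation "m \<equiv> mdim M"
abbreviation "X \<equiv> mtop M"
abbreviation "I \<equiv> mfd_interior M"
abbreviation "S c \<equiv> snd c ` fst c"
abbreviation "iv c \<equiv> inv_into (fst c) (snd c)"

lemma m1: "m \<ge> 1" using mfd by (simp add: complex_manifold_with_boundary_def)

lemma chart:
  assumes "c \<in> atlas M"
  shows "openin X (fst c)" "S c \<subseteq> Cn m" "homeomorphic_map (subtopology X (fst c)) (top_of_set (S c)) (snd c)"
  using mfd assms by (auto simp: complex_manifold_with_boundary_def smooth_domain_def)

lemma chart_sub: "c \<in> atlas M \<Longrightarrow> fst c \<subseteq> pts M"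
  using chart(1) openin_subset by blast

lemma chart_exists: "p \<in> pts M \<Longrightarrow> \<exists>c\<in>atlas M. p \<in> fst c"
proof -
  assume p: "p \<in> pts M"
  have "\<Union> (fst ` atlas M) = pts M"
    using mfd unfolding complex_manifold_with_boundary_def by (elim conjE)
  then show ?thesis using p by blast
qed

lemma chart_at:
  assumes "p \<in> pts M"
  shows "chart_at M p \<in> atlas M \<and> p \<in> fst (chart_at M p)"
proof -
  have "\<exists>c. c \<in> atlas M \<and> p \<in> fst c" using chart_exists[OF assms] by blast
  then show ?thesis unfolding chart_at_def by (rule someI_ex)
qed

lemma chart_inj: "c \<in> atlas M \<Longrightarrow> inj_on (snd c) (fst c)"
proof -
  assume c: "c \<in> atlas M"
  have "topspace (subtopology X (fst c)) = fst c" using chart_sub[OF c] by auto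
  then show ?thesis using homeomorphic_imp_injective_map[OF chart(3)[OF c]] by simp
qed

lemma iv_snd: "c \<in> atlas M \<Longrightarrow> p \<in> fst c \<Longrightarrow> iv c (snd c p) = p"
  by (simp add: chart_inj)

lemma in_chart_snd: "c \<in> atlas M \<Longrightarrow> p \<in> fst c \<Longrightarrow> in_chart c f (snd c p) = f p"
  by (simp add: in_chart_def iv_snd)

lemma iv_S: "c \<in> atlas M \<Longrightarrow> z \<in> S c \<Longrightarrow> iv c z \<in> fst c \<and> snd c (iv c z) = z"
  by (auto simp: iv_snd)

lemma open_preimage:
  assumes c: "c \<in> atlas M" and V: "openin (top_of_set (S c)) V"
  shows "openin X {q \<in> fst c. snd c q \<in> V}"
proof -
  have "continuous_map (subtopology X (fst c)) (top_of_set (S c)) (snd c)"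
    by (rule homeomorphic_imp_continuous_map[OF chart(3)[OF c]])
  from openin_continuous_map_preimage[OF this V]
  have "openin (subtopology X (fst c)) {q \<in> fst c. snd c q \<in> V}"
    using chart_sub[OF c] by (simp add: Int_absorb1)
  then show ?thesis using chart(1)[OF c] openin_trans_full by blast
qed

lemma open_image:
  assumes c: "c \<in> atlas M" and N: "openin X N"
  shows "openin (top_of_set (S c)) (chart_img c N)"
proof -
  have "openin (subtopology X (fst c)) (fst c \<inter> N)"
    using N chart(1)[OF c] by (metis inf_commute openin_subtopology_Int)
  then show ?thesis unfolding chart_img_def
    using homeomorphic_imp_open_map[OF chart(3)[OF c]] by (auto simp: open_map_def)
qed

lemma continuous_iv:
  assumes c: "c \<in> atlas M"
  shows "continuous_map (top_of_set (S c)) X (iv c)"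
proof -
  have s: "topspace (subtopology X (fst c)) = fst c" using chart_sub[OF c] by auto
  obtain k where k: "homeomorphic_maps (subtopology X (fst c)) (top_of_set (S c)) (snd c) k"
    using chart(3)[OF c] homeomorphic_map_maps by blast
  then have kc: "continuous_map (top_of_set (S c)) X k"
    unfolding homeomorphic_maps_def by (blast dest: continuous_map_into_fulltopology)
  have kk: "k (snd c p) = p" if "p \<in> fst c" for p
    using k that unfolding homeomorphic_maps_def s by blast
  have "k z = iv c z" if z: "z \<in> topspace (top_of_set (S c))" for z
  proof -
    obtain p where "p \<in> fst c" "z = snd c p" using z by auto
    then show ?thesis using kk iv_snd[OF c] by simp
  qed
  then show ?thesis by (rule continuous_map_eq[OF kc])
qed

text \<open>Interior points are defined by the existence of one suitable chart. A transition map is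
  continuous and injective on an open set of \<open>Cn m\<close>, so by invariance of domain its
  image is open and consists of interior points of the other chart.\<close>

lemma interior_chart:
  assumes c: "c \<in> atlas M" and p: "p \<in> fst c" "p \<in> I"
  shows "snd c p \<in> Cint m (S c)"
proof -
  obtain d where d: "d \<in> atlas M" "p \<in> fst d" "snd d p \<in> Cint m (S d)"
    using p(2) by (auto simp: mfd_interior_def)
  define Y where "Y = chart_img d (fst c) \<inter> Cint m (S d)"
  have "openin (top_of_set (S d)) (chart_img d (fst c))" by (rule open_image[OF d(1) chart(1)[OF c]])
  then obtain V where V: "open V" "chart_img d (fst c) = S d \<inter> V" by (auto simp: openin_open)
  have "Y = Cint m (S d) \<inter> V" using V(2) Cint_open(2) unfolding Y_def by blast
  then have Y: "opn m Y" using Cint_open(1) V(1) by (metis openin_Int_open)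
  have YS: "z \<in> S d \<and> iv d z \<in> fst d \<inter> fst c" if "z \<in> Y" for z
    using that iv_snd[OF d(1)] by (auto simp: Y_def chart_img_def)
  let ?T = "\<lambda>z. snd c (iv d z)"
  have "continuous_on Y ?T"
  proof -
    have 1: "continuous_map (top_of_set Y) (subtopology X (fst c)) (iv d)"
      using YS continuous_map_from_subtopology_mono[OF continuous_iv[OF d(1)], of Y]
      by (auto simp: continuous_map_in_subtopology)
    have "continuous_map (subtopology X (fst c)) (top_of_set (S c)) (snd c)"
      by (rule homeomorphic_imp_continuous_map[OF chart(3)[OF c]])
    from continuous_map_compose[OF 1 this] have "continuous_map (top_of_set Y) euclidean ?T"
      by (simp add: continuous_map_in_subtopology o_def)
    then show ?thesis by simp
  qed
  moreover have TS: "?T ` Y \<subseteq> S c" using YS by auto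
  moreover have "inj_on ?T Y"
  proof (rule inj_onI)
    fix x y assume xy: "x \<in> Y" "y \<in> Y" "?T x = ?T y"
    then have "iv d x = iv d y" using YS chart_inj[OF c] by (auto dest: inj_onD)
    then show "x = y" using iv_S[OF d(1)] YS xy by metis
  qed
  ultimately have "opn m (?T ` Y)" using chart(2)[OF c] Y by (intro invariance_of_domain_Cn) auto
  then have "?T ` Y \<subseteq> Cint m (S c)" using TS by (intro Cint_maximal)
  moreover have "snd d p \<in> Y" using d p by (auto simp: Y_def chart_img_def)
  ultimately show ?thesis using iv_snd[OF d(1,2)] by force
qed

lemma I_sub: "I \<subseteq> pts M"
  using chart_sub by (auto simp: mfd_interior_def)

lemma opn_img:
  assumes c: "c \<in> atlas M" and N: "openin X N" "N \<subseteq> I"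
  shows "opn m (chart_img c N)"
proof -
  obtain V where V: "open V" "chart_img c N = S c \<inter> V" using open_image[OF c N(1)] by (auto simp: openin_open)
  have "chart_img c N \<subseteq> Cint m (S c)" using interior_chart[OF c] N(2) by (auto simp: chart_img_def)
  then have "chart_img c N = Cint m (S c) \<inter> V" using V(2) Cint_open(2) by blast
  then show ?thesis using Cint_open(1) V(1) by (metis openin_Int_open)
qed

lemma openin_I: "openin X I"
proof (subst openin_subopen, intro ballI)
  fix p assume p: "p \<in> I"
  then obtain c where c: "c \<in> atlas M" "p \<in> fst c" using chart_exists I_sub by blast
  have "openin (top_of_set (S c)) (Cint m (S c))"
    using Cint_open chart(2)[OF c(1)] by (metis openin_subset_trans)
  then have "openin X {q \<in> fst c. snd c q \<in> Cint m (S c)}" by (rule open_preimage[OF c(1)])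
  then show "\<exists>T. openin X T \<and> p \<in> T \<and> T \<subseteq> I"
    using c interior_chart[OF c p] by (intro exI[of _ "{q \<in> fst c. snd c q \<in> Cint m (S c)}"]) (auto simp: mfd_interior_def)
qed

lemma chart_img_S: "chart_img c N \<subseteq> S c" by (auto simp: chart_img_def)

lemma iv_img: "c \<in> atlas M \<Longrightarrow> z \<in> chart_img c N \<Longrightarrow> iv c z \<in> fst c \<and> iv c z \<in> N \<and> snd c (iv c z) = z"
  by (auto simp: chart_img_def iv_snd)

lemma snd_img: "p \<in> fst c \<Longrightarrow> p \<in> N \<Longrightarrow> snd c p \<in> chart_img c N"
  by (auto simp: chart_img_def)

section \<open>Derivatives in charts and their transformation\<close>

lemma pd_eq:
  assumes c: "c \<in> atlas M" and N: "openin X N" "N \<subseteq> I" and p: "p \<in> fst c" "p \<in> N"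
    and u: "Ck (Suc k) m (chart_img c N) (in_chart c u)" and j: "j < m"
  shows "pd M c j u p = Dz j (in_chart c u) (snd c p)" "pdbar M c j u p = Dzb j (in_chart c u) (snd c p)"
  unfolding pd_def pdbar_def using dz_local[OF opn_img[OF c N] chart_img_S u snd_img[OF p] j] .

lemma pd_pdbar_eq:
  assumes c: "c \<in> atlas M" and N: "openin X N" "N \<subseteq> I" and p: "p \<in> fst c" "p \<in> N"
    and u: "Ck (Suc (Suc k)) m (chart_img c N) (in_chart c u)" and j: "j < m" "l < m"
  shows "pd M c j (pdbar M c l u) p = Dz j (Dzb l (in_chart c u)) (snd c p)"
proof -
  have eq: "in_chart c (pdbar M c l u) w = Dzb l (in_chart c u) w" if "w \<in> chart_img c N" for w
  proof -
    have w: "iv c w \<in> fst c" "iv c w \<in> N" "snd c (iv c w) = w" using iv_img[OF c that] by auto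
    then show ?thesis using pd_eq(2)[OF c N w(1,2) u j(2)] by (simp add: in_chart_def)
  qed
  have "Ck (Suc k) m (chart_img c N) (in_chart c (pdbar M c l u))"
    using eq by (intro Ck_cong[OF _ Ck_Wd[OF opn_img[OF c N] u j(2)]]) auto
  from pd_eq(1)[OF c N p this j(1)] show ?thesis
    using Wd_transform[OF opn_img[OF c N] snd_img[OF p] j(1) eq] by simp
qed

lemma transition:
  assumes c: "c \<in> atlas M" and d: "d \<in> atlas M" and N: "openin X N" "N \<subseteq> I"
  shows "hmap m (chart_img c (N \<inter> fst d)) (chart_img d N) (\<lambda>w. snd d (iv c w))"
proof -
  have N': "openin X (N \<inter> fst d)" "N \<inter> fst d \<subseteq> I" using N chart(1)[OF d] by auto
  have sub: "chart_img c (N \<inter> fst d) \<subseteq> chart_img c (fst d)" by (auto simp: chart_img_def)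
  have hol: "Cholo m (chart_img c (fst d)) (in_chart c (\<lambda>p. snd d p i))" if "i < m" for i
    using mfd c d that by (auto simp: complex_manifold_with_boundary_def)
  note W = opn_img[OF c N']
  have sm: "Ck k m (chart_img c (N \<inter> fst d)) (\<lambda>w. snd d (iv c w) i)" if "i < m" for i k
  proof -
    have "Ck k m (chart_img c (fst d)) (in_chart c (\<lambda>p. snd d p i))"
      using hol[OF that] by (auto simp: Cholo_def Csmooth_def)
    from Ck_subset[OF this W sub] show ?thesis by (simp add: in_chart_def)
  qed
  show ?thesis
  proof
    show "opn m (chart_img c (N \<inter> fst d))" "opn m (chart_img d N)" using W opn_img[OF d N] by auto
    show "snd d (iv c w) \<in> chart_img d N" if "w \<in> chart_img c (N \<inter> fst d)" for w
      using iv_img[OF c that] by (auto intro: snd_img)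
    show "Ck k m (chart_img c (N \<inter> fst d)) (\<lambda>w. snd d (iv c w) a)" if "a < m" for a k by (rule sm[OF that])
    show "Dzb j (\<lambda>w. snd d (iv c w) a) w = 0" if aj: "a < m" "j < m" and w: "w \<in> chart_img c (N \<inter> fst d)" for a j w
    proof -
      have "dzbar m (chart_img c (fst d)) j (in_chart c (\<lambda>p. snd d p a)) w = 0"
        using hol[OF aj(1)] aj w sub by (auto simp: Cholo_def)
      then show ?thesis using dz_local(2)[OF W sub sm[OF aj(1), of "Suc 0"] w aj(2)] by (simp add: in_chart_def)
    qed
  qed
qed

lemma transition_J:
  assumes c: "c \<in> atlas M" and d: "d \<in> atlas M" and N: "openin X N" "N \<subseteq> I" and p: "p \<in> fst c" "p \<in> fst d" "p \<in> N"
    and a: "a < m" "j < m"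
  shows "pd M c j (\<lambda>q. snd d q a) p = Dz j (\<lambda>w. snd d (iv c w) a) (snd c p)"
proof -
  interpret hmap m "chart_img c (N \<inter> fst d)" "chart_img d N" "\<lambda>w. snd d (iv c w)"
    by (rule transition[OF c d N])
  have N': "openin X (N \<inter> fst d)" "N \<inter> fst d \<subseteq> I" using N chart(1)[OF d] by auto
  show ?thesis
    using pd_eq(1)[OF c N' p(1) _ _ a(2), of "Suc 0" "\<lambda>q. snd d q a"] smooth[OF a(1), of "Suc (Suc 0)"] p
    by (simp add: in_chart_def)
qed

lemma in_chart_transition:
  assumes c: "c \<in> atlas M" and d: "d \<in> atlas M" and w: "w \<in> chart_img c (N \<inter> fst d)"
  shows "in_chart d u (snd d (iv c w)) = in_chart c u w"
  using iv_img[OF c w] by (simp add: in_chart_def iv_snd[OF d])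

definition jac :: "'a chart \<Rightarrow> 'a chart \<Rightarrow> 'a \<Rightarrow> nat \<Rightarrow> nat \<Rightarrow> complex" where
  "jac c d p a j = pd M c j (\<lambda>q. snd d q a) p"

lemma real_form_pull:
  assumes "real_form11 M \<omega>" "c \<in> atlas M" "d \<in> atlas M" "p \<in> fst c" "p \<in> fst d" "j < m" "k < m"
  shows "\<omega> c p j k = pull m (jac c d p) (\<omega> d p) j k"
  using assms unfolding real_form11_def pull_def jac_def by blast

lemma pd_transform:
  assumes c: "c \<in> atlas M" and d: "d \<in> atlas M" and N: "openin X N" "N \<subseteq> I" and p: "p \<in> fst c" "p \<in> fst d" "p \<in> N"
    and u: "Ck (Suc k) m (chart_img d N) (in_chart d u)" and j: "j < m"
  shows "pd M c j u p = (\<Sum>a<m. pd M d a u p * jac c d p a j)"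
    and "pdbar M c j u p = (\<Sum>a<m. pdbar M d a u p * cnj (jac c d p a j))"
proof -
  interpret hmap m "chart_img c (N \<inter> fst d)" "chart_img d N" "\<lambda>w. snd d (iv c w)"
    by (rule transition[OF c d N])
  have N': "openin X (N \<inter> fst d)" "N \<inter> fst d \<subseteq> I" using N chart(1)[OF d] by auto
  have pN: "p \<in> N \<inter> fst d" using p by auto
  have "Ck (Suc k) m (chart_img c (N \<inter> fst d)) (in_chart c u)"
    using in_chart_transition[OF c d] by (intro Ck_cong[OF _ Ck_pull[OF u]]) auto
  note e = pd_eq[OF c N' p(1) pN this j]
  have t: "Wd s j (in_chart c u) (snd c p) = Wd s j (\<lambda>w. in_chart d u (snd d (iv c w))) (snd c p)" for s
    by (intro Wd_transform[OF W snd_img[OF p(1) pN] j] in_chart_transition[OF c d, symmetric])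
  have Jj: "J a j (snd c p) = jac c d p a j" if "a < m" for a
    unfolding J_def jac_def using transition_J[OF c d N p that j] by simp
  note e' = pd_eq[OF d N p(2,3) u]
  show "pd M c j u p = (\<Sum>a<m. pd M d a u p * jac c d p a j)"
    "pdbar M c j u p = (\<Sum>a<m. pdbar M d a u p * cnj (jac c d p a j))"
    unfolding e t Dz_pull[OF u snd_img[OF p(1) pN] j] by (auto intro!: sum.cong simp: e' Jj iv_snd[OF c p(1)])
qed

lemma ddbar_transform:
  assumes c: "c \<in> atlas M" and d: "d \<in> atlas M" and N: "openin X N" "N \<subseteq> I" and p: "p \<in> fst c" "p \<in> fst d" "p \<in> N"
    and u: "Ck (Suc (Suc k)) m (chart_img d N) (in_chart d (\<lambda>q. complex_of_real (u q)))" and j: "j < m" "l < m"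
  shows "ddbar M u c p j l = pull m (jac c d p) (ddbar M u d p) j l"
proof -
  let ?u = "\<lambda>q. complex_of_real (u q)"
  interpret hmap m "chart_img c (N \<inter> fst d)" "chart_img d N" "\<lambda>w. snd d (iv c w)"
    by (rule transition[OF c d N])
  have N': "openin X (N \<inter> fst d)" "N \<inter> fst d \<subseteq> I" using N chart(1)[OF d] by auto
  have pN: "p \<in> N \<inter> fst d" using p by auto
  have "Ck (Suc (Suc k)) m (chart_img c (N \<inter> fst d)) (in_chart c ?u)"
    using in_chart_transition[OF c d] by (intro Ck_cong[OF _ Ck_pull[OF u]]) auto
  note e = pd_pdbar_eq[OF c N' p(1) pN this j]
  have t: "Dz j (Dzb l (in_chart c ?u)) (snd c p) = Dz j (Dzb l (\<lambda>w. in_chart d ?u (snd d (iv c w)))) (snd c p)"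
    using j by (intro Wd_transform[OF W snd_img[OF p(1) pN]] Wd_transform[OF W] in_chart_transition[OF c d, symmetric])
  have Jj: "J a j (snd c p) = jac c d p a j" if "a < m" "j < m" for a j
    unfolding J_def jac_def using transition_J[OF c d N p that] by simp
  note e' = pd_pdbar_eq[OF d N p(2,3) u]
  show ?thesis
    unfolding ddbar_def pull_def e t ddb_pull[OF u snd_img[OF p(1) pN] j]
    using j by (auto intro!: sum.cong simp: e' Jj iv_snd[OF c p(1)])
qed

end

lemma ginv_cong:
  assumes "\<And>j k. j < m \<Longrightarrow> k < m \<Longrightarrow> g j k = g' j k"
  shows "ginv m g = ginv m g'"
proof -
  have *: "(\<Sum>k<m. h j k * g l k) = (\<Sum>k<m. h j k * g' l k)" if "l < m" for h j l
    using assms that by (intro sum.cong) auto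
  show ?thesis unfolding ginv_def by (simp add: *)
qed

lemma gtr_cong:
  assumes "\<And>j k. j < m \<Longrightarrow> k < m \<Longrightarrow> g j k = g' j k" "\<And>j k. j < m \<Longrightarrow> k < m \<Longrightarrow> x j k = x' j k"
  shows "gtr m g x = gtr m g' x'"
proof -
  have "ginv m g = ginv m g'" by (rule ginv_cong[OF assms(1)])
  then show ?thesis unfolding gtr_def using assms(2) by (auto intro!: sum.cong)
qed

lemma pull_rank1:
  "pull m A (\<lambda>a b. x a * y b) j k = (\<Sum>a<m. x a * A a j) * (\<Sum>b<m. y b * cnj (A b k))"
  unfolding pull_def sum_product by (intro sum.cong refl) (simp add: ac_simps)

text \<open>The number \<open>s * cnj s\<close> is positive, hence off the branch cut, and its
  logarithm can be written with the holomorphic \<open>Ln\<close>. The conjugate derivative of the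
  result is the conjugate of the holomorphic function \<open>Dz l s / s\<close>, so
  \<open>log |s|^2\<close> is pluriharmonic.\<close>

lemma ddb_log_norm:
  assumes U: "opn m U" and s: "\<And>k. Ck k m U s" and hol: "\<And>w j. w \<in> U \<Longrightarrow> j < m \<Longrightarrow> Dzb j s w = 0"
    and nz: "\<And>w. w \<in> U \<Longrightarrow> s w \<noteq> 0" and z: "z \<in> U" and j: "j < m" "l < m"
  shows "Ck k m U (\<lambda>w. complex_of_real (ln ((cmod (s w))\<^sup>2)))"
    and "Dz j (\<lambda>w. of_real (ln ((cmod (s w))\<^sup>2))) z = Dz j s z / s z"
    and "Dz j (Dzb l (\<lambda>w. of_real (ln ((cmod (s w))\<^sup>2)))) z = 0"
proof -
  have eq: "of_real (ln ((cmod (s w))\<^sup>2)) = Ln (s w * cnj (s w))" if "w \<in> U" for w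
  proof -
    have "(cmod (s w))\<^sup>2 > 0" using nz[OF that] by simp
    from Ln_of_real[OF this] show ?thesis unfolding complex_norm_square by simp
  qed
  have pos: "s w * cnj (s w) \<notin> \<real>\<^sub>\<le>\<^sub>0" if "w \<in> U" for w
    using nz[OF that] unfolding complex_norm_square[symmetric] nonpos_Reals_of_real_iff by simp
  have open': "open (- \<real>\<^sub>\<le>\<^sub>0 :: complex set)" by (simp add: closed_nonpos_Reals_complex open_Compl)
  have "Ck k m U (\<lambda>w. Ln (s w * cnj (s w)))"
    using pos by (intro Ck_comp[OF U open' Ck_mult[OF U s Ck_cnj[OF U s]]]) (auto intro!: holomorphic_on_Ln)
  then show "Ck k m U (\<lambda>w. complex_of_real (ln ((cmod (s w))\<^sup>2)))" using eq by (intro Ck_cong[OF _ \<open>Ck k m U (\<lambda>w. Ln (s w * cnj (s w)))\<close>]) auto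
  have sd: "dj i s w" if "w \<in> U" "i < m" for w i using Ck_dj[OF U s that] .
  have D: "Wd t i (\<lambda>w. of_real (ln ((cmod (s w))\<^sup>2))) w = inverse (s w * cnj (s w)) * (Wd t i s w * cnj (s w) + s w * cnj (Wd (cnj t) i s w))"
    if "w \<in> U" "i < m" for t i w
  proof -
    have "Wd t i (\<lambda>w. of_real (ln ((cmod (s w))\<^sup>2))) w = Wd t i (\<lambda>w. Ln (s w * cnj (s w))) w"
      using that eq by (intro Wd_transform[OF U])
    also have "\<dots> = inverse (s w * cnj (s w)) * Wd t i (\<lambda>w. s w * cnj (s w)) w"
      by (rule Wd_comp(2)[OF Wd_mult(1)[OF sd[OF that] Wd_cnj(1)[OF sd[OF that]]] has_field_derivative_Ln[OF pos[OF that(1)]]])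
    finally show ?thesis
      using Wd_mult(2)[OF sd[OF that] Wd_cnj(1)[OF sd[OF that]]] Wd_cnj(2)[OF sd[OF that]] by simp
  qed
  show "Dz j (\<lambda>w. of_real (ln ((cmod (s w))\<^sup>2))) z = Dz j s z / s z"
    using D[OF z j(1), of "-\<i>"] hol[OF z j(1)] nz[OF z] by (simp add: field_simps)
  have "Dz j (Dzb l (\<lambda>w. of_real (ln ((cmod (s w))\<^sup>2)))) z = Dz j (\<lambda>w. cnj (Dz l s w * inverse (s w))) z"
    using D[OF _ j(2), of _ \<i>] hol[OF _ j(2)] nz by (intro Wd_transform[OF U z j(1)]) (simp add: field_simps)
  also have "\<dots> = cnj (Dzb j (\<lambda>w. Dz l s w * inverse (s w)) z)"
  proof -
    have i: "dj j (\<lambda>w. inverse (s w)) z"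
      using nz[OF z] by (intro Wd_comp(1)[OF sd[OF z j(1)], where \<psi>=inverse]) (auto intro!: derivative_eq_intros)
    show ?thesis using Wd_cnj(2)[OF Wd_mult(1)[OF Ck_dj[OF U Ck_Wd[OF U s j(2)] z j(1)] i], of "-\<i>"] by simp
  qed
  also have "Dzb j (\<lambda>w. Dz l s w * inverse (s w)) z = 0"
  proof -
    have d: "(inverse has_field_derivative - (inverse (s z) * inverse (s z))) (at (s z))"
      using nz[OF z] by (auto intro!: derivative_eq_intros)
    have "Dzb j (Dz l s) z = Dz l (Dzb j s) z" by (rule Wd_commute[OF U s z j])
    also have "\<dots> = Dz l (\<lambda>_. 0) z" using hol j by (intro Wd_transform[OF U z]) auto
    finally have "Dzb j (Dz l s) z = 0" by (simp add: Wd_const)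
    then show ?thesis
      using Wd_mult(2)[OF Ck_dj[OF U Ck_Wd[OF U s j(2)] z j(1)] Wd_comp(1)[OF sd[OF z j(1)] d]] Wd_comp(2)[OF sd[OF z j(1)] d] hol[OF z j(1)]
      by simp
  qed
  finally show "Dz j (Dzb l (\<lambda>w. of_real (ln ((cmod (s w))\<^sup>2)))) z = 0" by simp
qed

section \<open>The metric, the divisor and the norm of its section\<close>

locale geo = mfd M for M :: "'a mfd" +
  fixes \<Omega> g :: "'a form11" and E :: "'a local_eqn set" and \<epsilon> :: real and H :: "'a local_eqn \<Rightarrow> 'a \<Rightarrow> real"
  assumes compact: "compact_space (mtop M)"
    and \<Omega>: "real_form11 M \<Omega>" "smooth_form11 M \<Omega>"
    and E: "effective_divisor M E" and Ebd: "divisor_support E \<inter> mfd_boundary M = {}"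
    and \<epsilon>: "\<epsilon> > 0" and H: "hermitian_metric M E H"
    and g_eq: "g = form_add \<Omega> (ddbar_log_metric M E H \<epsilon>)" and g: "kaehler_form M g"
begin

lemmas E_cover = E[unfolded effective_divisor_def, THEN conjunct1]
lemmas E_eqns = E[unfolded effective_divisor_def, THEN conjunct2, THEN conjunct1]
lemmas E_trans = E[unfolded effective_divisor_def, THEN conjunct2, THEN conjunct2]
lemmas H_smooth = H[unfolded hermitian_metric_def, THEN conjunct1]
lemmas H_trans = H[unfolded hermitian_metric_def, THEN conjunct2]

abbreviation "Z \<equiv> divisor_support E"
abbreviation "D \<equiv> I - Z"
abbreviation "sn \<equiv> section_norm E H"

lemma g_pos: "c \<in> atlas M \<Longrightarrow> p \<in> fst c \<Longrightarrow> \<exists>j<m. a j \<noteq> 0 \<Longrightarrow> Re (bf m (g c p) a a) > 0"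
  using g unfolding kaehler_form_def pos_form11_def sqn_bf by blast

lemma g_dt: "c \<in> atlas M \<Longrightarrow> p \<in> fst c \<Longrightarrow> dt m (g c p) \<noteq> 0"
  using g_pos by (intro dt_pos)

lemma g_real: "real_form11 M g" using g by (simp add: kaehler_form_def)

lemma g_herm: "c \<in> atlas M \<Longrightarrow> p \<in> fst c \<Longrightarrow> j < m \<Longrightarrow> k < m \<Longrightarrow> g c p k j = cnj (g c p j k)"
  using g_real unfolding real_form11_def by blast

lemma g_smooth: "c \<in> atlas M \<Longrightarrow> j < m \<Longrightarrow> l < m \<Longrightarrow> Ck k m (S c) (in_chart c (\<lambda>p. g c p j l))"
  using g unfolding kaehler_form_def smooth_form11_def Csmooth_def by blast

lemma kdata_chart:
  assumes c: "c \<in> atlas M" and N: "openin X N" "N \<subseteq> I"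
  shows "kdata m (chart_img c N) (\<lambda>z. g c (iv c z))"
proof
  show U: "opn m (chart_img c N)" by (rule opn_img[OF c N])
  show C: "Ck k m (chart_img c N) (\<lambda>z. g c (iv c z) j l)" if "j < m" "l < m" for k j l
    using Ck_subset[OF g_smooth[OF c that] U chart_img_S] by (simp add: in_chart_def)
  show "g c (iv c z) l j = cnj (g c (iv c z) j l)" if "z \<in> chart_img c N" "j < m" "l < m" for z j l
    using g_herm[OF c _ that(2,3)] iv_img[OF c that(1)] by blast
  show "Re (bf m (g c (iv c z)) a a) > 0" if "z \<in> chart_img c N" "\<exists>j<m. a j \<noteq> 0" for z a
    using g_pos[OF c _ that(2)] iv_img[OF c that(1)] by blast
  show "Dz l (\<lambda>w. g c (iv c w) j k) z = Dz j (\<lambda>w. g c (iv c w) l k) z" if z: "z \<in> chart_img c N" and i: "j < m" "k < m" "l < m" for z j k l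
  proof -
    have p: "iv c z \<in> fst c" "iv c z \<in> N" "snd c (iv c z) = z" using iv_img[OF c z] by auto
    have "pd M c l (\<lambda>q. g c q j k) (iv c z) = pd M c j (\<lambda>q. g c q l k) (iv c z)"
      using g c p(1) i unfolding kaehler_form_def closed_form11_def by blast
    moreover have C': "Ck (Suc 0) m (chart_img c N) (in_chart c (\<lambda>q. g c q j k))" if "j < m" "k < m" for j k
      using C[OF that] by (simp add: in_chart_def)
    ultimately show ?thesis
      using pd_eq(1)[OF c N p(1,2) C'] i p(3) by (simp add: in_chart_def)
  qed
qed

lemma gtr_invariant:
  assumes "c \<in> atlas M" "d \<in> atlas M" "p \<in> fst c" "p \<in> fst d"
    and x: "\<And>j k. j < m \<Longrightarrow> k < m \<Longrightarrow> x j k = pull m (jac c d p) y j k"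
  shows "gtr m (g c p) x = gtr m (g d p) y"
proof -
  note gp = real_form_pull[OF g_real assms(1-4)]
  have "dt m (pull m (jac c d p) (g d p)) = dt m (g c p)" by (intro dt_cong gp[symmetric])
  then have "gtr m (pull m (jac c d p) (g d p)) (pull m (jac c d p) y) = gtr m (g d p) y"
    using g_dt[OF assms(1,3)] by (intro gtr_pull) simp
  then show ?thesis using gtr_cong[of m "g c p" "pull m (jac c d p) (g d p)" x] gp x by simp
qed

text \<open>The squared gradient norm in a freely chosen chart. \<open>grad_norm\<close> uses a
  chart that may change with the point, which is unsuitable for limits.\<close>

definition gq :: "'a chart \<Rightarrow> 'a \<Rightarrow> ('a \<Rightarrow> real) \<Rightarrow> complex" where
  "gq c p f = gtr m (g c p) (\<lambda>j k. pd M c j (\<lambda>q. complex_of_real (f q)) p * pdbar M c k (\<lambda>q. complex_of_real (f q)) p)"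

lemma grad_norm_gq: "grad_norm M g f p = sqrt (Re (gq (chart_at M p) p f))"
  by (simp add: grad_norm_def gq_def gtr_def Let_def mult.assoc)

lemma laplacian_gtr: "laplacian M g f p = Re (gtr m (g (chart_at M p) p) (ddbar M f (chart_at M p) p))"
  by (simp add: laplacian_def gtr_def Let_def)

lemma Ck_on_chart:
  assumes "Ck_on k M N f" "c \<in> atlas M" "openin X N'" "N' \<subseteq> I" "N' \<subseteq> N"
  shows "Ck k m (chart_img c N') (in_chart c (\<lambda>q. complex_of_real (f q)))"
proof -
  have "Ck k m (chart_img c N) (in_chart c f)" using assms by (simp add: Ck_on_def)
  from Ck_subset[OF Ck_of_real[OF this] opn_img[OF assms(2-4)]] show ?thesis
    using assms(5) by (auto simp: in_chart_def chart_img_def)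
qed

text \<open>Refers to the complex valued version of a real function, since the calculus of
  \<open>Dz\<close> is set up for complex functions.\<close>

definition cCk :: "nat \<Rightarrow> 'a set \<Rightarrow> ('a \<Rightarrow> real) \<Rightarrow> bool" where
  "cCk k N f \<longleftrightarrow> (\<forall>c\<in>atlas M. Ck k m (chart_img c N) (in_chart c (\<lambda>q. complex_of_real (f q))))"

lemma cCkD: "cCk k N f \<Longrightarrow> c \<in> atlas M \<Longrightarrow> Ck k m (chart_img c N) (in_chart c (\<lambda>q. complex_of_real (f q)))"
  by (simp add: cCk_def)

lemma cCk_on: "Ck_on k M N f \<Longrightarrow> openin X N' \<Longrightarrow> N' \<subseteq> I \<Longrightarrow> N' \<subseteq> N \<Longrightarrow> cCk k N' f"
  using Ck_on_chart unfolding cCk_def by blast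

lemma gq_invariant:
  assumes c: "c \<in> atlas M" and d: "d \<in> atlas M" and p: "p \<in> fst c" "p \<in> fst d" "p \<in> N"
    and N: "openin X N" "N \<subseteq> I" and f: "cCk (Suc k) N f"
  shows "gq c p f = gq d p f"
  unfolding gq_def
proof (rule gtr_invariant[OF c d p(1,2)])
  fix j k assume "j < m" "k < m"
  then show "pd M c j (\<lambda>q. complex_of_real (f q)) p * pdbar M c k (\<lambda>q. complex_of_real (f q)) p =
    pull m (jac c d p) (\<lambda>j k. pd M d j (\<lambda>q. complex_of_real (f q)) p * pdbar M d k (\<lambda>q. complex_of_real (f q)) p) j k"
    unfolding pull_rank1 using pd_transform[OF c d N p cCkD[OF f d]] by simp
qed

lemma triv:
  assumes "p \<in> pts M"
  shows "triv_at E p \<in> E" "p \<in> fst (triv_at E p)"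
proof -
  have "\<exists>t. t \<in> E \<and> p \<in> fst t" using E_cover assms by blast
  then have "triv_at E p \<in> E \<and> p \<in> fst (triv_at E p)" unfolding triv_at_def by (rule someI_ex)
  then show "triv_at E p \<in> E" "p \<in> fst (triv_at E p)" by auto
qed

lemma E_local:
  assumes "t \<in> E"
  shows "openin X (fst t)" "holo_on M (fst t) (snd t)" "smooth_on M (fst t) (H t)" "\<And>p. p \<in> fst t \<Longrightarrow> H t p > 0"
  using E_eqns H_smooth assms by blast+

text \<open>The factor by which the representative of the section changes is compensated by that of
  the metric; hence the arbitrary choice in \<open>triv_at\<close> is harmless.\<close>

lemma sn_local:
  assumes t: "t \<in> E" "p \<in> fst t"
  shows "(sn p)\<^sup>2 = (cmod (snd t p))\<^sup>2 * H t p" "sn p \<ge> 0" "p \<in> Z \<longleftrightarrow> snd t p = 0" "p \<in> Z \<longleftrightarrow> sn p = 0"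
proof -
  have pM: "p \<in> pts M" using E_local(1)[OF t(1)] t(2) openin_subset by blast
  have ind: "(cmod (snd t' p))\<^sup>2 * H t' p = (cmod (snd t p))\<^sup>2 * H t p \<and> (snd t' p = 0 \<longleftrightarrow> snd t p = 0)"
    if t': "t' \<in> E" "p \<in> fst t'" for t'
  proof -
    obtain u where u: "transition_fun M t' t u" using E_trans t(1) t'(1) by blast
    then have "u p \<noteq> 0" "snd t' p = u p * snd t p" using t t' unfolding transition_fun_def by blast+
    moreover have "H t p = (cmod (u p))\<^sup>2 * H t' p"
      using H_trans u t t' by blast
    ultimately show ?thesis by (simp add: norm_mult power_mult_distrib)
  qed
  have Ht: "H t p > 0" using E_local(4)[OF t(1)] t(2) by blast
  then have nn: "(cmod (snd t p))\<^sup>2 * H t p \<ge> 0" by simp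
  have sn: "sn p = sqrt ((cmod (snd t p))\<^sup>2 * H t p)"
    unfolding section_norm_def Let_def using ind[OF triv[OF pM]] by simp
  show "(sn p)\<^sup>2 = (cmod (snd t p))\<^sup>2 * H t p" "sn p \<ge> 0" using nn by (simp_all add: sn)
  show z: "p \<in> Z \<longleftrightarrow> snd t p = 0" unfolding divisor_support_def using ind t by blast
  show "p \<in> Z \<longleftrightarrow> sn p = 0" unfolding z sn using Ht by simp
qed

lemma sn_pos: "p \<in> pts M \<Longrightarrow> p \<notin> Z \<Longrightarrow> sn p > 0"
  using sn_local(2,4)[OF triv] by (metis less_eq_real_def)

lemma chart_nbhd:
  assumes c: "c \<in> atlas M" and p: "p \<in> fst c" "p \<in> N" and N: "openin X N"
    and ev: "\<forall>\<^sub>F z in inf (nhds (snd c p)) (principal (chart_img c N)). P z"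
  shows "\<exists>U. openin X U \<and> p \<in> U \<and> U \<subseteq> N \<and> U \<subseteq> fst c \<and> (\<forall>q\<in>U. P (snd c q))"
proof -
  obtain V where V: "open V" "snd c p \<in> V" "\<forall>z\<in>V. z \<in> chart_img c N \<longrightarrow> P z"
    using ev unfolding eventually_inf_principal eventually_nhds by blast
  have "openin (top_of_set (S c)) (S c \<inter> V)" using V(1) by (simp add: openin_open_Int)
  from open_preimage[OF c this] have o: "openin X {q \<in> fst c. snd c q \<in> S c \<inter> V}" .
  have P: "P (snd c q)" if "q \<in> {q \<in> fst c. snd c q \<in> S c \<inter> V} \<inter> N" for q
  proof -
    have q: "q \<in> fst c" "snd c q \<in> V" "q \<in> N" using that by simp_all
    show ?thesis using V(3) q(2) snd_img[OF q(1,3)] by simp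
  qed
  have "p \<in> {q \<in> fst c. snd c q \<in> S c \<inter> V} \<inter> N" using V(2) p by simp
  then show ?thesis
    by (intro exI[of _ "{q \<in> fst c. snd c q \<in> S c \<inter> V} \<inter> N"] conjI ballI openin_Int[OF o N] P) auto
qed

lemma continuous_nbhd:
  fixes f :: "'a \<Rightarrow> 'b::metric_space"
  assumes c: "c \<in> atlas M" and p: "p \<in> fst c" "p \<in> N" and N: "openin X N"
    and f: "continuous_on (chart_img c N) (in_chart c f)" and e: "e > 0"
  shows "\<exists>U. openin X U \<and> p \<in> U \<and> U \<subseteq> N \<and> U \<subseteq> fst c \<and> (\<forall>q\<in>U. dist (f q) (f p) < e)"
proof -
  have "(in_chart c f \<longlongrightarrow> in_chart c f (snd c p)) (inf (nhds (snd c p)) (principal (chart_img c N)))"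
    by (rule tendsto_within_open[OF f snd_img[OF p]])
  from chart_nbhd[OF c p N tendstoD[OF this e]] obtain U where U: "openin X U" "p \<in> U" "U \<subseteq> N" "U \<subseteq> fst c"
    "\<forall>q\<in>U. dist (in_chart c f (snd c q)) (in_chart c f (snd c p)) < e"
    by (elim exE conjE)
  have "dist (f q) (f p) < e" if "q \<in> U" for q
  proof -
    have "q \<in> fst c" using that U(4) by (rule subsetD[rotated])
    then show ?thesis using U(5) that in_chart_snd[OF c, of q f] in_chart_snd[OF c p(1), of f] by auto
  qed
  then show ?thesis using U by blast
qed

lemma sn2_nbhd:
  assumes p: "p \<in> pts M" and e: "e > 0"
  shows "\<exists>U. openin X U \<and> p \<in> U \<and> (\<forall>q\<in>U. \<bar>(sn q)\<^sup>2 - (sn p)\<^sup>2\<bar> < e)"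
proof -
  define t where "t = triv_at E p"
  have t: "t \<in> E" "p \<in> fst t" using triv[OF p] by (auto simp: t_def)
  obtain c where c: "c \<in> atlas M" "p \<in> fst c" using chart_exists[OF p] by blast
  note tl = E_local[OF t(1)]
  have "continuous_on (chart_img c (fst t)) (in_chart c (snd t))"
    using tl(2) c(1) unfolding holo_on_def Cholo_def Csmooth_def using Ck_continuous by blast
  moreover have "continuous_on (chart_img c (fst t)) (in_chart c (H t))"
    using tl(3) c(1) unfolding smooth_on_def Ck_on_def using Ck_continuous by blast
  ultimately have "continuous_on (chart_img c (fst t)) (in_chart c (\<lambda>q. (cmod (snd t q))\<^sup>2 * H t q))"
    unfolding in_chart_def by (intro continuous_intros)
  from continuous_nbhd[OF c t(2) tl(1) this e] obtain U where U: "openin X U" "p \<in> U" "U \<subseteq> fst t"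
    "\<forall>q\<in>U. dist ((cmod (snd t q))\<^sup>2 * H t q) ((cmod (snd t p))\<^sup>2 * H t p) < e" by blast
  then show ?thesis
    using sn_local(1)[OF t] sn_local(1)[OF t(1)] by (intro exI[of _ U]) (auto simp: dist_real_def subset_iff)
qed

lemma openin_D: "openin X D"
proof (subst openin_subopen, intro ballI)
  fix p assume p: "p \<in> D"
  then have pM: "p \<in> pts M" using I_sub by auto
  have "(sn p)\<^sup>2 > 0" using sn_pos[OF pM] p by auto
  then obtain U where U: "openin X U" "p \<in> U" "\<forall>q\<in>U. \<bar>(sn q)\<^sup>2 - (sn p)\<^sup>2\<bar> < (sn p)\<^sup>2"
    using sn2_nbhd[OF pM, of "(sn p)\<^sup>2"] by auto
  have "q \<notin> Z" if "q \<in> U" for q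
  proof
    assume "q \<in> Z"
    then have "sn q = 0" using sn_local(4)[OF triv] U(1) that openin_subset by blast
    then show False using U(3) that by force
  qed
  then show "\<exists>T. openin X T \<and> p \<in> T \<and> T \<subseteq> D"
    using U openin_I p by (intro exI[of _ "U \<inter> I"]) auto
qed

text \<open>Up to the factor \<open>\<epsilon>\<close> this is the potential that relates
  \<open>\<Omega>\<close> to \<open>g\<close> off the divisor.\<close>

definition lsn :: "'a \<Rightarrow> real" where "lsn q = ln ((sn q)\<^sup>2)"

text \<open>In a trivialization \<open>lsn\<close> is \<open>log |s|^2 + log H\<close>, and the
  first summand is pluriharmonic off the divisor.\<close>

lemma lsn_local:
  assumes t: "t \<in> E" and c: "c \<in> atlas M" and N: "N = fst t \<inter> D" and p: "p \<in> N" "p \<in> fst c" and jl: "j < m" "l < m"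
  shows "Ck k m (chart_img c N) (in_chart c (\<lambda>q. complex_of_real (lsn q)))"
    and "Dz j (in_chart c (\<lambda>q. complex_of_real (lsn q))) (snd c p) =
       Dz j (in_chart c (snd t)) (snd c p) / snd t p + Dz j (in_chart c (\<lambda>q. complex_of_real (H t q))) (snd c p) / of_real (H t p)"
    and "Dz j (Dzb l (in_chart c (\<lambda>q. complex_of_real (lsn q)))) (snd c p) = Dz j (Dzb l (in_chart c (\<lambda>q. complex_of_real (ln (H t q))))) (snd c p)"
    and "Ck k m (chart_img c N) (in_chart c (\<lambda>q. complex_of_real (ln (H t q))))"
proof -
  note tl = E_local[OF t]
  have No: "openin X N" "N \<subseteq> I" using tl(1) openin_D unfolding N by auto
  note U = opn_img[OF c No]
  let ?s = "in_chart c (snd t)" and ?H = "in_chart c (\<lambda>q. complex_of_real (H t q))"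
  have sub: "chart_img c N \<subseteq> chart_img c (fst t)" by (auto simp: chart_img_def N)
  have s: "Ck k m (chart_img c N) ?s" for k
    using tl(2) c Ck_subset[OF _ U sub] unfolding holo_on_def Cholo_def Csmooth_def by blast
  have hol: "Dzb j ?s w = 0" if "w \<in> chart_img c N" "j < m" for w j
  proof -
    have "dzbar m (chart_img c (fst t)) j ?s w = 0"
      using tl(2) c that sub unfolding holo_on_def Cholo_def by blast
    then show ?thesis using dz_local(2)[OF U sub s[of "Suc 0"] that] by simp
  qed
  have nz: "?s w \<noteq> 0" if "w \<in> chart_img c N" for w
    using sn_local(3)[OF t, of "iv c w"] iv_img[OF c that] by (auto simp: N in_chart_def)
  have Hp: "H t (iv c w) > 0" if "w \<in> chart_img c N" for w
    using tl(4) iv_img[OF c that] by (auto simp: N)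
  have HC: "Ck k m (chart_img c N) ?H" for k
    using tl(3) Ck_on_chart[OF _ c No] unfolding smooth_on_def N by blast
  have open': "open (- \<real>\<^sub>\<le>\<^sub>0 :: complex set)" by (simp add: closed_nonpos_Reals_complex open_Compl)
  have pos: "?H w \<notin> \<real>\<^sub>\<le>\<^sub>0" if "w \<in> chart_img c N" for w using Hp[OF that] by (simp add: in_chart_def)
  have X: "Ck k m (chart_img c N) (\<lambda>w. Ln (?H w))" for k
    using pos by (intro Ck_comp[OF U open' HC]) (auto intro!: holomorphic_on_Ln)
  have lH: "Ck k m (chart_img c N) (in_chart c (\<lambda>q. complex_of_real (ln (H t q))))" for k
    by (rule Ck_cong[OF _ X]) (use Hp in \<open>auto simp: in_chart_def Ln_of_real\<close>)
  show "Ck k m (chart_img c N) (in_chart c (\<lambda>q. complex_of_real (ln (H t q))))" by (rule lH)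
  have eq: "in_chart c (\<lambda>q. complex_of_real (lsn q)) w = of_real (ln ((cmod (?s w))\<^sup>2)) + in_chart c (\<lambda>q. complex_of_real (ln (H t q))) w"
    if "w \<in> chart_img c N" for w
  proof -
    have "iv c w \<in> fst t" using iv_img[OF c that] by (auto simp: N)
    then have "lsn (iv c w) = ln ((cmod (?s w))\<^sup>2 * H t (iv c w))"
      using sn_local(1)[OF t] by (simp add: lsn_def in_chart_def)
    also have "\<dots> = ln ((cmod (?s w))\<^sup>2) + ln (H t (iv c w))"
      using nz[OF that] Hp[OF that] by (simp add: ln_mult)
    finally show ?thesis by (simp add: in_chart_def)
  qed
  have z: "snd c p \<in> chart_img c N" using p by (intro snd_img)
  note L = ddb_log_norm[OF U s hol nz z jl]
  show "Ck k m (chart_img c N) (in_chart c (\<lambda>q. complex_of_real (lsn q)))"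
    using eq by (intro Ck_cong[OF _ Ck_add[OF U L(1) lH]]) auto
  have "Dz j (in_chart c (\<lambda>q. complex_of_real (lsn q))) (snd c p) = Dz j (\<lambda>w. of_real (ln ((cmod (?s w))\<^sup>2)) + in_chart c (\<lambda>q. complex_of_real (ln (H t q))) w) (snd c p)"
    using eq by (intro Wd_transform[OF U z jl(1)])
  also have "\<dots> = Dz j ?s (snd c p) / ?s (snd c p) + Dz j (in_chart c (\<lambda>q. complex_of_real (ln (H t q)))) (snd c p)"
    using Wd_add(2)[OF Ck_dj[OF U L(1) z jl(1)] Ck_dj[OF U lH z jl(1)]] L(2) by simp
  also have "Dz j (in_chart c (\<lambda>q. complex_of_real (ln (H t q)))) (snd c p) = Dz j (\<lambda>w. Ln (?H w)) (snd c p)"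
    using Hp by (intro Wd_transform[OF U z jl(1)]) (auto simp: in_chart_def Ln_of_real)
  also have "\<dots> = inverse (?H (snd c p)) * Dz j ?H (snd c p)"
    by (rule Wd_comp(2)[OF Ck_dj[OF U HC z jl(1)] has_field_derivative_Ln[OF pos[OF z]]])
  finally show "Dz j (in_chart c (\<lambda>q. complex_of_real (lsn q))) (snd c p) =
       Dz j ?s (snd c p) / snd t p + Dz j ?H (snd c p) / of_real (H t p)"
    by (simp add: in_chart_snd[OF c p(2)] divide_inverse mult.commute)
  have d: "dj l (\<lambda>w. complex_of_real (ln ((cmod (?s w))\<^sup>2))) w" "dj l (in_chart c (\<lambda>q. complex_of_real (ln (H t q)))) w"
    if "w \<in> chart_img c N" for w
    using Ck_dj[OF U L(1) that jl(2)] Ck_dj[OF U lH that jl(2)] by auto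
  have "Dz j (Dzb l (in_chart c (\<lambda>q. complex_of_real (lsn q)))) (snd c p) =
    Dz j (\<lambda>w. Dzb l (\<lambda>w. of_real (ln ((cmod (?s w))\<^sup>2))) w + Dzb l (in_chart c (\<lambda>q. complex_of_real (ln (H t q)))) w) (snd c p)"
  proof (intro Wd_transform[OF U z jl(1)])
    fix w assume w: "w \<in> chart_img c N"
    have "Dzb l (in_chart c (\<lambda>q. complex_of_real (lsn q))) w = Dzb l (\<lambda>w. of_real (ln ((cmod (?s w))\<^sup>2)) + in_chart c (\<lambda>q. complex_of_real (ln (H t q))) w) w"
      using eq by (intro Wd_transform[OF U w jl(2)])
    also have "\<dots> = Dzb l (\<lambda>w. of_real (ln ((cmod (?s w))\<^sup>2))) w + Dzb l (in_chart c (\<lambda>q. complex_of_real (ln (H t q)))) w"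
      by (rule Wd_add(2)[OF d[OF w]])
    finally show "Dzb l (in_chart c (\<lambda>q. complex_of_real (lsn q))) w = Dzb l (\<lambda>w. of_real (ln ((cmod (?s w))\<^sup>2))) w + Dzb l (in_chart c (\<lambda>q. complex_of_real (ln (H t q)))) w" .
  qed
  also have "\<dots> = Dz j (Dzb l (in_chart c (\<lambda>q. complex_of_real (ln (H t q))))) (snd c p)"
    using Wd_add(2)[OF Ck_dj[OF U Ck_Wd[OF U L(1) jl(2)] z jl(1)] Ck_dj[OF U Ck_Wd[OF U lH jl(2)] z jl(1)]] L(3) by simp
  finally show "Dz j (Dzb l (in_chart c (\<lambda>q. complex_of_real (lsn q)))) (snd c p) = Dz j (Dzb l (in_chart c (\<lambda>q. complex_of_real (ln (H t q))))) (snd c p)" .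
qed

end

section \<open>Limits and positivity of traces\<close>

lemma cof_dt:
  assumes "i < m" "j < m"
  shows "cof m A i j = (-1) ^ (i + j) * dt (m - 1) (\<lambda>a b. A (if a < i then a else Suc a) (if b < j then b else Suc b))"
  unfolding cof_def cofactor_def dt_def using assms
  by (intro arg_cong2[where f="(*)"] refl arg_cong[where f=Determinant.det] eq_matI)
     (auto simp: mt_def mat_delete_def)

lemma tendsto_dt:
  assumes "\<And>i j. i < n \<Longrightarrow> j < n \<Longrightarrow> ((\<lambda>z. A z i j) \<longlongrightarrow> B i j) F"
  shows "((\<lambda>z. dt n (A z)) \<longlongrightarrow> dt n B) F"
  unfolding dt_leibniz
  by (intro tendsto_intros assms) (auto simp: permutes_in_image[of _ "{..<n}", simplified])

lemma tendsto_ginv: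
  assumes A: "\<And>i j. i < m \<Longrightarrow> j < m \<Longrightarrow> ((\<lambda>z. A z i j) \<longlongrightarrow> B i j) F" and nz: "\<forall>\<^sub>F z in F. dt m (A z) \<noteq> 0" "dt m B \<noteq> 0"
    and ij: "i < m" "j < m"
  shows "((\<lambda>z. ginv m (A z) i j) \<longlongrightarrow> ginv m B i j) F"
proof -
  have "((\<lambda>z. cof m (A z) i j / dt m (A z)) \<longlongrightarrow> cof m B i j / dt m B) F"
    unfolding cof_dt[OF ij] by (intro tendsto_intros tendsto_dt A nz(2)) auto
  then have "((\<lambda>z. ginv m (A z) i j) \<longlongrightarrow> cof m B i j / dt m B) F"
    by (rule Lim_transform_eventually) (use nz(1) in eventually_elim, simp add: ginv_cof ij)
  then show ?thesis using nz(2) ij by (simp add: ginv_cof)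
qed

lemma tendsto_gtr:
  assumes "\<And>i j. i < m \<Longrightarrow> j < m \<Longrightarrow> ((\<lambda>z. A z i j) \<longlongrightarrow> B i j) F" "\<forall>\<^sub>F z in F. dt m (A z) \<noteq> 0" "dt m B \<noteq> 0"
    and "\<And>i j. i < m \<Longrightarrow> j < m \<Longrightarrow> ((\<lambda>z. x z i j) \<longlongrightarrow> y i j) F"
  shows "((\<lambda>z. gtr m (A z) (x z)) \<longlongrightarrow> gtr m B y) F"
  unfolding gtr_def by (intro tendsto_sum tendsto_mult tendsto_ginv assms) auto

lemma gtr_hermitian:
  assumes gh: "\<And>j k. j < m \<Longrightarrow> k < m \<Longrightarrow> g k j = cnj (g j k)"
    and gpos: "\<And>a. \<exists>j<m. a j \<noteq> 0 \<Longrightarrow> Re (bf m g a a) > 0"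
  obtains L where "\<And>x. gtr m g x = (\<Sum>i<m. pull m L x i i)"
proof -
  obtain L where "\<forall>i<m. \<forall>j<m. pull m L g i j = (if i = j then 1 else 0)"
    using simultaneous_diagonalization[of m g g] gh gpos by blast
  then show ?thesis using that gtr_orthonormal[of m L g] by blast
qed

context geo
begin

lemma gtr_nonneg:
  assumes c: "c \<in> atlas M" and p: "p \<in> fst c" and x: "\<And>a. Re (bf m x a a) \<ge> 0"
  shows "Re (gtr m (g c p) x) \<ge> 0"
proof -
  obtain L where "gtr m (g c p) x = (\<Sum>i<m. pull m L x i i)"
    using gtr_hermitian[OF g_herm[OF c p] g_pos[OF c p]] by blast
  then show ?thesis using x by (simp add: pull_bf sum_nonneg)
qed

lemma gtr_real:
  assumes c: "c \<in> atlas M" and p: "p \<in> fst c" and x: "\<And>j k. j < m \<Longrightarrow> k < m \<Longrightarrow> x k j = cnj (x j k)"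
  shows "gtr m (g c p) x \<in> \<real>"
proof -
  obtain L where L: "gtr m (g c p) x = (\<Sum>i<m. pull m L x i i)"
    using gtr_hermitian[OF g_herm[OF c p] g_pos[OF c p]] by blast
  have "pull m L x i i \<in> \<real>" for i
    using bf_herm[OF x, where x="\<lambda>a. L a i" and y="\<lambda>a. L a i"] by (simp add: pull_bf Reals_cnj_iff)
  then show ?thesis unfolding L by (intro sum_in_Reals)
qed

lemma pdbar_cnj:
  assumes c: "c \<in> atlas M" and p: "p \<in> fst c" "p \<in> N" and N: "openin X N" "N \<subseteq> I" and f: "cCk (Suc k) N f" and j: "j < m"
  shows "pdbar M c j (\<lambda>q. complex_of_real (f q)) p = cnj (pd M c j (\<lambda>q. complex_of_real (f q)) p)"
  unfolding pd_eq[OF c N p cCkD[OF f c] j]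
  by (rule Dzb_real[OF opn_img[OF c N] cCkD[OF f c] snd_img[OF p] j]) (simp add: in_chart_def)

text \<open>One matrix \<open>L\<close> serves all functions at once. Only then do the sums of
  squares for different functions obey the triangle inequality, as \<open>gq_add_le\<close>
  requires.\<close>

lemma gq_sq:
  assumes c: "c \<in> atlas M" and p: "p \<in> fst c" "p \<in> N" and N: "openin X N" "N \<subseteq> I"
  obtains L where "\<forall>f k. cCk (Suc k) N f \<longrightarrow> gq c p f = of_real (\<Sum>i<m. (cmod (\<Sum>a<m. pd M c a (\<lambda>q. complex_of_real (f q)) p * L a i))\<^sup>2)"
proof -
  obtain L where L: "\<And>x. gtr m (g c p) x = (\<Sum>i<m. pull m L x i i)"
    using gtr_hermitian[OF g_herm[OF c p(1)] g_pos[OF c p(1)]] by blast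
  have "gq c p f = of_real (\<Sum>i<m. (cmod (\<Sum>a<m. pd M c a (\<lambda>q. complex_of_real (f q)) p * L a i))\<^sup>2)" if f: "cCk (Suc k) N f" for f k
  proof -
    have "gq c p f = (\<Sum>i<m. (\<Sum>a<m. pd M c a (\<lambda>q. complex_of_real (f q)) p * L a i) * cnj (\<Sum>a<m. pd M c a (\<lambda>q. complex_of_real (f q)) p * L a i))"
      unfolding gq_def L pull_rank1 using pdbar_cnj[OF c p N f] by (intro sum.cong refl) simp
    then show ?thesis by (simp only: complex_norm_square[symmetric] of_real_sum)
  qed
  then show ?thesis using that[of L] by simp
qed

lemma gq_nonneg:
  assumes c: "c \<in> atlas M" and p: "p \<in> fst c" "p \<in> N" and N: "openin X N" "N \<subseteq> I" and f: "cCk (Suc k) N f"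
  shows "gq c p f \<in> \<real>" "Re (gq c p f) \<ge> 0"
proof -
  obtain L where L0: "\<forall>f k. cCk (Suc k) N f \<longrightarrow> gq c p f = of_real (\<Sum>i<m. (cmod (\<Sum>a<m. pd M c a (\<lambda>q. complex_of_real (f q)) p * L a i))\<^sup>2)"
    by (rule gq_sq[OF c p N])
  note L = L0[rule_format, OF f]
  show "gq c p f \<in> \<real>" unfolding L by (rule Reals_of_real)
  show "Re (gq c p f) \<ge> 0" unfolding L Re_complex_of_real by (intro sum_nonneg zero_le_power2)
qed

lemma cCk_lin:
  assumes "openin X N" "N \<subseteq> I" "cCk k N f1" "cCk k N f2"
  shows "cCk k N (\<lambda>q. f1 q + r * f2 q)"
  unfolding cCk_def
proof
  fix c assume c: "c \<in> atlas M"
  have "Ck k m (chart_img c N) (\<lambda>w. in_chart c (\<lambda>q. complex_of_real (f1 q)) w + complex_of_real r * in_chart c (\<lambda>q. complex_of_real (f2 q)) w)"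
    using assms c by (intro Ck_add Ck_cmult opn_img cCkD)
  then show "Ck k m (chart_img c N) (in_chart c (\<lambda>q. complex_of_real (f1 q + r * f2 q)))"
    by (simp add: in_chart_def)
qed

lemma pd_lin:
  assumes c: "c \<in> atlas M" and p: "p \<in> fst c" "p \<in> N" and N: "openin X N" "N \<subseteq> I" and f: "cCk (Suc k) N f1" "cCk (Suc k) N f2" and j: "j < m"
  shows "pd M c j (\<lambda>q. complex_of_real (f1 q + r * f2 q)) p =
     pd M c j (\<lambda>q. complex_of_real (f1 q)) p + of_real r * pd M c j (\<lambda>q. complex_of_real (f2 q)) p"
proof -
  note U = opn_img[OF c N] and z = snd_img[OF p]
  note d = Ck_dj[OF U cCkD[OF f(1) c] z j] Ck_dj[OF U cCkD[OF f(2) c] z j]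
  have "in_chart c (\<lambda>q. complex_of_real (f1 q + r * f2 q)) = (\<lambda>w. in_chart c (\<lambda>q. complex_of_real (f1 q)) w + complex_of_real r * in_chart c (\<lambda>q. complex_of_real (f2 q)) w)"
    by (simp add: in_chart_def)
  then show ?thesis
    using pd_eq(1)[OF c N p cCkD[OF cCk_lin[OF N f] c] j] pd_eq(1)[OF c N p cCkD[OF f(1) c] j] pd_eq(1)[OF c N p cCkD[OF f(2) c] j]
    by (simp add: Wd_add(2)[OF d(1) Wd_cmult(1)[OF d(2)]] Wd_cmult(2)[OF d(2)])
qed

lemma ddbar_lin:
  assumes c: "c \<in> atlas M" and p: "p \<in> fst c" "p \<in> N" and N: "openin X N" "N \<subseteq> I" and f: "cCk (Suc (Suc k)) N f1" "cCk (Suc (Suc k)) N f2" and j: "j < m" "l < m"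
  shows "ddbar M (\<lambda>q. f1 q + r * f2 q) c p j l = ddbar M f1 c p j l + of_real r * ddbar M f2 c p j l"
proof -
  note U = opn_img[OF c N] and z = snd_img[OF p]
  let ?f1 = "in_chart c (\<lambda>q. complex_of_real (f1 q))" and ?f2 = "in_chart c (\<lambda>q. complex_of_real (f2 q))"
  note C1 = cCkD[OF f(1) c] and C2 = cCkD[OF f(2) c]
  have eq: "in_chart c (\<lambda>q. complex_of_real (f1 q + r * f2 q)) = (\<lambda>w. ?f1 w + complex_of_real r * ?f2 w)"
    by (simp add: in_chart_def)
  have "Dz j (Dzb l (\<lambda>w. ?f1 w + complex_of_real r * ?f2 w)) (snd c p) = Dz j (\<lambda>w. Dzb l ?f1 w + complex_of_real r * Dzb l ?f2 w) (snd c p)"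
  proof (intro Wd_transform[OF U z j(1)])
    fix w assume w: "w \<in> chart_img c N"
    note d = Ck_dj[OF U C1 w j(2)] Ck_dj[OF U C2 w j(2)]
    show "Dzb l (\<lambda>w. ?f1 w + complex_of_real r * ?f2 w) w = Dzb l ?f1 w + complex_of_real r * Dzb l ?f2 w"
      by (simp add: Wd_add(2)[OF d(1) Wd_cmult(1)[OF d(2)]] Wd_cmult(2)[OF d(2)])
  qed
  also have "\<dots> = Dz j (Dzb l ?f1) (snd c p) + complex_of_real r * Dz j (Dzb l ?f2) (snd c p)"
  proof -
    note d = Ck_dj[OF U Ck_Wd[OF U C1 j(2)] z j(1)] Ck_dj[OF U Ck_Wd[OF U C2 j(2)] z j(1)]
    show ?thesis by (simp add: Wd_add(2)[OF d(1) Wd_cmult(1)[OF d(2)]] Wd_cmult(2)[OF d(2)])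
  qed
  finally show ?thesis
    unfolding ddbar_def pd_pdbar_eq[OF c N p cCkD[OF cCk_lin[OF N f] c] j] pd_pdbar_eq[OF c N p C1 j] pd_pdbar_eq[OF c N p C2 j] eq .
qed

lemma gq_add_le:
  assumes c: "c \<in> atlas M" and p: "p \<in> fst c" "p \<in> N" and N: "openin X N" "N \<subseteq> I" and f: "cCk (Suc k) N f1" "cCk (Suc k) N f2"
  shows "Re (gq c p (\<lambda>q. f1 q + r * f2 q)) \<le> 2 * Re (gq c p f1) + 2 * r\<^sup>2 * Re (gq c p f2)"
proof -
  obtain L where L0: "\<forall>f k. cCk (Suc k) N f \<longrightarrow> gq c p f = of_real (\<Sum>i<m. (cmod (\<Sum>a<m. pd M c a (\<lambda>q. complex_of_real (f q)) p * L a i))\<^sup>2)"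
    by (rule gq_sq[OF c p N])
  note L = L0[rule_format]
  let ?s = "\<lambda>f i. \<Sum>a<m. pd M c a (\<lambda>q. complex_of_real (f q)) p * L a i"
  have s: "?s (\<lambda>q. f1 q + r * f2 q) i = ?s f1 i + of_real r * ?s f2 i" for i
    using pd_lin[OF c p N f] by (simp add: sum.distrib sum_distrib_left algebra_simps)
  have sq: "(cmod (x + of_real r * y))\<^sup>2 \<le> 2 * (cmod x)\<^sup>2 + 2 * r\<^sup>2 * (cmod y)\<^sup>2" for x y
  proof -
    have "(cmod (x + of_real r * y))\<^sup>2 \<le> (cmod x + \<bar>r\<bar> * cmod y)\<^sup>2"
      by (intro power_mono order_trans[OF norm_triangle_ineq]) (auto simp: norm_mult)
    also have "\<dots> \<le> 2 * (cmod x)\<^sup>2 + 2 * (\<bar>r\<bar> * cmod y)\<^sup>2"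
      using sum_squares_bound[of "cmod x" "\<bar>r\<bar> * cmod y"] by (simp add: power2_sum)
    finally show ?thesis by (simp add: power_mult_distrib)
  qed
  have "(\<Sum>i<m. (cmod (?s (\<lambda>q. f1 q + r * f2 q) i))\<^sup>2) \<le> (\<Sum>i<m. 2 * (cmod (?s f1 i))\<^sup>2 + 2 * r\<^sup>2 * (cmod (?s f2 i))\<^sup>2)"
    unfolding s by (intro sum_mono sq)
  then show ?thesis
    unfolding L[OF cCk_lin[OF N f]] L[OF f(1)] L[OF f(2)] Re_complex_of_real by (simp add: sum.distrib sum_distrib_left)
qed

lemma lsn_cCk: "t \<in> E \<Longrightarrow> N = fst t \<inter> D \<Longrightarrow> cCk k N lsn"
  unfolding cCk_def
proof
  fix c assume t: "t \<in> E" and N: "N = fst t \<inter> D" and c: "c \<in> atlas M"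
  show "Ck k m (chart_img c N) (in_chart c (\<lambda>q. complex_of_real (lsn q)))"
  proof (cases "fst c \<inter> N = {}")
    case True
    then have e: "chart_img c N = {}" by (simp add: chart_img_def)
    have "openin X N" unfolding N by (intro openin_Int E_local(1)[OF t] openin_D)
    then show ?thesis
      using Ck_cong[OF _ Ck_const[of m "chart_img c N" k 0], of "in_chart c (\<lambda>q. complex_of_real (lsn q))"] e by simp
  next
    case False
    then show ?thesis using lsn_local(1)[OF t c N] m1 by fastforce
  qed
qed

text \<open>The pluriharmonic part of \<open>lsn\<close> drops out, which replaces the logarithm of
  the metric in the trivialization chosen at \<open>p\<close> by one global function.\<close>

lemma g_dd:
  assumes c: "c \<in> atlas M" and p: "p \<in> fst c" "p \<in> D" and j: "j < m" "l < m"
  shows "g c p j l = \<Omega> c p j l + of_real \<epsilon> * ddbar M lsn c p j l"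
proof -
  define t where "t = triv_at E p"
  have t: "t \<in> E" "p \<in> fst t" using triv[of p] I_sub p by (auto simp: t_def)
  define N where "N = fst t \<inter> D"
  have pN: "p \<in> N" using p t by (simp add: N_def)
  have N: "openin X N" "N \<subseteq> I"
    unfolding N_def by (intro openin_Int E_local(1)[OF t(1)] openin_D) auto
  note U = opn_img[OF c N] and z = snd_img[OF p(1) pN]
  note L = lsn_local[OF t(1) c N_def pN p(1) j]
  let ?u = "in_chart c (\<lambda>q. complex_of_real (ln (H t q powr \<epsilon>)))" and ?l = "in_chart c (\<lambda>q. complex_of_real (ln (H t q)))"
  have eq: "?u w = of_real \<epsilon> * ?l w" if "w \<in> chart_img c N" for w
    using E_local(4)[OF t(1)] iv_img[OF c that] by (simp add: in_chart_def ln_powr N_def)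
  have uC: "Ck k m (chart_img c N) ?u" for k
    by (rule Ck_cong[OF _ Ck_cmult[OF U L(4)]]) (use eq in auto)
  have "ddbar M (\<lambda>q. ln (H t q powr \<epsilon>)) c p j l = Dz j (Dzb l ?u) (snd c p)"
    unfolding ddbar_def by (rule pd_pdbar_eq[OF c N p(1) pN uC j])
  also have "\<dots> = Dz j (\<lambda>w. of_real \<epsilon> * Dzb l ?l w) (snd c p)"
  proof (intro Wd_transform[OF U z j(1)])
    fix w assume w: "w \<in> chart_img c N"
    have "Dzb l ?u w = Dzb l (\<lambda>w. of_real \<epsilon> * ?l w) w" using eq by (intro Wd_transform[OF U w j(2)])
    then show "Dzb l ?u w = of_real \<epsilon> * Dzb l ?l w" using Wd_cmult(2)[OF Ck_dj[OF U L(4) w j(2)]] by simp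
  qed
  also have "\<dots> = of_real \<epsilon> * Dz j (Dzb l ?l) (snd c p)"
    by (rule Wd_cmult(2)[OF Ck_dj[OF U Ck_Wd[OF U L(4) j(2)] z j(1)]])
  also have "Dz j (Dzb l ?l) (snd c p) = ddbar M lsn c p j l"
    unfolding ddbar_def L(3)[symmetric] by (rule pd_pdbar_eq[OF c N p(1) pN L(1) j, symmetric])
  finally show ?thesis by (simp add: g_eq form_add_def ddbar_log_metric_def t_def)
qed

subsection \<open>Limits and bounds\<close>

lemma tendsto_iv:
  fixes f :: "'a \<Rightarrow> 'b::topological_space"
  assumes "c \<in> atlas M" "p \<in> fst c" "continuous_on (S c) (in_chart c f)" "F \<le> inf (nhds (snd c p)) (principal (S c))"
  shows "((\<lambda>z. f (iv c z)) \<longlongrightarrow> f p) F"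
proof -
  have "(in_chart c f \<longlongrightarrow> in_chart c f (snd c p)) (inf (nhds (snd c p)) (principal (S c)))"
    using assms by (intro tendsto_within_open) auto
  then show ?thesis using filterlim_mono[OF _ order_refl assms(4)] in_chart_snd[OF assms(1,2), of f] by (simp add: in_chart_def)
qed

lemma tendsto_gtr_chart:
  assumes c: "c \<in> atlas M" and p: "p \<in> fst c" and F: "F \<le> inf (nhds (snd c p)) (principal (S c))"
    and x: "\<And>i j. i < m \<Longrightarrow> j < m \<Longrightarrow> ((\<lambda>z. x z i j) \<longlongrightarrow> y i j) F"
  shows "((\<lambda>z. gtr m (g c (iv c z)) (x z)) \<longlongrightarrow> gtr m (g c p) y) F"
proof (rule tendsto_gtr)
  show "((\<lambda>z. g c (iv c z) i j) \<longlongrightarrow> g c p i j) F" if "i < m" "j < m" for i j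
    using tendsto_iv[OF c p Ck_continuous[OF g_smooth[OF c that]] F] .
  have "\<forall>\<^sub>F z in inf (nhds (snd c p)) (principal (S c)). dt m (g c (iv c z)) \<noteq> 0"
    unfolding eventually_inf_principal using g_dt[OF c] iv_S[OF c] by (auto intro: always_eventually)
  then show "\<forall>\<^sub>F z in F. dt m (g c (iv c z)) \<noteq> 0" using F by (rule filter_leD[rotated])
qed (use x g_dt[OF c p] in auto)

abbreviation "nbI c p \<equiv> inner_nhds m (S c) (snd c p)"

lemma nbI_le: "nbI c p \<le> inf (nhds (snd c p)) (principal (S c))"
  unfolding inner_nhds_def using Cint_open(2)[of m "S c"] by (intro inf_mono) auto

lemma nbI_nbhd:
  assumes c: "c \<in> atlas M" and p: "p \<in> fst c" and ev: "\<forall>\<^sub>F z in nbI c p. P (iv c z)"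
  shows "\<exists>U. openin X U \<and> p \<in> U \<and> U \<subseteq> fst c \<and> (\<forall>q\<in>U \<inter> I. P q)"
proof -
  have "\<forall>\<^sub>F z in inf (nhds (snd c p)) (principal (chart_img c (fst c))). z \<in> Cint m (S c) \<longrightarrow> P (iv c z)"
    using ev unfolding inner_nhds_def eventually_inf_principal by (auto elim: eventually_mono)
  from chart_nbhd[OF c p p chart(1)[OF c] this] obtain U where U: "openin X U" "p \<in> U" "U \<subseteq> fst c"
    "\<forall>q\<in>U. snd c q \<in> Cint m (S c) \<longrightarrow> P (iv c (snd c q))" by (elim exE conjE)
  have "P q" if q: "q \<in> U \<inter> I" for q
  proof -
    have "q \<in> fst c" using q U(3) by blast
    then show ?thesis using U(4) q interior_chart[OF c \<open>q \<in> fst c\<close>] iv_snd[OF c \<open>q \<in> fst c\<close>] by auto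
  qed
  then show ?thesis using U by blast
qed

lemma ev_nbI: "c \<in> atlas M \<Longrightarrow> \<forall>\<^sub>F z in nbI c p. z \<in> Cint m (S c) \<and> iv c z \<in> fst c \<and> snd c (iv c z) = z"
  using iv_S Cint_open(2) unfolding inner_nhds_def eventually_inf_principal by (intro always_eventually) blast

lemma Ck_on_S: "Ck_on k M (pts M) f \<Longrightarrow> c \<in> atlas M \<Longrightarrow> Ck k m (S c) (in_chart c (\<lambda>q. complex_of_real (f q)))"
proof -
  assume *: "Ck_on k M (pts M) f" "c \<in> atlas M"
  have "chart_img c (pts M) = S c" using chart_sub[OF *(2)] unfolding chart_img_def by (simp add: Int_absorb2)
  then have "Ck k m (S c) (in_chart c f)" using * unfolding Ck_on_def by metis
  from Ck_of_real[OF this] show ?thesis by (simp add: in_chart_def)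
qed

text \<open>Derivatives at the boundary are by definition limits of interior ones. Through this the
  boundary bounds of the theorem control the solution at nearby interior points.\<close>

lemma tendsto_pd:
  assumes f: "Ck_on (Suc k) M (pts M) f" and c: "c \<in> atlas M" and p: "p \<in> fst c" and j: "j < m"
  shows "((\<lambda>z. pd M c j (\<lambda>q. complex_of_real (f q)) (iv c z)) \<longlongrightarrow> pd M c j (\<lambda>q. complex_of_real (f q)) p) (nbI c p)"
    and "((\<lambda>z. pdbar M c j (\<lambda>q. complex_of_real (f q)) (iv c z)) \<longlongrightarrow> pdbar M c j (\<lambda>q. complex_of_real (f q)) p) (nbI c p)"
proof -
  have z: "snd c p \<in> S c" using p by auto
  note D = dz_tendsto[OF Ck_on_S[OF f c] j]
  show "((\<lambda>z. pd M c j (\<lambda>q. complex_of_real (f q)) (iv c z)) \<longlongrightarrow> pd M c j (\<lambda>q. complex_of_real (f q)) p) (nbI c p)"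
    unfolding pd_def
  proof (rule Lim_transform_eventually[OF D(1)[OF z]])
    show "\<forall>\<^sub>F w in nbI c p. Dz j (in_chart c (\<lambda>q. complex_of_real (f q))) w = dz m (S c) j (in_chart c (\<lambda>q. complex_of_real (f q))) (snd c (iv c w))"
      using ev_nbI[OF c, of p]
    proof eventually_elim
      case (elim w)
      have "w \<in> S c" by (rule subsetD[OF Cint_open(2) conjunct1[OF elim]])
      from D(3)[OF this conjunct1[OF elim]] show ?case using elim by simp
    qed
  qed
  show "((\<lambda>z. pdbar M c j (\<lambda>q. complex_of_real (f q)) (iv c z)) \<longlongrightarrow> pdbar M c j (\<lambda>q. complex_of_real (f q)) p) (nbI c p)"
    unfolding pdbar_def
  proof (rule Lim_transform_eventually[OF D(2)[OF z]])
    show "\<forall>\<^sub>F w in nbI c p. Dzb j (in_chart c (\<lambda>q. complex_of_real (f q))) w = dzbar m (S c) j (in_chart c (\<lambda>q. complex_of_real (f q))) (snd c (iv c w))"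
      using ev_nbI[OF c, of p]
    proof eventually_elim
      case (elim w)
      have "w \<in> S c" by (rule subsetD[OF Cint_open(2) conjunct1[OF elim]])
      from D(4)[OF this conjunct1[OF elim]] show ?case using elim by simp
    qed
  qed
qed

lemma tendsto_ddbar:
  assumes f: "Ck_on (Suc (Suc k)) M (pts M) f" and c: "c \<in> atlas M" and p: "p \<in> fst c" and j: "j < m" "l < m"
  shows "((\<lambda>z. ddbar M f c (iv c z) j l) \<longlongrightarrow> ddbar M f c p j l) (nbI c p)"
proof -
  let ?f = "\<lambda>q. complex_of_real (f q)"
  have q: "in_chart c (pdbar M c l ?f) w = dzbar m (S c) l (in_chart c ?f) w" if "w \<in> S c" for w
    using iv_S[OF c that] by (simp add: in_chart_def pdbar_def)
  have z: "snd c p \<in> S c" using p by auto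
  have D1: "((\<lambda>w. Dz j (Dzb l (in_chart c ?f)) w) \<longlongrightarrow> dz m (S c) j (in_chart c (pdbar M c l ?f)) (snd c p)) (nbI c p)"
    by (rule dz_dzbar_tendsto(1)[OF Ck_on_S[OF f c] j z q])
  have D2: "dz m (S c) j (in_chart c (pdbar M c l ?f)) w = Dz j (Dzb l (in_chart c ?f)) w" if "w \<in> Cint m (S c)" for w
    by (rule dz_dzbar_tendsto(2)[OF Ck_on_S[OF f c] j subsetD[OF Cint_open(2) that] q that])
  show ?thesis
    unfolding ddbar_def pd_def
  proof (rule Lim_transform_eventually[OF D1])
    show "\<forall>\<^sub>F w in nbI c p. Dz j (Dzb l (in_chart c ?f)) w = dz m (S c) j (in_chart c (pdbar M c l ?f)) (snd c (iv c w))"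
      using ev_nbI[OF c, of p]
    proof eventually_elim
      case (elim w)
      from D2[OF conjunct1[OF elim]] show ?case using elim by simp
    qed
  qed
qed

lemma tendsto_gq:
  assumes f: "Ck_on (Suc k) M (pts M) f" and c: "c \<in> atlas M" and p: "p \<in> fst c"
  shows "((\<lambda>z. gq c (iv c z) f) \<longlongrightarrow> gq c p f) (nbI c p)"
  unfolding gq_def by (intro tendsto_gtr_chart[OF c p nbI_le] tendsto_mult tendsto_pd[OF f c p])

section \<open>Compactness and the maximum principle\<close>

lemma compact_bound:
  assumes "\<And>p. p \<in> pts M \<Longrightarrow> \<exists>U K. openin X U \<and> p \<in> U \<and> (\<forall>q\<in>U \<inter> A. f q \<le> (K::real))"
  shows "\<exists>K\<ge>0. \<forall>q\<in>A \<inter> pts M. f q \<le> K"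
proof -
  obtain U K where UK: "\<And>p. p \<in> pts M \<Longrightarrow> openin X (U p) \<and> p \<in> U p \<and> (\<forall>q\<in>U p \<inter> A. f q \<le> K p)"
    using assms by metis
  have "compactin X (pts M)" using compact by (simp add: compact_space_def)
  moreover have "pts M \<subseteq> \<Union> (U ` pts M)" using UK by blast
  ultimately obtain \<F> where F: "finite \<F>" "\<F> \<subseteq> U ` pts M" "pts M \<subseteq> \<Union> \<F>"
    using UK unfolding compactin_def by (smt (verit, best) imageE)
  then obtain P where P: "finite P" "P \<subseteq> pts M" "\<F> = U ` P" by (meson finite_subset_image)
  define B where "B = Max (insert 0 (K ` P))"
  have "f q \<le> B" if q: "q \<in> A \<inter> pts M" for q
  proof -
    obtain p where p: "p \<in> P" "q \<in> U p" using F(3) P(3) q by blast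
    then have "f q \<le> K p" using UK P(2) q by blast
    also have "K p \<le> B" unfolding B_def using P(1) p by (intro Max_ge) auto
    finally show ?thesis .
  qed
  moreover have "B \<ge> 0" unfolding B_def using P(1) by (intro Max_ge) auto
  ultimately show ?thesis by blast
qed

lemma tendsto_bound_nbhd:
  assumes c: "c \<in> atlas M" and p: "p \<in> fst c" and lim: "((\<lambda>z. f (iv c z)) \<longlongrightarrow> l) (nbI c p)" and e: "(l::real) < K"
  shows "\<exists>U. openin X U \<and> p \<in> U \<and> U \<subseteq> fst c \<and> (\<forall>q\<in>U \<inter> I. f q < K)"
  by (rule nbI_nbhd[OF c p order_tendstoD(2)[OF lim e]])

text \<open>\<open>A\<close> need not be closed: around points of \<open>M\<close> outside
  \<open>A\<close> it suffices that \<open>G\<close> exceeds \<open>K\<close> by arbitrarily little.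
  If the supremum \<open>s\<close> were above \<open>K\<close> and not attained,
  \<open>1 / (s - G)\<close> would be bounded near every point, hence bounded by compactness, which
  contradicts the choice of \<open>s\<close>.\<close>

lemma max_principle:
  fixes G :: "'a \<Rightarrow> real"
  assumes A: "A \<subseteq> pts M"
    and local: "\<And>p. p \<in> pts M \<Longrightarrow>
      (\<forall>e>0. \<exists>U. openin X U \<and> p \<in> U \<and> (\<forall>q\<in>U \<inter> A. G q \<le> K + e)) \<or>
      (p \<in> A \<and> (\<forall>e>0. \<exists>U. openin X U \<and> p \<in> U \<and> (\<forall>q\<in>U \<inter> A. G q \<le> G p + e)) \<and> ((\<forall>q\<in>A. G q \<le> G p) \<longrightarrow> G p \<le> K))"
    and z: "z \<in> A"
  shows "G z \<le> K"
proof (rule ccontr)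
  assume "\<not> G z \<le> K"
  then have Gz: "G z > K" by simp
  have "\<exists>B\<ge>0. \<forall>q\<in>A \<inter> pts M. G q \<le> B"
  proof (rule compact_bound)
    fix p assume "p \<in> pts M"
    from local[OF this] show "\<exists>U K. openin X U \<and> p \<in> U \<and> (\<forall>q\<in>U \<inter> A. G q \<le> K)"
    proof (elim disjE conjE)
      assume *: "\<forall>e>0. \<exists>U. openin X U \<and> p \<in> U \<and> (\<forall>q\<in>U \<inter> A. G q \<le> K + e)"
      obtain U where "openin X U" "p \<in> U" "\<forall>q\<in>U \<inter> A. G q \<le> K + 1"
        using *[rule_format, of 1] by auto
      then show ?thesis by blast
    next
      assume *: "\<forall>e>0. \<exists>U. openin X U \<and> p \<in> U \<and> (\<forall>q\<in>U \<inter> A. G q \<le> G p + e)"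
      obtain U where "openin X U" "p \<in> U" "\<forall>q\<in>U \<inter> A. G q \<le> G p + 1"
        using *[rule_format, of 1] by auto
      then show ?thesis by blast
    qed
  qed
  then obtain B where B: "\<And>q. q \<in> A \<Longrightarrow> G q \<le> B" using A by blast
  define s where "s = Sup (G ` A)"
  have bdd: "bdd_above (G ` A)" by (rule bdd_aboveI2[OF B])
  have le: "G q \<le> s" if "q \<in> A" for q unfolding s_def using that bdd by (auto intro: cSup_upper)
  have sK: "s > K" using le[OF z] Gz by simp
  have no: "\<not> (\<forall>p\<in>pts M. \<exists>U K'. openin X U \<and> p \<in> U \<and> (\<forall>q\<in>U \<inter> A. 1 / (s - G q) \<le> K' \<and> G q < s))"
  proof
    assume *: "\<forall>p\<in>pts M. \<exists>U K'. openin X U \<and> p \<in> U \<and> (\<forall>q\<in>U \<inter> A. 1 / (s - G q) \<le> K' \<and> G q < s)"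
    have "\<exists>K\<ge>0. \<forall>q\<in>A \<inter> pts M. 1 / (s - G q) \<le> K"
    proof (rule compact_bound)
      fix p assume "p \<in> pts M"
      from *[rule_format, OF this] obtain U K' where
        "openin X U" "p \<in> U" "\<And>q. q \<in> U \<inter> A \<Longrightarrow> 1 / (s - G q) \<le> K'"
        by fast
      then show "\<exists>U K. openin X U \<and> p \<in> U \<and> (\<forall>q\<in>U \<inter> A. 1 / (s - G q) \<le> K)" by fast
    qed
    then obtain L where L: "L \<ge> 0" "\<And>q. q \<in> A \<Longrightarrow> 1 / (s - G q) \<le> L" using A by blast
    have lt: "G q < s" if "q \<in> A" for q using * A that by blast
    \<comment> \<open>\<open>L + 1\<close> rather than \<open>L\<close>, since only
      \<open>L \<ge> 0\<close> is known and a positive divisor is wanted.\<close>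
    have "G q \<le> s - 1 / (L + 1)" if "q \<in> A" for q
    proof -
      have "1 / (s - G q) \<le> L + 1" using L(2)[OF that] by simp
      then show ?thesis using lt[OF that] L(1) by (simp add: field_simps)
    qed
    then have "s \<le> s - 1 / (L + 1)" unfolding s_def using z by (intro cSup_least) (auto simp: s_def)
    then show False using L(1) by simp
  qed
  have sep: "\<exists>U K'. openin X U \<and> p \<in> U \<and> (\<forall>q\<in>U \<inter> A. 1 / (s - G q) \<le> K' \<and> G q < s)"
    if r: "r < s" and U: "\<forall>e>0. \<exists>U. openin X U \<and> p \<in> U \<and> (\<forall>q\<in>U \<inter> A. G q \<le> r + e)" for p r
  proof -
    obtain U where U: "openin X U" "p \<in> U" "\<forall>q\<in>U \<inter> A. G q \<le> r + (s - r) / 2" using U r by (meson diff_gt_0_iff_gt half_gt_zero)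
    have "1 / (s - G q) \<le> 1 / ((s - r) / 2) \<and> G q < s" if "q \<in> U \<inter> A" for q
    proof -
      have "G q \<le> r + (s - r) / 2" using U(3) that by blast
      then have "s - G q \<ge> (s - r) / 2" by (simp add: field_simps)
      then show ?thesis using r by (intro conjI divide_left_mono mult_pos_pos) auto
    qed
    then show ?thesis using U by blast
  qed
  from no obtain p where p: "p \<in> pts M" "\<not> (\<exists>U K'. openin X U \<and> p \<in> U \<and> (\<forall>q\<in>U \<inter> A. 1 / (s - G q) \<le> K' \<and> G q < s))" by blast
  from local[OF p(1)] show False
  proof (elim disjE conjE)
    assume "\<forall>e>0. \<exists>U. openin X U \<and> p \<in> U \<and> (\<forall>q\<in>U \<inter> A. G q \<le> K + e)"
    then show False using sep[OF sK] p(2) by blast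
  next
    assume pA: "p \<in> A" and usc: "\<forall>e>0. \<exists>U. openin X U \<and> p \<in> U \<and> (\<forall>q\<in>U \<inter> A. G q \<le> G p + e)"
      and mx: "(\<forall>q\<in>A. G q \<le> G p) \<longrightarrow> G p \<le> K"
    have "\<not> G p < s" using sep[OF _ usc] p(2) by blast
    then have "\<forall>q\<in>A. G q \<le> G p" "G p \<ge> s" using le by force+
    then show False using mx sK by auto
  qed
qed

end

subsection \<open>Solutions of the Dirichlet problem\<close>

lemma bf_pull: "bf m (pull m A g) a a = bf m g (\<lambda>c. \<Sum>j<m. A c j * a j) (\<lambda>c. \<Sum>j<m. A c j * a j)"
proof -
  have "bf m (pull m A g) a a = (\<Sum>j<m. \<Sum>k<m. \<Sum>c<m. \<Sum>d<m. g c d * (A c j * a j) * cnj (A d k * a k))"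
    unfolding bf_def pull_def by (simp add: sum_distrib_right sum_distrib_left ac_simps)
  also have "\<dots> = (\<Sum>c<m. \<Sum>d<m. \<Sum>j<m. \<Sum>k<m. g c d * (A c j * a j) * cnj (A d k * a k))"
    unfolding sum.cartesian_product
    by (rule sum.reindex_bij_witness[of _ "\<lambda>(i,j,k,l). (k,l,i,j)" "\<lambda>(k,l,i,j). (i,j,k,l)"]) auto
  also have "\<dots> = bf m g (\<lambda>c. \<Sum>j<m. A c j * a j) (\<lambda>c. \<Sum>j<m. A c j * a j)"
    unfolding bf_def by (intro sum.cong refl, subst sum.swap) (simp add: sum_distrib_left sum_distrib_right mult.assoc)
  finally show ?thesis .
qed

lemma bf_orthonormal:
  assumes "\<And>i j. i < m \<Longrightarrow> j < m \<Longrightarrow> pull m L g i j = (if i = j then 1 else 0)"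
  shows "bf m g (\<lambda>c. \<Sum>j<m. L c j * a j) (\<lambda>c. \<Sum>j<m. L c j * a j) = of_real (\<Sum>k<m. (cmod (a k))\<^sup>2)"
proof -
  have "bf m (pull m L g) a a = (\<Sum>j<m. \<Sum>k<m. (if j = k then 1 else 0) * (a j * cnj (a k)))"
    unfolding bf_def using assms by (intro sum.cong refl) (simp add: mult.assoc)
  also have "\<dots> = (\<Sum>j<m. a j * cnj (a j))"
    by (intro sum.cong refl) (simp only: sum_delta_mult lessThan_iff)
  finally show ?thesis unfolding bf_pull by (simp add: complex_norm_square[symmetric])
qed

context geo
begin

lemma curvature_eq:
  assumes c: "c \<in> atlas M" and p: "p \<in> fst c" "p \<in> I" and i: "i < m" "j < m" "k < m" "l < m"
  shows "curvature M g c p i j k l = curv m (\<lambda>z. g c (iv c z)) (snd c p) i j k l"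
proof -
  have C: "Ck (Suc (Suc 0)) m (chart_img c I) (in_chart c (\<lambda>q. g c q a b))" if "a < m" "b < m" for a b
    using kdata.gC[OF kdata_chart[OF c openin_I subset_refl] that] by (simp add: in_chart_def)
  note e1 = pd_eq[OF c openin_I subset_refl p C] and e2 = pd_pdbar_eq[OF c openin_I subset_refl p C]
  show ?thesis
    unfolding curvature_def curv_def e2[OF i(3,4,1,2)] iv_snd[OF c p(1)]
    using i by (intro arg_cong2[where f="(+)"] sum.cong refl) (auto simp: e1 in_chart_def)
qed

text \<open>In normal coordinates the Laplacian at the point is the sum of the terms
  \<open>Dz j (Dzb j u)\<close>, and each of them is nonpositive by the second derivative
  test.\<close>

lemma lap_max:
  assumes c: "c \<in> atlas M" and p: "p \<in> fst c" "p \<in> N" and N: "openin X N" "N \<subseteq> I" and u: "cCk (Suc (Suc k)) N u"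
    and max: "\<And>q. q \<in> N \<Longrightarrow> u q \<le> u p"
  shows "Re (gtr m (g c p) (ddbar M u c p)) \<le> 0"
proof -
  let ?u = "in_chart c (\<lambda>q. complex_of_real (u q))"
  note uC = cCkD[OF u c]
  interpret kdata m "chart_img c N" "\<lambda>z. g c (iv c z)" by (rule kdata_chart[OF c N])
  have z: "snd c p \<in> chart_img c N" by (rule snd_img[OF p])
  obtain W T L where n: "hmap m W (chart_img c N) T" "(\<lambda>_. 0) \<in> W" "T (\<lambda>_. 0) = snd c p"
    "\<And>a j. a < m \<Longrightarrow> j < m \<Longrightarrow> Dz j (\<lambda>w. T w a) (\<lambda>_. 0) = L a j"
    "\<And>i j. i < m \<Longrightarrow> j < m \<Longrightarrow> pull m L (g c (iv c (snd c p))) i j = (if i = j then 1 else 0)"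
    apply (rule normal_coordinates[OF z, where ?h0.0="g c p"])
     apply (rule g_herm[OF c p(1)]; assumption)
    subgoal premises prems for W T L lam
      by (rule prems(1)[of W T L]) (fact prems)+
    done
  interpret hmap m W "chart_img c N" T by (rule n(1))
  have "Re (Dz j (Dzb j (\<lambda>w. ?u (T w))) (\<lambda>_. 0)) \<le> 0" if j: "j < m" for j
  proof (rule max_derivatives(2)[OF W Ck_pull[OF uC] n(2) j])
    show "?u (T w) \<in> \<real>" for w by (simp add: in_chart_def)
    show "Re (?u (T w)) \<le> Re (?u (T (\<lambda>_. 0)))" if "w \<in> W" for w
      using max iv_img[OF c T[OF that]] by (simp add: n(3) in_chart_def iv_snd[OF c p(1)])
  qed
  moreover have "Dz j (Dzb j (\<lambda>w. ?u (T w))) (\<lambda>_. 0) = pull m L (ddbar M u c p) j j" if j: "j < m" for j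
    unfolding ddb_pull[OF uC n(2) j j] pull_def
    using j n(4) pd_pdbar_eq[OF c N p uC] by (intro sum.cong refl) (simp add: J_def n(3) ddbar_def)
  moreover have "gtr m (g c p) (ddbar M u c p) = (\<Sum>i<m. pull m L (ddbar M u c p) i i)"
    using n(5) by (intro gtr_orthonormal) (simp add: iv_snd[OF c p(1)])
  ultimately show ?thesis by (auto intro!: sum_nonpos)
qed

end

locale sol = geo M \<Omega> g E \<epsilon> H for M :: "'a mfd" and \<Omega> g E \<epsilon> H +
  fixes F \<phi>b \<Phi> :: "'a \<Rightarrow> real"
  assumes sol: "dirichlet_solution M \<Omega> g F \<phi>b \<Phi>" and F: "smooth_on M (pts M) F" and Fpos: "\<And>p. p \<in> pts M \<Longrightarrow> F p > 0"
begin

definition hf :: "'a form11" where "hf = form_add \<Omega> (ddbar M \<Phi>)"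

definition phi :: "'a \<Rightarrow> real" where "phi q = \<Phi> q + (- \<epsilon>) * lsn q"

lemma \<Phi>2: "Ck_on (Suc (Suc 0)) M (pts M) \<Phi>"
  using sol unfolding dirichlet_solution_def by (simp add: numeral_2_eq_2)

lemma \<Phi>4: "Ck_on (Suc (Suc (Suc (Suc 0)))) M I \<Phi>"
proof -
  have "Ck_on 4 M I \<Phi>" using sol unfolding dirichlet_solution_def by blast
  moreover have "(4::nat) = Suc (Suc (Suc (Suc 0)))" by simp
  ultimately show ?thesis by simp
qed

lemma hf_pos: "c \<in> atlas M \<Longrightarrow> p \<in> fst c \<Longrightarrow> Re (bf m (hf c p) a a) \<ge> 0"
  using sol unfolding dirichlet_solution_def nonneg_form11_def sqn_bf hf_def by blast

lemma hf_det: "c \<in> atlas M \<Longrightarrow> p \<in> fst c \<Longrightarrow> dt m (hf c p) = of_real (F p) * dt m (g c p)"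
proof -
  assume "c \<in> atlas M" "p \<in> fst c"
  then have "wedge_power_coeff m (hf c p) = of_real (F p) * wedge_power_coeff m (g c p)"
    using sol unfolding dirichlet_solution_def hf_def by blast
  then show ?thesis by (simp add: wedge_power_coeff_dt)
qed

lemma lnF_cCk: "openin X N \<Longrightarrow> N \<subseteq> I \<Longrightarrow> cCk k N (\<lambda>q. ln (F q))"
  unfolding cCk_def
proof
  fix c assume N: "openin X N" "N \<subseteq> I" and c: "c \<in> atlas M"
  have "cCk k N F" using F cCk_on[OF _ N, of k "pts M" F] N I_sub unfolding smooth_on_def by blast
  note FC = cCkD[OF this c]
  have Fp: "F (iv c w) > 0" if "w \<in> chart_img c N" for w
    using iv_img[OF c that] Fpos N(2) I_sub by blast
  have open': "open (- \<real>\<^sub>\<le>\<^sub>0 :: complex set)" by (simp add: closed_nonpos_Reals_complex open_Compl)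
  have X: "Ck k m (chart_img c N) (\<lambda>w. Ln (in_chart c (\<lambda>q. complex_of_real (F q)) w))"
    using Fp by (intro Ck_comp[OF opn_img[OF c N] open' FC]) (auto simp: in_chart_def intro!: holomorphic_on_Ln dest: Fp)
  show "Ck k m (chart_img c N) (in_chart c (\<lambda>q. complex_of_real (ln (F q))))"
    by (rule Ck_cong[OF _ X]) (use Fp in \<open>auto simp: in_chart_def Ln_of_real\<close>)
qed

lemma \<Phi>_cCk: "openin X N \<Longrightarrow> N \<subseteq> I \<Longrightarrow> cCk (Suc (Suc (Suc (Suc 0)))) N \<Phi>"
  using cCk_on[OF \<Phi>4] by blast

lemma phi_cCk: "t \<in> E \<Longrightarrow> N = fst t \<inter> D \<Longrightarrow> openin X N \<Longrightarrow> cCk (Suc (Suc (Suc (Suc 0)))) N phi"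
  unfolding phi_def[abs_def] by (intro cCk_lin \<Phi>_cCk lsn_cCk) auto

lemma hf_phi:
  assumes c: "c \<in> atlas M" and p: "p \<in> fst c" "p \<in> D" and j: "j < m" "l < m"
  shows "hf c p j l = g c p j l + ddbar M phi c p j l"
proof -
  define t where "t = triv_at E p"
  have t: "t \<in> E" "p \<in> fst t" using triv[of p] I_sub p by (auto simp: t_def)
  define N where "N = fst t \<inter> D"
  have N: "openin X N" "N \<subseteq> I" unfolding N_def by (intro openin_Int E_local(1)[OF t(1)] openin_D) auto
  have "ddbar M phi c p j l = ddbar M \<Phi> c p j l + of_real (- \<epsilon>) * ddbar M lsn c p j l"
    unfolding phi_def[abs_def] using p t
    by (intro ddbar_lin[OF c p(1) _ N \<Phi>_cCk[OF N] lsn_cCk[OF t(1) N_def] j]) (simp add: N_def)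
  then show ?thesis using g_dd[OF c p j] by (simp add: hf_def form_add_def)
qed

text \<open>The bridge from the manifold to the coordinate calculus: normal coordinates at
  \<open>p\<close> that also diagonalize \<open>hf\<close>, together with the identification of the
  local quantities of \<open>ndata\<close> with their global counterparts and the transfer of the
  curvature bounds to the frame \<open>L\<close>.\<close>

lemma local_solution:
  assumes c: "c \<in> atlas M" and t: "t \<in> E" and N: "N = fst t \<inter> D" and p: "p \<in> fst c" "p \<in> N"
  obtains W gt \<phi> f lam h T where "ndata m W gt \<phi> f lam h"
    "\<And>w. w \<in> W \<Longrightarrow> T w \<in> N \<and> T w \<in> fst c" "T (\<lambda>_. 0) = p"
    "\<And>w. w \<in> W \<Longrightarrow> \<phi> w = of_real (phi (T w))"
    "\<And>w. w \<in> W \<Longrightarrow> f w = of_real (ln (F (T w)))"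
    "\<And>w. w \<in> W \<Longrightarrow> ndata.\<beta> m gt \<phi> w = gq c (T w) phi"
    "\<And>w. w \<in> W \<Longrightarrow> ndata.tr m gt h w = gtr m (g c (T w)) (hf c (T w))"
    "(\<Sum>j<m. (cmod (Dz j f (\<lambda>_. 0)))\<^sup>2) = Re (gq c p (\<lambda>q. ln (F q)))"
    "(\<Sum>j<m. Dz j (Dzb j f) (\<lambda>_. 0)) = gtr m (g c p) (ddbar M (\<lambda>q. ln (F q)) c p)"
    "\<And>B a b. bisectional_ge M g (- B) \<Longrightarrow> a < m \<Longrightarrow> Re (\<Sum>k<m. \<Sum>l<m. ndata0.Rm gt a k l * b k * cnj (b l)) \<ge> - B * (\<Sum>k<m. (cmod (b k))\<^sup>2)"
    "(\<Sum>a<m. \<Sum>j<m. ndata0.Rm gt a j j) = (\<Sum>i<m. \<Sum>j<m. \<Sum>k<m. \<Sum>l<m. ginv m (g c p) i j * ginv m (g c p) k l * curvature M g c p i j k l)"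
proof -
  have No: "openin X N" "N \<subseteq> I" unfolding N by (intro openin_Int E_local(1)[OF t] openin_D) auto
  have ND: "N \<subseteq> D" by (auto simp: N)
  let ?p = "in_chart c (\<lambda>q. complex_of_real (phi q))" and ?f = "in_chart c (\<lambda>q. complex_of_real (ln (F q)))"
  note pC = cCkD[OF phi_cCk[OF t N No(1)] c] and fC' = cCkD[OF lnF_cCk[OF No] c]
  note UN = opn_img[OF c No]
  interpret K: kdata m "chart_img c N" "\<lambda>z. g c (iv c z)" by (rule kdata_chart[OF c No])
  have z: "snd c p \<in> chart_img c N" by (rule snd_img[OF p])
  have ivp: "iv c (snd c p) = p" by (simp add: iv_snd[OF c p(1)])
  have dd: "ddbar M phi c (iv c w) j l = Dz j (Dzb l ?p) w" if "w \<in> chart_img c N" "j < m" "l < m" for w j l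
    using pd_pdbar_eq[OF c No _ _ pC that(2,3), of "iv c w"] iv_img[OF c that(1)] by (simp add: ddbar_def)
  have hfw: "hf c (iv c w) j l = g c (iv c w) j l + Dz j (Dzb l ?p) w" if "w \<in> chart_img c N" "j < m" "l < m" for w j l
    using hf_phi[OF c _ _ that(2,3), of "iv c w"] iv_img[OF c that(1)] ND dd[OF that] by auto
  have h0: "hf c p k j = cnj (hf c p j k)" if "j < m" "k < m" for j k
  proof -
    have "Dz k (Dzb j ?p) (snd c p) = cnj (Dz j (Dzb k ?p) (snd c p))"
      by (rule ddb_real[OF UN pC z that]) (simp add: in_chart_def)
    then show ?thesis using hfw[OF z] that g_herm[OF c p(1) that] by (simp add: ivp)
  qed
  obtain W T L lam where n: "hmap m W (chart_img c N) T" "(\<lambda>_. 0) \<in> W" "T (\<lambda>_. 0) = snd c p"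
    "\<And>a j. a < m \<Longrightarrow> j < m \<Longrightarrow> Dz j (\<lambda>w. T w a) (\<lambda>_. 0) = L a j"
    "kdata m W (\<lambda>w. pull m (\<lambda>a j. Dz j (\<lambda>w. T w a) w) (g c (iv c (T w))))"
    "\<And>i j. i < m \<Longrightarrow> j < m \<Longrightarrow> pull m L (g c (iv c (snd c p))) i j = (if i = j then 1 else 0)"
    "\<And>i j. i < m \<Longrightarrow> j < m \<Longrightarrow> pull m L (hf c p) i j = (if i = j then complex_of_real (lam i) else 0)"
    "\<And>j k l. j < m \<Longrightarrow> k < m \<Longrightarrow> l < m \<Longrightarrow> Dz l (\<lambda>w. pull m (\<lambda>a j. Dz j (\<lambda>w. T w a) w) (g c (iv c (T w))) j k) (\<lambda>_. 0) = 0"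
    "\<And>p' q k' l'. p' < m \<Longrightarrow> q < m \<Longrightarrow> k' < m \<Longrightarrow> l' < m \<Longrightarrow>
       - Dz p' (Dzb q (\<lambda>w. pull m (\<lambda>a j. Dz j (\<lambda>w. T w a) w) (g c (iv c (T w))) k' l')) (\<lambda>_. 0) =
       (\<Sum>i<m. \<Sum>j<m. \<Sum>k<m. \<Sum>l<m. curv m (\<lambda>z. g c (iv c z)) (snd c p) i j k l * L i p' * cnj (L j q) * L k k' * cnj (L l l'))"
    apply (rule K.normal_coordinates[OF z, where ?h0.0="hf c p"])
     apply (rule h0; assumption)
    subgoal premises prems for W T L lam
      by (rule prems(1)[of W T L lam]) (fact prems)+
    done
  interpret hmap m W "chart_img c N" T by (rule n(1))
  define gt where "gt = (\<lambda>w. pull m (\<lambda>a j. J a j w) (g c (iv c (T w))))"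
  have gtn: "gt = (\<lambda>w. pull m (\<lambda>a j. Dz j (\<lambda>w. T w a) w) (g c (iv c (T w))))" by (simp add: gt_def J_def)
  note n' = n(5)[folded gtn]
  interpret gt: kdata m W gt unfolding gtn by (rule n(5))
  define \<phi> where "\<phi> = (\<lambda>w. ?p (T w))"
  define f where "f = (\<lambda>w. ?f (T w))"
  define h where "h = (\<lambda>w j k. gt w j k + Dz j (Dzb k \<phi>) w)"
  have J0: "J a j (\<lambda>_. 0) = L a j" if "a < m" "j < m" for a j using n(4)[OF that] by (simp add: J_def)
  have gt0: "gt (\<lambda>_. 0) i j = (if i = j then 1 else 0)" if "i < m" "j < m" for i j
  proof -
    have "gt (\<lambda>_. 0) i j = pull m L (g c (iv c (snd c p))) i j"
      unfolding gt_def pull_def n(3) using that J0 by (intro sum.cong refl) simp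
    then show ?thesis using n(6)[OF that] by simp
  qed
  have hw: "h w j k = pull m (\<lambda>a j. J a j w) (hf c (iv c (T w))) j k" if w: "w \<in> W" and jk: "j < m" "k < m" for w j k
    unfolding h_def gt_def \<phi>_def ddb_pull[OF pC w jk] pull_def sum.distrib[symmetric]
    using hfw[OF T[OF w]] by (intro sum.cong refl) (simp add: algebra_simps)
  have hh0: "h (\<lambda>_. 0) j k = (if j = k then of_real (lam j) else 0)" if "j < m" "k < m" for j k
  proof -
    have "h (\<lambda>_. 0) j k = pull m L (hf c p) j k"
      unfolding hw[OF n(2) that] pull_def n(3) ivp using that J0 by (intro sum.cong refl) simp
    then show ?thesis using n(7)[OF that] by simp
  qed
  have ivT: "iv c (T w) \<in> fst c" "iv c (T w) \<in> N" if "w \<in> W" for w using iv_img[OF c T[OF that]] by auto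
  have Fp: "F (iv c (T w)) > 0" if "w \<in> W" for w using ivT(2)[OF that] No(2) I_sub Fpos by blast
  have dth: "dt m (h w) = exp (f w) * dt m (gt w)" if w: "w \<in> W" for w
  proof -
    have "dt m (h w) = dt m (pull m (\<lambda>a j. J a j w) (hf c (iv c (T w))))" by (intro dt_cong hw[OF w])
    moreover have "exp (f w) = of_real (F (iv c (T w)))"
      using Fp[OF w] by (simp add: f_def in_chart_def exp_of_real)
    ultimately show ?thesis unfolding gt_def dt_pull hf_det[OF c ivT(1)[OF w]] by simp
  qed
  \<comment> \<open>Semidefiniteness gives only \<open>lam j \<ge> 0\<close>; the equation with
    \<open>F > 0\<close> makes the determinant nonzero.\<close>
  have lam: "lam j > 0" if j: "j < m" for j
  proof -
    have "lam j \<ge> 0"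
      using hf_pos[OF c p(1), of "\<lambda>a. L a j"] n(7)[OF j j] by (simp add: pull_bf)
    moreover have "dt m (h (\<lambda>_. 0)) \<noteq> 0" using dth[OF n(2)] gt.dt_nz[OF n(2)] by simp
    then have "(\<Prod>i<m. lam i) \<noteq> 0"
      using dt_cong[of m "h (\<lambda>_. 0)" "\<lambda>i j. if i = j then of_real (lam i) else 0"] hh0 by (simp add: dt_diag)
    then have "lam j \<noteq> 0" using j by (metis finite_lessThan lessThan_iff prod_zero)
    ultimately show ?thesis by simp
  qed
  have nd: "ndata m W gt \<phi> f lam h"
  proof
    show "(\<lambda>_. 0) \<in> W" by (rule n(2))
    show "\<And>j k. j < m \<Longrightarrow> k < m \<Longrightarrow> gt (\<lambda>_. 0) j k = (if j = k then 1 else 0)" by (rule gt0)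
    show "\<And>j k l. j < m \<Longrightarrow> k < m \<Longrightarrow> l < m \<Longrightarrow> Dz l (\<lambda>w. gt w j k) (\<lambda>_. 0) = 0" unfolding gtn by (rule n(8))
    show "Ck (Suc (Suc (Suc (Suc 0)))) m W \<phi>" unfolding \<phi>_def by (rule Ck_pull[OF pC])
    show "Ck (Suc (Suc 0)) m W f" unfolding f_def by (rule Ck_pull[OF fC'])
    show "\<And>w. w \<in> W \<Longrightarrow> \<phi> w \<in> \<real>" "\<And>w. w \<in> W \<Longrightarrow> f w \<in> \<real>" by (simp_all add: \<phi>_def f_def in_chart_def)
    show "\<And>w j k. h w j k = gt w j k + Dz j (Dzb k \<phi>) w" by (simp add: h_def)
    show "\<And>j k. j < m \<Longrightarrow> k < m \<Longrightarrow> h (\<lambda>_. 0) j k = (if j = k then complex_of_real (lam j) else 0)" by (rule hh0)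
    show "\<And>j. j < m \<Longrightarrow> lam j > 0" by (rule lam)
    show "\<And>w. w \<in> W \<Longrightarrow> dt m (h w) = exp (f w) * dt m (gt w)" by (rule dth)
  qed
  interpret nd: ndata m W gt \<phi> f lam h by (rule nd)
  have pdp: "pd M c j (\<lambda>q. complex_of_real (phi q)) (iv c w) = Dz j ?p w" "pdbar M c j (\<lambda>q. complex_of_real (phi q)) (iv c w) = Dzb j ?p w"
    if "w \<in> chart_img c N" "j < m" for w j
    using pd_eq[OF c No _ _ pC that(2), of "iv c w"] iv_img[OF c that(1)] by simp_all
  have \<beta>: "nd.\<beta> w = gq c (iv c (T w)) phi" if w: "w \<in> W" for w
  proof -
    have "nd.\<beta> w = gtr m (gt w) (pull m (\<lambda>a j. J a j w) (\<lambda>j k. pd M c j (\<lambda>q. complex_of_real (phi q)) (iv c (T w)) * pdbar M c k (\<lambda>q. complex_of_real (phi q)) (iv c (T w))))"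
      unfolding nd.\<beta>_def
    proof (intro gtr_cong refl)
      fix j k assume jk: "j < m" "k < m"
      show "Dz j \<phi> w * Dzb k \<phi> w = pull m (\<lambda>a j. J a j w) (\<lambda>j k. pd M c j (\<lambda>q. complex_of_real (phi q)) (iv c (T w)) * pdbar M c k (\<lambda>q. complex_of_real (phi q)) (iv c (T w))) j k"
        unfolding \<phi>_def Dz_pull[OF pC w jk(1)] Dz_pull[OF pC w jk(2)] pull_rank1
        by (simp add: pdp[OF T[OF w]])
    qed
    also have "\<dots> = gq c (iv c (T w)) phi"
      unfolding gq_def gt_def using gt.dt_nz[OF w] by (intro gtr_pull) (simp add: gt_def)
    finally show ?thesis .
  qed
  have tr: "nd.tr w = gtr m (g c (iv c (T w))) (hf c (iv c (T w)))" if w: "w \<in> W" for w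
  proof -
    have "nd.tr w = gtr m (gt w) (pull m (\<lambda>a j. J a j w) (hf c (iv c (T w))))"
      unfolding nd.tr_def by (intro gtr_cong refl hw[OF w])
    also have "\<dots> = gtr m (g c (iv c (T w))) (hf c (iv c (T w)))"
      unfolding gt_def using gt.dt_nz[OF w] by (intro gtr_pull) (simp add: gt_def)
    finally show ?thesis .
  qed
  have Lo: "pull m L (g c p) i j = (if i = j then 1 else 0)" if "i < m" "j < m" for i j
    using n(6)[OF that] by (simp add: ivp)
  have gto: "gtr m (g c p) x = (\<Sum>i<m. pull m L x i i)" for x by (rule gtr_orthonormal) (rule Lo)
  have gio: "ginv m (g c p) i j = (\<Sum>a<m. L i a * cnj (L j a))" if "i < m" "j < m" for i j
    by (rule ginv_orthonormal[OF _ that]) (rule Lo)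
  have bfo: "bf m (g c p) (\<lambda>c. \<Sum>j<m. L c j * a j) (\<lambda>c. \<Sum>j<m. L c j * a j) = of_real (\<Sum>k<m. (cmod (a k))\<^sup>2)" for a
    by (rule bf_orthonormal) (rule Lo)
  have Df: "Dz j f (\<lambda>_. 0) = (\<Sum>a<m. pd M c a (\<lambda>q. complex_of_real (ln (F q))) p * L a j)" if j: "j < m" for j
    unfolding f_def Dz_pull(1)[OF fC' n(2) j] n(3)
    using j J0 pd_eq(1)[OF c No p fC'] by (intro sum.cong refl) simp
  have gqf: "(\<Sum>j<m. (cmod (Dz j f (\<lambda>_. 0)))\<^sup>2) = Re (gq c p (\<lambda>q. ln (F q)))"
  proof -
    have "gq c p (\<lambda>q. ln (F q)) = (\<Sum>i<m. Dz i f (\<lambda>_. 0) * cnj (Dz i f (\<lambda>_. 0)))"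
      unfolding gq_def gto pull_rank1
      using Df pdbar_cnj[OF c p No lnF_cCk[OF No]] by (intro sum.cong refl) simp
    then show ?thesis by (simp only: complex_norm_square[symmetric] of_real_sum[symmetric] Re_complex_of_real)
  qed
  have lapf: "(\<Sum>j<m. Dz j (Dzb j f) (\<lambda>_. 0)) = gtr m (g c p) (ddbar M (\<lambda>q. ln (F q)) c p)"
    unfolding gto
  proof (rule sum.cong)
    fix j assume "j \<in> {..<m}"
    then have j: "j < m" by simp
    show "Dz j (Dzb j f) (\<lambda>_. 0) = pull m L (ddbar M (\<lambda>q. ln (F q)) c p) j j"
      unfolding f_def ddb_pull[OF fC' n(2) j j] pull_def n(3)
      using j J0 pd_pdbar_eq[OF c No p fC'] by (intro sum.cong refl) (simp add: ddbar_def)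
  qed simp
  have pI: "p \<in> I" using p(2) No(2) by blast
  have Rm: "nd.Rm a k' l' = (\<Sum>i<m. \<Sum>j<m. \<Sum>k<m. \<Sum>l<m. curvature M g c p i j k l * L i a * cnj (L j a) * L k k' * cnj (L l l'))"
    if "a < m" "k' < m" "l' < m" for a k' l'
    unfolding nd.Rm_def unfolding gtn n(9)[OF that(1,1,2,3)] using curvature_eq[OF c p(1) pI] by (intro sum.cong refl) simp
  \<comment> \<open>The bisectional bound is applied to column \<open>a\<close> of \<open>L\<close>,
    a unit vector, and to the vector whose components in the frame \<open>L\<close> are
    \<open>b\<close>.\<close>
  have bis: "Re (\<Sum>k<m. \<Sum>l<m. nd.Rm a k l * b k * cnj (b l)) \<ge> - B * (\<Sum>k<m. (cmod (b k))\<^sup>2)"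
    if B: "bisectional_ge M g (- B)" and a: "a < m" for B a b
  proof -
    let ?x = "\<lambda>i. \<Sum>k<m. L i k * b k"
    have "(\<Sum>k'<m. \<Sum>l'<m. nd.Rm a k' l' * b k' * cnj (b l')) =
      (\<Sum>k'<m. \<Sum>l'<m. \<Sum>i<m. \<Sum>j<m. \<Sum>k<m. \<Sum>l<m. curvature M g c p i j k l * L i a * cnj (L j a) * L k k' * cnj (L l l') * b k' * cnj (b l'))"
      using a Rm by (simp add: sum_distrib_right)
    also have "\<dots> = (\<Sum>i<m. \<Sum>j<m. \<Sum>k<m. \<Sum>l<m. \<Sum>k'<m. \<Sum>l'<m. curvature M g c p i j k l * L i a * cnj (L j a) * L k k' * cnj (L l l') * b k' * cnj (b l'))"
      unfolding sum.cartesian_product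
      by (rule sum.reindex_bij_witness[of _ "\<lambda>(i,j,k,l,k',l'). (k',l',i,j,k,l)" "\<lambda>(k',l',i,j,k,l). (i,j,k,l,k',l')"]) auto
    also have "\<dots> = (\<Sum>i<m. \<Sum>j<m. \<Sum>k<m. \<Sum>l<m. curvature M g c p i j k l * L i a * cnj (L j a) * ?x k * cnj (?x l))"
    proof (intro sum.cong refl)
      fix i j k l
      have "(?x k) * cnj (?x l) = (\<Sum>k'<m. \<Sum>l'<m. L k k' * b k' * cnj (L l l' * b l'))"
        unfolding cnj_sum sum_product ..
      then show "(\<Sum>k'<m. \<Sum>l'<m. curvature M g c p i j k l * L i a * cnj (L j a) * L k k' * cnj (L l l') * b k' * cnj (b l')) =
        curvature M g c p i j k l * L i a * cnj (L j a) * ?x k * cnj (?x l)"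
        unfolding mult.assoc[of _ "?x k" "cnj (?x l)"] by (simp only: sum_distrib_left) (intro sum.cong refl, simp add: ac_simps)
    qed
    finally have eq: "(\<Sum>k'<m. \<Sum>l'<m. nd.Rm a k' l' * b k' * cnj (b l')) = \<dots>" .
    have "Re (\<Sum>i<m. \<Sum>j<m. \<Sum>k<m. \<Sum>l<m. curvature M g c p i j k l * L i a * cnj (L j a) * ?x k * cnj (?x l))
      \<ge> - B * sqn m (g c p) (\<lambda>i. L i a) * sqn m (g c p) ?x"
      using B[unfolded bisectional_ge_def, rule_format, OF c p(1), of "\<lambda>i. L i a" ?x] .
    moreover have "sqn m (g c p) (\<lambda>i. L i a) = 1" using Lo[OF a a] by (simp add: sqn_bf pull_bf)
    moreover have "sqn m (g c p) ?x = (\<Sum>k<m. (cmod (b k))\<^sup>2)" unfolding sqn_bf bfo by simp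
    ultimately show ?thesis unfolding eq by simp
  qed
  have scal: "(\<Sum>a<m. \<Sum>j<m. nd.Rm a j j) = (\<Sum>i<m. \<Sum>j<m. \<Sum>k<m. \<Sum>l<m. ginv m (g c p) i j * ginv m (g c p) k l * curvature M g c p i j k l)"
  proof -
    have "(\<Sum>a<m. \<Sum>b<m. nd.Rm a b b) = (\<Sum>a<m. \<Sum>b<m. \<Sum>i<m. \<Sum>j<m. \<Sum>k<m. \<Sum>l<m. curvature M g c p i j k l * L i a * cnj (L j a) * L k b * cnj (L l b))"
      using Rm by simp
    also have "\<dots> = (\<Sum>i<m. \<Sum>j<m. \<Sum>k<m. \<Sum>l<m. \<Sum>a<m. \<Sum>b<m. curvature M g c p i j k l * L i a * cnj (L j a) * L k b * cnj (L l b))"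
      unfolding sum.cartesian_product
      by (rule sum.reindex_bij_witness[of _ "\<lambda>(i,j,k,l,k',l'). (k',l',i,j,k,l)" "\<lambda>(k',l',i,j,k,l). (i,j,k,l,k',l')"]) auto
    also have "\<dots> = (\<Sum>i<m. \<Sum>j<m. \<Sum>k<m. \<Sum>l<m. ginv m (g c p) i j * ginv m (g c p) k l * curvature M g c p i j k l)"
    proof (intro sum.cong refl)
      fix i j k l assume "i \<in> {..<m}" "j \<in> {..<m}" "k \<in> {..<m}" "l \<in> {..<m}"
      then have ijkl: "i < m" "j < m" "k < m" "l < m" by auto
      have "ginv m (g c p) i j * ginv m (g c p) k l = (\<Sum>a<m. \<Sum>b<m. L i a * cnj (L j a) * (L k b * cnj (L l b)))"
        unfolding gio[OF ijkl(1,2)] gio[OF ijkl(3,4)] sum_product ..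
      then show "(\<Sum>a<m. \<Sum>b<m. curvature M g c p i j k l * L i a * cnj (L j a) * L k b * cnj (L l b)) = ginv m (g c p) i j * ginv m (g c p) k l * curvature M g c p i j k l"
        by (simp only: sum_distrib_right) (intro sum.cong refl, simp add: ac_simps)
    qed
    finally show ?thesis .
  qed
  show ?thesis
    by (rule that[of W gt \<phi> f lam h "\<lambda>w. iv c (T w)"])
       (use nd ivT n(3) ivp \<beta> tr gqf lapf bis scal in \<open>auto simp: \<phi>_def f_def in_chart_def\<close>)
qed

end

section \<open>Semicontinuity, and bounds near the divisor\<close>

lemma gtr_add: "gtr m g (\<lambda>j k. x j k + y j k) = gtr m g x + gtr m g y"
  by (simp add: gtr_def ring_distribs sum.distrib)

lemma gtr_cmult: "gtr m g (\<lambda>j k. c * x j k) = c * gtr m g x"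
  by (simp add: gtr_def sum_distrib_left ac_simps)

lemma pull_add: "pull m A (\<lambda>j k. x j k + y j k) i l = pull m A x i l + pull m A y i l"
  by (simp add: pull_def ring_distribs sum.distrib)

lemma add_mult_eps:
  fixes a b e :: real
  assumes "a \<ge> 0" "b \<ge> 0" "e > 0"
  obtains d where "d > 0" "(a + d) * (b + d) \<le> a * b + e"
proof -
  define d where "d = min 1 (e / (a + b + 1))"
  have d: "d > 0" "d \<le> 1" "d \<le> e / (a + b + 1)" using assms by (simp_all add: d_def)
  have "d * (a + b + d) \<le> (e / (a + b + 1)) * (a + b + 1)"
    using assms d by (intro mult_mono) auto
  also have "\<dots> = e" using assms by simp
  finally show ?thesis using that[of d] d(1) by (simp add: algebra_simps)
qed

context geo
begin

text \<open>Upper semicontinuity passes to products when the factors are nonnegative; the test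
  functions of both estimates have this form.\<close>

lemma nbhd_mult:
  assumes f: "\<forall>e>0. \<exists>U. openin X U \<and> p \<in> U \<and> (\<forall>q\<in>U \<inter> A. f q \<le> f p + e)" "\<forall>q\<in>A. f q \<ge> 0"
    and h: "\<forall>e>0. \<exists>U. openin X U \<and> p \<in> U \<and> (\<forall>q\<in>U \<inter> A. h q \<le> h p + e)" "\<forall>q\<in>A. h q \<ge> 0" and p: "p \<in> A"
  shows "\<forall>e>0. \<exists>U. openin X U \<and> p \<in> U \<and> (\<forall>q\<in>U \<inter> A. f q * h q \<le> f p * h p + (e::real))"
proof (intro allI impI)
  fix e :: real assume e: "e > 0"
  obtain d where d: "d > 0" "(f p + d) * (h p + d) \<le> f p * h p + e"
    using add_mult_eps[of "f p" "h p" e] f(2) h(2) p e by blast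
  obtain U where U: "openin X U" "p \<in> U" "\<forall>q\<in>U \<inter> A. f q \<le> f p + d" using f(1) d(1) by blast
  obtain V where V: "openin X V" "p \<in> V" "\<forall>q\<in>V \<inter> A. h q \<le> h p + d" using h(1) d(1) by blast
  have "f q * h q \<le> f p * h p + e" if "q \<in> (U \<inter> V) \<inter> A" for q
  proof -
    have "f q * h q \<le> (f p + d) * (h p + d)"
    proof (rule mult_mono)
      show "f q \<le> f p + d" "h q \<le> h p + d" using that U(3) V(3) by blast+
      show "0 \<le> h q" using that h(2) by blast
      show "0 \<le> f p + d" using f(2) p d(1) by fastforce
    qed
    then show ?thesis using d(2) by simp
  qed
  then show "\<exists>U. openin X U \<and> p \<in> U \<and> (\<forall>q\<in>U \<inter> A. f q * h q \<le> f p * h p + e)"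
    using openin_Int[OF U(1) V(1)] U(2) V(2) by blast
qed

lemma \<Omega>_tendsto:
  assumes c: "c \<in> atlas M" and p: "p \<in> fst c" and F: "F \<le> inf (nhds (snd c p)) (principal (S c))" and j: "j < m" "k < m"
  shows "((\<lambda>z. \<Omega> c (iv c z) j k) \<longlongrightarrow> \<Omega> c p j k) F"
proof (rule tendsto_iv[OF c p _ F])
  show "continuous_on (S c) (in_chart c (\<lambda>q. \<Omega> c q j k))"
    using \<Omega>(2) c j Ck_continuous unfolding smooth_form11_def Csmooth_def by blast
qed

lemma chart_limit_nbhd:
  fixes f :: "'a \<Rightarrow> real"
  assumes c: "c \<in> atlas M" and p: "p \<in> fst c" "p \<in> N" and N: "openin X N"
    and lim: "((\<lambda>z. f (iv c z)) \<longlongrightarrow> l) (inf (nhds (snd c p)) (principal (chart_img c N)))" and K: "l < K"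
  shows "\<exists>U. openin X U \<and> p \<in> U \<and> U \<subseteq> N \<and> U \<subseteq> fst c \<and> (\<forall>q\<in>U. f q < K)"
proof -
  obtain U where U: "openin X U" "p \<in> U" "U \<subseteq> N" "U \<subseteq> fst c" "\<forall>q\<in>U. f (iv c (snd c q)) < K"
    using chart_nbhd[OF c p N order_tendstoD(2)[OF lim K]] by blast
  have "f q < K" if "q \<in> U" for q
  proof -
    have "q \<in> fst c" using that U(4) by blast
    from iv_snd[OF c this] show ?thesis using U(5) that by auto
  qed
  then show ?thesis using U by blast
qed

lemma chart_img_fst: "chart_img c (fst c) = S c"
  by (simp add: chart_img_def)

text \<open>The bound depends on the form and the metric alone, not on the solution, so it may enter
  the constant \<open>C2\<close>.\<close>

lemma tr_\<Omega>_bound: "\<exists>C\<ge>0. \<forall>p\<in>pts M. Re (gtr m (g (chart_at M p) p) (\<Omega> (chart_at M p) p)) \<le> C"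
proof -
  let ?f = "\<lambda>p. Re (gtr m (g (chart_at M p) p) (\<Omega> (chart_at M p) p))"
  have inv: "?f q = Re (gtr m (g c q) (\<Omega> c q))" if c: "c \<in> atlas M" "q \<in> fst c" for c q
  proof -
    have d: "chart_at M q \<in> atlas M" "q \<in> fst (chart_at M q)" using chart_at[of q] chart_sub[OF c(1)] c(2) by auto
    show ?thesis
      by (intro arg_cong[where f=Re] gtr_invariant[OF d(1) c(1) d(2) c(2)] real_form_pull[OF \<Omega>(1) d(1) c(1) d(2) c(2)])
  qed
  have "\<exists>K\<ge>0. \<forall>q\<in>pts M \<inter> pts M. ?f q \<le> K"
  proof (rule compact_bound)
    fix p assume p: "p \<in> pts M"
    define c where "c = chart_at M p"
    have c: "c \<in> atlas M" "p \<in> fst c" using chart_at[OF p] by (auto simp: c_def)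
    have "((\<lambda>z. Re (gtr m (g c (iv c z)) (\<Omega> c (iv c z)))) \<longlongrightarrow> Re (gtr m (g c p) (\<Omega> c p))) (inf (nhds (snd c p)) (principal (chart_img c (fst c))))"
      unfolding chart_img_fst by (intro tendsto_Re tendsto_gtr_chart[OF c] \<Omega>_tendsto[OF c] order_refl)
    from chart_limit_nbhd[OF c c(2) chart(1)[OF c(1)] this, of "Re (gtr m (g c p) (\<Omega> c p)) + 1"]
    obtain U where U: "openin X U" "p \<in> U" "U \<subseteq> fst c" "\<forall>q\<in>U. Re (gtr m (g c q) (\<Omega> c q)) < Re (gtr m (g c p) (\<Omega> c p)) + 1"
      by auto
    have "?f q \<le> Re (gtr m (g c p) (\<Omega> c p)) + 1" if "q \<in> U" for q
      using inv[OF c(1), of q] U(3,4) that by fastforce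
    then show "\<exists>U K. openin X U \<and> p \<in> U \<and> (\<forall>q\<in>U \<inter> pts M. ?f q \<le> K)" using U by blast
  qed
  then show ?thesis by simp
qed

lemma cCk_continuous:
  assumes f: "cCk k N f" and N: "openin X N" "N \<subseteq> I" and p: "p \<in> N" and e: "e > 0"
  shows "\<exists>U. openin X U \<and> p \<in> U \<and> (\<forall>q\<in>U. \<bar>f q - f p\<bar> < e)"
proof -
  obtain c where c: "c \<in> atlas M" "p \<in> fst c" using chart_exists[of p] p N(2) I_sub by blast
  from continuous_nbhd[OF c p N(1) Ck_continuous[OF cCkD[OF f c(1)]] e]
  show ?thesis by (auto simp: dist_norm norm_of_real simp flip: of_real_diff)
qed

lemma gq_continuous:
  assumes f: "cCk (Suc k) N f" and N: "openin X N" "N \<subseteq> I" and p: "p \<in> N" and e: "e > 0"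
  shows "\<exists>U. openin X U \<and> p \<in> U \<and> (\<forall>q\<in>U. Re (gq (chart_at M q) q f) < Re (gq (chart_at M p) p f) + e)"
proof -
  define c where "c = chart_at M p"
  have c: "c \<in> atlas M" "p \<in> fst c" using chart_at[of p] p N(2) I_sub by (auto simp: c_def)
  let ?F = "inf (nhds (snd c p)) (principal (chart_img c N))" and ?f = "in_chart c (\<lambda>q. complex_of_real (f q))"
  have F: "?F \<le> inf (nhds (snd c p)) (principal (S c))" by (intro inf_mono) (auto simp: chart_img_def)
  have "((\<lambda>z. Wd s j ?f z) \<longlongrightarrow> Wd s j ?f (snd c p)) ?F" if "j < m" for s j
    by (rule tendsto_within_open[OF Ck_continuous[OF Ck_Wd[OF opn_img[OF c(1) N] cCkD[OF f c(1)] that]] snd_img[OF c(2) p]])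
  then have "((\<lambda>z. Re (gtr m (g c (iv c z)) (\<lambda>j k. Dz j ?f z * Dzb k ?f z))) \<longlongrightarrow> Re (gtr m (g c p) (\<lambda>j k. Dz j ?f (snd c p) * Dzb k ?f (snd c p)))) ?F"
    by (intro tendsto_Re tendsto_gtr_chart[OF c F] tendsto_mult)
  moreover have eq: "gq c q f = gtr m (g c q) (\<lambda>j k. Dz j ?f (snd c q) * Dzb k ?f (snd c q))" if "q \<in> fst c" "q \<in> N" for q
    unfolding gq_def by (intro gtr_cong refl) (simp add: pd_eq[OF c(1) N that cCkD[OF f c(1)]])
  ultimately have "((\<lambda>z. Re (gq c (iv c z) f)) \<longlongrightarrow> Re (gq c p f)) ?F"
    unfolding eq[OF c(2) p]
    by (elim Lim_transform_eventually) (auto simp: eventually_inf_principal eq iv_img[OF c(1)])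
  from chart_limit_nbhd[OF c p N(1) this, of "Re (gq c p f) + e"] e
  obtain U where U: "openin X U" "p \<in> U" "U \<subseteq> N" "U \<subseteq> fst c" "\<forall>q\<in>U. Re (gq c q f) < Re (gq c p f) + e" by auto
  have "gq (chart_at M q) q f = gq c q f" if "q \<in> U" for q
  proof -
    have q: "q \<in> N" "q \<in> fst c" using that U by auto
    then have "chart_at M q \<in> atlas M \<and> q \<in> fst (chart_at M q)" using chart_at N(2) I_sub by blast
    then show ?thesis using gq_invariant[OF _ c(1) _ q(2,1) N f] by blast
  qed
  then have "\<forall>q\<in>U. Re (gq (chart_at M q) q f) < Re (gq c p f) + e" using U(5) by simp
  then show ?thesis using U(1,2) unfolding c_def by blast
qed

text \<open>Near the divisor the gradient of \<open>lsn\<close> blows up, but \<open>s\<close> times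
  its derivative is \<open>Ds + s DH / H\<close>, which stays bounded, and \<open>|s|^2 H\<close> is
  the squared norm of the section. Boundary points are covered because these derivatives have limits
  there.\<close>

lemma gq_lsn_bound: "\<exists>KL\<ge>0. \<forall>q\<in>D. Re (gq (chart_at M q) q lsn) * (sn q)\<^sup>2 \<le> KL"
proof -
  have "\<exists>K\<ge>0. \<forall>q\<in>D \<inter> pts M. Re (gq (chart_at M q) q lsn) * (sn q)\<^sup>2 \<le> K"
  proof (rule compact_bound)
    fix p assume p: "p \<in> pts M"
    define t where "t = triv_at E p"
    have t: "t \<in> E" "p \<in> fst t" using triv[OF p] by (auto simp: t_def)
    obtain c where c: "c \<in> atlas M" "p \<in> fst c" using chart_exists[OF p] by blast
    note tl = E_local[OF t(1)]
    define S' where "S' = chart_img c (fst t)"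
    define N where "N = fst t \<inter> D"
    have N: "openin X N" "N \<subseteq> I" unfolding N_def by (intro openin_Int tl(1) openin_D) auto
    let ?s = "in_chart c (snd t)" and ?H = "in_chart c (\<lambda>q. complex_of_real (H t q))"
    have C: "Ck (Suc 0) m S' ?s" "Ck (Suc 0) m S' ?H"
    proof -
      show "Ck (Suc 0) m S' ?s" using tl(2) c(1) unfolding S'_def holo_on_def Cholo_def Csmooth_def by blast
      have "Ck (Suc 0) m S' (in_chart c (H t))" using tl(3) c(1) unfolding S'_def smooth_on_def Ck_on_def by blast
      from Ck_of_real[OF this] show "Ck (Suc 0) m S' ?H" by (simp add: in_chart_def)
    qed
    have z: "snd c p \<in> S'" unfolding S'_def by (rule snd_img[OF c(2) t(2)])
    let ?F = "inner_nhds m S' (snd c p)"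
    have F': "?F \<le> inf (nhds (snd c p)) (principal S')"
      unfolding inner_nhds_def using Cint_open(2)[of m S'] by (intro inf_mono) auto
    also have "\<dots> \<le> inf (nhds (snd c p)) (principal (S c))" by (intro inf_mono) (auto simp: S'_def chart_img_def)
    finally have F: "?F \<le> inf (nhds (snd c p)) (principal (S c))" .
    define b where "b = (\<lambda>j z. Dz j ?s z + ?s z * Dz j ?H z / ?H z)"
    have Hp: "?H (snd c p) \<noteq> 0" using tl(4)[OF t(2)] by (simp add: in_chart_snd[OF c])
    have lims: "(?s \<longlongrightarrow> ?s (snd c p)) ?F" "(?H \<longlongrightarrow> ?H (snd c p)) ?F"
      using filterlim_mono[OF tendsto_within_open[OF Ck_continuous[OF C(1)] z] order_refl F']
        filterlim_mono[OF tendsto_within_open[OF Ck_continuous[OF C(2)] z] order_refl F'] .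
    define b' where "b' = (\<lambda>j. dz m S' j ?s (snd c p) + ?s (snd c p) * dz m S' j ?H (snd c p) / ?H (snd c p))"
    have "(b j \<longlongrightarrow> b' j) ?F" if "j < m" for j
      unfolding b_def b'_def using Hp
      by (intro tendsto_intros lims dz_tendsto(1)[OF C(1) that z] dz_tendsto(1)[OF C(2) that z])
    then have lim: "((\<lambda>z. Re (?H z * gtr m (g c (iv c z)) (\<lambda>j k. b j z * cnj (b k z)))) \<longlongrightarrow>
        Re (?H (snd c p) * gtr m (g c p) (\<lambda>j k. b' j * cnj (b' k)))) ?F"
      by (intro tendsto_intros lims tendsto_gtr_chart[OF c F])
    define L where "L = Re (?H (snd c p) * gtr m (g c p) (\<lambda>j k. b' j * cnj (b' k))) + 1"
    have "\<forall>\<^sub>F z in ?F. Re (?H z * gtr m (g c (iv c z)) (\<lambda>j k. b j z * cnj (b k z))) < L"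
      by (rule order_tendstoD(2)[OF lim]) (simp add: L_def)
    then have "\<forall>\<^sub>F z in inf (nhds (snd c p)) (principal S'). z \<in> Cint m S' \<longrightarrow> Re (?H z * gtr m (g c (iv c z)) (\<lambda>j k. b j z * cnj (b k z))) < L"
      unfolding inner_nhds_def eventually_inf_principal by (auto elim: eventually_mono)
    from chart_nbhd[OF c t(2) tl(1) this[unfolded S'_def]]
    obtain U where U: "openin X U" "p \<in> U" "U \<subseteq> fst t" "U \<subseteq> fst c"
      and UL: "\<And>q. q \<in> U \<Longrightarrow> snd c q \<in> Cint m S' \<Longrightarrow> Re (?H (snd c q) * gtr m (g c (iv c (snd c q))) (\<lambda>j k. b j (snd c q) * cnj (b k (snd c q)))) < L"
      unfolding S'_def by (elim exE conjE) blast
    have "Re (gq (chart_at M q) q lsn) * (sn q)\<^sup>2 \<le> L" if q: "q \<in> U \<inter> D" for q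
    proof -
      have qc: "q \<in> fst c" "q \<in> fst t" "q \<in> N" "q \<in> D" using q U by (auto simp: N_def)
      have d: "chart_at M q \<in> atlas M" "q \<in> fst (chart_at M q)" using chart_at[of q] qc(4) I_sub by auto
      have "chart_img c N \<subseteq> Cint m S'"
        by (rule Cint_maximal[OF opn_img[OF c(1) N]]) (auto simp: S'_def chart_img_def N_def)
      then have zq: "snd c q \<in> Cint m S'" using snd_img[OF qc(1,3)] by blast
      note lC = lsn_cCk[OF t(1) N_def]
      define a where "a = (\<lambda>j. pd M c j (\<lambda>q. complex_of_real (lsn q)) q)"
      have s0: "snd t q \<noteq> 0" using sn_local(3)[OF t(1) qc(2)] qc(4) by auto
      have H0: "H t q > 0" using tl(4)[OF qc(2)] .
      have ba: "b j (snd c q) = snd t q * a j" if j: "j < m" for j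
        unfolding a_def b_def pd_eq(1)[OF c(1) N qc(1,3) cCkD[OF lC c(1)] j] lsn_local(2)[OF t(1) c(1) N_def qc(3,1) j j]
        using s0 H0 by (simp add: in_chart_snd[OF c(1) qc(1)] field_simps)
      have "gtr m (g c q) (\<lambda>j k. b j (snd c q) * cnj (b k (snd c q))) = gtr m (g c q) (\<lambda>j k. of_real ((cmod (snd t q))\<^sup>2) * (a j * cnj (a k)))"
        by (intro gtr_cong refl) (simp add: ba complex_norm_square ac_simps del: of_real_power)
      also have "\<dots> = of_real ((cmod (snd t q))\<^sup>2) * gq c q lsn"
        unfolding gtr_cmult gq_def a_def
        by (intro arg_cong2[where f="(*)"] refl gtr_cong) (simp add: pdbar_cnj[OF c(1) qc(1,3) N lC])
      finally have "?H (snd c q) * gtr m (g c (iv c (snd c q))) (\<lambda>j k. b j (snd c q) * cnj (b k (snd c q))) = of_real ((sn q)\<^sup>2) * gq c q lsn"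
        by (simp add: iv_snd[OF c(1) qc(1)] in_chart_snd[OF c(1) qc(1)] sn_local(1)[OF t(1) qc(2)] mult.commute)
      moreover have "gq (chart_at M q) q lsn = gq c q lsn"
        by (rule gq_invariant[OF d(1) c(1) d(2) qc(1,3) N lC])
      ultimately show ?thesis using UL[OF _ zq] q by (simp add: mult.commute)
    qed
    then show "\<exists>U K. openin X U \<and> p \<in> U \<and> (\<forall>q\<in>U \<inter> D. Re (gq (chart_at M q) q lsn) * (sn q)\<^sup>2 \<le> K)" using U by blast
  qed
  then show ?thesis using I_sub by (metis (no_types, lifting) Diff_iff Int_iff subsetD)
qed

lemma exp_lsn: "sn q > 0 \<Longrightarrow> exp (r * lsn q) = sn q powr (2 * r)"
  by (simp add: lsn_def powr_def ln_realpow)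

lemma sn_small:
  assumes p: "p \<in> pts M" "p \<in> Z" and b: "b > 0" and e: "e > 0"
  shows "\<exists>U. openin X U \<and> p \<in> U \<and> (\<forall>q\<in>U. sn q powr (2 * b) < e)"
proof -
  have "sn p = 0" using sn_local(4)[OF triv[OF p(1)]] p(2) by simp
  then obtain U where U: "openin X U" "p \<in> U" "\<forall>q\<in>U. (sn q)\<^sup>2 < e powr (1 / b)"
    using sn2_nbhd[OF p(1), of "e powr (1 / b)"] e by auto
  have "sn q powr (2 * b) < e" if q: "q \<in> U" for q
  proof (cases "sn q = 0")
    case False
    have "q \<in> pts M" using U(1) q openin_subset by blast
    then have s: "sn q > 0" using sn_local(2)[OF triv] False by fastforce
    have "sn q powr (2 * b) = ((sn q)\<^sup>2) powr b" using s by (simp add: powr_powr flip: powr_numeral)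
    also have "\<dots> < (e powr (1 / b)) powr b" using U(3) q b by (intro powr_less_mono2) auto
    finally show ?thesis using b e by (simp add: powr_powr)
  qed (use e in simp)
  then show ?thesis using U by blast
qed

end

subsection \<open>The second order estimate\<close>

context sol
begin

definition tr_hf :: "'a \<Rightarrow> real" where
  "tr_hf q = Re (gtr m (g (chart_at M q) q) (hf (chart_at M q) q))"

lemma tr_hf_nonneg: "p \<in> pts M \<Longrightarrow> tr_hf p \<ge> 0"
  unfolding tr_hf_def using chart_at[of p] hf_pos by (intro gtr_nonneg) auto

text \<open>The trace of \<open>\<Omega>\<close> lies between zero and a fixed constant when
  \<open>\<Omega>\<close> is nonnegative, so bounds for \<open>tr_hf\<close> and for the Laplacian
  of the solution are interchangeable.\<close>

lemma tr_hf_lap: "tr_hf p = Re (gtr m (g (chart_at M p) p) (\<Omega> (chart_at M p) p)) + laplacian M g \<Phi> p"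
  unfolding tr_hf_def laplacian_gtr hf_def form_add_def gtr_add by simp

lemma hf_herm:
  assumes c: "c \<in> atlas M" and p: "p \<in> fst c" "p \<in> I" and j: "j < m" "k < m"
  shows "hf c p k j = cnj (hf c p j k)"
proof -
  note C = cCkD[OF \<Phi>_cCk[OF openin_I subset_refl] c] and pe = pd_pdbar_eq[OF c openin_I subset_refl p]
  have "ddbar M \<Phi> c p k j = cnj (ddbar M \<Phi> c p j k)"
    unfolding ddbar_def pe[OF C j(2,1)] pe[OF C j]
    by (rule ddb_real[OF opn_img[OF c openin_I subset_refl] C snd_img[OF p] j]) (simp add: in_chart_def)
  moreover have "\<Omega> c p k j = cnj (\<Omega> c p j k)" using \<Omega>(1) c p(1) j unfolding real_form11_def by blast
  ultimately show ?thesis by (simp add: hf_def form_add_def)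
qed

lemma tr_hf_chart:
  assumes c: "c \<in> atlas M" and p: "p \<in> fst c" "p \<in> I"
  shows "gtr m (g c p) (hf c p) = of_real (tr_hf p)"
proof -
  have d: "chart_at M p \<in> atlas M" "p \<in> fst (chart_at M p)" using chart_at[of p] p(2) I_sub by auto
  have "gtr m (g c p) (hf c p) = gtr m (g (chart_at M p) p) (hf (chart_at M p) p)"
  proof (rule gtr_invariant[OF c d(1) p(1) d(2)])
    fix j k assume j: "j < m" "k < m"
    show "hf c p j k = pull m (jac c (chart_at M p) p) (hf (chart_at M p) p) j k"
      unfolding hf_def form_add_def pull_add
      using real_form_pull[OF \<Omega>(1) c d(1) p(1) d(2) j]
        ddbar_transform[OF c d(1) openin_I subset_refl p(1) d(2) p(2) cCkD[OF \<Phi>_cCk[OF openin_I subset_refl] d(1)] j] by simp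
  qed
  moreover have "gtr m (g c p) (hf c p) \<in> \<real>" by (rule gtr_real[OF c p(1) hf_herm[OF c p]])
  ultimately show ?thesis unfolding tr_hf_def by (metis of_real_Re)
qed

lemma tr_hf_near:
  assumes p: "p \<in> pts M" and e: "e > 0"
  shows "\<exists>U. openin X U \<and> p \<in> U \<and> (\<forall>q\<in>U \<inter> I. tr_hf q < tr_hf p + e)"
proof -
  define c where "c = chart_at M p"
  have c: "c \<in> atlas M" "p \<in> fst c" using chart_at[OF p] by (auto simp: c_def)
  have "((\<lambda>z. Re (gtr m (g c (iv c z)) (hf c (iv c z)))) \<longlongrightarrow> Re (gtr m (g c p) (hf c p))) (nbI c p)"
    unfolding hf_def form_add_def
    by (intro tendsto_Re tendsto_gtr_chart[OF c nbI_le] tendsto_add \<Omega>_tendsto[OF c nbI_le] tendsto_ddbar[OF \<Phi>2 c])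
  from tendsto_bound_nbhd[OF c this, of "tr_hf p + e"] e
  obtain U where U: "openin X U" "p \<in> U" "U \<subseteq> fst c" "\<forall>q\<in>U \<inter> I. Re (gtr m (g c q) (hf c q)) < tr_hf p + e"
    by (auto simp: tr_hf_def c_def)
  have "tr_hf q < tr_hf p + e" if "q \<in> U \<inter> I" for q
  proof -
    have "q \<in> fst c" "q \<in> I" using that U(3) by auto
    from tr_hf_chart[OF c(1) this] have "Re (gtr m (g c q) (hf c q)) = tr_hf q" by simp
    then show ?thesis using U(4) that by metis
  qed
  then show ?thesis using U by blast
qed

lemma \<Phi>_near:
  assumes p: "p \<in> pts M" and e: "e > 0"
  shows "\<exists>U. openin X U \<and> p \<in> U \<and> (\<forall>q\<in>U. \<bar>\<Phi> q - \<Phi> p\<bar> < e)"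
proof -
  obtain c where c: "c \<in> atlas M" "p \<in> fst c" using chart_exists[OF p] by blast
  have "continuous_on (chart_img c (pts M)) (in_chart c \<Phi>)"
    using \<Phi>2 c(1) Ck_continuous unfolding Ck_on_def by blast
  from continuous_nbhd[OF c p openin_topspace this e] show ?thesis by (auto simp: dist_real_def)
qed

lemma \<Phi>_bounded: "bdd_above (\<Phi> ` pts M)" "bdd_below (\<Phi> ` pts M)"
proof -
  have *: "\<exists>U. openin X U \<and> p \<in> U \<and> (\<forall>q\<in>U. \<bar>\<Phi> q - \<Phi> p\<bar> < 1)" if "p \<in> pts M" for p
    using \<Phi>_near[OF that, of 1] by simp
  have "\<exists>K\<ge>0. \<forall>q\<in>pts M \<inter> pts M. \<bar>\<Phi> q\<bar> \<le> K"
  proof (rule compact_bound)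
    fix p assume "p \<in> pts M"
    from *[OF this] obtain U where U: "openin X U" "p \<in> U" "\<forall>q\<in>U. \<bar>\<Phi> q - \<Phi> p\<bar> < 1" by blast
    have "\<bar>\<Phi> q\<bar> \<le> \<bar>\<Phi> p\<bar> + 1" if "q \<in> U" for q using U(3)[rule_format, OF that] by linarith
    then show "\<exists>U K. openin X U \<and> p \<in> U \<and> (\<forall>q\<in>U \<inter> pts M. \<bar>\<Phi> q\<bar> \<le> K)" using U by blast
  qed
  then obtain K where K: "\<And>q. q \<in> pts M \<Longrightarrow> \<bar>\<Phi> q\<bar> \<le> K" by auto
  show "bdd_above (\<Phi> ` pts M)"
  proof (rule bdd_aboveI2)
    show "\<Phi> q \<le> K" if "q \<in> pts M" for q using K[OF that] by linarith
  qed
  show "bdd_below (\<Phi> ` pts M)"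
  proof (rule bdd_belowI2)
    show "- K \<le> \<Phi> q" if "q \<in> pts M" for q using K[OF that] by linarith
  qed
qed

definition sup_\<Phi> :: real where "sup_\<Phi> = (SUP q\<in>pts M. \<Phi> q)"
definition inf_\<Phi> :: real where "inf_\<Phi> = (INF q\<in>pts M. \<Phi> q)"

lemma \<Phi>_le: "q \<in> pts M \<Longrightarrow> \<Phi> q \<le> sup_\<Phi>" "q \<in> pts M \<Longrightarrow> inf_\<Phi> \<le> \<Phi> q"
  unfolding sup_\<Phi>_def inf_\<Phi>_def using \<Phi>_bounded by (auto intro: cSUP_upper cINF_lower)

lemma osc_eq: "osc (pts M) \<Phi> = sup_\<Phi> - inf_\<Phi>"
  by (simp add: osc_def sup_\<Phi>_def inf_\<Phi>_def)

text \<open>\<open>F\<close> is the product of the eigenvalues of \<open>hf\<close> relative to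
  \<open>g\<close>, and each of the \<open>m\<close> nonnegative factors is at most their
  sum.\<close>

lemma F_le_trace:
  assumes p: "p \<in> I"
  shows "F p \<le> tr_hf p ^ m"
proof -
  define c where "c = chart_at M p"
  have c: "c \<in> atlas M" "p \<in> fst c" using chart_at[of p] p I_sub by (auto simp: c_def)
  obtain L lam where L: "\<forall>i<m. \<forall>j<m. pull m L (g c p) i j = (if i = j then 1 else 0)"
    "\<forall>i<m. \<forall>j<m. pull m L (hf c p) i j = (if i = j then complex_of_real (lam i) else 0)"
    using simultaneous_diagonalization[of m "g c p" "hf c p"] g_herm[OF c] g_pos[OF c] hf_herm[OF c p] by blast
  have lam: "lam i \<ge> 0" if "i < m" for i
    using hf_pos[OF c, of "\<lambda>a. L a i"] L(2) that by (simp add: pull_bf[symmetric])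
  have "gtr m (g c p) (hf c p) = (\<Sum>i<m. pull m L (hf c p) i i)"
    by (rule gtr_orthonormal) (use L(1) in blast)
  also have "\<dots> = of_real (\<Sum>i<m. lam i)" using L(2) by simp
  finally have tr: "tr_hf p = (\<Sum>i<m. lam i)" unfolding tr_hf_chart[OF c p] of_real_eq_iff .
  have "dt m (pull m L (hf c p)) = of_real (F p) * dt m (pull m L (g c p))"
    by (simp add: dt_pull hf_det[OF c])
  moreover have "dt m (pull m L (hf c p)) = of_real (\<Prod>i<m. lam i)"
    using dt_cong[of m "pull m L (hf c p)" "\<lambda>i j. if i = j then of_real (lam i) else 0"] L(2) by (simp add: dt_diag)
  moreover have "dt m (pull m L (g c p)) = 1"
    using dt_cong[of m "pull m L (g c p)" "\<lambda>i j. if i = j then 1 else 0"] L(1) by (simp add: dt_diag)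
  ultimately have "complex_of_real (F p) = of_real (\<Prod>i<m. lam i)" by simp
  then have "F p = (\<Prod>i<m. lam i)" unfolding of_real_eq_iff .
  also have "\<dots> \<le> (\<Prod>i<m. tr_hf p)"
    unfolding tr using lam by (intro prod_mono conjI member_le_sum) auto
  finally show ?thesis by simp
qed

lemma ln_F_le:
  assumes p: "p \<in> I" and P: "tr_hf p \<le> P" "P \<ge> 1"
  shows "ln (F p) \<le> real m * ln P"
proof -
  have pM: "p \<in> pts M" using p I_sub by blast
  have "F p \<le> P ^ m" using F_le_trace[OF p] power_mono[OF P(1) tr_hf_nonneg[OF pM], of m] by linarith
  then have "ln (F p) \<le> ln (P ^ m)" using Fpos[OF pM] P(2) by (intro ln_le_cancel_iff[THEN iffD2]) auto
  then show ?thesis using P(2) by (simp add: ln_realpow)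
qed

context
  fixes C0 kL k\<Delta> P kosc :: real
  assumes C0: "\<And>p. p \<in> pts M \<Longrightarrow> Re (gtr m (g (chart_at M p) p) (\<Omega> (chart_at M p) p)) \<le> C0" "C0 \<ge> 0"
    and kL: "\<And>p. p \<in> pts M \<Longrightarrow> - laplacian M g (\<lambda>q. ln (F q)) p \<le> kL"
    and k\<Delta>: "\<And>p. p \<in> mfd_boundary M \<Longrightarrow> real m + laplacian M g \<Phi> p \<le> k\<Delta>"
    and kosc: "osc (pts M) \<Phi> \<le> kosc"
    and P: "P = C0 + max kL 0 + max k\<Delta> 0 + 1"
begin

text \<open>\<open>P\<close> bounds the trace wherever the data do so directly. The spare
  \<open>1\<close> leaves room for neighbourhoods of boundary points and ensures
  \<open>P \<ge> 1\<close>.\<close>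

lemma tr_hf_boundary: "p \<in> mfd_boundary M \<Longrightarrow> tr_hf p \<le> P - 1"
proof -
  assume p: "p \<in> mfd_boundary M"
  then have "p \<in> pts M" by (simp add: mfd_boundary_def)
  then show ?thesis using C0(1)[of p] k\<Delta>[OF p] tr_hf_lap[of p] P m1 by linarith
qed

text \<open>At an interior maximum of \<open>u\<close> the Laplacian of the solution is at most
  \<open>max kL 0 / m\<close>, which puts the trace below \<open>P\<close> and \<open>F\<close>
  below \<open>P^m\<close> there. The oscillation of the solution carries the bound to other
  points.\<close>

lemma F_bound:
  assumes z: "z \<in> I"
  shows "F z \<le> exp (real m * (ln P + kosc))"
proof -
  have mp: "real m > 0" using m1 by simp
  have P1: "P \<ge> 1" using P C0(2) by simp
  define u where "u = (\<lambda>q. \<Phi> q + (1 / real m) * ln (F q))"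
  have uC: "cCk (Suc (Suc 0)) I u"
    unfolding u_def by (rule cCk_lin[OF openin_I subset_refl cCk_on[OF \<Phi>2 openin_I subset_refl I_sub] lnF_cCk[OF openin_I subset_refl]])
  have step: "u q \<le> ln P + sup_\<Phi>" if q: "q \<in> I" "tr_hf q \<le> P" for q
  proof -
    have "(1 / real m) * ln (F q) \<le> (1 / real m) * (real m * ln P)"
      using ln_F_le[OF q P1] by (intro mult_left_mono) auto
    then show ?thesis using \<Phi>_le(1)[of q] q(1) I_sub mp by (auto simp: u_def)
  qed
  have "u z \<le> ln P + sup_\<Phi>"
  proof (rule max_principle[OF I_sub _ z])
    fix p assume p: "p \<in> pts M"
    show "(\<forall>e>0. \<exists>U. openin X U \<and> p \<in> U \<and> (\<forall>q\<in>U \<inter> I. u q \<le> ln P + sup_\<Phi> + e)) \<or>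
      (p \<in> I \<and> (\<forall>e>0. \<exists>U. openin X U \<and> p \<in> U \<and> (\<forall>q\<in>U \<inter> I. u q \<le> u p + e)) \<and> ((\<forall>q\<in>I. u q \<le> u p) \<longrightarrow> u p \<le> ln P + sup_\<Phi>))"
    proof (cases "p \<in> I")
      case False
      then have pb: "p \<in> mfd_boundary M" using p by (simp add: mfd_boundary_def)
      obtain U where U: "openin X U" "p \<in> U" "\<forall>q\<in>U \<inter> I. tr_hf q < tr_hf p + 1" using tr_hf_near[OF p, of 1] by auto
      have "u q \<le> ln P + sup_\<Phi>" if "q \<in> U \<inter> I" for q
      proof (rule step)
        show "q \<in> I" using that by blast
        show "tr_hf q \<le> P" using U(3)[rule_format, OF that] tr_hf_boundary[OF pb] by linarith
      qed
      then have "\<forall>e>0. \<forall>q\<in>U \<inter> I. u q \<le> ln P + sup_\<Phi> + e" by fastforce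
      then show ?thesis using U(1,2) by blast
    next
      case True
      have usc: "\<exists>U. openin X U \<and> p \<in> U \<and> (\<forall>q\<in>U \<inter> I. u q \<le> u p + e)" if e: "e > 0" for e
      proof -
        obtain U where U: "openin X U" "p \<in> U" "\<forall>q\<in>U. \<bar>u q - u p\<bar> < e"
          using cCk_continuous[OF uC openin_I subset_refl True e] by blast
        have "u q \<le> u p + e" if "q \<in> U" for q using U(3)[rule_format, OF that] by linarith
        then show ?thesis using U(1,2) by blast
      qed
      have "u p \<le> ln P + sup_\<Phi>" if mx: "\<forall>q\<in>I. u q \<le> u p"
      proof (rule step[OF True])
        have c: "chart_at M p \<in> atlas M" "p \<in> fst (chart_at M p)" using chart_at[OF p] by auto
        have "Re (gtr m (g (chart_at M p) p) (ddbar M u (chart_at M p) p)) \<le> 0"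
          using lap_max[OF c True openin_I subset_refl uC] mx by blast
        also have "gtr m (g (chart_at M p) p) (ddbar M u (chart_at M p) p) =
          gtr m (g (chart_at M p) p) (\<lambda>j l. ddbar M \<Phi> (chart_at M p) p j l + of_real (1 / real m) * ddbar M (\<lambda>q. ln (F q)) (chart_at M p) p j l)"
          unfolding u_def
          by (intro gtr_cong refl ddbar_lin[OF c True openin_I subset_refl cCk_on[OF \<Phi>2 openin_I subset_refl I_sub] lnF_cCk[OF openin_I subset_refl]])
        also have "Re \<dots> = laplacian M g \<Phi> p + (1 / real m) * laplacian M g (\<lambda>q. ln (F q)) p"
          unfolding gtr_add gtr_cmult laplacian_gtr by simp
        finally have "laplacian M g \<Phi> p \<le> (1 / real m) * (- laplacian M g (\<lambda>q. ln (F q)) p)" by simp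
        also have "\<dots> \<le> (1 / real m) * max kL 0" using kL[OF p] by (intro mult_left_mono) auto
        also have "\<dots> \<le> 1 * max kL 0" using m1 by (intro mult_right_mono) auto
        finally show "tr_hf p \<le> P" using tr_hf_lap[of p] C0(1)[OF p] P by linarith
      qed
      then show ?thesis using True usc by blast
    qed
  qed
  moreover have "\<Phi> z \<ge> inf_\<Phi>" using \<Phi>_le(2) z I_sub by blast
  ultimately have "(1 / real m) * ln (F z) \<le> ln P + kosc" using kosc osc_eq by (simp add: u_def)
  then have "ln (F z) \<le> real m * (ln P + kosc)" using mp by (simp add: field_simps)
  moreover have "F z > 0" using Fpos z I_sub by blast
  ultimately show ?thesis by (metis exp_le_cancel_iff exp_ln)
qed

lemma trace_estimate:
  assumes B: "bisectional_ge M g (- B)" and b: "\<forall>p\<in>pts M. scalar_curvature M g p \<le> b" "b \<ge> 0"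
    and A: "A \<ge> B + max kL 0 + b + 1" "A \<ge> 1"
    and Sg: "\<And>q. q \<in> pts M \<Longrightarrow> sn q powr (2 * \<epsilon> * A) \<le> Sg" "Sg \<ge> 0"
    and TT: "TT = real m * (exp (real m * (ln P + kosc)) * (A * real m) ^ (m - 1))"
    and z: "z \<in> pts M - Z"
  shows "tr_hf z \<le> (TT + P) * exp (A * kosc) * Sg * sn z powr (- (2 * \<epsilon> * A))"
proof -
  have P1: "P \<ge> 1" using P C0(2) by simp
  have TT0: "TT \<ge> 0" unfolding TT using A(2) by simp
  define h where "h = (\<lambda>q. exp (- (A * phi q)))"
  define G where "G = (\<lambda>q. tr_hf q * h q)"
  \<comment> \<open>\<open>TT\<close> covers an interior maximum and \<open>P\<close> the boundary;
    the last factor bounds \<open>h\<close> everywhere off the divisor.\<close>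
  define K where "K = (TT + P) * (exp (- A * inf_\<Phi>) * Sg)"
  have K0: "K \<ge> 0" unfolding K_def using TT0 P1 Sg(2) by simp
  have heq: "h q = exp (- A * \<Phi> q) * sn q powr (2 * \<epsilon> * A)" if q: "q \<in> pts M" "q \<notin> Z" for q
  proof -
    have "h q = exp (- A * \<Phi> q) * exp (\<epsilon> * A * lsn q)"
      unfolding h_def phi_def by (simp add: algebra_simps flip: exp_add)
    then show ?thesis using exp_lsn[OF sn_pos[OF q], of "\<epsilon> * A"] by (simp add: ac_simps)
  qed
  have e\<Phi>: "exp (- A * \<Phi> q) \<le> exp (- A * inf_\<Phi>)" if "q \<in> pts M" for q using \<Phi>_le(2)[OF that] A(2) by simp
  have hb: "h q \<le> exp (- A * inf_\<Phi>) * Sg" if q: "q \<in> pts M" "q \<notin> Z" for q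
    unfolding heq[OF q] using e\<Phi>[OF q(1)] Sg(1)[OF q(1)] by (intro mult_mono) auto
  have step: "G q \<le> K" if q: "q \<in> pts M" "q \<notin> Z" "tr_hf q \<le> TT + P" for q
    unfolding G_def K_def using q hb[OF q(1,2)] TT0 P1 by (intro mult_mono) (auto simp: h_def)
  have DI: "D \<subseteq> pts M" using I_sub by blast
  have main: "G z \<le> K" if z: "z \<in> D" for z
  proof (rule max_principle[OF DI _ z])
    fix p assume p: "p \<in> pts M"
    consider "p \<in> Z" | "p \<in> mfd_boundary M" | "p \<in> D" using p by (auto simp: mfd_boundary_def)
    then show "(\<forall>e>0. \<exists>U. openin X U \<and> p \<in> U \<and> (\<forall>q\<in>U \<inter> D. G q \<le> K + e)) \<or>
      (p \<in> D \<and> (\<forall>e>0. \<exists>U. openin X U \<and> p \<in> U \<and> (\<forall>q\<in>U \<inter> D. G q \<le> G p + e)) \<and> ((\<forall>q\<in>D. G q \<le> G p) \<longrightarrow> G p \<le> K))"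
    proof cases
      case 1
      have "\<exists>U. openin X U \<and> p \<in> U \<and> (\<forall>q\<in>U \<inter> D. G q \<le> K + e)" if e: "e > 0" for e
      proof -
        obtain U where U: "openin X U" "p \<in> U" "\<forall>q\<in>U \<inter> I. tr_hf q < tr_hf p + 1" using tr_hf_near[OF p, of 1] by auto
        \<comment> \<open>Near the divisor the trace is below \<open>tr_hf p + 1\<close>; with the
          power of the norm below \<open>d\<close> the product is at most \<open>e\<close>.\<close>
        define d where "d = e / ((tr_hf p + 1) * exp (- A * inf_\<Phi>))"
        have t1: "(tr_hf p + 1) * exp (- A * inf_\<Phi>) > 0" using tr_hf_nonneg[OF p] by simp
        then have d: "d > 0" using e by (simp add: d_def)
        have "\<epsilon> * A > 0" using A(2) \<epsilon> by simp
        from sn_small[OF p 1 this d] obtain V where V: "openin X V" "p \<in> V" "\<forall>q\<in>V. sn q powr (2 * (\<epsilon> * A)) < d" by blast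
        have "G q \<le> K + e" if q: "q \<in> (U \<inter> V) \<inter> D" for q
        proof -
          have qM: "q \<in> pts M" "q \<notin> Z" "q \<in> U \<inter> I" using q I_sub by auto
          have sd: "sn q powr (2 * \<epsilon> * A) \<le> d" using V(3) q by (auto simp: mult.assoc intro: less_imp_le)
          have "h q \<le> exp (- A * inf_\<Phi>) * d"
            unfolding heq[OF qM(1,2)] using e\<Phi>[OF qM(1)] sd by (intro mult_mono) auto
          then have "G q \<le> (tr_hf p + 1) * (exp (- A * inf_\<Phi>) * d)"
            unfolding G_def using U(3)[rule_format, OF qM(3)] tr_hf_nonneg[OF p] by (intro mult_mono) (auto simp: h_def)
          also have "\<dots> = e" using tr_hf_nonneg[OF p] by (simp add: d_def)
          finally show ?thesis using K0 by simp
        qed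
        then show ?thesis using openin_Int[OF U(1) V(1)] U(2) V(2) by blast
      qed
      then show ?thesis by blast
    next
      case 2
      obtain U where U: "openin X U" "p \<in> U" "\<forall>q\<in>U \<inter> I. tr_hf q < tr_hf p + 1" using tr_hf_near[OF p, of 1] by auto
      have "G q \<le> K" if q: "q \<in> U \<inter> D" for q
      proof (rule step)
        show "q \<in> pts M" "q \<notin> Z" using q I_sub by auto
        have "q \<in> U \<inter> I" using q by blast
        from U(3)[rule_format, OF this] show "tr_hf q \<le> TT + P" using tr_hf_boundary[OF 2] TT0 by linarith
      qed
      then have "\<forall>e>0. \<forall>q\<in>U \<inter> D. G q \<le> K + e" by fastforce
      then show ?thesis using U(1,2) by blast
    next
      case 3
      define t where "t = triv_at E p"
      have t: "t \<in> E" "p \<in> fst t" using triv[OF p] by (auto simp: t_def)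
      define N where "N = fst t \<inter> D"
      have N: "openin X N" "N \<subseteq> I" unfolding N_def by (intro openin_Int E_local(1)[OF t(1)] openin_D) auto
      have pN: "p \<in> N" using 3 t by (simp add: N_def)
      note phC = phi_cCk[OF t(1) N_def N(1)]
      have usch: "\<forall>e>0. \<exists>U. openin X U \<and> p \<in> U \<and> (\<forall>q\<in>U \<inter> D. h q \<le> h p + e)"
      proof (intro allI impI)
        fix e :: real assume e: "e > 0"
        have "isCont (\<lambda>x. exp (- (A * x))) (phi p)" by (intro continuous_intros)
        then obtain d where d: "d > 0" "\<And>x. \<bar>x - phi p\<bar> < d \<Longrightarrow> \<bar>exp (- (A * x)) - exp (- (A * phi p))\<bar> < e"
          using e unfolding continuous_at_eps_delta dist_real_def by blast
        obtain U where U: "openin X U" "p \<in> U" "\<forall>q\<in>U. \<bar>phi q - phi p\<bar> < d"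
          using cCk_continuous[OF phC N pN d(1)] by blast
        have "h q \<le> h p + e" if "q \<in> U" for q
          using d(2)[OF U(3)[rule_format, OF that]] unfolding h_def by linarith
        then show "\<exists>U. openin X U \<and> p \<in> U \<and> (\<forall>q\<in>U \<inter> D. h q \<le> h p + e)" using U(1,2) by blast
      qed
      have usct: "\<forall>e>0. \<exists>U. openin X U \<and> p \<in> U \<and> (\<forall>q\<in>U \<inter> D. tr_hf q \<le> tr_hf p + e)"
      proof (intro allI impI)
        fix e :: real assume "e > 0"
        from tr_hf_near[OF p this] obtain U where U: "openin X U" "p \<in> U" "\<forall>q\<in>U \<inter> I. tr_hf q < tr_hf p + e" by blast
        have "tr_hf q \<le> tr_hf p + e" if "q \<in> U \<inter> D" for q using U(3) that by force
        then show "\<exists>U. openin X U \<and> p \<in> U \<and> (\<forall>q\<in>U \<inter> D. tr_hf q \<le> tr_hf p + e)" using U(1,2) by blast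
      qed
      have usc: "\<forall>e>0. \<exists>U. openin X U \<and> p \<in> U \<and> (\<forall>q\<in>U \<inter> D. G q \<le> G p + e)"
        unfolding G_def by (rule nbhd_mult[OF usct _ usch _ 3]) (use tr_hf_nonneg DI in \<open>auto simp: h_def\<close>)
      have "G p \<le> K" if mx: "\<forall>q\<in>D. G q \<le> G p"
      proof (rule step)
        show "p \<in> pts M" "p \<notin> Z" using p 3 by auto
        define c where "c = chart_at M p"
        have c: "c \<in> atlas M" "p \<in> fst c" using chart_at[OF p] by (auto simp: c_def)
        obtain W gt \<phi> f lam hh T where n: "ndata m W gt \<phi> f lam hh"
          "\<And>w. w \<in> W \<Longrightarrow> T w \<in> N \<and> T w \<in> fst c" "T (\<lambda>_. 0) = p"
          "\<And>w. w \<in> W \<Longrightarrow> \<phi> w = of_real (phi (T w))"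
          "\<And>w. w \<in> W \<Longrightarrow> f w = of_real (ln (F (T w)))"
          "\<And>w. w \<in> W \<Longrightarrow> ndata.tr m gt hh w = gtr m (g c (T w)) (hf c (T w))"
          "(\<Sum>j<m. Dz j (Dzb j f) (\<lambda>_. 0)) = gtr m (g c p) (ddbar M (\<lambda>q. ln (F q)) c p)"
          "\<And>B a b. bisectional_ge M g (- B) \<Longrightarrow> a < m \<Longrightarrow> Re (\<Sum>k<m. \<Sum>l<m. ndata0.Rm gt a k l * b k * cnj (b l)) \<ge> - B * (\<Sum>k<m. (cmod (b k))\<^sup>2)"
          "(\<Sum>a<m. \<Sum>j<m. ndata0.Rm gt a j j) = (\<Sum>i<m. \<Sum>j<m. \<Sum>k<m. \<Sum>l<m. ginv m (g c p) i j * ginv m (g c p) k l * curvature M g c p i j k l)"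
          by (rule local_solution[OF c(1) t(1) N_def c(2) pN]) blast
        interpret n: ndata m W gt \<phi> f lam hh by (rule n(1))
        have tr: "n.tr w = of_real (tr_hf (T w))" if w: "w \<in> W" for w
          unfolding n(6)[OF w] using n(2)[OF w] N(2) by (intro tr_hf_chart[OF c(1)]) auto
        have Gw: "Re (n.tr w * exp (- (of_real A * \<phi> w))) = G (T w)" if w: "w \<in> W" for w
        proof -
          have "exp (- (of_real A * \<phi> w)) = of_real (h (T w))"
            unfolding h_def n(4)[OF w] by (simp flip: exp_of_real)
          then show ?thesis by (simp add: tr[OF w] G_def)
        qed
        have "Re (n.tr (\<lambda>_. 0)) \<le> real m * (exp (Re (f (\<lambda>_. 0))) * (A * real m) ^ (m - 1))"
        proof (rule n.trace_bound_at_max[where B=B and b=b and kL="max kL 0"])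
          show "- B \<le> Re (n.Rm a j j)" if a: "a < m" "j < m" for a j
          proof -
            \<comment> \<open>With the unit vector in direction \<open>j\<close> the bisectional
              bound becomes a bound for a single curvature component.\<close>
            let ?b = "\<lambda>k. if k = j then 1 else (0::complex)"
            have "(\<Sum>k<m. \<Sum>l<m. n.Rm a k l * ?b k * cnj (?b l)) = (\<Sum>k<m. \<Sum>l<m. if k = j then (if l = j then n.Rm a k l else 0) else 0)"
              by (intro sum.cong refl) auto
            also have "\<dots> = (\<Sum>k<m. if k = j then (\<Sum>l<m. if l = j then n.Rm a k l else 0) else 0)"
              by (intro sum.cong refl) auto
            also have "\<dots> = n.Rm a j j" using a(2) by simp
            finally have e1: "(\<Sum>k<m. \<Sum>l<m. n.Rm a k l * ?b k * cnj (?b l)) = n.Rm a j j" .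
            have "(\<Sum>k<m. (cmod (?b k))\<^sup>2) = (\<Sum>k<m. if k = j then 1 else 0)" by (intro sum.cong refl) auto
            also have "\<dots> = 1" using a(2) by simp
            finally have e2: "(\<Sum>k<m. (cmod (?b k))\<^sup>2) = 1" .
            show ?thesis using n(8)[OF B a(1), of ?b] unfolding e1 e2 by simp
          qed
          show "Re (\<Sum>p<m. \<Sum>j<m. n.Rm p j j) \<le> b"
            unfolding n(9) using b(1) p by (auto simp: scalar_curvature_def Let_def c_def)
          show "- max kL 0 \<le> Re (\<Sum>j<m. Dz j (Dzb j f) (\<lambda>_. 0))"
            unfolding n(7) using kL[OF p] by (simp add: laplacian_gtr c_def)
          show "1 \<le> m" using m1 .
          show "n.tr w \<in> \<real>" if "w \<in> W" for w unfolding tr[OF that] by simp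
          show "0 \<le> b" "0 \<le> max kL 0" "B + max kL 0 + b + 1 \<le> A" using b(2) A(1) by auto
          show "Re (n.tr w * exp (- (of_real A * \<phi> w))) \<le> Re (n.tr (\<lambda>_. 0) * exp (- (of_real A * \<phi> (\<lambda>_. 0))))" if w: "w \<in> W" for w
            unfolding Gw[OF w] Gw[OF n.o] n(3) using mx n(2)[OF w] by (auto simp: N_def)
        qed
        also have "Re (n.tr (\<lambda>_. 0)) = tr_hf p" using tr[OF n.o] by (simp add: n(3))
        also have "exp (Re (f (\<lambda>_. 0))) = F p" using n(5)[OF n.o] Fpos[OF p] by (simp add: n(3))
        also have "real m * (F p * (A * real m) ^ (m - 1)) \<le> TT"
          unfolding TT using F_bound[of p] 3 A(2) by (intro mult_left_mono mult_right_mono) auto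
        finally show "tr_hf p \<le> TT + P" using P1 by simp
      qed
      then show ?thesis using 3 usc by blast
    qed
  qed
  have zM: "z \<in> pts M" "z \<notin> Z" using z by auto
  have Gz: "G z \<le> K"
  \<comment> \<open>The maximum principle was run on interior points only; a boundary point is
    covered directly by the boundary bound.\<close>
  proof (cases "z \<in> I")
    case True
    then show ?thesis using main[of z] zM by blast
  next
    case False
    then have "z \<in> mfd_boundary M" using zM by (simp add: mfd_boundary_def)
    then show ?thesis using tr_hf_boundary[of z] TT0 by (intro step zM) auto
  qed
  have "tr_hf z * sn z powr (2 * \<epsilon> * A) * exp (- A * \<Phi> z) \<le> K"
    using Gz unfolding G_def heq[OF zM] by (simp add: ac_simps)
  then have "tr_hf z * sn z powr (2 * \<epsilon> * A) * exp (- A * \<Phi> z) * exp (A * \<Phi> z) \<le> K * exp (A * \<Phi> z)"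
    by (rule mult_right_mono) simp
  then have "tr_hf z * sn z powr (2 * \<epsilon> * A) \<le> K * exp (A * \<Phi> z)"
    by (simp add: mult.assoc flip: exp_add)
  also have "\<dots> = (TT + P) * Sg * exp (A * (\<Phi> z - inf_\<Phi>))"
    unfolding K_def by (simp add: algebra_simps flip: exp_add)
  also have "\<dots> \<le> (TT + P) * Sg * exp (A * kosc)"
    using \<Phi>_le(1)[OF zM(1)] kosc osc_eq A(2) TT0 P1 Sg(2) by (intro mult_left_mono) auto
  finally have "tr_hf z * sn z powr (2 * \<epsilon> * A) * sn z powr (- (2 * \<epsilon> * A)) \<le> (TT + P) * Sg * exp (A * kosc) * sn z powr (- (2 * \<epsilon> * A))"
    by (rule mult_right_mono) simp
  then show ?thesis using sn_pos[OF zM] by (simp add: ac_simps flip: powr_add)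
qed

end

end

subsection \<open>The gradient estimate\<close>

text \<open>The cube of \<open>y \<le> exp y\<close> at \<open>y = x / 3\<close>, whence the
  constant \<open>27\<close>.\<close>

lemma cube_exp_le: "(x::real) \<ge> 0 \<Longrightarrow> x ^ 3 * exp (- x) \<le> 27"
proof -
  assume x: "x \<ge> 0"
  have "(x / 3) ^ 3 \<le> exp (x / 3) ^ 3"
    using x exp_ge_add_one_self[of "x / 3"] by (intro power_mono) linarith+
  also have "exp (x / 3) ^ 3 = exp x" by (simp flip: exp_of_nat_mult)
  finally have "x ^ 3 \<le> 27 * exp x" by (simp add: power_divide)
  then have "x ^ 3 * exp (- x) \<le> 27 * exp x * exp (- x)" by (intro mult_right_mono) auto
  then show ?thesis by (simp add: exp_minus field_simps)
qed

lemma mult_cancel4: "u * u' = 1 \<Longrightarrow> v * v' = 1 \<Longrightarrow> a * u * v * (u' * v') = (a::real)"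
proof -
  assume "u * u' = 1" "v * v' = 1"
  moreover have "a * u * v * (u' * v') = a * ((u * u') * (v * v'))" by (simp only: ac_simps)
  ultimately show ?thesis by simp
qed

context geo
begin

lemma cCk_cong:
  assumes f: "cCk k N f" and eq: "\<And>q. q \<in> N \<Longrightarrow> f q = f' q"
  shows "cCk k N f'"
  unfolding cCk_def
proof
  fix c assume c: "c \<in> atlas M"
  show "Ck k m (chart_img c N) (in_chart c (\<lambda>q. complex_of_real (f' q)))"
    by (rule Ck_cong[OF _ cCkD[OF f c]]) (use eq iv_img[OF c] in \<open>auto simp: in_chart_def\<close>)
qed

lemma gq_cong:
  assumes c: "c \<in> atlas M" and p: "p \<in> fst c" "p \<in> N" and N: "openin X N" "N \<subseteq> I"
    and f: "cCk (Suc k) N f" and eq: "\<And>q. q \<in> N \<Longrightarrow> f q = f' q"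
  shows "gq c p f = gq c p f'"
proof -
  have "Wd s j (in_chart c (\<lambda>q. complex_of_real (f q))) (snd c p) = Wd s j (in_chart c (\<lambda>q. complex_of_real (f' q))) (snd c p)" if "j < m" for s j
    using eq iv_img[OF c] by (intro Wd_transform[OF opn_img[OF c N] snd_img[OF p] that]) (auto simp: in_chart_def)
  then show ?thesis
    unfolding gq_def
    by (intro gtr_cong refl) (simp add: pd_eq[OF c N p cCkD[OF f c]] pd_eq[OF c N p cCkD[OF cCk_cong[OF f eq] c]])
qed

text \<open>Used with \<open>r = 1 / m\<close> to pass between \<open>log F\<close> and
  \<open>F^(1/m)\<close>.\<close>

lemma gq_exp:
  assumes c: "c \<in> atlas M" and p: "p \<in> fst c" "p \<in> N" and N: "openin X N" "N \<subseteq> I" and f: "cCk (Suc k) N f"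
  shows "cCk (Suc k) N (\<lambda>q. exp (r * f q))"
    and "gq c p (\<lambda>q. exp (r * f q)) = of_real ((r * exp (r * f p))\<^sup>2) * gq c p f"
proof -
  have ce: "in_chart d (\<lambda>q. complex_of_real (exp (r * f q))) = (\<lambda>w. exp (of_real r * in_chart d (\<lambda>q. complex_of_real (f q)) w))" for d
    by (rule ext) (simp add: in_chart_def exp_of_real[symmetric])
  show C: "cCk (Suc k) N (\<lambda>q. exp (r * f q))"
    unfolding cCk_def ce
    by (intro ballI Ck_comp[OF opn_img[OF _ N] open_UNIV cCkD[OF f]]) (auto intro!: holomorphic_intros)
  let ?e = "complex_of_real (r * exp (r * f p))"
  have W: "Wd s j (in_chart c (\<lambda>q. complex_of_real (exp (r * f q)))) (snd c p) = ?e * Wd s j (in_chart c (\<lambda>q. complex_of_real (f q))) (snd c p)" if j: "j < m" for s j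
  proof -
    have d: "((\<lambda>x. exp (complex_of_real r * x)) has_field_derivative ?e) (at (in_chart c (\<lambda>q. complex_of_real (f q)) (snd c p)))"
      by (auto intro!: derivative_eq_intros simp: in_chart_snd[OF c p(1)] exp_of_real[symmetric] mult.commute)
    show ?thesis unfolding ce
      by (rule Wd_comp(2)[OF Ck_dj[OF opn_img[OF c N] cCkD[OF f c] snd_img[OF p] j] d])
  qed
  have "gq c p (\<lambda>q. exp (r * f q)) = gtr m (g c p) (\<lambda>j k. of_real ((r * exp (r * f p))\<^sup>2) *
      (pd M c j (\<lambda>q. complex_of_real (f q)) p * pdbar M c k (\<lambda>q. complex_of_real (f q)) p))"
    unfolding gq_def
    by (intro gtr_cong refl) (simp add: pd_eq[OF c N p cCkD[OF f c]] pd_eq[OF c N p cCkD[OF C c]] W power2_eq_square)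
  then show "gq c p (\<lambda>q. exp (r * f q)) = of_real ((r * exp (r * f p))\<^sup>2) * gq c p f"
    unfolding gtr_cmult gq_def .
qed

end

context sol
begin

text \<open>This and the next two are squared norms, in contrast to
  \<open>grad_norm\<close>.\<close>

definition grad_phi :: "'a \<Rightarrow> real" where "grad_phi q = Re (gq (chart_at M q) q phi)"
definition grad_\<Phi> :: "'a \<Rightarrow> real" where "grad_\<Phi> q = Re (gq (chart_at M q) q \<Phi>)"
definition grad_lsn :: "'a \<Rightarrow> real" where "grad_lsn q = Re (gq (chart_at M q) q lsn)"

lemma D_local:
  assumes q: "q \<in> D"
  obtains c t N where "c = chart_at M q" "c \<in> atlas M" "q \<in> fst c" "t \<in> E" "N = fst t \<inter> D" "q \<in> N" "openin X N" "N \<subseteq> I"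
    "cCk (Suc (Suc (Suc (Suc 0)))) N phi" "cCk (Suc (Suc (Suc (Suc 0)))) N lsn" "cCk (Suc (Suc (Suc (Suc 0)))) N \<Phi>"
proof -
  define t where "t = triv_at E q"
  have qM: "q \<in> pts M" using q I_sub by blast
  have t: "t \<in> E" "q \<in> fst t" using triv[OF qM] by (auto simp: t_def)
  define N where "N = fst t \<inter> D"
  have N: "openin X N" "N \<subseteq> I" unfolding N_def by (intro openin_Int E_local(1)[OF t(1)] openin_D) auto
  have "q \<in> N" using q t by (simp add: N_def)
  then show ?thesis
    using that[OF refl _ _ t(1) N_def _ N phi_cCk[OF t(1) N_def N(1)] lsn_cCk[OF t(1) N_def] \<Phi>_cCk[OF N]] chart_at[OF qM] by blast
qed

lemma grad_phi_nonneg: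
  assumes "q \<in> D"
  shows "grad_phi q \<ge> 0"
proof -
  obtain c t N where n: "c = chart_at M q" "c \<in> atlas M" "q \<in> fst c" "q \<in> N" "openin X N" "N \<subseteq> I"
    "cCk (Suc (Suc (Suc (Suc 0)))) N phi"
    by (rule D_local[OF assms])
  show ?thesis unfolding grad_phi_def n(1)[symmetric] by (rule gq_nonneg(2)[OF n(2-7)])
qed

lemma grad_phi_le:
  assumes "q \<in> D"
  shows "grad_phi q \<le> 2 * grad_\<Phi> q + 2 * \<epsilon>\<^sup>2 * grad_lsn q" "grad_\<Phi> q \<le> 2 * grad_phi q + 2 * \<epsilon>\<^sup>2 * grad_lsn q"
proof -
  obtain c t N where n: "c = chart_at M q" "c \<in> atlas M" "q \<in> fst c" "t \<in> E" "N = fst t \<inter> D" "q \<in> N" "openin X N" "N \<subseteq> I"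
    "cCk (Suc (Suc (Suc (Suc 0)))) N phi" "cCk (Suc (Suc (Suc (Suc 0)))) N lsn" "cCk (Suc (Suc (Suc (Suc 0)))) N \<Phi>"
    by (rule D_local[OF assms])
  have "phi = (\<lambda>q. \<Phi> q + (- \<epsilon>) * lsn q)" "\<Phi> = (\<lambda>q. phi q + \<epsilon> * lsn q)" by (auto simp: phi_def)
  with gq_add_le[OF n(2,3,6,7,8,11,10), of "- \<epsilon>"] gq_add_le[OF n(2,3,6,7,8,9,10), of \<epsilon>]
  show "grad_phi q \<le> 2 * grad_\<Phi> q + 2 * \<epsilon>\<^sup>2 * grad_lsn q" "grad_\<Phi> q \<le> 2 * grad_phi q + 2 * \<epsilon>\<^sup>2 * grad_lsn q"
    unfolding grad_phi_def grad_\<Phi>_def grad_lsn_def n(1)[symmetric] by (metis power2_minus)+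
qed

lemma grad_\<Phi>_near:
  assumes p: "p \<in> pts M" and e: "e > 0"
  shows "\<exists>U. openin X U \<and> p \<in> U \<and> (\<forall>q\<in>U \<inter> I. grad_\<Phi> q < grad_\<Phi> p + e)"
proof -
  define c where "c = chart_at M p"
  have c: "c \<in> atlas M" "p \<in> fst c" using chart_at[OF p] by (auto simp: c_def)
  from tendsto_bound_nbhd[OF c tendsto_Re[OF tendsto_gq[OF \<Phi>2 c]], of "grad_\<Phi> p + e"] e
  obtain U where U: "openin X U" "p \<in> U" "U \<subseteq> fst c" "\<forall>q\<in>U \<inter> I. Re (gq c q \<Phi>) < grad_\<Phi> p + e"
    by (auto simp: grad_\<Phi>_def c_def)
  have "grad_\<Phi> q < grad_\<Phi> p + e" if "q \<in> U \<inter> I" for q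
  proof -
    have q: "q \<in> fst c" "q \<in> I" using that U(3) by auto
    then have d: "chart_at M q \<in> atlas M" "q \<in> fst (chart_at M q)" using chart_at[of q] I_sub by auto
    have "gq (chart_at M q) q \<Phi> = gq c q \<Phi>"
      by (rule gq_invariant[OF d(1) c(1) d(2) q openin_I subset_refl \<Phi>_cCk[OF openin_I subset_refl]])
    then show ?thesis using U(4) that unfolding grad_\<Phi>_def by metis
  qed
  then show ?thesis using U by blast
qed

lemma grad_ln_F:
  assumes c: "c = chart_at M p" and p: "p \<in> I" and k: "grad_norm M g (\<lambda>q. F q powr (1 / real m)) p \<le> kdF"
  shows "sqrt (Re (gq c p (\<lambda>q. ln (F q)))) \<le> real m * exp (- ln (F p) / real m) * kdF"
proof -
  have pM: "p \<in> pts M" using p I_sub by blast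
  have c': "c \<in> atlas M" "p \<in> fst c" using chart_at[OF pM] by (auto simp: c)
  have mp: "real m > 0" using m1 by simp
  note ex = gq_exp[OF c' p openin_I subset_refl lnF_cCk[OF openin_I subset_refl], where r="1 / real m"]
  \<comment> \<open>The ratio of the gradients of \<open>F^(1/m)\<close> and \<open>log F\<close>;
    its reciprocal is \<open>m exp (- log F / m)\<close>.\<close>
  define E' where "E' = (1 / real m) * exp ((1 / real m) * ln (F p))"
  have "gq c p (\<lambda>q. exp (1 / real m * ln (F q))) = gq c p (\<lambda>q. F q powr (1 / real m))"
  proof (rule gq_cong[OF c' p openin_I subset_refl ex(1)])
    fix q assume "q \<in> I"
    then have "F q > 0" using Fpos I_sub by blast
    then show "exp (1 / real m * ln (F q)) = F q powr (1 / real m)" by (simp add: powr_def)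
  qed
  then have "Re (gq c p (\<lambda>q. F q powr (1 / real m))) = E'\<^sup>2 * Re (gq c p (\<lambda>q. ln (F q)))"
    unfolding ex(2) E'_def by (metis Re_complex_of_real times_complex.sel(1) Im_complex_of_real mult_zero_left diff_zero)
  then have "E' * sqrt (Re (gq c p (\<lambda>q. ln (F q)))) \<le> kdF"
    using k mp unfolding grad_norm_gq c[symmetric] by (simp add: real_sqrt_mult E'_def)
  then have "E' * sqrt (Re (gq c p (\<lambda>q. ln (F q)))) * (real m * exp (- ln (F p) / real m)) \<le> kdF * (real m * exp (- ln (F p) / real m))"
    using mp by (intro mult_right_mono) auto
  moreover have "E' * (real m * exp (- ln (F p) / real m)) = 1"
    using mp unfolding E'_def by (simp add: exp_minus)
  ultimately have "sqrt (Re (gq c p (\<lambda>q. ln (F q)))) \<le> kdF * (real m * exp (- ln (F p) / real m))"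
    using mult_cancel4[of E' "real m * exp (- ln (F p) / real m)" 1 1 "sqrt (Re (gq c p (\<lambda>q. ln (F q))))"]
    unfolding mult.commute[of E' "sqrt _"] by (simp only: mult_1_right)
  then show ?thesis by (simp only: ac_simps)
qed

lemma gradient_estimate:
  assumes KL: "\<And>q. q \<in> D \<Longrightarrow> grad_lsn q * (sn q)\<^sup>2 \<le> KL" "KL \<ge> 0"
    and B: "bisectional_ge M g (- B)"
    and kdF: "\<And>p. p \<in> pts M \<Longrightarrow> grad_norm M g (\<lambda>q. F q powr (1 / real m)) p \<le> kdF" "kdF \<ge> 0"
    and kF: "\<And>p. p \<in> pts M \<Longrightarrow> F p \<le> kF" and k\<Phi>: "\<And>p. p \<in> pts M \<Longrightarrow> \<bar>\<Phi> p\<bar> \<le> k\<Phi>"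
    and A: "A \<ge> B + 2 * kdF + 1" "A \<ge> 1" "\<epsilon> * A > 1"
    and Sg: "\<And>q. q \<in> pts M \<Longrightarrow> sn q powr (2 * \<epsilon>) \<le> Sg" "Sg \<ge> 1"
    and kd: "\<And>p. p \<in> mfd_boundary M \<Longrightarrow> grad_norm M g \<Phi> p \<le> kd"
    and Sp: "\<And>p. p \<in> mfd_boundary M \<Longrightarrow> 1 / (sn p)\<^sup>2 \<le> Sp" "Sp \<ge> 0"
    and K0: "K0 = 3 * exp (A * (k\<Phi> + ln Sg + 1)) * (27 * kF * ((real m + 2) * (A + 1)) ^ m + 1 + (2 * (kd\<^sup>2 + 1) + 4 * \<epsilon>\<^sup>2 * KL * Sp))"
    and z: "z \<in> D"
  shows "grad_phi z \<le> K0 * exp (A * k\<Phi>) * sn z powr (- (2 * \<epsilon> * A))"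
proof -
  \<comment> \<open>From \<open>\<Phi> \<ge> - k\<Phi>\<close> and
    \<open>\<epsilon> * lsn \<le> ln Sg\<close> this shift makes
    \<open>phi + C \<ge> 1\<close>.\<close>
  define C where "C = k\<Phi> + ln Sg + 1"
  define K where "K = (real m + 2) * (A + 1)"
  define Kb where "Kb = 2 * (kd\<^sup>2 + 1) + 4 * \<epsilon>\<^sup>2 * KL * Sp"
  have Kb0: "Kb \<ge> 0" unfolding Kb_def using KL(2) Sp(2) by simp
  have K00: "K ^ m \<ge> 0" unfolding K_def using A(2) by simp
  have zM: "z \<in> pts M" "z \<notin> Z" using z I_sub by auto
  have kF0: "kF \<ge> 0" using kF[OF zM(1)] Fpos[OF zM(1)] by linarith
  have K0': "K0 = 3 * exp (A * C) * (27 * kF * K ^ m + 1 + Kb)" by (simp add: K0 C_def K_def Kb_def)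
  define h where "h = (\<lambda>q. exp (- (A * phi q - 1 / (phi q + C))))"
  define G where "G = (\<lambda>q. grad_phi q * h q)"
  have DI: "D \<subseteq> pts M" using I_sub by blast
  have ph: "phi q = \<Phi> q - \<epsilon> * lsn q" for q by (simp add: phi_def)
  have x1: "phi q + C \<ge> 1" if q: "q \<in> pts M" "q \<notin> Z" for q
  proof -
    have "exp (\<epsilon> * lsn q) \<le> Sg" using Sg(1)[OF q(1)] exp_lsn[OF sn_pos[OF q], of \<epsilon>] by simp
    then have "\<epsilon> * lsn q \<le> ln Sg" using Sg(2) by (subst ln_ge_iff) auto
    then show ?thesis using k\<Phi>[OF q(1)] unfolding ph C_def by linarith
  qed
  \<comment> \<open>The correction \<open>exp (1 / x)\<close> lies between \<open>1\<close> and
    \<open>3\<close>, so inserting or removing it costs at most the factor \<open>3\<close> in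
    \<open>K0\<close>.\<close>
  have e3: "exp (1 / (phi q + C)) \<le> 3" if q: "q \<in> pts M" "q \<notin> Z" for q
  proof -
    have "exp (1 / (phi q + C)) \<le> exp 1" using x1[OF q] by simp
    then show ?thesis using exp_le by linarith
  qed
  have heq: "h q = exp (- (A * phi q)) * exp (1 / (phi q + C))" for q
    unfolding h_def by (simp flip: exp_add)
  have h1: "h q \<le> 3 * exp (A * C) * exp (- (A * (phi q + C)))" if q: "q \<in> pts M" "q \<notin> Z" for q
  proof -
    have "h q \<le> exp (- (A * phi q)) * 3" unfolding heq by (intro mult_left_mono e3[OF q]) auto
    also have "\<dots> = 3 * exp (A * C) * exp (- (A * (phi q + C)))" by (simp add: algebra_simps flip: exp_add)
    finally show ?thesis .
  qed
  have h2: "h q \<le> 3 * exp (A * C)" if q: "q \<in> pts M" "q \<notin> Z" for q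
  proof -
    have "A * (phi q + C) \<ge> 0" using x1[OF q] A(2) by (intro mult_nonneg_nonneg) auto
    then have "3 * exp (A * C) * exp (- (A * (phi q + C))) \<le> 3 * exp (A * C) * 1" by (intro mult_left_mono) auto
    then show ?thesis using h1[OF q] by linarith
  qed
  have phe: "exp (- (A * phi q)) = exp (- (A * \<Phi> q)) * sn q powr (2 * \<epsilon> * A)" if q: "q \<in> pts M" "q \<notin> Z" for q
  proof -
    have "exp (- (A * phi q)) = exp (- (A * \<Phi> q)) * exp ((\<epsilon> * A) * lsn q)"
      unfolding ph by (simp add: algebra_simps flip: exp_add)
    then show ?thesis unfolding exp_lsn[OF sn_pos[OF q]] by (simp add: mult.assoc)
  qed
  have h3: "h q \<le> 3 * exp (A * k\<Phi>) * sn q powr (2 * \<epsilon> * A)" if q: "q \<in> pts M" "q \<notin> Z" for q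
  proof -
    have "A * (- \<Phi> q) \<le> A * k\<Phi>" using k\<Phi>[OF q(1)] A(2) by (intro mult_left_mono) auto
    then have "exp (- (A * \<Phi> q)) \<le> exp (A * k\<Phi>)" by simp
    then have "exp (- (A * phi q)) \<le> exp (A * k\<Phi>) * sn q powr (2 * \<epsilon> * A)"
      unfolding phe[OF q] by (intro mult_right_mono) auto
    then have "h q \<le> (exp (A * k\<Phi>) * sn q powr (2 * \<epsilon> * A)) * 3"
      unfolding heq by (intro mult_mono e3[OF q]) auto
    then show ?thesis by (simp add: ac_simps)
  qed
  have K03: "3 * exp (A * C) * y \<le> K0" if "y \<le> 27 * kF * K ^ m + 1 + Kb" for y
    unfolding K0' using that by (intro mult_left_mono) auto
  have K0nn: "K0 \<ge> 0" using K03[of 0] kF0 K00 Kb0 by simp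
  have step: "G q \<le> K0" if q: "q \<in> D" "grad_phi q \<le> 1 + Kb" for q
  proof -
    have qM: "q \<in> pts M" "q \<notin> Z" using q(1) DI by auto
    have "G q \<le> (1 + Kb) * (3 * exp (A * C))"
      unfolding G_def using q(2) h2[OF qM] Kb0 by (intro mult_mono) (auto simp: h_def)
    also have "\<dots> \<le> K0" using K03[of "1 + Kb"] kF0 K00 by (simp add: mult.commute)
    finally show ?thesis .
  qed
  have "G z \<le> K0"
  proof (rule max_principle[OF DI _ z])
    fix p assume p: "p \<in> pts M"
    consider "p \<in> Z" | "p \<in> mfd_boundary M" | "p \<in> D" using p by (auto simp: mfd_boundary_def)
    then show "(\<forall>e>0. \<exists>U. openin X U \<and> p \<in> U \<and> (\<forall>q\<in>U \<inter> D. G q \<le> K0 + e)) \<or>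
      (p \<in> D \<and> (\<forall>e>0. \<exists>U. openin X U \<and> p \<in> U \<and> (\<forall>q\<in>U \<inter> D. G q \<le> G p + e)) \<and> ((\<forall>q\<in>D. G q \<le> G p) \<longrightarrow> G p \<le> K0))"
    proof cases
      case 1
      have "\<exists>U. openin X U \<and> p \<in> U \<and> (\<forall>q\<in>U \<inter> D. G q \<le> K0 + e)" if e: "e > 0" for e
      proof -
        obtain U where U: "openin X U" "p \<in> U" "\<forall>q\<in>U \<inter> I. grad_\<Phi> q < grad_\<Phi> p + 1" using grad_\<Phi>_near[OF p, of 1] by auto
        \<comment> \<open>Will bound \<open>grad_phi\<close> times the squared norm of the section
          near the divisor, once that norm is below 1.\<close>
        define k where "k = 2 * \<bar>grad_\<Phi> p + 1\<bar> + 2 * \<epsilon>\<^sup>2 * KL"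
        have k0: "k \<ge> 0" using KL(2) by (simp add: k_def)
        define r where "r = 3 * exp (A * k\<Phi>)"
        have r: "r > 0" by (simp add: r_def)
        \<comment> \<open>The test function decays like the power \<open>2 \<epsilon> A\<close> of
          the norm, and the gradient consumes at most the power \<open>2\<close>; a positive power
          is left.\<close>
        have b: "\<epsilon> * A - 1 > 0" using A(3) by simp
        have d: "e / ((k + 1) * r) > 0" using e k0 r by simp
        obtain V where V: "openin X V" "p \<in> V" "\<forall>q\<in>V. sn q powr (2 * (\<epsilon> * A - 1)) < e / ((k + 1) * r)" using sn_small[OF p 1 b d] by blast
        obtain Y where Y: "openin X Y" "p \<in> Y" "\<forall>q\<in>Y. sn q powr (2 * 1) < 1" using sn_small[OF p 1, of 1 1] by auto
        have "G q \<le> K0 + e" if q: "q \<in> (U \<inter> V \<inter> Y) \<inter> D" for q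
        proof -
          have qM: "q \<in> pts M" "q \<notin> Z" "q \<in> D" "q \<in> U \<inter> I" using q I_sub by auto
          have s: "sn q > 0" using sn_pos[OF qM(1,2)] .
          define y where "y = (sn q)\<^sup>2"
          have y: "y > 0" "y < 1" using s Y(3) q by (auto simp: y_def)
          have "grad_phi q \<le> 2 * grad_\<Phi> q + 2 * \<epsilon>\<^sup>2 * grad_lsn q" by (rule grad_phi_le(1)[OF qM(3)])
          then have "grad_phi q * y \<le> (2 * grad_\<Phi> q + 2 * \<epsilon>\<^sup>2 * grad_lsn q) * y" using y by (intro mult_right_mono) auto
          also have "\<dots> = 2 * (grad_\<Phi> q * y) + 2 * \<epsilon>\<^sup>2 * (grad_lsn q * y)" by (simp add: algebra_simps)
          also have "\<dots> \<le> 2 * \<bar>grad_\<Phi> p + 1\<bar> + 2 * \<epsilon>\<^sup>2 * KL"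
          proof (intro add_mono mult_left_mono)
            have "grad_\<Phi> q * y \<le> \<bar>grad_\<Phi> p + 1\<bar> * y" using U(3)[rule_format, OF qM(4)] y by (intro mult_right_mono) auto
            also have "\<dots> \<le> \<bar>grad_\<Phi> p + 1\<bar> * 1" using y by (intro mult_left_mono) auto
            finally show "grad_\<Phi> q * y \<le> \<bar>grad_\<Phi> p + 1\<bar>" by simp
            show "grad_lsn q * y \<le> KL" using KL(1)[OF qM(3)] by (simp add: y_def)
          qed auto
          finally have gy: "grad_phi q * y \<le> k" by (simp add: k_def)
          have sp: "sn q powr (2 * \<epsilon> * A) = y * sn q powr (2 * (\<epsilon> * A - 1))"
            using s by (simp add: y_def algebra_simps flip: powr_numeral powr_add)
          have "G q \<le> grad_phi q * (r * (y * sn q powr (2 * (\<epsilon> * A - 1))))"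
            unfolding G_def using h3[OF qM(1,2)] grad_phi_nonneg[OF qM(3)] by (intro mult_left_mono) (auto simp: r_def sp)
          also have "\<dots> = (grad_phi q * y) * (r * sn q powr (2 * (\<epsilon> * A - 1)))" by (simp add: ac_simps)
          also have "\<dots> \<le> (k + 1) * (r * (e / ((k + 1) * r)))"
          proof (intro mult_mono mult_left_mono)
            show "grad_phi q * y \<le> k + 1" using gy by simp
            show "sn q powr (2 * (\<epsilon> * A - 1)) \<le> e / ((k + 1) * r)" using V(3) q by (auto intro: less_imp_le)
          qed (use k0 r in auto)
          also have "\<dots> = e" using k0 r by simp
          finally show ?thesis using K0nn by simp
        qed
        then show ?thesis using openin_Int[OF openin_Int[OF U(1) V(1)] Y(1)] U(2) V(2) Y(2) by blast
      qed
      then show ?thesis by blast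
    next
      case 2
      then have pZ: "p \<notin> Z" using Ebd by blast
      have sp: "sn p > 0" using sn_pos[OF p pZ] .
      obtain U where U: "openin X U" "p \<in> U" "\<forall>q\<in>U \<inter> I. grad_\<Phi> q < grad_\<Phi> p + 1" using grad_\<Phi>_near[OF p, of 1] by auto
      obtain V where V: "openin X V" "p \<in> V" "\<forall>q\<in>V. \<bar>(sn q)\<^sup>2 - (sn p)\<^sup>2\<bar> < (sn p)\<^sup>2 / 2"
        using sn2_nbhd[OF p, of "(sn p)\<^sup>2 / 2"] sp by auto
      have gsp: "grad_\<Phi> p \<le> kd\<^sup>2" using kd[OF 2] unfolding grad_norm_gq grad_\<Phi>_def by (rule sqrt_le_D)
      have "G q \<le> K0" if q: "q \<in> (U \<inter> V) \<inter> D" for q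
      proof (rule step)
        show qD: "q \<in> D" using q by blast
        have qI: "q \<in> U \<inter> I" using q by blast
        have "\<bar>(sn q)\<^sup>2 - (sn p)\<^sup>2\<bar> < (sn p)\<^sup>2 / 2" using V(3) q by blast
        \<comment> \<open>The factor \<open>1/2\<close> compares the norm at \<open>q\<close> with
          its boundary value; it is the reason for the \<open>4\<close> in
          \<open>Kb\<close>.\<close>
        then have s2: "(sn q)\<^sup>2 \<ge> (sn p)\<^sup>2 / 2" by linarith
        have p2: "(sn p)\<^sup>2 > 0" using sp by simp
        have "grad_lsn q * ((sn p)\<^sup>2 / 2) \<le> KL"
        proof (cases "grad_lsn q \<ge> 0")
          case True
          have "grad_lsn q * ((sn p)\<^sup>2 / 2) \<le> grad_lsn q * (sn q)\<^sup>2" by (rule mult_left_mono[OF s2 True])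
          then show ?thesis using KL(1)[OF qD] by linarith
        next
          case False
          then have "grad_lsn q * ((sn p)\<^sup>2 / 2) \<le> 0" using p2 by (intro mult_nonpos_nonneg) auto
          then show ?thesis using KL(2) by linarith
        qed
        then have "grad_lsn q \<le> 2 * KL * (1 / (sn p)\<^sup>2)" using p2 by (simp add: field_simps)
        also have "\<dots> \<le> 2 * KL * Sp" using Sp(1)[OF 2] KL(2) by (intro mult_left_mono) auto
        finally have "2 * \<epsilon>\<^sup>2 * grad_lsn q \<le> 2 * \<epsilon>\<^sup>2 * (2 * KL * Sp)" by (intro mult_left_mono) auto
        moreover have "grad_\<Phi> q \<le> kd\<^sup>2 + 1" using U(3)[rule_format, OF qI] gsp by linarith
        ultimately show "grad_phi q \<le> 1 + Kb" using grad_phi_le(1)[OF qD] unfolding Kb_def by (simp add: algebra_simps)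
      qed
      then have "\<forall>e>0. \<forall>q\<in>(U \<inter> V) \<inter> D. G q \<le> K0 + e" by fastforce
      then show ?thesis using openin_Int[OF U(1) V(1)] U(2) V(2) by blast
    next
      case 3
      obtain c t N where n: "c = chart_at M p" "c \<in> atlas M" "p \<in> fst c" "t \<in> E" "N = fst t \<inter> D" "p \<in> N" "openin X N" "N \<subseteq> I"
        "cCk (Suc (Suc (Suc (Suc 0)))) N phi" "cCk (Suc (Suc (Suc (Suc 0)))) N lsn" "cCk (Suc (Suc (Suc (Suc 0)))) N \<Phi>"
        by (rule D_local[OF 3])
      have pZ: "p \<notin> Z" using 3 by blast
      have usch: "\<forall>e>0. \<exists>U. openin X U \<and> p \<in> U \<and> (\<forall>q\<in>U \<inter> D. h q \<le> h p + e)"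
      proof (intro allI impI)
        fix e :: real assume e: "e > 0"
        have "isCont (\<lambda>x. exp (- (A * x - 1 / (x + C)))) (phi p)"
          using x1[OF p pZ] by (intro continuous_intros) auto
        then obtain d where d: "d > 0" "\<And>x. \<bar>x - phi p\<bar> < d \<Longrightarrow> \<bar>exp (- (A * x - 1 / (x + C))) - exp (- (A * phi p - 1 / (phi p + C)))\<bar> < e"
          using e unfolding continuous_at_eps_delta dist_real_def by blast
        obtain U where U: "openin X U" "p \<in> U" "\<forall>q\<in>U. \<bar>phi q - phi p\<bar> < d"
          using cCk_continuous[OF n(9,7,8,6) d(1)] by blast
        have "h q \<le> h p + e" if "q \<in> U" for q
          using d(2)[OF U(3)[rule_format, OF that]] unfolding h_def by linarith
        then show "\<exists>U. openin X U \<and> p \<in> U \<and> (\<forall>q\<in>U \<inter> D. h q \<le> h p + e)" using U(1,2) by blast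
      qed
      have uscb: "\<forall>e>0. \<exists>U. openin X U \<and> p \<in> U \<and> (\<forall>q\<in>U \<inter> D. grad_phi q \<le> grad_phi p + e)"
      proof (intro allI impI)
        fix e :: real assume "e > 0"
        from gq_continuous[OF n(9,7,8,6) this] obtain U where U: "openin X U" "p \<in> U" "\<forall>q\<in>U. grad_phi q < grad_phi p + e"
          unfolding grad_phi_def by blast
        then show "\<exists>U. openin X U \<and> p \<in> U \<and> (\<forall>q\<in>U \<inter> D. grad_phi q \<le> grad_phi p + e)" by (meson IntD1 less_imp_le)
      qed
      have usc: "\<forall>e>0. \<exists>U. openin X U \<and> p \<in> U \<and> (\<forall>q\<in>U \<inter> D. G q \<le> G p + e)"
        unfolding G_def by (rule nbhd_mult[OF uscb _ usch _ 3]) (use grad_phi_nonneg in \<open>auto simp: h_def\<close>)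
      have "G p \<le> K0" if mx: "\<forall>q\<in>D. G q \<le> G p"
      \<comment> \<open>A small gradient at the maximum is harmless; otherwise the pointwise
        estimate applies, whose proof needs a gradient of size at least 1.\<close>
      proof (cases "grad_phi p \<ge> 1")
        case False
        then show ?thesis using Kb0 by (intro step 3) auto
      next
        case True
        obtain W gt \<phi> f lam hh T where l: "ndata m W gt \<phi> f lam hh"
          "\<And>w. w \<in> W \<Longrightarrow> T w \<in> N \<and> T w \<in> fst c" "T (\<lambda>_. 0) = p"
          "\<And>w. w \<in> W \<Longrightarrow> \<phi> w = of_real (phi (T w))"
          "\<And>w. w \<in> W \<Longrightarrow> f w = of_real (ln (F (T w)))"
          "\<And>w. w \<in> W \<Longrightarrow> ndata.\<beta> m gt \<phi> w = gq c (T w) phi"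
          "(\<Sum>j<m. (cmod (Dz j f (\<lambda>_. 0)))\<^sup>2) = Re (gq c p (\<lambda>q. ln (F q)))"
          "\<And>B a b. bisectional_ge M g (- B) \<Longrightarrow> a < m \<Longrightarrow> Re (\<Sum>k<m. \<Sum>l<m. ndata0.Rm gt a k l * b k * cnj (b l)) \<ge> - B * (\<Sum>k<m. (cmod (b k))\<^sup>2)"
          by (rule local_solution[OF n(2,4,5,3,6)]) blast
        interpret l: ndata m W gt \<phi> f lam hh by (rule l(1))
        have \<beta>: "l.\<beta> w = of_real (grad_phi (T w))" if w: "w \<in> W" for w
        proof -
          have q: "T w \<in> fst c" "T w \<in> N" using l(2)[OF w] by auto
          then have d: "chart_at M (T w) \<in> atlas M" "T w \<in> fst (chart_at M (T w))" using chart_at[of "T w"] n(8) I_sub by blast+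
          have "gq (chart_at M (T w)) (T w) phi = gq c (T w) phi" by (rule gq_invariant[OF d(1) n(2) d(2) q n(7,8,9)])
          moreover have "gq c (T w) phi \<in> \<real>" by (rule gq_nonneg(1)[OF n(2) q n(7,8,9)])
          ultimately show ?thesis unfolding l(6)[OF w] grad_phi_def by (metis of_real_Re)
        qed
        have TD: "T w \<in> D" "T w \<in> pts M" "T w \<notin> Z" if "w \<in> W" for w using l(2)[OF that] n(5) DI by auto
        have Gw: "Re (l.\<beta> w * exp (- (of_real A * \<phi> w - 1 / (\<phi> w + of_real C)))) = G (T w)" if w: "w \<in> W" for w
        proof -
          have "exp (- (of_real A * \<phi> w - 1 / (\<phi> w + of_real C))) = of_real (h (T w))"
            unfolding h_def l(4)[OF w] by (simp flip: exp_of_real)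
          then show ?thesis by (simp add: \<beta>[OF w] G_def)
        qed
        have pI: "p \<in> I" using 3 by blast
        have "Re (l.\<beta> (\<lambda>_. 0)) \<le> exp (Re (f (\<lambda>_. 0))) * K ^ m * (Re (\<phi> (\<lambda>_. 0)) + C) ^ 3"
        proof (rule l.gradient_bound_at_max[where B=B and kd=kdF and A=A])
          show "- B * (\<Sum>k<m. (cmod (b k))\<^sup>2) \<le> Re (\<Sum>k<m. \<Sum>l<m. l.Rm a k l * b k * cnj (b l))" if "a < m" for a b
            by (rule l(8)[OF B that])
          show "sqrt (\<Sum>j<m. (cmod (Dz j f (\<lambda>_. 0)))\<^sup>2) \<le> real m * exp (- Re (f (\<lambda>_. 0)) / real m) * kdF"
            unfolding l(7) using grad_ln_F[OF n(1) pI kdF(1)[OF p]] l(5)[OF l.o] by (simp add: l(3))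
          show "l.\<beta> w \<in> \<real>" if "w \<in> W" for w unfolding \<beta>[OF that] by simp
          show "1 \<le> Re (l.\<beta> (\<lambda>_. 0))" using True \<beta>[OF l.o] by (simp add: l(3))
          show "1 \<le> m" using m1 .
          show "1 \<le> Re (\<phi> w) + C" if "w \<in> W" for w using x1[OF TD(2,3)[OF that]] l(4)[OF that] by simp
          show "B + 2 * kdF + 1 \<le> A" "0 \<le> kdF" "0 \<le> A" using A(1,2) kdF(2) by auto
          show "Re (l.\<beta> w * exp (- (of_real A * \<phi> w - 1 / (\<phi> w + of_real C)))) \<le> Re (l.\<beta> (\<lambda>_. 0) * exp (- (of_real A * \<phi> (\<lambda>_. 0) - 1 / (\<phi> (\<lambda>_. 0) + of_real C))))" if w: "w \<in> W" for w
            unfolding Gw[OF w] Gw[OF l.o] l(3) using mx TD(1)[OF w] by blast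
          show "K = (real m + 2) * (A + 1)" by (rule K_def)
        qed
        then have gbp: "grad_phi p \<le> F p * K ^ m * (phi p + C) ^ 3"
          using \<beta>[OF l.o] l(4,5)[OF l.o] Fpos[OF p] by (simp add: l(3))
        define x where "x = phi p + C"
        have x: "x \<ge> 1" using x1[OF p pZ] by (simp add: x_def)
        have "G p \<le> (F p * K ^ m * x ^ 3) * (3 * exp (A * C) * exp (- (A * x)))"
          unfolding G_def x_def using gbp h1[OF p pZ] grad_phi_nonneg[OF 3] by (intro mult_mono) (auto simp: h_def intro: order_trans)
        \<comment> \<open>Since \<open>A \<ge> 1\<close>, the decay \<open>exp (- x)\<close> is
          available; it pays for the factor \<open>x^3\<close> that the correction
          \<open>1 / x\<close> has cost.\<close>
        also have "\<dots> \<le> (kF * K ^ m * x ^ 3) * (3 * exp (A * C) * exp (- x))"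
          using kF[OF p] kF0 Fpos[OF p] K00 x A(2) by (intro mult_mono) (auto simp: mult_le_cancel_right1)
        also have "\<dots> = 3 * exp (A * C) * (kF * K ^ m * (x ^ 3 * exp (- x)))" by (simp add: ac_simps)
        also have "\<dots> \<le> 3 * exp (A * C) * (kF * K ^ m * 27)"
          using cube_exp_le[of x] x kF0 K00 by (intro mult_left_mono) auto
        also have "\<dots> \<le> K0" using Kb0 by (intro K03) simp
        finally show ?thesis .
      qed
      then show ?thesis using 3 usc by blast
    qed
  qed
  \<comment> \<open>Return from the test function to the gradient: the correction is at least 1, and
    \<open>exp (- A phi)\<close> splits into a bounded factor and a power of the norm.\<close>
  have "grad_phi z * exp (- (A * phi z)) \<le> G z"
    unfolding G_def heq using grad_phi_nonneg[OF z] x1[OF zM] by (intro mult_left_mono) auto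
  then have "grad_phi z * exp (- (A * \<Phi> z)) * sn z powr (2 * \<epsilon> * A) \<le> K0"
    using \<open>G z \<le> K0\<close> unfolding phe[OF zM] by (simp add: mult.assoc)
  then have "grad_phi z * exp (- (A * \<Phi> z)) * sn z powr (2 * \<epsilon> * A) * (exp (A * \<Phi> z) * sn z powr (- (2 * \<epsilon> * A))) \<le> K0 * (exp (A * \<Phi> z) * sn z powr (- (2 * \<epsilon> * A)))"
    by (intro mult_right_mono) auto
  moreover have "exp (- (A * \<Phi> z)) * exp (A * \<Phi> z) = 1" "sn z powr (2 * \<epsilon> * A) * sn z powr (- (2 * \<epsilon> * A)) = 1"
    using sn_pos[OF zM] by (simp_all flip: exp_add powr_add)
  ultimately have "grad_phi z \<le> K0 * (exp (A * \<Phi> z) * sn z powr (- (2 * \<epsilon> * A)))"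
    using mult_cancel4[of "exp (- (A * \<Phi> z))" "exp (A * \<Phi> z)" "sn z powr (2 * \<epsilon> * A)" "sn z powr (- (2 * \<epsilon> * A))" "grad_phi z"] by simp
  also have "\<dots> \<le> K0 * (exp (A * k\<Phi>) * sn z powr (- (2 * \<epsilon> * A)))"
  proof (intro mult_left_mono mult_right_mono K0nn)
    show "exp (A * \<Phi> z) \<le> exp (A * k\<Phi>)" using k\<Phi>[OF zM(1)] A(2) by simp
  qed auto
  finally show ?thesis by (simp add: mult.assoc)
qed

end

section \<open>Choice of the constants\<close>

context geo
begin

text \<open>\<open>C1\<close> and \<open>C2\<close> are chosen before \<open>F\<close> and the
  solution, but after the manifold, the metric and the divisor, so \<open>C0\<close> and
  \<open>KL\<close> may enter. In (i) the test function controls the square of the gradient and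
  taking the root halves the exponent; in (ii) no root is taken, whence the factor \<open>2\<close>
  in the exponent.\<close>

lemma estimates:
  assumes nonneg: "nonneg_form11 M \<Omega>"
  shows "\<exists>(C1 :: real \<Rightarrow> real \<Rightarrow> real \<Rightarrow> real \<Rightarrow> real \<Rightarrow> real \<Rightarrow> real \<Rightarrow> real)
        (C2 :: real \<Rightarrow> real \<Rightarrow> real \<Rightarrow> real \<Rightarrow> real \<Rightarrow> real \<Rightarrow> real).
       \<forall>(F :: 'a \<Rightarrow> real) (\<phi> :: 'a \<Rightarrow> real) (\<Phi> :: 'a \<Rightarrow> real) (B :: real) (b :: real).
         smooth_on M (pts M) F \<and> (\<forall>p\<in>pts M. F p > 0) \<and>
         smooth_on_boundary M \<phi> \<and>
         dirichlet_solution M \<Omega> g F \<phi> \<Phi> \<and>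
         bisectional_ge M g (- B) \<and> B * \<epsilon> > 1 \<and>
         b \<ge> 0 \<and> (\<forall>p\<in>pts M. scalar_curvature M g p \<le> b)
         \<longrightarrow>
         (\<forall>kB kdF kF k\<Phi> k\<sigma> kd\<Phi> k\<sigma>'.
            B \<le> kB \<and>
            (\<forall>p\<in>pts M. grad_norm M g (\<lambda>q. F q powr (1 / real (mdim M))) p \<le> kdF) \<and>
            (\<forall>p\<in>pts M. F p \<le> kF) \<and>
            (\<forall>p\<in>pts M. \<bar>\<Phi> p\<bar> \<le> k\<Phi>) \<and>
            (\<forall>p\<in>pts M. section_norm E H p powr (2 * \<epsilon>) \<le> k\<sigma>) \<and>
            (\<forall>p\<in>mfd_boundary M. grad_norm M g \<Phi> p \<le> kd\<Phi>) \<and>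
            (\<forall>p\<in>mfd_boundary M. 1 / section_norm E H p powr (2 * \<epsilon>) \<le> k\<sigma>')
            \<longrightarrow>
            (\<forall>z\<in>pts M - divisor_support E.
               grad_norm M g \<Phi> z
                 \<le> C1 kB kdF kF k\<Phi> k\<sigma> kd\<Phi> k\<sigma>' * section_norm E H z powr (- \<epsilon> * (kB + 2 * max kdF 0 + 1))))
         \<and>
         (\<forall>kL kb kB kosc k\<sigma> k\<Delta>.
            (\<forall>p\<in>pts M. - laplacian M g (\<lambda>q. ln (F q)) p \<le> kL) \<and>
            b \<le> kb \<and>
            B \<le> kB \<and>
            osc (pts M) \<Phi> \<le> kosc \<and>
            (\<forall>p\<in>pts M. section_norm E H p powr (2 * \<epsilon>) \<le> k\<sigma>) \<and>
            (\<forall>p\<in>mfd_boundary M. real (mdim M) + laplacian M g \<Phi> p \<le> k\<Delta>)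
            \<longrightarrow>
            (\<forall>z\<in>pts M - divisor_support E.
               \<bar>laplacian M g \<Phi> z\<bar>
                 \<le> C2 kL kb kB kosc k\<sigma> k\<Delta> * section_norm E H z powr (- \<epsilon> * (2 * (kB + max kL 0 + kb + 1)))))"
proof -
  obtain C0 where C0: "C0 \<ge> 0" "\<And>p. p \<in> pts M \<Longrightarrow> Re (gtr m (g (chart_at M p) p) (\<Omega> (chart_at M p) p)) \<le> C0"
    using tr_\<Omega>_bound by blast
  obtain KL where KL: "KL \<ge> 0" "\<And>q. q \<in> D \<Longrightarrow> Re (gq (chart_at M q) q lsn) * (sn q)\<^sup>2 \<le> KL"
    using gq_lsn_bound by blast
  \<comment> \<open>The given bounds are arbitrary reals, possibly negative when they bound over an empty set or
    the bounded quantity is; hence the truncations \<open>max _ 0\<close> and \<open>max _ 1\<close>.\<close>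
  define K0 where "K0 = (\<lambda>A kF k\<Phi> Sg kd Sp. 3 * exp (A * (k\<Phi> + ln Sg + 1)) *
    (27 * kF * ((real m + 2) * (A + 1)) ^ m + 1 + (2 * (kd\<^sup>2 + 1) + 4 * \<epsilon>\<^sup>2 * KL * Sp)))"
  \<comment> \<open>The root serves interior points, the second summand boundary points.\<close>
  define c1 where "c1 = (\<lambda>A kF k\<Phi> Sg kd Sp. sqrt (2 * (K0 A kF k\<Phi> Sg kd Sp * exp (A * k\<Phi>)) + 2 * \<epsilon>\<^sup>2 * (KL * Sg powr A)) + \<bar>kd\<bar> * Sg powr A)"
  define P where "P = (\<lambda>kL k\<Delta>. C0 + max kL 0 + max k\<Delta> 0 + 1)"
  define TT where "TT = (\<lambda>A kL k\<Delta> kosc. real m * (exp (real m * (ln (P kL k\<Delta>) + kosc)) * (A * real m) ^ (m - 1)))"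
  define c2 where "c2 = (\<lambda>A kL k\<Delta> kosc Sg. (C0 + (TT A kL k\<Delta> kosc + P kL k\<Delta>) * exp (A * kosc)) * Sg)"
  have snA: "sn q powr (2 * \<epsilon> * A) \<le> max k\<sigma> 1 powr A" if "sn q powr (2 * \<epsilon>) \<le> k\<sigma>" "A \<ge> 0" for q k\<sigma> A
  proof -
    have "sn q powr (2 * \<epsilon> * A) = (sn q powr (2 * \<epsilon>)) powr A" by (simp add: powr_powr)
    also have "\<dots> \<le> max k\<sigma> 1 powr A" using that by (intro powr_mono2) auto
    finally show ?thesis .
  qed
  show ?thesis
  proof (rule exI[of _ "\<lambda>kB kdF kF k\<Phi> k\<sigma> kd k\<sigma>'. c1 (kB + 2 * max kdF 0 + 1) kF k\<Phi> (max k\<sigma> 1) kd (max k\<sigma>' 0 powr (1 / \<epsilon>))"],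
      rule exI[of _ "\<lambda>kL kb kB kosc k\<sigma> k\<Delta>. c2 (kB + max kL 0 + kb + 1) kL k\<Delta> kosc (max k\<sigma> 1 powr (kB + max kL 0 + kb + 1))"],
      intro allI impI conjI ballI, goal_cases)
    case prems: (1 F \<phi> \<Phi> B b kB kdF kF k\<Phi> k\<sigma> kd k\<sigma>' z)
    interpret sol M \<Omega> g E \<epsilon> H F \<phi> \<Phi> using prems(1) by unfold_locales (elim conjE, blast)+
    define A where "A = kB + 2 * max kdF 0 + 1"
    define Sg where "Sg = max k\<sigma> 1"
    \<comment> \<open>The hypothesis bounds the reciprocal of the power \<open>2 \<epsilon>\<close>
      of the norm; the exponent \<open>1 / \<epsilon>\<close> converts this into a bound for the
      reciprocal of its square.\<close>
    define Sp where "Sp = max k\<sigma>' 0 powr (1 / \<epsilon>)"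
    define K where "K = K0 A kF k\<Phi> Sg kd Sp"
    have hyps: "B \<le> kB" "\<forall>p\<in>pts M. grad_norm M g (\<lambda>q. F q powr (1 / real m)) p \<le> kdF" "\<forall>p\<in>pts M. F p \<le> kF"
      "\<forall>p\<in>pts M. \<bar>\<Phi> p\<bar> \<le> k\<Phi>" "\<forall>p\<in>pts M. sn p powr (2 * \<epsilon>) \<le> k\<sigma>" "\<forall>p\<in>mfd_boundary M. grad_norm M g \<Phi> p \<le> kd"
      "\<forall>p\<in>mfd_boundary M. 1 / sn p powr (2 * \<epsilon>) \<le> k\<sigma>'" "B * \<epsilon> > 1" "bisectional_ge M g (- B)"
      using prems(1,2) by - (elim conjE, assumption)+
    have B0: "B > 0" using hyps(8) \<epsilon> by (intro zero_less_mult_pos2[of B \<epsilon>]) linarith+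
    have A: "A \<ge> B + 2 * max kdF 0 + 1" "A \<ge> 1" "A > B" using hyps(1) B0 by (auto simp: A_def)
    have "\<epsilon> * B \<le> \<epsilon> * A" using A(3) \<epsilon> by (intro mult_left_mono) auto
    then have A1: "\<epsilon> * A > 1" using hyps(8) by (simp add: mult.commute)
    have zM: "z \<in> pts M" "z \<notin> Z" using prems(3) by auto
    note s = sn_pos[OF zM]
    have Sg1: "Sg \<ge> 1" by (simp add: Sg_def)
    have sA: "sn z powr (2 * \<epsilon> * r) \<le> Sg powr A" if "r \<ge> 0" "r \<le> A" for r
    proof -
      have "sn z powr (2 * \<epsilon> * r) \<le> Sg powr r" unfolding Sg_def using hyps(5) zM that by (intro snA) auto
      also have "\<dots> \<le> Sg powr A" using Sg1 that by (intro powr_mono) auto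
      finally show ?thesis .
    qed
    have "grad_norm M g \<Phi> z \<le> c1 A kF k\<Phi> Sg kd Sp * sn z powr (- (\<epsilon> * A))"
    proof (cases "z \<in> I")
      case True
      then have zD: "z \<in> D" using zM by blast
      have grad_phi: "grad_phi z \<le> K * exp (A * k\<Phi>) * sn z powr (- (2 * \<epsilon> * A))"
      proof (rule gradient_estimate[where KL=KL and B=B and kdF="max kdF 0" and kF=kF and Sg=Sg and kd=kd and Sp=Sp])
        show "grad_lsn q * (sn q)\<^sup>2 \<le> KL" if "q \<in> D" for q unfolding grad_lsn_def by (rule KL(2)[OF that])
        show "grad_norm M g (\<lambda>q. F q powr (1 / real m)) p \<le> max kdF 0" if "p \<in> pts M" for p
          using hyps(2) that by (auto intro: max.coboundedI1)
        show "sn q powr (2 * \<epsilon>) \<le> Sg" if "q \<in> pts M" for q using hyps(5) that by (auto simp: Sg_def intro: max.coboundedI1)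
        show "1 / (sn p)\<^sup>2 \<le> Sp" if p: "p \<in> mfd_boundary M" for p
        proof -
          have "p \<in> pts M" "p \<notin> Z" using p Ebd by (auto simp: mfd_boundary_def)
          then have sp: "sn p > 0" by (rule sn_pos)
          have "1 / (sn p)\<^sup>2 = (1 / sn p powr (2 * \<epsilon>)) powr (1 / \<epsilon>)"
            using sp \<epsilon> by (simp add: powr_divide powr_powr)
          also have "\<dots> \<le> Sp" unfolding Sp_def using hyps(7) p \<epsilon> by (intro powr_mono2) (auto intro: max.coboundedI1)
          finally show ?thesis .
        qed
        show "K = 3 * exp (A * (k\<Phi> + ln Sg + 1)) * (27 * kF * ((real m + 2) * (A + 1)) ^ m + 1 + (2 * (kd\<^sup>2 + 1) + 4 * \<epsilon>\<^sup>2 * KL * Sp))"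
          by (simp add: K_def K0_def)
        show "0 \<le> Sp" by (simp add: Sp_def)
      qed (use KL(1) hyps A A1 Sg1 zD in auto)
      have "grad_lsn z * (sn z)\<^sup>2 \<le> KL" using KL(2)[OF zD] by (simp add: grad_lsn_def)
      then have "grad_lsn z \<le> KL * (1 / (sn z)\<^sup>2)" using s by (simp add: field_simps)
      \<comment> \<open>The squared gradient of \<open>lsn\<close> grows at most like the power
        \<open>- 2\<close> of the norm. As \<open>A > 1 / \<epsilon>\<close>, this is less than the
        growth allowed, and the surplus power is bounded by \<open>Sg powr A\<close>.\<close>
      also have "1 / (sn z)\<^sup>2 = sn z powr (2 * \<epsilon> * (A - 1 / \<epsilon>)) * sn z powr (- (2 * \<epsilon> * A))"
      proof -
        have e: "2 * \<epsilon> * (A - 1 / \<epsilon>) + - (2 * \<epsilon> * A) = - 2" using \<epsilon> by (simp add: field_simps)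
        show ?thesis unfolding powr_add[symmetric] e using s by (simp add: powr_minus divide_inverse)
      qed
      also have "KL * \<dots> \<le> KL * (Sg powr A * sn z powr (- (2 * \<epsilon> * A)))"
        using KL(1) A1 \<epsilon> by (intro mult_left_mono mult_right_mono sA) (auto simp: field_simps)
      finally have grad_lsn: "grad_lsn z \<le> KL * Sg powr A * sn z powr (- (2 * \<epsilon> * A))" by (simp add: mult.assoc)
      define Y where "Y = 2 * (K * exp (A * k\<Phi>)) + 2 * \<epsilon>\<^sup>2 * (KL * Sg powr A)"
      have "grad_\<Phi> z \<le> 2 * grad_phi z + 2 * \<epsilon>\<^sup>2 * grad_lsn z" by (rule grad_phi_le(2)[OF zD])
      also have "\<dots> \<le> 2 * (K * exp (A * k\<Phi>) * sn z powr (- (2 * \<epsilon> * A))) + 2 * \<epsilon>\<^sup>2 * (KL * Sg powr A * sn z powr (- (2 * \<epsilon> * A)))"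
        by (intro add_mono mult_left_mono grad_phi grad_lsn) auto
      also have "\<dots> = Y * (sn z powr (- (\<epsilon> * A)))\<^sup>2"
        unfolding Y_def power2_eq_square powr_add[symmetric] by (simp add: algebra_simps)
      finally have "sqrt (grad_\<Phi> z) \<le> sqrt (Y * (sn z powr (- (\<epsilon> * A)))\<^sup>2)" by (rule real_sqrt_le_mono)
      also have "\<dots> = sqrt Y * sn z powr (- (\<epsilon> * A))" by (simp add: real_sqrt_mult)
      also have "\<dots> \<le> c1 A kF k\<Phi> Sg kd Sp * sn z powr (- (\<epsilon> * A))"
        by (intro mult_right_mono) (auto simp: c1_def Y_def K_def)
      finally show ?thesis by (simp add: grad_norm_gq grad_\<Phi>_def)
    next
      case False
      then have zb: "z \<in> mfd_boundary M" using zM by (simp add: mfd_boundary_def)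
      have Knn: "0 \<le> 2 * (K * exp (A * k\<Phi>)) + 2 * \<epsilon>\<^sup>2 * (KL * Sg powr A)"
      proof -
        have "kF \<ge> 0" using hyps(3) Fpos zM by force
        then have "K \<ge> 0" unfolding K_def K0_def using A(2) KL(1) by (intro mult_nonneg_nonneg add_nonneg_nonneg) (auto simp: Sp_def)
        then show ?thesis using KL(1) by simp
      qed
      \<comment> \<open>A negative power of the norm can be small where the norm is large, so a
        constant has to be scaled by an upper bound for the positive power.\<close>
      have "sn z powr (2 * \<epsilon> * (A / 2)) \<le> Sg powr A" using A(2) by (intro sA) auto
      then have "sn z powr (\<epsilon> * A) * sn z powr (- (\<epsilon> * A)) \<le> Sg powr A * sn z powr (- (\<epsilon> * A))" by (intro mult_right_mono) auto
      moreover have "sn z powr (\<epsilon> * A) * sn z powr (- (\<epsilon> * A)) = 1" using s by (simp flip: powr_add)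
      ultimately have one: "1 \<le> Sg powr A * sn z powr (- (\<epsilon> * A))" by simp
      have "grad_norm M g \<Phi> z \<le> \<bar>kd\<bar> * 1" using hyps(6) zb by fastforce
      also have "\<dots> \<le> \<bar>kd\<bar> * (Sg powr A * sn z powr (- (\<epsilon> * A)))" using one by (intro mult_left_mono) auto
      also have "\<dots> = (\<bar>kd\<bar> * Sg powr A) * sn z powr (- (\<epsilon> * A))" by simp
      also have "\<dots> \<le> c1 A kF k\<Phi> Sg kd Sp * sn z powr (- (\<epsilon> * A))"
        using Knn by (intro mult_right_mono) (auto simp: c1_def K_def)
      finally show ?thesis .
    qed
    then show ?case by (simp add: A_def Sg_def Sp_def)
  next
    case prems: (2 F \<phi> \<Phi> B b kL kb kB kosc k\<sigma> k\<Delta> z)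
    interpret sol M \<Omega> g E \<epsilon> H F \<phi> \<Phi> using prems(1) by unfold_locales (elim conjE, blast)+
    define A where "A = kB + max kL 0 + kb + 1"
    define Sg where "Sg = max k\<sigma> 1 powr A"
    have hyps: "B \<le> kB" "b \<le> kb" "\<forall>p\<in>pts M. - laplacian M g (\<lambda>q. ln (F q)) p \<le> kL" "osc (pts M) \<Phi> \<le> kosc"
      "\<forall>p\<in>pts M. sn p powr (2 * \<epsilon>) \<le> k\<sigma>" "\<forall>p\<in>mfd_boundary M. real m + laplacian M g \<Phi> p \<le> k\<Delta>"
      "B * \<epsilon> > 1" "bisectional_ge M g (- B)" "b \<ge> 0" "\<forall>p\<in>pts M. scalar_curvature M g p \<le> b"
      using prems(1,2) by - (elim conjE, assumption)+
    have B0: "B > 0" using hyps(7) \<epsilon> by (intro zero_less_mult_pos2[of B \<epsilon>]) linarith+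
    have A: "A \<ge> B + max kL 0 + b + 1" "A \<ge> 1" using hyps(1,2,9) B0 by (auto simp: A_def)
    have zM: "z \<in> pts M" "z \<notin> Z" "z \<in> pts M - Z" using prems(3) by auto
    note s = sn_pos[OF zM(1,2)]
    have SgA: "sn q powr (2 * \<epsilon> * A) \<le> Sg" if "q \<in> pts M" for q
      unfolding Sg_def using hyps(5) that A(2) by (intro snA) auto
    let ?P = "P kL k\<Delta>" and ?T = "TT A kL k\<Delta> kosc" and ?s = "sn z powr (- (2 * \<epsilon> * A))"
    have tr: "tr_hf z \<le> (?T + ?P) * exp (A * kosc) * Sg * ?s"
      by (rule trace_estimate[OF C0(2) C0(1) _ _ hyps(4) P_def[THEN fun_cong, THEN fun_cong] hyps(8,10,9) A SgA _ _ zM(3)])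
         (use hyps(3,6) in \<open>auto simp: TT_def Sg_def\<close>)
    \<comment> \<open>From below the Laplacian is at least \<open>- C0\<close>, and this constant is
      absorbed into the negative power of the norm. From above it is at most \<open>tr_hf\<close>,
      because the trace of \<open>\<Omega>\<close> is nonnegative.\<close>
    have "sn z powr (2 * \<epsilon> * A) * ?s \<le> Sg * ?s" by (intro mult_right_mono SgA zM) auto
    moreover have "sn z powr (2 * \<epsilon> * A) * ?s = 1" using s by (simp flip: powr_add)
    ultimately have "C0 * 1 \<le> C0 * (Sg * ?s)" using C0(1) by (intro mult_left_mono) auto
    moreover have "c2 A kL k\<Delta> kosc Sg * ?s = C0 * (Sg * ?s) + (?T + ?P) * exp (A * kosc) * Sg * ?s"
      by (simp add: c2_def algebra_simps)
    moreover have "Re (gtr m (g (chart_at M z) z) (\<Omega> (chart_at M z) z)) \<ge> 0"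
      using nonneg chart_at[OF zM(1)] unfolding nonneg_form11_def sqn_bf by (intro gtr_nonneg) auto
    moreover have "tr_hf z \<ge> 0" by (rule tr_hf_nonneg[OF zM(1)])
    ultimately have "\<bar>laplacian M g \<Phi> z\<bar> \<le> c2 A kL k\<Delta> kosc Sg * ?s"
      using tr_hf_lap[of z] C0(2)[OF zM(1)] tr by linarith
    moreover have "- (2 * \<epsilon> * A) = - \<epsilon> * (2 * A)" by simp
    ultimately show ?case by (simp only: A_def Sg_def)
  qed
qed

end

theorem theorem1:
  shows
   "\<exists>(A1 :: real \<Rightarrow> real \<Rightarrow> real) (A2 :: real \<Rightarrow> real \<Rightarrow> real \<Rightarrow> real).
    \<forall>(M :: 'a mfd) (\<Omega>0 :: 'a form11) (E :: 'a local_eqn set) (\<epsilon> :: real)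
      (H :: 'a local_eqn \<Rightarrow> 'a \<Rightarrow> real) (g :: 'a form11).
      complex_manifold_with_boundary M \<and> compact_space (mtop M) \<and>
      real_form11 M \<Omega>0 \<and> smooth_form11 M \<Omega>0 \<and> closed_form11 M \<Omega>0 \<and> nonneg_form11 M \<Omega>0 \<and>
      effective_divisor M E \<and> divisor_support E \<inter> mfd_boundary M = {} \<and>
      \<epsilon> > 0 \<and> hermitian_metric M E H \<and>
      g = form_add \<Omega>0 (ddbar_log_metric M E H \<epsilon>) \<and> kaehler_form M g
      \<longrightarrow>
      (\<exists>(C1 :: real \<Rightarrow> real \<Rightarrow> real \<Rightarrow> real \<Rightarrow> real \<Rightarrow> real \<Rightarrow> real \<Rightarrow> real)
        (C2 :: real \<Rightarrow> real \<Rightarrow> real \<Rightarrow> real \<Rightarrow> real \<Rightarrow> real \<Rightarrow> real).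
       \<forall>(F :: 'a \<Rightarrow> real) (\<phi> :: 'a \<Rightarrow> real) (\<Phi> :: 'a \<Rightarrow> real) (B :: real) (b :: real).
         smooth_on M (pts M) F \<and> (\<forall>p\<in>pts M. F p > 0) \<and>
         smooth_on_boundary M \<phi> \<and>
         dirichlet_solution M \<Omega>0 g F \<phi> \<Phi> \<and>
         bisectional_ge M g (- B) \<and> B * \<epsilon> > 1 \<and>
         b \<ge> 0 \<and> (\<forall>p\<in>pts M. scalar_curvature M g p \<le> b)
         \<longrightarrow>
         (\<forall>kB kdF kF k\<Phi> k\<sigma> kd\<Phi> k\<sigma>'.
            B \<le> kB \<and>
            (\<forall>p\<in>pts M. grad_norm M g (\<lambda>q. F q powr (1 / real (mdim M))) p \<le> kdF) \<and>
            (\<forall>p\<in>pts M. F p \<le> kF) \<and>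
            (\<forall>p\<in>pts M. \<bar>\<Phi> p\<bar> \<le> k\<Phi>) \<and>
            (\<forall>p\<in>pts M. section_norm E H p powr (2 * \<epsilon>) \<le> k\<sigma>) \<and>
            (\<forall>p\<in>mfd_boundary M. grad_norm M g \<Phi> p \<le> kd\<Phi>) \<and>
            (\<forall>p\<in>mfd_boundary M. 1 / section_norm E H p powr (2 * \<epsilon>) \<le> k\<sigma>')
            \<longrightarrow>
            (\<forall>z\<in>pts M - divisor_support E.
               grad_norm M g \<Phi> z
                 \<le> C1 kB kdF kF k\<Phi> k\<sigma> kd\<Phi> k\<sigma>' * section_norm E H z powr (- \<epsilon> * A1 kB kdF)))
         \<and>
         (\<forall>kL kb kB kosc k\<sigma> k\<Delta>.
            (\<forall>p\<in>pts M. - laplacian M g (\<lambda>q. ln (F q)) p \<le> kL) \<and>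
            b \<le> kb \<and>
            B \<le> kB \<and>
            osc (pts M) \<Phi> \<le> kosc \<and>
            (\<forall>p\<in>pts M. section_norm E H p powr (2 * \<epsilon>) \<le> k\<sigma>) \<and>
            (\<forall>p\<in>mfd_boundary M. real (mdim M) + laplacian M g \<Phi> p \<le> k\<Delta>)
            \<longrightarrow>
            (\<forall>z\<in>pts M - divisor_support E.
               \<bar>laplacian M g \<Phi> z\<bar>
                 \<le> C2 kL kb kB kosc k\<sigma> k\<Delta> * section_norm E H z powr (- \<epsilon> * A2 kL kb kB))))"
proof (rule exI[of _ "\<lambda>kB kdF. kB + 2 * max kdF 0 + 1"], rule exI[of _ "\<lambda>kL kb kB. 2 * (kB + max kL 0 + kb + 1)"],
    intro allI, rule impI, goal_cases)
  case (1 M \<Omega>0 E \<epsilon> H g)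
  then interpret geo M \<Omega>0 g E \<epsilon> H by unfold_locales auto
  show ?case by (rule estimates) (use 1 in blast)
qed

end
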